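(* Let $b>0$ and $2<p<4$, and assume $V$ satisfies $(V_0)$ and $(V_1)$. Then equation (1.5) has a ground state solution in $E$.
   Context: Let $V:\mathbb R^2\to\mathbb R$. Condition $(V_0)$: $V\in L^1_{loc}(\mathbb R^2)$, $V_0:=\inf_{\mathbb R^2}V>0$, and the Lebesgue measure of $\{x\in\mathbb R^2: V(x)\le M\}$ is finite for every $M>0$. Condition $(V_1)$: $V\in C(\mathbb R^2,\mathbb R)$ is weakly differentiable and there exist $\alpha,\beta>0$ such that for a.e. $x\in\mathbb R^2$: $|(\nabla V(x),x)|\le \alpha V(x)$ and $2V(x)+(\nabla V(x),x)\ge-\beta$. $|\cdot|_s$ denotes the $L^s(\mathbb R^2)$-norm. $H_V=\{u\in H^1(\mathbb R^2):\int_{\mathbb R^2}Vu^2\,dx<\infty\}$ with norm $\|u\|_V=(\int_{\mathbb R^2}(|\nabla u|^2+V(x)u^2)\,dx)^{1/2}$. For measurable $u$, $|u|_*=(\int_{\mathbb R^2}\log(1+|x|)u^2\,dx)^{1/2}$. $E=\{u\in H_V:|u|_*<\infty\}$ is the Hilbert space with norm $\|u\|_E=(\|u\|_V^2+|u|_*^2)^{1/2}$. $N_0(u)=\frac1{2\pi}\int_{\mathbb R^2}\int_{\mathbb R^2}\log(|x-y|)u^2(x)u^2(y)\,dx\,dy$. For $b\ge0$, $p>2$, $I:E\to\mathbb R$ is $I(u)=\frac12\|u\|_V^2+\frac14N_0(u)-\frac bp|u|_p^p$, a $C^1$ functional. Equation (1.5) is $-\Delta u+V(x)u+\frac1{2\pi}(\log(|\cdot|)*|u|^2)u=b|u|^{p-2}u$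 in $\mathbb R^2$; its (weak) solutions are the critical points of $I$ in $E$. A ground state solution is a critical point $u\ne0$ of $I$ with $I(u)\le I(w)$ for every critical point $w\ne0$ of $I$. *)

theory Defs
  imports "HOL-Analysis.Analysis"
begin

type_synonym R2 = "real ^ 2"

definition loc_int :: "(R2 \<Rightarrow> 'b::{banach, second_countable_topology}) \<Rightarrow> bool" where
  "loc_int f \<longleftrightarrow> f \<in> borel_measurable lebesgue \<and>
     (\<forall>K. compact K \<longrightarrow> set_integrable lebesgue K f)"

definition cgrad :: "(R2 \<Rightarrow> real) \<Rightarrow> R2 \<Rightarrow> R2" where
  "cgrad \<phi> x = (\<chi> i. frechet_derivative \<phi> (at x) (axis i 1))"

definition test_fun :: "(R2 \<Rightarrow> real) \<Rightarrow> bool" where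
  "test_fun \<phi> \<longleftrightarrow> (\<forall>x. \<phi> differentiable (at x)) \<and> continuous_on UNIV (cgrad \<phi>)
     \<and> bounded {x. \<phi> x \<noteq> 0}"

definition weak_grad :: "(R2 \<Rightarrow> real) \<Rightarrow> (R2 \<Rightarrow> R2) \<Rightarrow> bool" where
  "weak_grad u g \<longleftrightarrow> loc_int u \<and> loc_int g \<and>
     (\<forall>\<phi>. test_fun \<phi> \<longrightarrow> (\<forall>i.
        (\<integral>x. u x * cgrad \<phi> x $ i \<partial>lebesgue) = - (\<integral>x. g x $ i * \<phi> x \<partial>lebesgue)))"

definition wgrad :: "(R2 \<Rightarrow> real) \<Rightarrow> R2 \<Rightarrow> R2" where
  "wgrad u = (SOME g. weak_grad u g)"

definition H1 :: "(R2 \<Rightarrow> real) set" where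
  "H1 = {u. u \<in> borel_measurable lebesgue \<and> integrable lebesgue (\<lambda>x. (u x)\<^sup>2) \<and>
           (\<exists>g. weak_grad u g \<and> integrable lebesgue (\<lambda>x. (norm (g x))\<^sup>2))}"

definition HV :: "(R2 \<Rightarrow> real) \<Rightarrow> (R2 \<Rightarrow> real) set" where
  "HV V = {u \<in> H1. integrable lebesgue (\<lambda>x. V x * (u x)\<^sup>2)}"

definition EV :: "(R2 \<Rightarrow> real) \<Rightarrow> (R2 \<Rightarrow> real) set" where
  "EV V = {u \<in> HV V. integrable lebesgue (\<lambda>x. ln (1 + norm x) * (u x)\<^sup>2)}"

definition normV_sq :: "(R2 \<Rightarrow> real) \<Rightarrow> (R2 \<Rightarrow> real) \<Rightarrow> real" where
  "normV_sq V u = (\<integral>x. (norm (wgrad u x))\<^sup>2 + V x * (u x)\<^sup>2 \<partial>lebesgue)"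

definition N0 :: "(R2 \<Rightarrow> real) \<Rightarrow> real" where
  "N0 u = (1 / (2 * pi)) *
     (\<integral>x. (\<integral>y. ln (norm (x - y)) * (u x)\<^sup>2 * (u y)\<^sup>2 \<partial>lebesgue) \<partial>lebesgue)"

definition Lp_pow :: "real \<Rightarrow> (R2 \<Rightarrow> real) \<Rightarrow> real" where
  "Lp_pow p u = (\<integral>x. \<bar>u x\<bar> powr p \<partial>lebesgue)"

definition Ifun :: "(R2 \<Rightarrow> real) \<Rightarrow> real \<Rightarrow> real \<Rightarrow> (R2 \<Rightarrow> real) \<Rightarrow> real" where
  "Ifun V b p u = normV_sq V u / 2 + N0 u / 4 - (b / p) * Lp_pow p u"

text \<open>Critical point of I in E: all directional derivatives (in directions of E) vanish.
  Since I is C^1 on E, this is the same as I'(u) = 0.\<close>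
definition crit_point :: "(R2 \<Rightarrow> real) \<Rightarrow> real \<Rightarrow> real \<Rightarrow> (R2 \<Rightarrow> real) \<Rightarrow> bool" where
  "crit_point V b p u \<longleftrightarrow> u \<in> EV V \<and>
     (\<forall>\<phi>\<in>EV V. ((\<lambda>t. Ifun V b p (\<lambda>x. u x + t * \<phi> x)) has_real_derivative 0) (at 0))"

definition nonzero_ae :: "(R2 \<Rightarrow> real) \<Rightarrow> bool" where
  "nonzero_ae u \<longleftrightarrow> \<not> (AE x in lebesgue. u x = 0)"

definition ground_state :: "(R2 \<Rightarrow> real) \<Rightarrow> real \<Rightarrow> real \<Rightarrow> (R2 \<Rightarrow> real) \<Rightarrow> bool" where
  "ground_state V b p u \<longleftrightarrow> crit_point V b p u \<and> nonzero_ae u \<and>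
     (\<forall>w. crit_point V b p w \<and> nonzero_ae w \<longrightarrow> Ifun V b p u \<le> Ifun V b p w)"

definition cond_V0 :: "(R2 \<Rightarrow> real) \<Rightarrow> bool" where
  "cond_V0 V \<longleftrightarrow> loc_int V \<and> (\<exists>c>0. \<forall>x. c \<le> V x) \<and>
     (\<forall>M>0. emeasure lebesgue {x. V x \<le> M} < \<infinity>)"

definition cond_V1 :: "(R2 \<Rightarrow> real) \<Rightarrow> bool" where
  "cond_V1 V \<longleftrightarrow> continuous_on UNIV V \<and>
     (\<exists>gV. weak_grad V gV \<and> (\<exists>\<alpha>>0. \<exists>\<beta>>0. AE x in lebesgue.
        \<bar>gV x \<bullet> x\<bar> \<le> \<alpha> * V x \<and> 2 * V x + gV x \<bullet> x \<ge> - \<beta>))"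

end

theory Submission
  imports Defs "HOL-Complex_Analysis.Great_Picard" "HOL-Library.Diagonal_Subsequence"
begin

text \<open>
The functional is unbounded below on rays but has mountain pass geometry. Since \<open>p < 4\<close> a Palais-Smale sequence need not
be bounded, so the minimax is run with an additional scalar constraint: a path is deformed either along a direction
of descent or along the dilations \<open>u(x) \<mapsto> u(x / (1 - s))\<close>. By \<open>(V\<^sub>1)\<close> the potential energy along the dilation is controlled, and the
energy changes at rate at most \<open>- PP u\<close>, where \<open>PP\<close> is a one-sided Pohozaev functional. This yields an almost critical
sequence with \<open>PP u\<^sub>n \<le> o(1)\<close>, and such sequences are bounded in \<open>H\<^sub>V\<close> by Gagliardo-Nirenberg. The sublevel sets of \<open>V\<close>
have finite measure, hence \<open>H\<^sub>V\<close> embeds compactly in \<open>L\<^sup>2\<close>; once the mass does not vanish, the positive part of the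
logarithmic kernel controls \<open>|u|\<^sub>*\<close>, and strict monotonicity of the derivative modulo \<open>L\<^sup>2\<close>-small terms gives convergence in \<open>E\<close>.

Every critical point satisfies \<open>PP u \<le> 0\<close>: testing the equation with \<open>\<eta>\<^sup>2 u\<close> for weights \<open>\<eta>\<close> growing linearly shows
\<open>|x| \<nabla>u \<in> L\<^sup>2\<close>, so the dilation moves \<open>u\<close> by \<open>O(s)\<close> in \<open>L\<^sup>2\<close> and the second order remainder of the energy is \<open>o(s)\<close>. Hence
critical points of bounded energy are precompact, and a minimizing sequence among them converges to a ground state.
\<close>

text \<open>Almost critical means here that \<open>dI u w\<close> is small for all \<open>w\<close>
  with \<open>nE w <= 1 + nE u\<close>, a condition of Cerami type. It has two uses:
  \<open>w = u\<close> is always admissible, so the Nehari quantity \<open>dI u u\<close> is small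
  before any bound on \<open>nE u\<close> is known; and a descent step of size \<open>h\<close>
  multiplies 1 + radius by at most 1 + O(h), so all chains stay in a ball that can be fixed before
  \<open>h\<close> is chosen. Dilations cannot be treated as a vector field on E: the orbit of a
  function is continuous, but its formal derivative, x times the gradient, need not lie in E.
  Therefore only values of the energy are expanded along them, and (V1) gives this expansion from
  above only, which is why \<open>PP\<close> is one-sided. The same one-sidedness is enough at a
  critical point: the energy of \<open>T s u\<close> is at most
  \<open>II u - s * PP u + O(s^2)\<close> by dilation, and at least \<open>II u - o(s)\<close> by
  Taylor expansion at \<open>u\<close>, where the first-order term vanishes. Comparison gives
  \<open>PP u <= 0\<close> with no regularity theory for the equation.\<close>

abbreviation tendsto_seq :: "(nat => 'a::topological_space) => 'a => bool" (infix "--->" 60) where "f ---> l == f \<longlonglongrightarrow> l"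

notation scaleR (infixr "*r" 75)

abbreviation lint :: "(R2 => 'a::{banach, second_countable_topology}) => 'a" (binder "LI " 10) where "lint f == integral\<^sup>L lebesgue f"
abbreviation li :: "(R2 => 'a::{banach, second_countable_topology}) => bool" where "li f == integrable lebesgue f"
abbreviation lm :: "(R2 => 'a::topological_space) => bool" where "lm f == f : borel_measurable lebesgue"
abbreviation LL :: "(R2 \<times> R2) measure" where "LL == lebesgue \<Otimes>\<^sub>M lebesgue"

lemmas bint = Bochner_Integration.integrable_add Bochner_Integration.integrable_diff integrable_mult_right
 integrable_mult_left integrable_divide

subsection \<open>Square integrable functions\<close>

definition L2 :: "(R2 => 'a::euclidean_space) => bool" where
 "L2 f \<longleftrightarrow> f : borel_measurable lebesgue \<and> li (%x. (norm (f x))^2)"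

definition n2 :: "(R2 => 'a::euclidean_space) => real" where
 "n2 f = sqrt (LI x. (norm (f x))^2)"

lemma L2_measurable [measurable_dest]: "L2 f ==> f : borel_measurable lebesgue"
 and L2_integrable: "L2 f ==> li (%x. (norm (f x))^2)"
 by (auto simp: L2_def)

lemma n2_nonneg [simp]: "0 <= n2 f"
 by (simp add: n2_def)

lemma n2_sq: "(n2 f)^2 = (LI x. (norm (f x))^2)"
 by (simp add: n2_def)

lemma L2_bound:
 assumes "L2 g" "lm f" "AE x in lebesgue. norm (f x) <= norm (g x)"
 shows "L2 f"
proof -
 have "li (%x. (norm (f x))^2)"
  by (rule Bochner_Integration.integrable_bound[OF L2_integrable[OF assms(1)]])
   (use assms in \<open>auto elim!: eventually_mono intro!: power_mono\<close>)
 then show ?thesis using assms by (simp add: L2_def)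
qed

lemma n2_mono:
 assumes "L2 g" "lm f" "AE x in lebesgue. norm (f x) <= norm (g x)"
 shows "n2 f <= n2 g"
 unfolding n2_def
 by (intro real_sqrt_le_mono integral_mono_AE L2_integrable L2_bound[OF assms] assms(1))
  (use assms(3) in \<open>auto elim!: eventually_mono intro!: power_mono\<close>)

lemma L2_cong_AE:
 assumes "L2 g" "lm f" "AE x in lebesgue. f x = g x"
 shows "L2 f"
 by (rule L2_bound[OF assms(1,2)]) (use assms(3) in \<open>auto elim!: eventually_mono\<close>)

lemma n2_cong_AE:
 assumes "lm f" "lm g" "AE x in lebesgue. f x = g x"
 shows "n2 f = n2 g"
 unfolding n2_def
 by (intro arg_cong[where f=sqrt] integral_cong_AE) (use assms in \<open>auto elim!: eventually_mono\<close>)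

lemma L2_norm: "L2 f ==> L2 (%x. norm (f x))" and n2_norm: "n2 (%x. norm (f x)) = n2 f"
 by (auto simp: L2_def n2_def)

lemma L2_scaleR: "L2 f ==> L2 (%x. c *r f x)"
 by (auto simp: L2_def power_mult_distrib)

lemma n2_scaleR: "n2 (%x. c *r f x) = abs c * n2 f"
 by (simp add: n2_def power_mult_distrib real_sqrt_mult)

lemma L2_cmult: "L2 f ==> L2 (%x. c * f x)" and n2_cmult: "n2 (%x. c * f x) = abs c * n2 f"
 for f :: "R2 => real"
 using L2_scaleR[of f c] n2_scaleR[of c f] by auto

lemma L2_minus: "L2 f ==> L2 (%x. - f x)" and n2_minus: "n2 (%x. - f x) = n2 f"
 by (auto simp: L2_def n2_def)

lemma L2_zero [simp]: "L2 (%x. 0)" and n2_zero [simp]: "n2 (%x. 0) = 0"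
 by (auto simp: L2_def n2_def)

lemma L2_prod_integrable:
 assumes "L2 f" "L2 g" shows "li (%x. norm (f x) * norm (g x))"
proof (rule Bochner_Integration.integrable_bound)
 show "li (%x. (norm (f x))^2 + (norm (g x))^2)"
  using assms by (auto intro: L2_integrable)
 show "lm (%x. norm (f x) * norm (g x))"
  using assms by (auto simp: L2_def)
 have "a * b <= a^2 + b^2" if "a >= 0" "b >= 0" for a b :: real
  using sum_squares_bound[of a b] that mult_nonneg_nonneg[OF that] by linarith
 then show "AE x in lebesgue. norm (norm (f x) * norm (g x)) <= norm ((norm (f x))^2 + (norm (g x))^2)"
  by (auto simp: abs_mult)
qed

lemma L2_Cauchy_Schwarz:
 assumes "L2 f" "L2 g" shows "(LI x. norm (f x) * norm (g x)) <= n2 f * n2 g"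
proof -
 let ?A = "n2 f" and ?B = "n2 g"
 have weighted: "(Y / X * X^2 + Y^2 / (Y / X)) / 2 = X * Y" if "X > 0" "Y > 0" for X Y :: real
  using that by (simp add: field_simps power2_eq_square)
 have *: "(LI x. norm (f x) * norm (g x)) <= (?A + e) * (?B + e)" if e: "e > 0" for e
 proof -
  \<comment> \<open>This weight balances the two squares in Young's inequality. The shift by
    \<open>e\<close> keeps numerator and denominator positive; it is removed at the end by letting
    \<open>e\<close> tend to 0.\<close>
  define s where "s = (?B + e) / (?A + e)"
  have pos: "?A + e > 0" "?B + e > 0" using e by (auto intro: add_nonneg_pos)
  then have s: "s > 0" by (simp add: s_def)
  have "a * b <= (s * a^2 + b^2 / s) / 2" for a b :: real
  proof -
   have "0 <= (s * a - b)^2 / s" using s by simp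
   also have "... = s * a^2 + b^2 / s - 2 * (a * b)"
    using s by (simp add: field_simps power2_eq_square)
   finally show ?thesis by simp
  qed
  then have "(LI x. norm (f x) * norm (g x)) <= (LI x. (s * (norm (f x))^2 + (norm (g x))^2 / s) / 2)"
   using assms by (intro integral_mono L2_prod_integrable bint L2_integrable) auto
  also have "... = (s * ?A^2 + ?B^2 / s) / 2"
   using assms by (simp add: n2_sq L2_integrable)
  also have "... <= (s * (?A + e)^2 + (?B + e)^2 / s) / 2"
   using s e by (intro divide_right_mono add_mono mult_left_mono power_mono) auto
  also have "... = (?A + e) * (?B + e)"
   using arg_cong[of _ _ "%t. t", OF weighted[OF pos]] by (simp add: s_def)
  finally show ?thesis .
 qed
 have "((%e. (?A + e) * (?B + e)) \<longlongrightarrow> (?A + 0) * (?B + 0)) (at_right 0)"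
  by (intro tendsto_intros)
 then have "(LI x. norm (f x) * norm (g x)) <= (?A + 0) * (?B + 0)"
  by (rule tendsto_lowerbound) (auto simp: eventually_at_filter intro!: always_eventually *)
 then show ?thesis by simp
qed

lemma L2_inner_integrable: "L2 f ==> L2 g ==> li (%x. f x \<bullet> g x)"
 by (rule Bochner_Integration.integrable_bound[OF L2_prod_integrable[of f g]])
  (auto simp: L2_def Cauchy_Schwarz_ineq2)

lemma L2_inner_le: "L2 f ==> L2 g ==> abs (LI x. f x \<bullet> g x) <= n2 f * n2 g"
proof -
 assume a: "L2 f" "L2 g"
 have "abs (LI x. f x \<bullet> g x) <= (LI x. abs (f x \<bullet> g x))"
  by (rule integral_abs_bound)
 also have "... <= (LI x. norm (f x) * norm (g x))"
  using a by (intro integral_mono L2_prod_integrable integrable_abs L2_inner_integrable)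
   (auto simp: Cauchy_Schwarz_ineq2)
 finally show ?thesis using L2_Cauchy_Schwarz[OF a] by simp
qed

lemma L2_mult_integrable: "L2 f ==> L2 g ==> li (%x. f x * g x)"
 and L2_mult_le: "L2 f ==> L2 g ==> abs (LI x. f x * g x) <= n2 f * n2 g"
 and L2_abs_mult_le: "L2 f ==> L2 g ==> (LI x. abs (f x * g x)) <= n2 f * n2 g"
 for f g :: "R2 => real"
 using L2_inner_integrable[of f g] L2_inner_le[of f g] L2_Cauchy_Schwarz[of f g] by (auto simp: abs_mult)

lemma L2_add: assumes "L2 f" "L2 g" shows "L2 (%x. f x + g x)"
 and n2_triangle: "n2 (%x. f x + g x) <= n2 f + n2 g"
proof -
 let ?h = "%x. (norm (f x))^2 + 2 * (norm (f x) * norm (g x)) + (norm (g x))^2"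
 have le: "(norm (f x + g x))^2 <= ?h x" for x
  using power_mono[OF norm_triangle_ineq[of "f x" "g x"], of 2] by (simp add: power2_sum)
 have i: "li ?h"
  using assms by (intro bint L2_integrable L2_prod_integrable)
 have i2: "li (%x. (norm (f x + g x))^2)"
  by (rule Bochner_Integration.integrable_bound[OF i]) (use assms le in \<open>auto simp: L2_def\<close>)
 then show L: "L2 (%x. f x + g x)" using assms by (auto simp: L2_def)
 have "(n2 (%x. f x + g x))^2 <= integral\<^sup>L lebesgue ?h"
  unfolding n2_sq by (intro integral_mono i i2 le)
 also have "... = (n2 f)^2 + 2 * (LI x. norm (f x) * norm (g x)) + (n2 g)^2"
  using assms by (simp add: n2_sq L2_integrable L2_prod_integrable)
 also have "... <= (n2 f + n2 g)^2"
  using L2_Cauchy_Schwarz[OF assms] by (simp add: power2_sum)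
 finally show "n2 (%x. f x + g x) <= n2 f + n2 g"
  by (rule power2_le_imp_le) (auto intro: add_nonneg_nonneg)
qed

lemma L2_diff: "L2 f ==> L2 g ==> L2 (%x. f x - g x)"
 and n2_triangle_diff: "L2 f ==> L2 g ==> n2 (%x. f x - g x) <= n2 f + n2 g"
 using L2_add[of f "%x. - g x"] n2_triangle[of f "%x. - g x"] by (auto simp: L2_minus n2_minus)

lemma n2_commute: "n2 (%x. f x - g x) = n2 (%x. g x - f x)"
 by (simp add: n2_def norm_minus_commute)

lemma n2_triangle3:
 "L2 f ==> L2 g ==> L2 h ==> n2 (%x. f x - h x) <= n2 (%x. f x - g x) + n2 (%x. g x - h x)"
 using n2_triangle[of "%x. f x - g x" "%x. g x - h x"] by (simp add: L2_diff)

lemma L2_Fatou: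
 fixes f :: "nat => R2 => 'a::euclidean_space"
 assumes f: "!!k. L2 (f k)" and g: "lm g"
  and lim: "AE x in lebesgue. (%k. f k x) ---> g x" and C: "\<forall>\<^sub>F k in sequentially. n2 (f k) <= C"
 shows "L2 g" "n2 g <= C"
proof -
 have C0: "C >= 0"
  using eventually_happens[OF C] by (auto intro: order_trans[OF n2_nonneg])
 have "(\<integral>\<^sup>+x. ennreal ((norm (g x))^2) \<partial>lebesgue) = (\<integral>\<^sup>+x. liminf (%k. ennreal ((norm (f k x))^2)) \<partial>lebesgue)"
 proof (rule nn_integral_cong_AE)
  show "AE x in lebesgue. ennreal ((norm (g x))^2) = liminf (%k. ennreal ((norm (f k x))^2))"
   using lim
  proof eventually_elim
   case (elim x)
   have "(%k. ennreal ((norm (f k x))^2)) ---> ennreal ((norm (g x))^2)"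
    by (intro tendsto_ennrealI tendsto_intros elim)
   then show ?case by (metis lim_imp_Liminf trivial_limit_sequentially)
  qed
 qed
 also have "... <= liminf (%k. \<integral>\<^sup>+x. ennreal ((norm (f k x))^2) \<partial>lebesgue)"
  using f by (intro nn_integral_liminf) auto
 also have "... = liminf (%k. ennreal ((n2 (f k))^2))"
  by (simp add: n2_sq nn_integral_eq_integral L2_integrable[OF f])
 also have "... <= liminf (%k. ennreal (C^2))"
  by (rule Liminf_mono) (use C in \<open>auto elim!: eventually_mono intro!: ennreal_leI power_mono\<close>)
 also have "... = ennreal (C^2)" by (simp add: Liminf_const)
 finally have le: "(\<integral>\<^sup>+x. ennreal ((norm (g x))^2) \<partial>lebesgue) <= ennreal (C^2)" .
 have i: "li (%x. (norm (g x))^2)"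
  by (rule integrableI_bounded) (use g le le_less_trans[OF le] in auto)
 then show "L2 g" using g by (simp add: L2_def)
 have "(n2 g)^2 <= C^2"
  using le nn_integral_eq_integral[OF i] C0 by (simp add: n2_sq)
 then show "n2 g <= C" using C0 by (rule power2_le_imp_le)
qed

lemma L2_AE_subseq:
 fixes f :: "nat => R2 => 'a::euclidean_space"
 assumes "!!k. L2 (f k)" "L2 g" "(%k. n2 (%x. f k x - g x)) ---> 0"
 obtains r where "strict_mono (r::nat=>nat)" "AE x in lebesgue. (%k. f (r k) x) ---> g x"
proof -
 have "(%k. (n2 (%x. f k x - g x))^2) ---> 0"
  using tendsto_power[OF assms(3), of 2] by simp
 then have "(%k. LI x. norm ((norm (f k x - g x))^2)) ---> 0"
  by (simp add: n2_sq)
 then obtain r where r: "strict_mono (r::nat=>nat)"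
  and ae: "AE x in lebesgue. (%k. (norm (f (r k) x - g x))^2) ---> 0"
  using tendsto_L1_AE_subseq[of lebesgue "%k x. (norm (f k x - g x))^2"] L2_integrable[OF L2_diff[OF assms(1,2)]]
  by blast
 have "AE x in lebesgue. (%k. f (r k) x) ---> g x"
  using ae
 proof eventually_elim
  case (elim x)
  have "(%k. norm (f (r k) x - g x)) ---> 0"
   using tendsto_real_sqrt[OF elim] by simp
  then show ?case using LIM_zero_iff tendsto_norm_zero_iff by blast
 qed
 with r show ?thesis using that by blast
qed

text \<open>Riesz-Fischer. Along a subsequence with increments \<open>D k\<close> of norm at most
  2^-k, the sum of \<open>2^k * (D k)^2\<close> has a finite integral, so it is finite almost
  everywhere. The weight \<open>2^k\<close> is what turns this into geometric decay of
  \<open>D k x\<close> at almost every point; Fatou's lemma then identifies the limit in the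
  norm.\<close>

lemma L2_complete:
 fixes f :: "nat => R2 => 'a::euclidean_space"
 assumes f: "!!n. L2 (f n)" and cau: "!!e. e > 0 ==> EX N. ALL m>=N. ALL n>=N. n2 (%x. f m x - f n x) < e"
 obtains g where "L2 g" "(%n. n2 (%x. f n x - g x)) ---> 0"
proof -
 have "EX N. ALL m>=N. ALL n>=N. n2 (%x. f m x - f n x) < (1/2)^k" for k :: nat
  using cau[of "(1/2)^k"] by simp
 then obtain N where N: "!!k m n. m >= N k ==> n >= N k ==> n2 (%x. f m x - f n x) < (1/2)^k" by metis
 define r where "r k = (SUM i<=k. N i + 1)" for k
 have r: "strict_mono r" by (auto simp: strict_mono_Suc_iff r_def)
 have rN: "r k >= N k" for k by (cases k) (auto simp: r_def)
 have rN': "r (Suc k) >= N k" for k using rN[of k] by (simp add: r_def)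
 define D where "D k x = norm (f (r (Suc k)) x - f (r k) x)" for k x
 have D2: "L2 (D k)" for k unfolding D_def by (intro L2_norm L2_diff f)
 have [measurable]: "D k : borel_measurable lebesgue" for k using D2 by (rule L2_measurable)
 have nD: "n2 (D k) <= (1/2)^k" for k
  unfolding D_def n2_norm using N[OF rN' rN, of k] by simp
 have fin: "(\<integral>\<^sup>+x. (\<Sum>k. ennreal (2^k * (D k x)^2)) \<partial>lebesgue) ~= \<infinity>"
 proof -
  have "(\<integral>\<^sup>+x. (\<Sum>k. ennreal (2^k * (D k x)^2)) \<partial>lebesgue) = (\<Sum>k. \<integral>\<^sup>+x. ennreal (2^k * (D k x)^2) \<partial>lebesgue)"
   using D2 by (intro nn_integral_suminf) auto
  also have "... = (\<Sum>k. ennreal (2^k * (n2 (D k))^2))"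
  proof (intro suminf_cong)
   fix k
   have "li (%x. 2^k * (D k x)^2)" using L2_integrable[OF D2] by simp
   then show "(\<integral>\<^sup>+x. ennreal (2^k * (D k x)^2) \<partial>lebesgue) = ennreal (2^k * (n2 (D k))^2)"
    by (subst nn_integral_eq_integral) (auto simp: n2_sq)
  qed
  also have "... <= (\<Sum>k. ennreal ((1/2)^k))"
  proof (intro suminf_le allI ennreal_leI)
   fix k
   have "2^k * (n2 (D k))^2 <= 2^k * ((1/2)^k)^2"
    by (intro mult_left_mono power_mono nD) auto
   also have "... = (1/2)^k" by (simp add: power2_eq_square power_divide)
   finally show "2^k * (n2 (D k))^2 <= (1/2)^k" .
  qed auto
  also have "... = ennreal (\<Sum>k. (1/2)^k)" by (intro suminf_ennreal2) auto
  finally show ?thesis by (auto simp: top_unique)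
 qed
 have "AE x in lebesgue. (\<Sum>k. ennreal (2^k * (D k x)^2)) ~= \<infinity>"
  by (rule nn_integral_PInf_AE[OF _ fin]) measurable
 then have conv: "AE x in lebesgue. convergent (%k. f (r k) x)"
 proof eventually_elim
  case (elim x)
  have "EX S. T = ennreal S \<and> S >= 0" if "T ~= \<infinity>" for T :: ennreal using that by (cases T) auto
  from this[OF elim] obtain S where S: "(\<Sum>k. ennreal (2^k * (D k x)^2)) = ennreal S" "S >= 0"
   by blast
  have le: "2^k * (D k x)^2 <= S" for k
  proof -
   have "ennreal (2^k * (D k x)^2) = sum (%k. ennreal (2^k * (D k x)^2)) {k}" by simp
   also have "... <= (\<Sum>k. ennreal (2^k * (D k x)^2))" by (intro sum_le_suminf) auto
   finally show ?thesis using S by simp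
  qed
  have "summable (%k. f (r (Suc k)) x - f (r k) x)"
  proof (rule summable_norm_cancel, rule summable_comparison_test')
   show "summable (%k. sqrt S * (sqrt (1/2))^k)"
    by (intro summable_mult summable_geometric) (simp add: real_sqrt_divide)
   fix k
   have "(D k x)^2 <= S * (1/2)^k"
    using le[of k] by (simp add: field_simps)
   then have "D k x <= sqrt (S * (1/2)^k)" by (simp add: real_le_rsqrt)
   also have "... = sqrt S * (sqrt (1/2))^k" by (simp add: real_sqrt_mult real_sqrt_power)
   finally show "norm (norm (f (r (Suc k)) x - f (r k) x)) <= sqrt S * (sqrt (1/2))^k" by (simp add: D_def)
  qed
  then have "convergent (%n. SUM k<n. f (r (Suc k)) x - f (r k) x)" by (simp add: summable_iff_convergent)
  then have "convergent (%n. f (r n) x - f (r 0) x)"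
   by (simp add: sum_lessThan_telescope[of "%k. f (r k) x"])
  then have "convergent (%n. (f (r n) x - f (r 0) x) + f (r 0) x)"
   by (intro convergent_add convergent_const)
  then show ?case by simp
 qed
 define g where "g x = lim (%k. f (r k) x)" for x
 have g: "lm g"
  unfolding g_def using f by (intro borel_measurable_lim_metric) auto
 have lim: "AE x in lebesgue. (%k. f (r k) x) ---> g x"
  using conv by eventually_elim (simp add: g_def convergent_LIMSEQ_iff)
 have key: "L2 (%x. f m x - g x)" "n2 (%x. f m x - g x) <= e"
  if e: "e > 0" and m: "ALL m'>=M. ALL n>=M. n2 (%x. f m' x - f n x) < e" "m >= M" for m M e
 proof -
  have a: "L2 (%x. f m x - f (r k) x)" for k by (intro L2_diff f)
  have b: "lm (%x. f m x - g x)" using g f by auto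
  have c: "AE x in lebesgue. (%k. f m x - f (r k) x) ---> f m x - g x"
   using lim by eventually_elim (intro tendsto_intros)
  have d: "\<forall>\<^sub>F k in sequentially. n2 (%x. f m x - f (r k) x) <= e"
  proof (rule eventually_sequentiallyI)
   fix k assume "M <= k"
   then have "r k >= M" using seq_suble[OF r, of k] by linarith
   then show "n2 (%x. f m x - f (r k) x) <= e" using m by (simp add: less_imp_le)
  qed
  show "L2 (%x. f m x - g x)" "n2 (%x. f m x - g x) <= e"
   using L2_Fatou[OF a b c d] by auto
 qed
 obtain M where "ALL m>=M. ALL n>=M. n2 (%x. f m x - f n x) < 1" using cau[of 1] by auto
 then have "L2 (%x. f M x - g x)" using key(1)[of 1 M M] by auto
 from L2_diff[OF f this, of M] have "L2 g" by simp
 moreover have "(%n. n2 (%x. f n x - g x)) ---> 0"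
 proof (rule LIMSEQ_I)
  fix e :: real assume e: "e > 0"
  obtain M where M: "ALL m>=M. ALL n>=M. n2 (%x. f m x - f n x) < e / 2" using cau[of "e/2"] e by auto
  have "n2 (%x. f m x - g x) < e" if "m >= M" for m
   using key(2)[OF _ M that] e by simp
  then show "EX no. ALL n>=no. norm (n2 (%x. f n x - g x) - 0) < e" by auto
 qed
 ultimately show ?thesis using that by blast
qed

section \<open>Affine changes of variables in the plane\<close>

lemma lebesgue_affine_R2:
 fixes t :: R2 assumes c: "c ~= 0"
 shows lebesgue_R2_density: "lebesgue = density (distr lebesgue lebesgue (%x. t + c *r x)) (%_. ennreal (c^2))"
  and measurable_affine_R2: "(%x::R2. t + c *r x) : lebesgue \<rightarrow>\<^sub>M lebesgue"
proof -
 have eq: "(%x::R2. t + (SUM j:Basis. (c * (x \<bullet> j)) *r j)) = (%x. t + c *r x)"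
  by (rule ext) (simp add: scaleR_scaleR[symmetric] scaleR_sum_right[symmetric] euclidean_representation del: scaleR_scaleR)
 show "lebesgue = density (distr lebesgue lebesgue (%x. t + c *r x)) (%_. ennreal (c^2))"
  using lebesgue_affine_euclidean[of "%_::R2. c" t] c unfolding eq by (simp add: power2_eq_square abs_mult[symmetric] numeral_2_eq_2)
 show "(%x::R2. t + c *r x) : lebesgue \<rightarrow>\<^sub>M lebesgue"
  using lebesgue_affine_measurable[of "%_::R2. c" t] c unfolding eq by simp
qed

lemma
 fixes f :: "R2 => 'a::euclidean_space"
 assumes c: "c ~= 0" and f: "lm f"
 shows measurable_comp_affine: "lm (%x. f (t + c *r x))"
  and integral_affine_R2: "(LI x. f (t + c *r x)) = (LI x. f x) /\<^sub>R (c^2)"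
  and integrable_affine_R2: "li (%x. f (t + c *r x)) \<longleftrightarrow> li f"
proof -
 note m[measurable] = measurable_affine_R2[OF c, of t]
 show "lm (%x. f (t + c *r x))"
  by (rule measurable_compose[OF m f])
 have "integral\<^sup>L lebesgue f = integral\<^sup>L (density (distr lebesgue lebesgue (%x. t + c *r x)) (%_. ennreal (c^2))) f"
  using lebesgue_R2_density[OF c, of t] by simp
 also have "... = c^2 *r (LI x. f (t + c *r x))"
  using f by (subst integral_density) (auto simp: integral_distr)
 finally show "(LI x. f (t + c *r x)) = (LI x. f x) /\<^sub>R (c^2)"
  using c by simp
 have "li f \<longleftrightarrow> integrable (density (distr lebesgue lebesgue (%x. t + c *r x)) (%_. ennreal (c^2))) f"
  using lebesgue_R2_density[OF c, of t] by simp
 also have "... \<longleftrightarrow> li (%x. c^2 *r f (t + c *r x))"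
  using f by (subst integrable_density) (auto simp: integrable_distr_eq)
 also have "... \<longleftrightarrow> li (%x. f (t + c *r x))"
  using integrable_scaleR_right[of "inverse (c^2)" lebesgue "%x. c^2 *r f (t + c *r x)"] c
  by (auto intro: integrable_scaleR_right)
 finally show "li (%x. f (t + c *r x)) \<longleftrightarrow> li f" ..
qed

lemma L2_affine: "c ~= 0 ==> L2 f ==> L2 (%x. f (t + c *r x))"
 and n2_affine: "c ~= 0 ==> L2 f ==> n2 (%x. f (t + c *r x)) = n2 f / abs c"
 using measurable_comp_affine[of c f t] integrable_affine_R2[of c "%x. (norm (f x))^2" t]
  integral_affine_R2[of c "%x. (norm (f x))^2" t]
 by (auto simp: L2_def n2_def real_sqrt_divide divide_inverse_commute real_sqrt_mult real_sqrt_inverse)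

lemma L2_shift: "L2 f ==> L2 (%x. f (x + h))" and n2_shift: "L2 f ==> n2 (%x. f (x + h)) = n2 f"
 using L2_affine[of 1 f h] n2_affine[of 1 f h] by (auto simp: add.commute)

subsection \<open>Density of continuous functions\<close>

lemma borel_lebesgue_id [measurable]: "(%x. x) : lebesgue \<rightarrow>\<^sub>M borel"
 by (simp add: measurable_completion)

lemma continuous_lebesgue_measurable:
 "continuous_on UNIV f ==> f : borel_measurable (lebesgue :: 'a::euclidean_space measure)"
 by (simp add: borel_measurable_continuous_onI measurable_completion)

lemma sigma_finite_lebesgue: "sigma_finite_measure (lebesgue :: R2 measure)"
proof
 have "x : (\<Union>n::nat. cball 0 (real n))" for x :: R2
  using real_arch_simple[of "norm x"] by auto
 then have u: "(\<Union>n::nat. cball (0::R2) (real n)) = UNIV" by blast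
 have "emeasure lebesgue (cball (0::R2) n) ~= \<infinity>" for n
  using emeasure_lborel_cball_finite[of "0::R2" n] by auto
 then show "EX A::R2 set set. countable A \<and> A \<subseteq> sets lebesgue \<and> \<Union> A = space lebesgue \<and> (ALL a:A. emeasure lebesgue a ~= \<infinity>)"
  by (intro exI[of _ "range (%n::nat. cball 0 (real n))"]) (use u in auto)
qed

interpretation lebp: pair_sigma_finite "lebesgue :: R2 measure" "lebesgue :: R2 measure"
 by (intro pair_sigma_finite.intro sigma_finite_lebesgue)

lemma L2_bounded_support:
 fixes f :: "R2 => 'a::euclidean_space"
 assumes "lm f" "!!x. norm (f x) <= K" "!!x. norm x > n ==> f x = 0"
 shows "L2 f"
proof (rule L2_bound)
 have "li (indicat_real (cball (0::R2) n))"
  using emeasure_lborel_cball_finite[of "0::R2" n] by (auto simp: integrable_indicator_iff)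
 moreover have "(%x. (norm (K * indicat_real (cball (0::R2) n) x))^2) = (%x. K^2 * indicat_real (cball 0 n) x)"
  by (auto simp: indicator_def)
 ultimately show "L2 (%x. K * indicat_real (cball 0 n) x)" by (simp add: L2_def)
 show "AE x in lebesgue. norm (f x) <= norm (K * indicat_real (cball 0 n) x)"
  using assms(2,3) by (intro AE_I2) (auto simp: indicator_def not_le intro: order_trans[OF _ abs_ge_self])
qed (rule assms(1))

lemma n2_dominated:
 fixes f :: "nat => R2 => 'a::euclidean_space"
 assumes f: "!!k. f k : borel_measurable lebesgue" "lm g"
  and lim: "AE x in lebesgue. (%k. f k x) ---> g x" and w: "L2 (w :: R2 => real)"
  and le: "!!k. AE x in lebesgue. norm (f k x - g x) <= w x"
 shows "(%k. n2 (%x. f k x - g x)) ---> 0"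
proof -
 have "(%k. LI x. (norm (f k x - g x))^2) ---> (\<integral>x. (0::real) \<partial>(lebesgue :: R2 measure))"
 proof (rule integral_dominated_convergence)
  show "li (%x. (w x)^2)" using L2_integrable[OF w] by simp
  show "AE x in lebesgue. (%k. (norm (f k x - g x))^2) ---> 0"
   using lim
  proof eventually_elim
   case (elim x)
   have "(%k. (norm (f k x - g x))^2) ---> (norm (g x - g x))^2"
    by (intro tendsto_intros elim)
   then show ?case by simp
  qed
  show "AE x in lebesgue. norm ((norm (f k x - g x))^2) <= (w x)^2" for k
   using le[of k] by eventually_elim (simp add: power_mono)
 qed (use f in auto)
 then have "(%k. sqrt (LI x. (norm (f k x - g x))^2)) ---> sqrt 0"
  by (intro tendsto_real_sqrt) simp
 then show ?thesis by (simp add: n2_def)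
qed

text \<open>Continuous functions converging almost everywhere come from measurability. The radial
  retraction \<open>c\<close> onto the ball of radius \<open>K\<close> and the cutoff
  \<open>ps\<close> add the uniform bound and the common support without disturbing the limit, so
  that dominated convergence applies.\<close>

lemma bounded_continuous_approx:
 fixes F :: "R2 => 'a::euclidean_space"
 assumes F: "lm F" "!!x. norm (F x) <= K" "!!x. norm x > n ==> F x = 0" and K: "K > 0"
 obtains h where "!!k::nat. continuous_on UNIV (h k)" "!!k x. norm (h k x) <= K"
  "!!k x. norm x >= n + 1 ==> h k x = 0" "AE x in lebesgue. (%k. h k x) ---> F x"
proof -
 have "F measurable_on UNIV" using lebesgue_measurable_imp_measurable_on[OF F(1)] by simp
 then obtain N g where N: "negligible N" and g: "!!k::nat. continuous_on UNIV (g k)"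
  and lim: "!!x. x \<notin> N ==> (%k. g k x) ---> F x"
  by (auto simp: measurable_on_def)
 define c where "c y = (K / max K (norm y)) *r y" for y :: 'a
 define ps where "ps x = max 0 (min 1 (n + 1 - norm x))" for x :: R2
 define h where "h k x = ps x *r c (g k x)" for k x
 have mx: "max K (norm y) ~= 0" for y :: 'a using K by (auto simp: max_def)
 have cc: "continuous_on UNIV c" unfolding c_def
  by (intro continuous_intros) (use mx in auto)
 have nc: "norm (c y) <= K" for y
 proof -
  have "norm (c y) = K * (norm y / max K (norm y))" using K by (simp add: c_def)
  also have "... <= K * 1" using K by (intro mult_left_mono) (auto simp: divide_le_eq_1 max_def)
  finally show ?thesis by simp
 qed
 have cid: "c y = y" if "norm y <= K" for y using that K by (auto simp: c_def max_def)
 show ?thesis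
 proof (rule that[of h])
  show "continuous_on UNIV (h k)" for k
   unfolding h_def ps_def using continuous_on_compose2[OF cc g] by (intro continuous_intros) auto
  have "0 <= ps x" "ps x <= 1" for x by (auto simp: ps_def)
  then show "norm (h k x) <= K" for k x
   using mult_mono[OF _ nc, of "ps x" 1] by (simp add: h_def)
  show "h k x = 0" if "norm x >= n + 1" for k x using that by (simp add: h_def ps_def)
  have "AE x in lebesgue. x \<notin> N" using N by (simp add: negligible_iff_null_sets AE_not_in)
  then show "AE x in lebesgue. (%k. h k x) ---> F x"
  proof eventually_elim
   case (elim x)
   have "(%k. c (g k x)) ---> c (F x)"
    by (rule continuous_on_tendsto_compose[OF cc lim[OF elim]]) auto
   then have "(%k. h k x) ---> ps x *r F x"
    unfolding h_def cid[OF F(2)] by (intro tendsto_intros)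
   moreover have "ps x *r F x = F x" using F(3)[of x] by (cases "norm x > n") (auto simp: ps_def)
   ultimately show ?case by simp
  qed
 qed
qed

lemma L2_truncate:
 fixes f :: "R2 => 'a::euclidean_space"
 assumes f: "L2 f"
 shows "(%n::nat. n2 (%x. (if norm x <= n \<and> norm (f x) <= n then f x else 0) - f x)) ---> 0"
proof (rule n2_dominated[where w="%x. norm (f x)"])
 show "AE x in lebesgue. (%n::nat. if norm x <= n \<and> norm (f x) <= n then f x else 0) ---> f x"
 proof (intro AE_I2 tendsto_eventually)
  fix x
  obtain n :: nat where n: "max (norm x) (norm (f x)) <= n" using real_arch_simple by blast
  show "\<forall>\<^sub>F n::nat in sequentially. (if norm x <= n \<and> norm (f x) <= n then f x else 0) = f x"
   by (rule eventually_sequentiallyI[of n]) (use n in auto)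
 qed
qed (use f in \<open>auto intro: L2_norm\<close>)

lemma L2_dense:
 fixes f :: "R2 => 'a::euclidean_space"
 assumes f: "L2 f" and e: "e > 0"
 obtains g R where "continuous_on UNIV g" "!!x. norm x >= R ==> g x = 0" "L2 g" "n2 (%x. f x - g x) < e"
proof -
 define F where "F n x = (if norm x <= real n \<and> norm (f x) <= n then f x else 0)" for n x
 have "(%n. n2 (%x. F n x - f x)) ---> 0" unfolding F_def by (rule L2_truncate[OF f])
 then have "\<forall>\<^sub>F n in sequentially. n2 (%x. F n x - f x) < e / 2"
  using e by (intro order_tendstoD) auto
 then obtain n where n: "n2 (%x. F n x - f x) < e / 2"
  using eventually_happens by force
 have Fm: "F n : borel_measurable lebesgue" unfolding F_def using f by measurable
 have Fb: "norm (F n x) <= real n + 1" "norm x > real n ==> F n x = 0" for x by (auto simp: F_def)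
 have K1: "0 < real n + 1" by simp
 have FL: "L2 (F n)" by (rule L2_bounded_support[OF Fm Fb])
 obtain h where h: "!!k::nat. continuous_on UNIV (h k)" "!!k x. norm (h k x) <= real n + 1"
  "!!k x. norm x >= real n + 1 ==> h k x = 0" "AE x in lebesgue. (%k. h k x) ---> F n x"
  using bounded_continuous_approx[OF Fm Fb K1] by blast
 have hm: "h k : borel_measurable lebesgue" for k using h(1) by (rule continuous_lebesgue_measurable)
 have hL: "L2 (h k)" for k by (rule L2_bounded_support[OF hm h(2), where n="real n + 1"]) (use h(3) in force)
 have w: "L2 (%x::R2. (2 * (real n + 1)) * indicat_real (cball 0 (real n + 1)) x)"
  by (rule L2_bounded_support[where K="2 * (real n + 1)" and n="real n + 1"]) (auto simp: indicator_def)
 have "(%k. n2 (%x. h k x - F n x)) ---> 0"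
 proof (rule n2_dominated[OF hm Fm h(4) w])
  show "AE x in lebesgue. norm (h k x - F n x) <= 2 * (real n + 1) * indicat_real (cball 0 (real n + 1)) x" for k
  proof (rule AE_I2)
   fix x
   show "norm (h k x - F n x) <= 2 * (real n + 1) * indicat_real (cball 0 (real n + 1)) x"
   proof (cases "norm x <= real n + 1")
    case True
    have "norm (h k x - F n x) <= norm (h k x) + norm (F n x)" by (rule norm_triangle_ineq4)
    also have "... <= 2 * (real n + 1)" using h(2)[of k x] Fb(1)[of x] by simp
    finally show ?thesis using True by simp
   next
    case False
    then show ?thesis using h(3)[of x k] Fb(2)[of x] by simp
   qed
  qed
 qed
 then have "\<forall>\<^sub>F k in sequentially. n2 (%x. h k x - F n x) < e / 2"
  using e by (intro order_tendstoD) auto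
 then obtain k where k: "n2 (%x. h k x - F n x) < e / 2" using eventually_happens by force
 have "n2 (%x. f x - h k x) < e"
  using n2_triangle3[OF f FL hL, of k] n k n2_commute[of f "F n"] n2_commute[of "F n" "h k"] by simp
 then show ?thesis using that[OF h(1) h(3) hL] by blast
qed

subsection \<open>Mollification\<close>

text \<open>Test functions are only required to be of class C^1, so a truncated polynomial serves as
  mollifier. Its first-order Taylor remainder is quadratic with an explicit constant.\<close>

definition bump :: "R2 => real" where "bump z = (max 0 (1 - (norm z)^2))^2"

definition bumpg :: "R2 => R2" where "bumpg z = (- 4 * max 0 (1 - (norm z)^2)) *r z"

text \<open>The function \<open>s |-> (max 0 s)^2\<close> has a first-order remainder of at most the
  square of the increment. Here the increment \<open>d\<close> of 1 - |z|^2 satisfies |d| <= 5 |h|,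
  which gives 25; the missing 2 comes from the term - |h|^2 in \<open>d\<close>, which
  \<open>bumpg\<close> does not see.\<close>

lemma bump_taylor:
 assumes h: "norm h <= 1"
 shows "abs (bump (z + h) - bump z - bumpg z \<bullet> h) <= 27 * (norm h)^2"
proof (cases "norm z <= 2")
 case False
 have "norm z <= norm (z + h) + norm h" using norm_triangle_ineq4[of "z + h" h] by simp
 then have "1 <= (norm (z + h))^2" "1 <= (norm z)^2" using False h by (auto intro: one_le_power)
 then show ?thesis by (simp add: bump_def bumpg_def)
next
 case True
 define q where "q = 1 - (norm z)^2"
 define d where "d = - 2 * (z \<bullet> h) - (norm h)^2"
 have e: "1 - (norm (z + h))^2 = q + d"
  by (simp add: q_def d_def power2_norm_eq_inner inner_add_left inner_add_right inner_commute)
 have pos: "abs ((max 0 (s + d))^2 - (max 0 s)^2 - 2 * max 0 s * d) <= d^2" for s :: real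
 proof (cases "s >= 0"; cases "s + d >= 0")
  assume s: "s >= 0" "\<not> s + d >= 0"
  then have "s * (s + d) <= 0" "s * d <= 0" by (auto intro: mult_nonneg_nonpos)
  then have a: "s^2 + 2 * s * d <= 0" by (simp add: power2_eq_square distrib_left)
  have b: "0 <= s^2 + d^2 + 2 * s * d" using zero_le_power2[of "s + d"] by (simp only: power2_sum)
  show ?thesis using s a b zero_le_power2[of d] by (simp add: max_def abs_le_iff)
 next
  assume s: "\<not> s >= 0" "s + d >= 0"
  then have "(s + d)^2 <= d^2" by (intro power_mono) auto
  then show ?thesis using s by (auto simp: max_def)
 qed (auto simp: max_def power2_eq_square algebra_simps)
 have ab: "abs (z \<bullet> h) <= 2 * norm h"
  using Cauchy_Schwarz_ineq2[of z h] mult_right_mono[OF True, of "norm h"] by simp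
 have hh: "(norm h)^2 <= norm h" using h by (simp add: power2_eq_square mult_left_le)
 have "abs d <= 5 * norm h" 
  using ab hh zero_le_power2[of "norm h"] norm_ge_zero[of h] unfolding d_def abs_le_iff by linarith
 then have d2: "d^2 <= 25 * (norm h)^2"
  using power_mono[of "abs d" "5 * norm h" 2] by (simp add: power_mult_distrib)
 have q: "0 <= max 0 q" "max 0 q <= 1" by (auto simp: q_def)
 have "2 * max 0 q * (norm h)^2 <= 2 * (norm h)^2" using q by (intro mult_right_mono) auto
 moreover have "0 <= 2 * max 0 q * (norm h)^2" using q by simp
 moreover have "bumpg z \<bullet> h = 2 * max 0 q * d + 2 * max 0 q * (norm h)^2"
  by (simp add: bumpg_def q_def[symmetric] d_def algebra_simps)
 ultimately show ?thesis
  using pos[of q] d2 unfolding bump_def e q_def[symmetric] abs_le_iff by linarith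
qed

lemma bump_nonneg: "0 <= bump z" and bump_le_1: "bump z <= 1" and bump_eq_0: "norm z >= 1 ==> bump z = 0"
 and bumpg_eq_0: "norm z >= 1 ==> bumpg z = 0" and bump_minus: "bump (- z) = bump z"
 by (auto simp: bump_def bumpg_def power_le_one)

lemma continuous_bump: "continuous_on UNIV bump" and continuous_bumpg: "continuous_on UNIV bumpg"
 unfolding bump_def bumpg_def by (intro continuous_intros)+

lemma norm_bumpg_le: "norm (bumpg z) <= 4"
proof (cases "norm z >= 1")
 case False
 then have "max 0 (1 - (norm z)^2) * norm z <= 1 * 1" by (intro mult_mono) auto
 then show ?thesis by (simp add: bumpg_def)
qed (simp add: bumpg_eq_0)

definition bumpc :: real where "bumpc = (LI z. bump z)"

lemma integrable_bump: "li bump" and L2_bump: "L2 bump"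
proof -
 have "L2 (%z. sqrt (bump z))"
  by (rule L2_bounded_support[where K=1 and n=1]) (auto intro!: continuous_lebesgue_measurable continuous_intros continuous_bump simp: bump_nonneg bump_le_1 bump_eq_0)
 from L2_integrable[OF this] show "li bump" by (simp add: bump_nonneg)
 show "L2 bump"
  by (rule L2_bounded_support[where K=1 and n=1]) (auto intro!: continuous_lebesgue_measurable continuous_intros continuous_bump simp: bump_nonneg bump_le_1 bump_eq_0)
qed

lemma bumpc_pos: "bumpc > 0"
proof -
 have "0 < 9/16 * measure lebesgue (ball (0::R2) (1/2))"
  using content_ball_pos[of "1/2" "0::R2"] by simp
 also have "... = (LI z. 9/16 * indicat_real (ball (0::R2) (1/2)) z)"
  using emeasure_lborel_ball_finite[of "0::R2" "1/2"] by simp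
 also have "... <= bumpc" unfolding bumpc_def
 proof (rule integral_mono)
  show "li (%z. 9/16 * indicat_real (ball (0::R2) (1/2)) z)"
   using emeasure_lborel_ball_finite[of "0::R2" "1/2"] by (auto simp: integrable_indicator_iff)
  show "9/16 * indicat_real (ball 0 (1/2)) z <= bump z" for z :: R2
  proof (cases "norm z < 1/2")
   case True
   then have "(norm z)^2 <= (1/2)^2" by (intro power_mono) auto
   then have "(3/4)^2 <= (max 0 (1 - (norm z)^2))^2" by (intro power_mono) (auto simp: power2_eq_square)
   then show ?thesis using True by (simp add: bump_def power2_eq_square)
  qed (auto simp: bump_nonneg)
 qed (rule integrable_bump)
 finally show ?thesis .
qed

definition kern :: "real => R2 => real" where "kern r z = bump (z /\<^sub>R r) / (bumpc * r^2)"

definition kerng :: "real => R2 => R2" where "kerng r z = bumpg (z /\<^sub>R r) /\<^sub>R (bumpc * r ^ 3)"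

lemma kern_nonneg: "0 <= kern r z" and kern_minus: "kern r (- z) = kern r z"
 using bumpc_pos by (auto simp: kern_def bump_nonneg bump_minus)

lemma kern_eq_0: "r > 0 ==> norm z >= r ==> kern r z = 0"
 and kerng_eq_0: "r > 0 ==> norm z >= r ==> kerng r z = 0"
 by (auto simp: kern_def kerng_def bump_eq_0 bumpg_eq_0 field_simps)

lemma kern_le: "r > 0 ==> abs (kern r z) <= 1 / (bumpc * r^2)"
 using bumpc_pos by (auto simp: kern_def bump_nonneg bump_le_1 intro!: divide_right_mono)

lemma kerng_le: "r > 0 ==> norm (kerng r z) <= 4 / (bumpc * r ^ 3)"
proof -
 assume r: "r > 0"
 have "norm (kerng r z) = norm (bumpg (z /\<^sub>R r)) / (bumpc * r ^ 3)"
  using bumpc_pos r by (simp add: kerng_def divide_inverse abs_mult)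
 also have "... <= 4 / (bumpc * r ^ 3)"
  using bumpc_pos r norm_bumpg_le by (intro divide_right_mono) auto
 finally show ?thesis .
qed

lemma continuous_kern: "r > 0 ==> continuous_on UNIV (kern r)"
 and continuous_kerng: "r > 0 ==> continuous_on UNIV (kerng r)"
 unfolding kern_def kerng_def using bumpc_pos
 by (auto intro!: continuous_intros continuous_on_compose2[OF continuous_bump] continuous_on_compose2[OF continuous_bumpg])

lemma kern_taylor:
 assumes r: "r > 0" and h: "norm h <= r"
 shows "abs (kern r (z + h) - kern r z - kerng r z \<bullet> h) <= 27 / (bumpc * r ^ 4) * (norm h)^2"
proof -
 define c where "c = bumpc * r^2"
 have c: "c > 0" using bumpc_pos r by (simp add: c_def)
 have "kern r (z + h) - kern r z - kerng r z \<bullet> h = (bump (z /\<^sub>R r + h /\<^sub>R r) - bump (z /\<^sub>R r) - bumpg (z /\<^sub>R r) \<bullet> (h /\<^sub>R r)) / c"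
  using r bumpc_pos by (simp add: kern_def kerng_def c_def scaleR_add_right diff_divide_distrib divide_inverse power2_eq_square power3_eq_cube algebra_simps)
 moreover have "abs (bump (z /\<^sub>R r + h /\<^sub>R r) - bump (z /\<^sub>R r) - bumpg (z /\<^sub>R r) \<bullet> (h /\<^sub>R r)) <= 27 * (norm (h /\<^sub>R r))^2"
  by (rule bump_taylor) (use r h in \<open>simp add: field_simps\<close>)
 ultimately have "abs (kern r (z + h) - kern r z - kerng r z \<bullet> h) <= 27 * (norm (h /\<^sub>R r))^2 / c"
  using c by (simp add: abs_divide divide_right_mono)
 also have "... = 27 / (bumpc * r ^ 4) * (norm h)^2"
  using r by (simp add: c_def power_mult_distrib divide_inverse power2_eq_square eval_nat_numeral)
 finally show ?thesis .
qed

lemma has_derivative_quadratic: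
 fixes f :: "R2 => real"
 assumes d: "d > 0" and le: "!!h. norm h <= d ==> abs (f (x + h) - f x - D \<bullet> h) <= C * (norm h)^2"
 shows "(f has_derivative (%h. D \<bullet> h)) (at x)"
proof (unfold has_derivative_at, intro conjI)
 show "bounded_linear (%h. D \<bullet> h)" by (rule bounded_linear_inner_right)
 have "\<forall>\<^sub>F h in at 0. norm (h::R2) <= d"
  using d by (auto simp: eventually_at intro!: exI[of _ d])
 then have ev: "\<forall>\<^sub>F h in at 0. norm (norm (f (x + h) - f x - D \<bullet> h) / norm h) <= abs C * norm h"
 proof eventually_elim
  case (elim h)
  have "abs (f (x + h) - f x - D \<bullet> h) <= abs C * (norm h)^2"
   using le[OF elim] mult_right_mono[OF abs_ge_self[of C], of "(norm h)^2"] by simp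
  then show ?case by (cases "h = 0") (simp_all add: divide_le_eq power2_eq_square mult.assoc)
 qed
 have "((%h::R2. abs C * norm h) \<longlongrightarrow> abs C * norm (0::R2)) (at 0)"
  by (rule tendsto_mult[OF tendsto_const tendsto_norm[OF tendsto_ident_at]])
 then have "((%h::R2. abs C * norm h) \<longlongrightarrow> 0) (at 0)" by simp
 then show "(%h. norm (f (x + h) - f x - D \<bullet> h) / norm h) \<midarrow>0\<rightarrow> 0"
  by (rule Lim_null_comparison[OF ev])
qed

lemma cgrad_eqI: "(f has_derivative (%h. D \<bullet> h)) (at x) ==> cgrad f x = D"
proof -
 assume d: "(f has_derivative (%h. D \<bullet> h)) (at x)"
 have e: "frechet_derivative f (at x) = (%h. D \<bullet> h)" using frechet_derivative_at[OF d] by simp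
 show ?thesis unfolding cgrad_def e by (simp add: vec_eq_iff inner_axis)
qed

lemma kern_shift_has_derivative:
 assumes r: "r > 0" shows "((%y. kern r (x - y)) has_derivative (%h. - kerng r (x - y) \<bullet> h)) (at y)"
proof (rule has_derivative_quadratic[OF r])
 fix h :: R2 assume "norm h <= r"
 then show "abs (kern r (x - (y + h)) - kern r (x - y) - - kerng r (x - y) \<bullet> h) <= 27 / (bumpc * r ^ 4) * (norm h)^2"
  using kern_taylor[OF r, of "- h" "x - y"] by (simp add: algebra_simps)
qed

lemma bounded_ball_support: "(!!x. norm (x - a) >= r ==> f x = 0) ==> bounded {x. f x ~= 0}"
 for a :: R2 and f :: "R2 => real"
 by (rule bounded_subset[OF bounded_cball[of a r]]) (auto simp: dist_norm norm_minus_commute[of a], meson linear)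

lemma cgrad_kern_shift: "r > 0 ==> cgrad (%y. kern r (x - y)) y = - kerng r (x - y)"
 by (rule cgrad_eqI[OF kern_shift_has_derivative])

lemma test_fun_kern:
 assumes r: "r > 0" shows "test_fun (%y. kern r (x - y))"
proof -
 have "continuous_on UNIV (cgrad (%y. kern r (x - y)))"
  unfolding cgrad_kern_shift[OF r] by (intro continuous_intros continuous_on_compose2[OF continuous_kerng[OF r]]) auto
 moreover have "bounded {y. kern r (x - y) ~= 0}"
  by (rule bounded_ball_support[where a=x and r=r]) (auto simp: kern_eq_0[OF r] norm_minus_commute)
 ultimately show ?thesis
  using kern_shift_has_derivative[OF r, of x] by (auto simp: test_fun_def differentiable_def)
qed

lemma L2_loc_int:
 assumes f: "L2 f" shows "loc_int f"
 unfolding loc_int_def set_integrable_def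
proof (intro conjI allI impI)
 show m: "lm f" using f by auto
 fix K :: "R2 set" assume K: "compact K"
 have iK: "li (%x. indicat_real K x)"
  using emeasure_compact_finite[OF K] K by (auto simp: integrable_indicator_iff borel_compact)
 have m': "lm (%x. indicator K x *r f x)" 
  using m lmeasurable_compact[OF K] by (auto intro!: borel_measurable_scaleR borel_measurable_indicator)
 have "a <= 1 + a^2" for a :: real
  using sum_squares_bound[of a 1] by (cases "a >= 0") (auto simp: power2_eq_square intro: order_trans[of _ 0])
 then have "norm (indicator K x *r f x) <= norm (indicat_real K x + (norm (f x))^2)" for x
  by (auto simp: indicator_def)
 then show "li (%x. indicator K x *r f x)"
  by (intro Bochner_Integration.integrable_bound[OF Bochner_Integration.integrable_add[OF iK L2_integrable[OF f]] m'] AE_I2)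
qed

lemma loc_int_mult:
 fixes u :: "R2 => 'a::euclidean_space"
 assumes u: "loc_int u" and k: "lm k" "!!y. abs (k y) <= B" "!!y. y \<notin> K ==> k y = 0"
  and K: "compact K"
 shows "li (%y. k y *r u y)"
proof -
 have "li (%y. indicator K y *r u y)"
  using u K by (simp add: loc_int_def set_integrable_def)
 then have i: "li (%y. B *r (indicator K y *r u y))" by (rule integrable_scaleR_right)
 have "norm (k y *r u y) <= norm (B *r (indicator K y *r u y))" for y
  using k(2)[of y] k(3)[of y] by (cases "y : K") (auto intro!: mult_right_mono order_trans[OF _ abs_ge_self])
 then show ?thesis
  using u k by (intro Bochner_Integration.integrable_bound[OF i]) (auto simp: loc_int_def)
qed

definition conv :: "real => (R2 => 'a::euclidean_space) => R2 => 'a" where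
 "conv r u x = (LI y. kern r (x - y) *r u y)"

lemma integrable_shifted_kernel:
 fixes u :: "R2 => 'a::euclidean_space"
 assumes u: "loc_int u" and k: "continuous_on UNIV k" "!!z. abs (k z) <= B" "!!z. norm z >= r ==> k z = 0"
 shows "li (%y. k (x - y) *r u y)"
 by (rule loc_int_mult[OF u _ _ _ compact_cball[of x r]])
  (auto intro!: continuous_lebesgue_measurable continuous_on_compose2[OF k(1)] continuous_intros k simp: dist_norm)

lemma continuous_shifted_kernel:
 fixes u :: "R2 => 'a::euclidean_space"
 assumes u: "loc_int u" and k: "continuous_on UNIV k" "!!z. abs (k z) <= B" "!!z. norm z >= r ==> k z = 0"
 shows "continuous_on UNIV (%x. LI y. k (x - y) *r u y)"
proof (rule continuous_on_sequentiallyI)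
 fix X :: "nat => R2" and x assume X: "X ---> x"
 obtain R where R: "!!n. norm (X n) <= R" using X by (metis Bseq_def convergentI convergent_imp_Bseq)
 let ?K = "cball (0::R2) (R + r)"
 have iK: "li (%y. indicator ?K y *r u y)"
  using u by (auto simp: loc_int_def set_integrable_def)
 show "(%n. LI y. k (X n - y) *r u y) ---> (LI y. k (x - y) *r u y)"
 proof (rule integral_dominated_convergence)
  show "li (%y. B * norm (indicator ?K y *r u y))"
   by (intro integrable_mult_right integrable_norm iK)
  show "lm (%y. k (x - y) *r u y)" "!!n. (%y. k (X n - y) *r u y) : borel_measurable lebesgue"
   using integrable_shifted_kernel[OF u k] by (auto intro: borel_measurable_integrable)
  show "AE y in lebesgue. (%n. k (X n - y) *r u y) ---> k (x - y) *r u y"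
   using k(1) X by (intro AE_I2 tendsto_intros continuous_on_tendsto_compose[OF k(1)]) auto
  show "AE y in lebesgue. norm (k (X n - y) *r u y) <= B * norm (indicator ?K y *r u y)" for n
  proof (rule AE_I2)
   fix y
   show "norm (k (X n - y) *r u y) <= B * norm (indicator ?K y *r u y)"
   proof (cases "norm (X n - y) >= r")
    case False
    then have "y : ?K" using R[of n] norm_triangle_ineq4[of "X n" "X n - y"] by simp
    then show ?thesis using k(2)[of "X n - y"] by (auto intro: mult_right_mono)
   next
    case True
    have "B >= 0" using k(2)[of 0] by simp
    then show ?thesis using k(3)[OF True] by simp
   qed
  qed
 qed
qed

lemma
 assumes r: "r > 0" and u: "loc_int u"
 shows integrable_conv: "li (%y. kern r (x - y) *r u y)"
  and continuous_conv: "continuous_on UNIV (conv r u)"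
 unfolding conv_def
 by (rule integrable_shifted_kernel[OF u continuous_kern[OF r] kern_le[OF r] kern_eq_0[OF r]]
  continuous_shifted_kernel[OF u continuous_kern[OF r] kern_le[OF r] kern_eq_0[OF r]]; simp)+

lemma kerng_component:
 assumes "r > 0" shows "continuous_on UNIV (%z. kerng r z $ i)" "abs (kerng r z $ i) <= 4 / (bumpc * r ^ 3)"
  "norm z >= r ==> kerng r z $ i = 0"
 using kerng_le[OF assms, of z] component_le_norm_cart[of "kerng r z" i] kerng_eq_0[OF assms, of z] continuous_kerng[OF assms]
 by (auto intro!: continuous_on_component)

text \<open>The Taylor remainder of the kernel is quadratic in \<open>h\<close> uniformly in the
  base point. Integrated against \<open>u\<close> over a bounded set it stays quadratic, so
  differentiation under the integral needs no limit theorem.\<close>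

lemma conv_has_derivative:
 fixes u :: "R2 => real"
 assumes r: "r > 0" and u: "loc_int u"
 shows "(conv r u has_derivative (%h. (\<chi> i. LI y. kerng r (x - y) $ i * u y) \<bullet> h)) (at x)"
proof (rule has_derivative_quadratic[OF r])
 let ?K = "cball x (2 * r)" and ?c = "27 / (bumpc * r ^ 4)"
 have iK: "li (%y. indicator ?K y *r u y)"
  using u by (auto simp: loc_int_def set_integrable_def)
 fix h :: R2 assume h: "norm h <= r"
 have ig: "li (%y. kerng r (x - y) $ i * u y)" for i
  using integrable_shifted_kernel[OF u kerng_component(1)[OF r] kerng_component(2)[OF r] kerng_component(3)[OF r]] by simp
 have "(\<chi> i. LI y. kerng r (x - y) $ i * u y) \<bullet> h = (SUM i:UNIV. LI y. kerng r (x - y) $ i * u y * h $ i)"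
  by (simp add: inner_vec_def)
 also have "... = (LI y. (SUM i:UNIV. kerng r (x - y) $ i * u y * h $ i))"
  by (rule Bochner_Integration.integral_sum[symmetric]) (intro integrable_mult_left ig)
 also have "... = (LI y. (kerng r (x - y) \<bullet> h) * u y)"
  by (simp add: inner_vec_def sum_distrib_left sum_distrib_right mult_ac)
 finally have gi: "(\<chi> i. LI y. kerng r (x - y) $ i * u y) \<bullet> h = (LI y. (kerng r (x - y) \<bullet> h) * u y)" .
 have igh: "li (%y. (kerng r (x - y) \<bullet> h) * u y)"
 proof -
  have "li (%y. SUM i:UNIV. kerng r (x - y) $ i * u y * h $ i)"
   by (intro Bochner_Integration.integrable_sum integrable_mult_left ig)
  then show ?thesis by (simp add: inner_vec_def sum_distrib_left sum_distrib_right mult_ac)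
 qed
 note ic = integrable_conv[OF r u, simplified]
 have "conv r u (x + h) - conv r u x - (\<chi> i. LI y. kerng r (x - y) $ i * u y) \<bullet> h
   = (LI y. kern r (x + h - y) * u y - kern r (x - y) * u y - (kerng r (x - y) \<bullet> h) * u y)"
  unfolding gi conv_def using ic igh by (simp add: Bochner_Integration.integral_diff Bochner_Integration.integrable_diff)
 also have "abs ... <= (LI y. (?c * (norm h)^2) * norm (indicator ?K y *r u y))"
  unfolding real_norm_def[symmetric]
 proof (rule Bochner_Integration.integral_norm_bound_integral)
  show "li (%y. kern r (x + h - y) * u y - kern r (x - y) * u y - (kerng r (x - y) \<bullet> h) * u y)"
   by (intro Bochner_Integration.integrable_diff ic igh)
  show "li (%y. (?c * (norm h)^2) * norm (indicator ?K y *r u y))"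
   by (intro integrable_mult_right integrable_norm iK)
  fix y
  have eq: "kern r (x + h - y) * u y - kern r (x - y) * u y - (kerng r (x - y) \<bullet> h) * u y
    = (kern r ((x - y) + h) - kern r (x - y) - kerng r (x - y) \<bullet> h) * u y"
   by (simp add: algebra_simps)
  show "norm (kern r (x + h - y) * u y - kern r (x - y) * u y - (kerng r (x - y) \<bullet> h) * u y) <= (?c * (norm h)^2) * norm (indicator ?K y *r u y)"
  proof (cases "y : ?K")
   case True
   then show ?thesis
    unfolding eq using mult_right_mono[OF kern_taylor[OF r h, of "x - y"], of "abs (u y)"] by (simp add: abs_mult)
  next
   case False
   then have a: "norm (x - y) >= 2 * r" by (simp add: dist_norm)
   have "norm (x - y) <= norm ((x - y) + h) + norm h" using norm_triangle_ineq4[of "(x - y) + h" h] by simp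
   then have "norm ((x - y) + h) >= r" "norm (x - y) >= r" using a h r by auto
   then show ?thesis unfolding eq using r bumpc_pos by (simp add: kern_eq_0[OF r] kerng_eq_0[OF r])
  qed
 qed
 also have "... = (?c * (LI y. norm (indicator ?K y *r u y))) * (norm h)^2" by simp
 finally show "abs (conv r u (x + h) - conv r u x - (\<chi> i. LI y. kerng r (x - y) $ i * u y) \<bullet> h)
  <= (?c * (LI y. norm (indicator ?K y *r u y))) * (norm h)^2" .
qed

lemma cgrad_conv_component:
 fixes u :: "R2 => real"
 assumes "r > 0" "loc_int u" shows "cgrad (conv r u) x $ i = (LI y. kerng r (x - y) $ i * u y)"
 by (simp add: cgrad_eqI[OF conv_has_derivative[OF assms]])

lemma continuous_cgrad_conv:
 fixes u :: "R2 => real"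
 assumes "r > 0" "loc_int u" shows "continuous_on UNIV (cgrad (conv r u))"
proof -
 have "continuous_on UNIV (%x. cgrad (conv r u) x $ i)" for i
  unfolding cgrad_conv_component[OF assms]
  using continuous_shifted_kernel[OF assms(2) kerng_component(1)[OF assms(1)] kerng_component(2)[OF assms(1)] kerng_component(3)[OF assms(1)]] by simp
 then have "continuous_on UNIV (%x. \<chi> i. cgrad (conv r u) x $ i)" by (intro continuous_on_vec_lambda)
 then show ?thesis by simp
qed

lemma test_fun_conv:
 fixes u :: "R2 => real"
 assumes r: "r > 0" and u: "loc_int u" "!!x. norm x >= R ==> u x = 0"
 shows "test_fun (conv r u)"
proof -
 have "conv r u x = 0" if x: "norm (x - 0) >= R + r" for x
 proof -
  have "kern r (x - y) *r u y = 0" for y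
  proof (cases "norm y >= R")
   case False
   then have "norm (x - y) >= r" using x norm_triangle_ineq2[of x y] by simp
   then show ?thesis by (simp add: kern_eq_0[OF r])
  qed (use u in auto)
  then have "(%y. kern r (x - y) *r u y) = (%y. 0)" by blast
  then show ?thesis unfolding conv_def by (metis integral_zero)
 qed
 then have "bounded {x. conv r u x ~= 0}" by (rule bounded_ball_support)
 then show ?thesis
  using conv_has_derivative[OF r u(1)] continuous_cgrad_conv[OF r u(1)] by (auto simp: test_fun_def differentiable_def)
qed

text \<open>The shifted kernel \<open>kern r (x - y)\<close> is itself a test function in
  \<open>y\<close>, so the definition of the weak gradient moves the derivative from the kernel onto
  \<open>u\<close>.\<close>

lemma cgrad_conv_weak:
 assumes r: "r > 0" and w: "weak_grad u g"
 shows "cgrad (conv r u) x = conv r g x"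
proof -
 have u: "loc_int u" and g: "loc_int g" using w by (auto simp: weak_grad_def)
 have "cgrad (conv r u) x $ i = conv r g x $ i" for i
 proof -
  have "cgrad (conv r u) x $ i = - (LI y. u y * cgrad (%y. kern r (x - y)) y $ i)"
   by (simp add: cgrad_conv_component[OF r u] cgrad_kern_shift[OF r] mult.commute)
  also have "... = (LI y. g y $ i * kern r (x - y))"
   using w test_fun_kern[OF r] by (simp add: weak_grad_def)
  also have "... = (LI y. (kern r (x - y) *r g y) $ i)" by (simp add: mult.commute)
  also have "... = conv r g x $ i" unfolding conv_def
   by (rule integral_bounded_linear[OF bounded_linear_vec_nth integrable_conv[OF r g]])
  finally show ?thesis .
 qed
 then show ?thesis by (simp add: vec_eq_iff)
qed

lemma nn_integral_affine_R2:
 fixes f :: "R2 => ennreal"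
 assumes c: "c ~= 0" and f: "lm f"
 shows "(\<integral>\<^sup>+x. f x \<partial>lebesgue) = ennreal (c^2) * (\<integral>\<^sup>+x. f (t + c *r x) \<partial>lebesgue)"
proof -
 note m[measurable] = measurable_affine_R2[OF c, of t]
 have "(\<integral>\<^sup>+x. f x \<partial>lebesgue) = (\<integral>\<^sup>+x. f x \<partial>(density (distr lebesgue lebesgue (%x. t + c *r x)) (%_. ennreal (c^2))))"
  using lebesgue_R2_density[OF c, of t] by simp
 also have "... = (\<integral>\<^sup>+x. ennreal (c^2) * f x \<partial>distr lebesgue lebesgue (%x. t + c *r x))"
  using f by (intro nn_integral_density) auto
 also have "... = (\<integral>\<^sup>+x. ennreal (c^2) * f (t + c *r x) \<partial>lebesgue)"
  using f by (subst nn_integral_distr) auto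
 also have "... = ennreal (c^2) * (\<integral>\<^sup>+x. f (t + c *r x) \<partial>lebesgue)"
  by (rule nn_integral_cmult) (rule measurable_compose[OF m f])
 finally show ?thesis .
qed

lemma
 assumes r: "r > 0"
 shows kern_shift_integrable: "li (%y. kern r (x - y))"
  and kern_shift_integral: "(LI y. kern r (x - y)) = 1"
  and kern_integrable: "li (kern r)"
  and kern_integral: "(LI y. kern r y) = 1"
proof -
 have mb: "lm bump" by (rule continuous_lebesgue_measurable[OF continuous_bump])
 have e1: "(%y. bump (x /\<^sub>R r + (- 1 / r) *r y)) = (%y. bump ((x - y) /\<^sub>R r))" for x :: R2
  by (rule ext) (simp add: scaleR_diff_right divide_inverse)
 have "- 1 / r ~= 0" using r by simp
 from integrable_affine_R2[OF this mb, of "x /\<^sub>R r" for x] integral_affine_R2[OF this mb, of "x /\<^sub>R r" for x]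
 have "li (%y. bump ((x - y) /\<^sub>R r))" "(LI y. bump ((x - y) /\<^sub>R r)) = bumpc * r^2" for x
  unfolding e1 using integrable_bump r by (auto simp: bumpc_def power_divide)
 then show 1: "li (%y. kern r (x - y))" and 2: "(LI y. kern r (x - y)) = 1" for x
  using bumpc_pos r by (auto simp: kern_def)
 show "li (kern r)" "(LI y. kern r y) = 1"
  using 1[of 0] 2[of 0] kern_minus[of r] by auto
qed

text \<open>Jensen's inequality for the probability density \<open>kern r (x - y)\<close>, obtained
  from Cauchy-Schwarz by writing the density as a product of two square roots.\<close>

lemma kern_Jensen:
 fixes a :: "R2 => real"
 assumes r: "r > 0" and a: "lm a" "li (%y. kern r (x - y) * (a y)^2)"
 shows "li (%y. kern r (x - y) * abs (a y))"
  "(LI y. kern r (x - y) * abs (a y))^2 <= (LI y. kern r (x - y) * (a y)^2)"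
proof -
 let ?f = "%y. sqrt (kern r (x - y))" and ?g = "%y. sqrt (kern r (x - y)) * abs (a y)"
 have m: "lm (%y. kern r (x - y))"
  using kern_shift_integrable[OF r] by (rule borel_measurable_integrable)
 have f: "L2 ?f" "n2 ?f = 1"
  using m kern_shift_integrable[OF r, of x] kern_shift_integral[OF r, of x] by (auto simp: L2_def n2_def kern_nonneg)
 have g: "L2 ?g" "n2 ?g = sqrt (LI y. kern r (x - y) * (a y)^2)"
  using m a by (auto simp: L2_def n2_def kern_nonneg power_mult_distrib)
 have e: "?f y * ?g y = kern r (x - y) * abs (a y)" for y by (simp add: kern_nonneg mult.assoc[symmetric])
 show "li (%y. kern r (x - y) * abs (a y))"
  using L2_mult_integrable[OF f(1) g(1)] unfolding e .
 have "(LI y. kern r (x - y) * abs (a y)) <= sqrt (LI y. kern r (x - y) * (a y)^2)"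
  using L2_mult_le[OF f(1) g(1)] unfolding e f g by simp
 then have "(LI y. kern r (x - y) * abs (a y))^2 <= (sqrt (LI y. kern r (x - y) * (a y)^2))^2"
  by (intro power_mono) (auto simp: kern_nonneg intro!: integral_nonneg_AE)
 then show "(LI y. kern r (x - y) * abs (a y))^2 <= (LI y. kern r (x - y) * (a y)^2)"
  by (simp add: kern_nonneg integral_nonneg_AE)
qed

lemma kern_L2_integrable:
 assumes r: "r > 0" and u: "L2 u" shows "li (%y. kern r (x - y) * (norm (u y))^2)"
proof (rule Bochner_Integration.integrable_bound)
 show "li (%y. 1 / (bumpc * r^2) * (norm (u y))^2)"
  by (intro integrable_mult_right L2_integrable u)
 show "lm (%y. kern r (x - y) * (norm (u y))^2)"
  using borel_measurable_integrable[OF kern_shift_integrable[OF r]] u by auto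
 show "AE y in lebesgue. norm (kern r (x - y) * (norm (u y))^2) <= norm (1 / (bumpc * r^2) * (norm (u y))^2)"
  unfolding norm_mult using kern_le[OF r] bumpc_pos by (intro AE_I2 mult_right_mono) auto
qed

lemma measurable_kernel_pair [measurable]:
 "r > 0 ==> (%z. kern r (fst z - snd z)) : borel_measurable (LL)"
proof -
 assume r: "r > 0"
 have [measurable]: "kern r : borel_measurable borel" by (rule borel_measurable_continuous_onI[OF continuous_kern[OF r]])
 have [measurable]: "fst : LL \<rightarrow>\<^sub>M (borel :: R2 measure)" "snd : LL \<rightarrow>\<^sub>M (borel :: R2 measure)"
  using measurable_compose[OF measurable_fst borel_lebesgue_id] measurable_compose[OF measurable_snd borel_lebesgue_id] by auto
 show ?thesis by measurable
qed

lemma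
 fixes u :: "R2 => 'a::euclidean_space"
 assumes r: "r > 0" and u: "L2 u"
 shows L2_conv: "L2 (conv r u)" and n2_conv_le: "n2 (conv r u) <= n2 u"
proof -
 note li = L2_loc_int[OF u]
 have m: "conv r u : borel_measurable lebesgue" by (rule continuous_lebesgue_measurable[OF continuous_conv[OF r li]])
 have "(norm (conv r u x))^2 <= (LI y. kern r (x - y) * (norm (u y))^2)" for x
 proof -
  have "norm (conv r u x) <= (LI y. norm (kern r (x - y) *r u y))"
   unfolding conv_def by (rule integral_norm_bound)
  also have "... = (LI y. kern r (x - y) * abs (norm (u y)))" by (simp add: kern_nonneg)
  finally have "(norm (conv r u x))^2 <= (LI y. kern r (x - y) * abs (norm (u y)))^2"
   by (intro power_mono) auto
  also have "... <= (LI y. kern r (x - y) * (norm (u y))^2)"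
   by (rule kern_Jensen(2)[OF r _ kern_L2_integrable[OF r u]]) (use u in auto)
  finally show ?thesis .
 qed
 then have "(\<integral>\<^sup>+x. ennreal ((norm (conv r u x))^2) \<partial>lebesgue) <= (\<integral>\<^sup>+x. ennreal (LI y. kern r (x - y) * (norm (u y))^2) \<partial>lebesgue)"
  by (intro nn_integral_mono ennreal_leI)
 also have "... = (\<integral>\<^sup>+x. \<integral>\<^sup>+y. ennreal (kern r (x - y) * (norm (u y))^2) \<partial>lebesgue \<partial>lebesgue)"
  by (subst nn_integral_eq_integral[OF kern_L2_integrable[OF r u]]) (auto simp: kern_nonneg)
 also have "... = (\<integral>\<^sup>+y. \<integral>\<^sup>+x. ennreal (kern r (x - y) * (norm (u y))^2) \<partial>lebesgue \<partial>lebesgue)"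
 proof (rule lebp.Fubini'[symmetric])
  have [measurable]: "lm u" using u by auto
  show "(%(x, y). ennreal (kern r (x - y) * (norm (u y))^2)) : borel_measurable (LL)"
   unfolding split_beta by (intro measurable_compose[OF _ measurable_ennreal] borel_measurable_times measurable_kernel_pair[OF r]) measurable
 qed
 also have "... = (\<integral>\<^sup>+y. ennreal ((norm (u y))^2) \<partial>lebesgue)"
 proof (rule nn_integral_cong)
  fix y
  have "(\<integral>\<^sup>+x. ennreal (kern r (x - y)) \<partial>lebesgue) = (\<integral>\<^sup>+x. ennreal (kern r (y - x)) \<partial>lebesgue)"
   by (metis kern_minus minus_diff_eq)
  also have "... = 1"
   by (subst nn_integral_eq_integral[OF kern_shift_integrable[OF r]]) (auto simp: kern_nonneg kern_shift_integral[OF r])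
  finally have 1: "(\<integral>\<^sup>+x. ennreal (kern r (x - y)) \<partial>lebesgue) = 1" .
  have mm: "lm (%x. ennreal (kern r (x - y)))"
   by (intro measurable_compose[OF _ measurable_ennreal] continuous_lebesgue_measurable continuous_on_compose2[OF continuous_kern[OF r]] continuous_intros) auto
  show "(\<integral>\<^sup>+x. ennreal (kern r (x - y) * (norm (u y))^2) \<partial>lebesgue) = ennreal ((norm (u y))^2)"
   using nn_integral_multc[OF mm, of "ennreal ((norm (u y))^2)"] 1 by (simp add: ennreal_mult kern_nonneg)
 qed
 also have "... = ennreal ((n2 u)^2)"
  by (subst nn_integral_eq_integral[OF L2_integrable[OF u]]) (auto simp: n2_sq)
 finally have le: "(\<integral>\<^sup>+x. ennreal ((norm (conv r u x))^2) \<partial>lebesgue) <= ennreal ((n2 u)^2)" .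
 have i: "li (%x. (norm (conv r u x))^2)"
  by (rule integrableI_bounded) (use m le le_less_trans[OF le] in auto)
 then show "L2 (conv r u)" using m by (simp add: L2_def)
 have "(n2 (conv r u))^2 <= (n2 u)^2"
  using le nn_integral_eq_integral[OF i] by (simp add: n2_sq[of "conv r u"])
 then show "n2 (conv r u) <= n2 u" by (rule power2_le_imp_le) simp
qed

lemma conv_diff:
 "r > 0 ==> loc_int u ==> loc_int v ==> conv r (%y. u y - v y) x = conv r u x - conv r v x"
 unfolding conv_def by (simp add: scaleR_diff_right integrable_conv Bochner_Integration.integral_diff)

lemma conv_const_diff:
 assumes r: "r > 0" and u: "loc_int u"
 shows "c - conv r u x = (LI y. kern r (x - y) *r (c - u y))"
  and "li (%y. kern r (x - y) *r (c - u y))"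
proof -
 have i: "li (%y. kern r (x - y) *r c)" using kern_shift_integrable[OF r] by simp
 have "(LI y. kern r (x - y) *r (c - u y)) = (LI y. kern r (x - y) *r c) - conv r u x"
  unfolding conv_def scaleR_diff_right by (rule Bochner_Integration.integral_diff[OF i integrable_conv[OF r u]])
 also have "(LI y. kern r (x - y) *r c) = c"
  using integral_scaleR_left[OF kern_shift_integrable[OF r], of x c] kern_shift_integral[OF r, of x] by simp
 finally show "c - conv r u x = (LI y. kern r (x - y) *r (c - u y))" ..
 show "li (%y. kern r (x - y) *r (c - u y))"
  unfolding scaleR_diff_right by (intro Bochner_Integration.integrable_diff i integrable_conv[OF r u])
qed

lemma norm_conv_le:
 assumes r: "r > 0" and u: "loc_int u" and K: "!!y. norm (y - x) <= r ==> norm (c - u y) <= K"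
 shows "norm (c - conv r u x) <= K"
proof -
 have "norm (c - conv r u x) <= (LI y. K * kern r (x - y))"
  unfolding conv_const_diff(1)[OF r u]
 proof (rule Bochner_Integration.integral_norm_bound_integral)
  fix y
  show "norm (kern r (x - y) *r (c - u y)) <= K * kern r (x - y)"
  proof (cases "norm (x - y) >= r")
   case False
   then have "norm (c - u y) <= K" using K[of y] by (simp add: norm_minus_commute)
   from mult_left_mono[OF this kern_nonneg[of r "x - y"]] show ?thesis by (simp add: kern_nonneg mult.commute)
  qed (simp add: kern_eq_0[OF r])
 qed (use conv_const_diff(2)[OF r u] kern_shift_integrable[OF r] in auto)
 then show ?thesis using kern_shift_integral[OF r] by simp
qed

lemma conv_L2_tendsto:
 fixes u :: "R2 => 'a::euclidean_space"
 assumes u: "L2 u"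
 shows "(%k. n2 (%x. conv (1 / real (Suc k)) u x - u x)) ---> 0"
proof (rule LIMSEQ_I)
 fix e :: real assume e: "e > 0"
 obtain g R where g: "continuous_on UNIV g" "!!x. norm x >= R ==> g x = 0" "L2 g" "n2 (%x. u x - g x) < e / 3"
  using L2_dense[OF u, of "e/3"] e by auto
 have uc: "uniformly_continuous_on UNIV g"
 proof (rule uniformly_continuous_on_sequentially[THEN iffD2], intro allI impI)
  fix X Y :: "nat => R2" assume XY: "(ALL n. X n : UNIV) \<and> (ALL n. Y n : UNIV) \<and> (%n. dist (X n) (Y n)) ---> 0"
  have "uniformly_continuous_on (cball 0 (abs R + 1)) g"
   by (rule compact_uniformly_continuous) (auto intro: continuous_on_subset[OF g(1)])
  note ucK = this
  show "(%n. dist (g (X n)) (g (Y n))) ---> 0"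
  proof (rule LIMSEQ_I)
   fix epp :: real assume epp: "epp > 0"
   obtain d where d: "d > 0" "!!x y. x : cball 0 (abs R + 1) ==> y : cball 0 (abs R + 1) ==> dist y x < d ==> dist (g y) (g x) < epp"
    using ucK epp unfolding uniformly_continuous_on_def by blast
   have "\<forall>\<^sub>F n in sequentially. dist (X n) (Y n) < min d 1"
    using XY d by (intro order_tendstoD) auto
   then obtain N where N: "!!n. n >= N ==> dist (X n) (Y n) < min d 1" by (auto simp: eventually_sequentially)
   have "dist (g (X n)) (g (Y n)) < epp" if n: "n >= N" for n
   proof (cases "X n : cball 0 (abs R + 1) \<and> Y n : cball 0 (abs R + 1)")
    case False
    have "abs (norm (X n) - norm (Y n)) < 1"
     using N[OF n] norm_triangle_ineq3[of "X n" "Y n"] by (simp add: dist_norm)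
    then have "norm (X n) >= R" "norm (Y n) >= R" using False by auto
    then show ?thesis using g(2) epp by simp
   qed (use d(2) N[OF n] in auto)
   then show "EX no. ALL n>=no. norm (dist (g (X n)) (g (Y n)) - 0) < epp" by auto
  qed
 qed
 define Rb where "Rb = max 0 R + 1"
 have w: "L2 (%x::R2. 1 * indicat_real (cball 0 Rb) x)"
  by (rule L2_bounded_support[where K=1 and n=Rb]) (auto simp: indicator_def)
 define A where "A = n2 (%x::R2. 1 * indicat_real (cball 0 Rb) x)"
 have A0: "A >= 0" by (simp add: A_def)
 obtain d where d: "d > 0" "!!x y. dist y x < d ==> dist (g y) (g x) < e / (3 * (A + 1))"
  using uc e unfolding uniformly_continuous_on_def
  by (metis UNIV_I A_def add_nonneg_pos divide_pos_pos mult_pos_pos n2_nonneg zero_less_numeral zero_less_one)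
 obtain N where N: "N > 0" "1 / real N < d" using reals_Archimedean2[of "1/d"] d
  by (metis divide_less_eq gr0I mult.commute of_nat_0 of_nat_0_less_iff zero_less_divide_1_iff less_divide_eq not_less_iff_gr_or_eq)
 have "n2 (%x. conv (1 / real (Suc k)) u x - u x) < e" if k: "k >= N" for k
 proof -
  define r where "r = 1 / real (Suc k)"
  have "r < 1 / real N" unfolding r_def using k N by (intro divide_strict_left_mono) auto
  then have r: "r > 0" "r < d" "r <= 1" using N by (auto simp: r_def)
  have lg: "loc_int g" by (rule L2_loc_int[OF g(3)])
  have le: "norm (g x - conv r g x) <= norm (e / (3 * (A + 1)) * (1 * indicat_real (cball 0 Rb) x))" for x
  proof (cases "norm x <= Rb")
   case True
   have "norm (g x - conv r g x) <= e / (3 * (A + 1))"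
    by (rule norm_conv_le[OF r(1) lg]) (use d(2) r in \<open>auto simp: dist_norm norm_minus_commute intro!: less_imp_le\<close>)
   then show ?thesis using True A0 e by simp
  next
   case False
   have "norm (g x - conv r g x) <= 0"
   proof (rule norm_conv_le[OF r(1) lg])
    fix y assume "norm (y - x) <= r"
    then have "norm y >= R" "norm x >= R" using False r norm_triangle_ineq2[of x y] by (auto simp: Rb_def norm_minus_commute)
    then show "norm (g x - g y) <= 0" using g(2) by simp
   qed
   then show ?thesis by (rule order_trans) simp
  qed
  have Lc: "L2 (conv r g)" "L2 (conv r u)" using L2_conv[OF r(1)] g u by auto
  have "n2 (%x. g x - conv r g x) <= n2 (%x. e / (3 * (A + 1)) * (1 * indicat_real (cball 0 Rb) x))"
   by (rule n2_mono[OF L2_cmult[OF w]]) (use L2_diff[OF g(3) Lc(1)] le in auto)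
  also have "... = abs (e / (3 * (A + 1))) * A" unfolding A_def by (rule n2_cmult)
  also have "abs (e / (3 * (A + 1))) = e / (3 * (A + 1))" using e A0 by simp
  also have "e / (3 * (A + 1)) * A < e / 3" using e A0 by (simp add: field_simps)
  finally have 1: "n2 (%x. g x - conv r g x) < e / 3" .
  have "conv r (%y. u y - g y) = (%x. conv r u x - conv r g x)"
   by (rule ext) (rule conv_diff[OF r(1) L2_loc_int[OF u] lg])
  then have "n2 (%x. conv r u x - conv r g x) = n2 (conv r (%y. u y - g y))" by simp
  also have "... <= n2 (%y. u y - g y)" by (rule n2_conv_le[OF r(1) L2_diff[OF u g(3)]])
  finally have 2: "n2 (%x. conv r u x - conv r g x) < e / 3" using g(4) by simp
  show ?thesis unfolding r_def[symmetric]
   using n2_triangle3[OF Lc(2,1) u] n2_triangle3[OF Lc(1) g(3) u] 1 2 g(4) n2_commute[of g u] n2_commute[of g "conv r g"]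
   by simp
 qed
 then show "EX no. ALL k>=no. norm (n2 (%x. conv (1 / real (Suc k)) u x - u x) - 0) < e" by auto
qed

subsection \<open>Weak gradients\<close>

lemma test_fun_bounds:
 assumes "test_fun ph"
 obtains R B where "R > 0" "continuous_on UNIV ph" "continuous_on UNIV (cgrad ph)" "!!x. abs (ph x) <= B" "!!x. norm (cgrad ph x) <= B"
  "!!x. norm x >= R ==> ph x = 0" "!!x. norm x >= R ==> cgrad ph x = 0"
  "!!x. (ph has_derivative (%h. cgrad ph x \<bullet> h)) (at x)"
proof -
 have dif: "!!x. ph differentiable (at x)" and cg: "continuous_on UNIV (cgrad ph)" and bd: "bounded {x. ph x ~= 0}"
  using assms by (auto simp: test_fun_def)
 have der: "(ph has_derivative (%h. cgrad ph x \<bullet> h)) (at x)" for x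
 proof -
  have d: "(ph has_derivative frechet_derivative ph (at x)) (at x)" using dif frechet_derivative_works by blast
  have lin: "linear (frechet_derivative ph (at x))" using d has_derivative_linear by blast
  have "frechet_derivative ph (at x) h = cgrad ph x \<bullet> h" for h
  proof -
   have "h = (SUM i:UNIV. h $ i *r axis i 1)" using basis_expansion[of h] by (simp add: scalar_mult_eq_scaleR)
   then have "frechet_derivative ph (at x) h = frechet_derivative ph (at x) (SUM i:UNIV. h $ i *r axis i 1)" by simp
   also have "... = (SUM i:UNIV. h $ i * frechet_derivative ph (at x) (axis i 1))"
    by (simp add: linear_sum[OF lin] linear_scale[OF lin])
   finally have "frechet_derivative ph (at x) h = (SUM i:UNIV. h $ i * frechet_derivative ph (at x) (axis i 1))" .
   then show ?thesis by (simp add: inner_vec_def cgrad_def mult.commute)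
  qed
  then show ?thesis using d by (metis (no_types, lifting) has_derivative_eq_rhs ext)
 qed
 have c: "continuous_on UNIV ph" using der by (meson continuous_at_imp_continuous_on has_derivative_continuous)
 obtain R0 where R0: "!!x. ph x ~= 0 ==> norm x <= R0" using bd by (auto simp: bounded_iff)
 define R where "R = abs R0 + 1"
 have z: "ph x = 0" if "norm x > abs R0" for x using R0[of x] that by force
 have gz: "cgrad ph x = 0" if x: "norm x >= R" for x
 proof (rule cgrad_eqI)
  show "(ph has_derivative (%h. 0 \<bullet> h)) (at x)"
  proof (rule has_derivative_transform_within_open[of "%y. 0"])
   show "((%y. 0) has_derivative (%h. 0 \<bullet> h)) (at x)" by simp
   fix y assume "y : ball x 1"
   then have "norm y > abs R0" using x norm_triangle_ineq2[of x y] by (auto simp: R_def dist_norm)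
   then show "0 = ph y" using z by simp
  qed auto
 qed
 have "bounded (ph ` cball 0 R)" "bounded (cgrad ph ` cball 0 R)"
  using c cg by (auto intro!: compact_imp_bounded compact_continuous_image intro: continuous_on_subset)
 then have "EX B1. ALL x. norm x <= R --> abs (ph x) <= B1" "EX B2. ALL x. norm x <= R --> norm (cgrad ph x) <= B2"
  by (auto simp: bounded_iff, (metis mem_cball_0)+)
 then obtain B1 B2 where B: "!!x. norm x <= R ==> abs (ph x) <= B1" "!!x. norm x <= R ==> norm (cgrad ph x) <= B2"
  by blast
 have "abs (ph x) <= max B1 B2 \<and> norm (cgrad ph x) <= max B1 B2" for x
  using B[of x] B[of 0] z[of x] gz[of x] by (cases "norm x <= R") (auto simp: R_def le_max_iff_disj)
 moreover have "R > 0" by (simp add: R_def)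
 ultimately show ?thesis using that[of R "max B1 B2"] c cg gz z der by (auto simp: R_def)
qed

lemma
 fixes w :: "R2 => real"
 assumes t: "test_fun ph"
 shows L2_test_fun: "L2 ph" and L2_test_fun_cgrad: "L2 (cgrad ph)"
  and loc_int_test_integrable: "loc_int w ==> li (%x. w x * ph x)"
  and loc_int_cgrad_integrable: "loc_int w ==> li (%x. w x * cgrad ph x $ i)"
proof -
 obtain R B where R: "R > 0" "continuous_on UNIV ph" "continuous_on UNIV (cgrad ph)" "!!x. abs (ph x) <= B" "!!x. norm (cgrad ph x) <= B"
  "!!x. norm x >= R ==> ph x = 0" "!!x. norm x >= R ==> cgrad ph x = 0"
  using test_fun_bounds[OF t] by metis
 show "L2 ph" "L2 (cgrad ph)"
  by (rule L2_bounded_support[where K=B and n=R]; use R in \<open>auto intro: continuous_lebesgue_measurable\<close>)+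
 show "li (%x. w x * ph x)" if "loc_int w"
  using loc_int_mult[OF that continuous_lebesgue_measurable[OF R(2)] R(4), of "cball 0 R"] R(6) by (auto simp: mult.commute)
 have "abs (cgrad ph x $ i) <= B" for x using R(5)[of x] component_le_norm_cart[of "cgrad ph x" i] by linarith
 then show "li (%x. w x * cgrad ph x $ i)" if "loc_int w"
  using loc_int_mult[OF that continuous_lebesgue_measurable[OF continuous_on_component[OF R(3), of i]], of B "cball 0 R"] R(7) by (auto simp: mult.commute)
qed

lemma borel_measurable_vec_nth: "(%v::R2. v $ i) : borel_measurable borel"
 by (intro borel_measurable_continuous_onI continuous_intros)

lemma loc_int_component: "loc_int g ==> loc_int (%x. g x $ i)" for g :: "R2 => R2"
 unfolding loc_int_def set_integrable_def
proof safe
 assume m: "lm g" and a: "ALL K. compact K --> li (%x. indicator K x *r g x)"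
 show "lm (%x. g x $ i)"
  by (rule measurable_compose[OF m borel_measurable_vec_nth])
 fix K :: "R2 set" assume "compact K"
 then have "li (%x. (indicator K x *r g x) $ i)"
  using a by (intro integrable_bounded_linear[OF bounded_linear_vec_nth]) auto
 then show "li (%x. indicator K x *r g x $ i)" by simp
qed

lemma loc_int_lincomb:
 fixes f g :: "R2 => 'a::euclidean_space"
 assumes "loc_int f" "loc_int g" shows "loc_int (%x. a *r f x + b *r g x)"
 unfolding loc_int_def set_integrable_def
proof (intro conjI allI impI)
 show "lm (%x. a *r f x + b *r g x)" using assms by (auto simp: loc_int_def)
 fix K :: "R2 set" assume "compact K"
 then have "li (%x. a *r (indicator K x *r f x) + b *r (indicator K x *r g x))"
  using assms by (intro Bochner_Integration.integrable_add integrable_scaleR_right) (auto simp: loc_int_def set_integrable_def)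
 then show "li (%x. indicator K x *r (a *r f x + b *r g x))" by (simp add: scaleR_add_right mult.commute)
qed

lemma weak_grad_lincomb:
 assumes u: "weak_grad u g" and v: "weak_grad v h"
 shows "weak_grad (%x. a * u x + b * v x) (%x. a *r g x + b *r h x)"
 unfolding weak_grad_def
proof (intro conjI allI impI)
 have l: "loc_int u" "loc_int g" "loc_int v" "loc_int h" using u v by (auto simp: weak_grad_def)
 show "loc_int (%x. a * u x + b * v x)" "loc_int (%x. a *r g x + b *r h x)"
  using loc_int_lincomb[OF l(1,3), of a b] loc_int_lincomb[OF l(2,4), of a b] by auto
 fix ph i assume t: "test_fun ph"
 note ii = loc_int_cgrad_integrable[OF t l(1), of i] loc_int_cgrad_integrable[OF t l(3), of i]
  loc_int_test_integrable[OF t loc_int_component[OF l(2)], of i] loc_int_test_integrable[OF t loc_int_component[OF l(4)], of i]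
 have "(LI x. (a * u x + b * v x) * cgrad ph x $ i) = (LI x. a * (u x * cgrad ph x $ i) + b * (v x * cgrad ph x $ i))"
  by (simp add: algebra_simps)
 also have "... = a * (LI x. u x * cgrad ph x $ i) + b * (LI x. v x * cgrad ph x $ i)"
  using ii by simp
 also have "... = - (a * (LI x. g x $ i * ph x) + b * (LI x. h x $ i * ph x))"
  using u v t by (simp add: weak_grad_def)
 also have "... = - (LI x. a * (g x $ i * ph x) + b * (h x $ i * ph x))" using ii by simp
 also have "... = - (LI x. (a *r g x + b *r h x) $ i * ph x)" by (simp add: algebra_simps)
 finally show "(LI x. (a * u x + b * v x) * cgrad ph x $ i) = - (LI x. (a *r g x + b *r h x) $ i * ph x)" .
qed

text \<open>Fundamental lemma of the calculus of variations. The ideal test function is the sign of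
  \<open>d\<close> cut off to a ball, which would give the integral of |d|; its mollifications are
  test functions, bounded by 1, and converge to it almost everywhere along a subsequence.\<close>

lemma weak_grad_zero_AE:
 assumes d: "loc_int (d :: R2 => real)" and z: "!!ph. test_fun ph ==> (LI x. d x * ph x) = 0"
 shows "AE x in lebesgue. d x = 0"
proof -
 have dm: "lm d" using d by (simp add: loc_int_def)
 have "AE x in lebesgue. norm x <= real n --> d x = 0" for n :: nat
 proof -
  define F where "F x = (if norm x <= real n then sgn (d x) else 0)" for x
  have Fm: "lm F" unfolding F_def using dm by measurable
  have F1: "abs (F x) <= 1" for x by (auto simp: F_def abs_sgn_eq)
  have FL: "L2 F" by (rule L2_bounded_support[where K=1 and n="real n"]) (use Fm F1 in \<open>auto simp: F_def\<close>)
  have lF: "loc_int F" by (rule L2_loc_int[OF FL])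
  define rh where "rh k = 1 / real (Suc k)" for k
  have rh: "rh k > 0" "rh k <= 1" for k by (auto simp: rh_def)
  obtain r where r: "strict_mono (r::nat=>nat)" "AE x in lebesgue. (%k. conv (rh (r k)) F x) ---> F x"
   using L2_AE_subseq[where f="%k. conv (rh k) F" and g=F, OF L2_conv[OF rh(1) FL] FL conv_L2_tendsto[OF FL, folded rh_def]] by blast
  have t: "test_fun (conv (rh k) F)" for k
   by (rule test_fun_conv[OF rh(1) lF, of "real n + 1"]) (auto simp: F_def)
  have c1: "abs (conv (rh k) F x) <= 1" for k x
   using norm_conv_le[OF rh(1) lF, where x=x and c=0 and K=1 and k1=k] F1 by simp
  have c0: "conv (rh k) F x = 0" if "norm x > real n + 1" for k x
  proof -
   have "norm (0 - conv (rh k) F x) <= 0"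
   proof (rule norm_conv_le[OF rh(1) lF])
    fix y assume "norm (y - x) <= rh k"
    then have "norm y > real n" using that rh(2)[of k] norm_triangle_ineq2[of x y] by (simp add: norm_minus_commute)
    then show "norm (0 - F y) <= 0" by (simp add: F_def)
   qed
   then show ?thesis by simp
  qed
  have iK: "li (%x. abs (indicat_real (cball 0 (real n + 1)) x * d x))"
   using d by (auto simp: loc_int_def set_integrable_def)
  have dF: "(%x. d x * F x) = (%x. abs (d x) * indicat_real (cball 0 (real n)) x)"
   by (auto simp: F_def indicator_def mult_sgn_abs abs_sgn mult.commute)
  have "(%k. LI x. d x * conv (rh (r k)) F x) ---> (LI x. d x * F x)"
  proof (rule integral_dominated_convergence[OF _ _ iK])
   show "lm (%x. d x * F x)" using dm Fm by simp
   show "lm (%x. d x * conv (rh (r k)) F x)" for k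
    using dm L2_conv[OF rh(1) FL] by auto
   show "AE x in lebesgue. (%k. d x * conv (rh (r k)) F x) ---> d x * F x"
    using r(2) by eventually_elim (intro tendsto_intros)
   show "AE x in lebesgue. norm (d x * conv (rh (r k)) F x) <= abs (indicat_real (cball 0 (real n + 1)) x * d x)" for k
    using c1[of "r k"] c0[of _ "r k"] by (intro AE_I2) (auto simp: indicator_def abs_mult mult_left_le)
  qed
  then have 0: "(LI x. abs (d x) * indicat_real (cball 0 (real n)) x) = 0"
   unfolding z[OF t] dF by (simp add: LIMSEQ_const_iff)
  have "li (%x. abs (d x) * indicat_real (cball 0 (real n)) x)"
   using loc_int_mult[OF d _ _ _ compact_cball, of F 1 0 "real n"] Fm F1 dF by (auto simp: F_def mult.commute)
  then have "AE x in lebesgue. abs (d x) * indicat_real (cball 0 (real n)) x = 0"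
   using 0 by (subst (asm) integral_nonneg_eq_0_iff_AE) auto
  then show ?thesis by eventually_elim (auto simp: indicator_def)
 qed
 then have "AE x in lebesgue. ALL n::nat. norm x <= real n --> d x = 0" unfolding AE_all_countable by blast
 then show ?thesis by eventually_elim (use real_arch_simple in blast)
qed

lemma weak_grad_unique:
 assumes "weak_grad u g" "weak_grad u h" shows "AE x in lebesgue. g x = h x"
proof -
 have l: "loc_int g" "loc_int h" using assms by (auto simp: weak_grad_def)
 have "AE x in lebesgue. g x $ i - h x $ i = 0" for i
 proof (rule weak_grad_zero_AE)
  show "loc_int (%x. g x $ i - h x $ i)"
   using loc_int_lincomb[OF loc_int_component[OF l(1), of i] loc_int_component[OF l(2), of i], of 1 "-1"] by simp
  fix ph assume t: "test_fun ph"
  have "(LI x. (g x $ i - h x $ i) * ph x) = (LI x. g x $ i * ph x) - (LI x. h x $ i * ph x)"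
   unfolding left_diff_distrib using loc_int_test_integrable[OF t loc_int_component] l by simp
  then show "(LI x. (g x $ i - h x $ i) * ph x) = 0"
   using assms(1)[unfolded weak_grad_def, THEN conjunct2, THEN conjunct2, rule_format, OF t, of i]
    assms(2)[unfolded weak_grad_def, THEN conjunct2, THEN conjunct2, rule_format, OF t, of i] by linarith
 qed
 then have "AE x in lebesgue. ALL i. g x $ i - h x $ i = 0" by (simp add: AE_all_countable)
 then show ?thesis by eventually_elim (simp add: vec_eq_iff)
qed

lemma wgrad: "weak_grad u g ==> weak_grad u (wgrad u)"
 unfolding wgrad_def by (rule someI[of "weak_grad u"])

text \<open>\<open>wgrad\<close> is an arbitrary choice among the weak gradients. Every explicit
  formula for a gradient enters the later computations through this lemma, hence only almost
  everywhere.\<close>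

lemma wgrad_AE: "weak_grad u g ==> AE x in lebesgue. wgrad u x = g x"
 using weak_grad_unique wgrad by blast

lemma L2_component: "L2 g ==> L2 (%x. g x $ i)" and n2_component_le: "L2 g ==> n2 (%x. g x $ i) <= n2 g"
 for g :: "R2 => R2"
proof -
 assume g: "L2 g"
 have m: "lm (%x. g x $ i)"
  by (rule measurable_compose[OF L2_measurable[OF g] borel_measurable_vec_nth])
 show "L2 (%x. g x $ i)" "n2 (%x. g x $ i) <= n2 g"
  using L2_bound[OF g m] n2_mono[OF g m] component_le_norm_cart[of "g _" i] by auto
qed

lemma weak_grad_closed:
 assumes w: "!!n. weak_grad (u n) (g n)" and L: "!!n. L2 (u n)" "!!n. L2 (g n)" "L2 v" "L2 h"
  and lim: "(%n. n2 (%x. u n x - v x)) ---> 0" "(%n. n2 (%x. g n x - h x)) ---> 0"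
 shows "weak_grad v h"
 unfolding weak_grad_def
proof (intro conjI allI impI L2_loc_int L(3,4))
 fix ph i assume t: "test_fun ph"
 have tend: "(%n. LI x. a n x * ps x) ---> (LI x. b x * ps x)"
  if "!!n. L2 (a n)" "L2 b" "L2 ps" "(%n. n2 (%x. a n x - b x)) ---> 0" for a :: "nat => R2 => real" and b ps
 proof (rule LIM_zero_cancel, rule Lim_null_comparison)
  show "\<forall>\<^sub>F n in sequentially. norm ((LI x. a n x * ps x) - (LI x. b x * ps x)) <= n2 (%x. a n x - b x) * n2 ps"
  proof (rule always_eventually, rule allI)
   fix n
   have "(LI x. a n x * ps x) - (LI x. b x * ps x) = (LI x. (a n x - b x) * ps x)"
    unfolding left_diff_distrib using that by (simp add: L2_mult_integrable)
   then show "norm ((LI x. a n x * ps x) - (LI x. b x * ps x)) <= n2 (%x. a n x - b x) * n2 ps"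
    using L2_mult_le[OF L2_diff[OF that(1,2)] that(3), of n] by simp
  qed
  show "(%n. n2 (%x. a n x - b x) * n2 ps) ---> 0" using tendsto_mult_right[OF that(4), of "n2 ps"] by simp
 qed
 have "(%n. n2 (%x. g n x $ i - h x $ i)) ---> 0"
 proof (rule Lim_null_comparison[OF _ lim(2)], rule always_eventually, rule allI)
  show "norm (n2 (%x. g n x $ i - h x $ i)) <= n2 (%x. g n x - h x)" for n
   using n2_component_le[OF L2_diff[OF L(2,4)], of n i] by simp
 qed
 note b = tend[OF L2_component[OF L(2)] L2_component[OF L(4)] L2_test_fun[OF t] this]
 note a = tend[OF L(1,3) L2_component[OF L2_test_fun_cgrad[OF t], of i] lim(1)]
 have "(%n. LI x. u n x * cgrad ph x $ i) = (%n. - (LI x. g n x $ i * ph x))"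
  using w t by (auto simp: weak_grad_def)
 then show "(LI x. v x * cgrad ph x $ i) = - (LI x. h x $ i * ph x)"
  using LIMSEQ_unique[OF a] tendsto_minus[OF b] by simp
qed


lemma weak_gradI:
 assumes "loc_int u" "loc_int g" "!!ph i. test_fun ph ==> (LI x. u x * cgrad ph x $ i) = - (LI x. g x $ i * ph x)"
 shows "weak_grad u g"
 using assms by (simp add: weak_grad_def)

lemma weak_gradD:
 assumes "weak_grad u g"
 shows "loc_int u" "loc_int g" "test_fun ph ==> (LI x. u x * cgrad ph x $ i) = - (LI x. g x $ i * ph x)"
 using assms by (auto simp: weak_grad_def)

lemma loc_int_1: "loc_int (%x. 1::real)"
 using emeasure_compact_finite[of "K :: R2 set" for K]
 by (auto simp: loc_int_def set_integrable_def integrable_indicator_iff borel_compact)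

lemma loc_int_mult_continuous:
 fixes u :: "R2 => 'a::euclidean_space"
 assumes u: "loc_int u" and e: "continuous_on UNIV (et :: R2 => real)" shows "loc_int (%x. et x *r u x)"
 unfolding loc_int_def set_integrable_def
proof (intro conjI allI impI)
 have em: "lm et" by (rule continuous_lebesgue_measurable[OF e])
 show "lm (%x. et x *r u x)" using u em by (auto simp: loc_int_def)
 fix K :: "R2 set" assume K: "compact K"
 then have "bounded (et ` K)" using e by (meson compact_continuous_image compact_imp_bounded continuous_on_subset top_greatest)
 then obtain B where B: "!!x. x : K ==> abs (et x) <= B" by (auto simp: bounded_iff)
 have "li (%x. (indicator K x * et x) *r u x)"
  by (rule loc_int_mult[OF u _ _ _ K, of _ "abs B"])
   (use em B lmeasurable_compact[OF K] in \<open>auto intro!: borel_measurable_times borel_measurable_indicator simp: indicator_def intro: order_trans[OF _ abs_ge_self]\<close>)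
 then show "li (%x. indicator K x *r et x *r u x)" by simp
qed

lemma test_fun_mult:
 assumes t: "test_fun ph" and e: "!!x. (et has_derivative (%h. ga x \<bullet> h)) (at x)" "continuous_on UNIV ga"
 shows "test_fun (%x. et x * ph x)" "cgrad (%x. et x * ph x) x = et x *r cgrad ph x + ph x *r ga x"
proof -
 obtain R B where R: "R > 0" "continuous_on UNIV ph" "continuous_on UNIV (cgrad ph)" "!!x. abs (ph x) <= B" "!!x. norm (cgrad ph x) <= B"
  "!!x. norm x >= R ==> ph x = 0" "!!x. norm x >= R ==> cgrad ph x = 0" "!!x. (ph has_derivative (%h. cgrad ph x \<bullet> h)) (at x)"
  using test_fun_bounds[OF t] by metis
 have ec: "continuous_on UNIV et" using e(1) by (meson continuous_at_imp_continuous_on has_derivative_continuous)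
 have d: "((%x. et x * ph x) has_derivative (%h. (et x *r cgrad ph x + ph x *r ga x) \<bullet> h)) (at x)" for x
  by (rule has_derivative_eq_rhs[OF has_derivative_mult[OF e(1) R(8)]]) (auto simp: inner_add_left algebra_simps)
 show g: "cgrad (%x. et x * ph x) x = et x *r cgrad ph x + ph x *r ga x" for x by (rule cgrad_eqI[OF d])
 show "test_fun (%x. et x * ph x)" unfolding test_fun_def
 proof (intro conjI allI)
  show "(%x. et x * ph x) differentiable (at x)" for x using d by (auto simp: differentiable_def)
  show "continuous_on UNIV (cgrad (%x. et x * ph x))" unfolding g by (intro continuous_intros R ec e(2))
  show "bounded {x. et x * ph x ~= 0}" by (rule bounded_ball_support[where a=0 and r=R]) (use R in auto)
 qed
qed

lemma weak_grad_mult: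
 assumes w: "weak_grad u g" and e: "!!x. (et has_derivative (%h. ga x \<bullet> h)) (at x)" "continuous_on UNIV ga"
 shows "weak_grad (%x. et x * u x) (%x. et x *r g x + u x *r ga x)"
proof (rule weak_gradI)
 note l = weak_gradD(1,2)[OF w]
 have ec: "continuous_on UNIV et" using e(1) by (meson continuous_at_imp_continuous_on has_derivative_continuous)
 have gc: "continuous_on UNIV (%x. ga x $ i)" for i by (intro continuous_on_component e(2))
 show "loc_int (%x. et x * u x)" using loc_int_mult_continuous[OF l(1) ec] by simp
 have lc: "loc_int (%x. ga x $ i * u x)" for i using loc_int_mult_continuous[OF l(1) gc] by simp
 have 1: "loc_int (%x. u x *r ga x)"
 proof -
  have "loc_int (%x. (ga x $ i * u x) *r axis i (1::real))" for i :: 2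
   using lc[of i] unfolding loc_int_def set_integrable_def by (auto intro!: borel_measurable_scaleR)
  note this[of 1] this[of 2]
  from loc_int_lincomb[OF this, of 1 1] have "loc_int (%x. SUM i:UNIV. (ga x $ i * u x) *r axis i (1::real))" by (simp add: UNIV_2)
  moreover have "(SUM i:UNIV. (ga x $ i * u x) *r axis i (1::real)) = u x *r ga x" for x
   by (simp add: vec_eq_iff axis_def if_distrib sum.If_cases cong: if_cong)
  ultimately show ?thesis by simp
 qed
 show "loc_int (%x. et x *r g x + u x *r ga x)"
  using loc_int_lincomb[OF loc_int_mult_continuous[OF l(2) ec] 1, of 1 1] by simp
 fix ph i assume t: "test_fun ph"
 note tm = test_fun_mult[OF t e]
 have i1: "li (%x. u x * cgrad (%x. et x * ph x) x $ i)" by (rule loc_int_cgrad_integrable[OF tm(1) l(1)])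
 have i2: "li (%x. (ga x $ i * u x) * ph x)" by (rule loc_int_test_integrable[OF t lc])
 have i3: "li (%x. g x $ i * (et x * ph x))" by (rule loc_int_test_integrable[OF tm(1) loc_int_component[OF l(2)]])
 have "(LI x. et x * u x * cgrad ph x $ i) = (LI x. u x * cgrad (%x. et x * ph x) x $ i - (ga x $ i * u x) * ph x)"
  by (simp add: tm(2) algebra_simps)
 also have "... = - (LI x. g x $ i * (et x * ph x)) - (LI x. (ga x $ i * u x) * ph x)"
  using i1 i2 weak_gradD(3)[OF w tm(1)] by simp
 also have "... = - (LI x. g x $ i * (et x * ph x) + (ga x $ i * u x) * ph x)" using i3 i2 by simp
 also have "... = - (LI x. (et x *r g x + u x *r ga x) $ i * ph x)" by (simp add: algebra_simps)
 finally show "(LI x. et x * u x * cgrad ph x $ i) = - (LI x. (et x *r g x + u x *r ga x) $ i * ph x)" .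
qed

lemma loc_int_dilate:
 fixes u :: "R2 => 'a::euclidean_space"
 assumes u: "loc_int u" and c: "c ~= 0" shows "loc_int (%x. u (c *r x))"
 unfolding loc_int_def set_integrable_def
proof (intro conjI allI impI)
 have um: "lm u" using u by (simp add: loc_int_def)
 show "lm (%x. u (c *r x))" using measurable_comp_affine[OF c um, of 0] by simp
 fix K :: "R2 set" assume "compact K"
 then have K: "compact (scaleR c ` K)" by (intro compact_continuous_image continuous_intros)
 then have i: "li (%y. indicator (scaleR c ` K) y *r u y)" using u by (auto simp: loc_int_def set_integrable_def)
 have "indicator (scaleR c ` K) (c *r x) = (indicator K x :: real)" for x using c by (auto simp: indicator_def)
 then show "li (%x. indicator K x *r u (c *r x))"
  using integrable_affine_R2[OF c borel_measurable_integrable[OF i], of 0] i by simp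
qed

lemma weak_grad_dilate:
 assumes w: "weak_grad u g" and c: "c ~= 0"
 shows "weak_grad (%x. u (c *r x)) (%x. c *r g (c *r x))"
proof (rule weak_gradI)
 note l = weak_gradD(1,2)[OF w]
 show "loc_int (%x. u (c *r x))" by (rule loc_int_dilate[OF l(1) c])
 show "loc_int (%x. c *r g (c *r x))" using loc_int_lincomb[OF loc_int_dilate[OF l(2) c] loc_int_dilate[OF l(2) c], of c 0] by simp
 fix ph i assume t: "test_fun ph"
 obtain R B where R: "R > 0" "continuous_on UNIV ph" "continuous_on UNIV (cgrad ph)" "!!x. abs (ph x) <= B" "!!x. norm (cgrad ph x) <= B"
  "!!x. norm x >= R ==> ph x = 0" "!!x. norm x >= R ==> cgrad ph x = 0" "!!x. (ph has_derivative (%h. cgrad ph x \<bullet> h)) (at x)"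
  using test_fun_bounds[OF t] by metis
 define ps where "ps y = ph (y /\<^sub>R c)" for y
 have d: "(ps has_derivative (%h. (cgrad ph (y /\<^sub>R c) /\<^sub>R c) \<bullet> h)) (at y)" for y
  unfolding ps_def
  by (rule has_derivative_eq_rhs[OF has_derivative_compose[OF has_derivative_scaleR_right[OF has_derivative_ident] R(8)]]) auto
 have cg: "cgrad ps y = cgrad ph (y /\<^sub>R c) /\<^sub>R c" for y by (rule cgrad_eqI[OF d])
 have tp: "test_fun ps" unfolding test_fun_def
 proof (intro conjI allI)
  show "ps differentiable (at x)" for x using d by (auto simp: differentiable_def)
  show "continuous_on UNIV (cgrad ps)" unfolding cg by (intro continuous_intros continuous_on_compose2[OF R(3)]) auto
  have "ps x = 0" if "norm (x - 0) >= abs c * R" for x unfolding ps_def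
   by (rule R(6)) (use that c in \<open>simp add: field_simps\<close>)
  then show "bounded {x. ps x ~= 0}" by (rule bounded_ball_support)
 qed
 have m1: "lm (%y. u y * cgrad ps y $ i)" using loc_int_cgrad_integrable[OF tp l(1)] by (rule borel_measurable_integrable)
 have m2: "lm (%y. g y $ i * ps y)" using loc_int_test_integrable[OF tp loc_int_component[OF l(2)]] by (rule borel_measurable_integrable)
 have e1: "(LI x. u (c *r x) * cgrad ph x $ i) = (LI x. c * (u (0 + c *r x) * cgrad ps (0 + c *r x) $ i))"
  by (rule Bochner_Integration.integral_cong) (use c in \<open>auto simp: cg\<close>)
 have e2: "(LI x. (c *r g (c *r x)) $ i * ph x) = (LI x. c * (g (0 + c *r x) $ i * ps (0 + c *r x)))"
  using c by (simp add: ps_def mult.assoc)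
 show "(LI x. u (c *r x) * cgrad ph x $ i) = - (LI x. (c *r g (c *r x)) $ i * ph x)"
  unfolding e1 e2 integral_mult_right_zero integral_affine_R2[OF c m1] integral_affine_R2[OF c m2]
  using weak_gradD(3)[OF w tp, of i] by simp
qed

text \<open>Integration by parts from translation invariance: each difference quotient has integral
  0, and the quotients are bounded with a common bounded support, so dominated convergence passes to
  the partial derivative.\<close>

lemma integral_cgrad_zero:
 assumes t: "test_fun ps" shows "(LI x. cgrad ps x $ i) = 0"
proof -
 obtain R B where R: "R > 0" "continuous_on UNIV ps" "continuous_on UNIV (cgrad ps)" "!!x. abs (ps x) <= B" "!!x. norm (cgrad ps x) <= B"
  "!!x. norm x >= R ==> ps x = 0" "!!x. norm x >= R ==> cgrad ps x = 0" "!!x. (ps has_derivative (%h. cgrad ps x \<bullet> h)) (at x)"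
  using test_fun_bounds[OF t] by metis
 define e where "e = (axis i 1 :: R2)"
 define s where "s k = 1 / real (Suc k)" for k
 have s: "s k > 0" "s k <= 1" for k by (auto simp: s_def)
 have ne: "norm e = 1" by (simp add: e_def)
 have ip: "li ps" using loc_int_test_integrable[OF t loc_int_1] by simp
 have pm: "lm ps" using ip by (rule borel_measurable_integrable)
 have sh: "li (%x. ps (x + h))" "(LI x. ps (x + h)) = (LI x. ps x)" for h
  using integrable_affine_R2[of 1 ps h] integral_affine_R2[of 1 ps h] pm ip by (auto simp: add.commute)
 have lip: "abs (ps (x + h) - ps x) <= B * norm h" for x h
 proof -
  have "onorm (%h. cgrad ps x \<bullet> h) <= B" for x
   by (rule onorm_le) (use R(5)[of x] in \<open>auto intro!: order_trans[OF Cauchy_Schwarz_ineq2] mult_right_mono\<close>)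
  then show ?thesis using differentiable_bound[of UNIV ps "%x h. cgrad ps x \<bullet> h" B "x + h" x] R(8) by auto
 qed
 define D where "D k x = (ps (x + s k *r e) - ps x) / s k" for k x
 have i0: "(LI x. D k x) = 0" for k unfolding D_def using sh ip by simp
 have Db: "abs (D k x) <= B" for k x
  using lip[of x "s k *r e"] s(1)[of k] by (simp add: D_def ne divide_le_eq)
 have "(%k. LI x. D k x) ---> (LI x. cgrad ps x $ i)"
 proof (rule integral_dominated_convergence)
  show "lm (%x. cgrad ps x $ i)" by (intro continuous_lebesgue_measurable continuous_on_component R(3))
  show "lm (D k)" for k unfolding D_def using sh ip by (auto intro!: borel_measurable_divide borel_measurable_diff)
  show "li (%x. B * indicator (cball 0 (R + 1)) x)"
   using emeasure_lborel_cball_finite[of "0::R2" "R + 1"] by (auto simp: integrable_indicator_iff)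
  show "AE x in lebesgue. norm (D k x) <= B * indicator (cball 0 (R + 1)) x" for k
  proof (rule AE_I2)
   fix x show "norm (D k x) <= B * indicator (cball 0 (R + 1)) x"
   proof (cases "norm x <= R + 1")
    case False
    have "norm x <= norm (x + s k *r e) + norm (s k *r e)" using norm_triangle_ineq4[of "x + s k *r e" "s k *r e"] by simp
    then have "norm (x + s k *r e) >= R" using False s[of k] ne by simp
    then show ?thesis using R(6)[of x] R(6)[of "x + s k *r e"] False by (simp add: D_def)
   qed (use Db in auto)
  qed
  show "AE x in lebesgue. (%k. D k x) ---> cgrad ps x $ i"
  proof (rule AE_I2)
   fix x
   have "((%t. ps (x + t *r e)) has_derivative (%t. cgrad ps (x + 0 *r e) \<bullet> (t *r e))) (at 0)"
    by (rule has_derivative_compose[OF _ R(8)]) (auto intro!: derivative_eq_intros)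
   then have "((%t. ps (x + t *r e)) has_real_derivative (cgrad ps x $ i)) (at 0)"
    unfolding has_field_derivative_def by (rule has_derivative_eq_rhs) (auto simp: e_def inner_axis mult.commute)
   then have "(%t. (ps (x + t *r e) - ps x) / t) \<midarrow>0\<rightarrow> cgrad ps x $ i" by (simp add: DERIV_def)
   moreover have "s ---> 0" unfolding s_def using LIMSEQ_Suc[OF lim_1_over_n] by simp
   then have "filterlim s (at 0) sequentially" using s(1) by (simp add: filterlim_at less_imp_neq[symmetric])
   ultimately show "(%k. D k x) ---> cgrad ps x $ i" unfolding D_def by (rule filterlim_compose)
  qed
 qed
 then show ?thesis unfolding i0 by (simp add: LIMSEQ_const_iff)
qed

lemma weak_grad_test_fun:
 assumes f: "test_fun f" shows "weak_grad f (cgrad f)"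
proof (rule weak_gradI)
 show "loc_int f" "loc_int (cgrad f)" using L2_loc_int L2_test_fun[OF f] L2_test_fun_cgrad[OF f] by auto
 note lf = L2_test_fun[OF f] L2_component[OF L2_test_fun_cgrad[OF f]]
 have fd: "!!x. (f has_derivative (%h. cgrad f x \<bullet> h)) (at x)" "continuous_on UNIV (cgrad f)"
  using test_fun_bounds[OF f] by metis+
 fix ph i assume t: "test_fun ph"
 note lp = L2_test_fun[OF t] L2_component[OF L2_test_fun_cgrad[OF t]]
 have "0 = (LI x. f x * cgrad ph x $ i + cgrad f x $ i * ph x)"
  using integral_cgrad_zero[OF test_fun_mult(1)[OF t fd], of i] unfolding test_fun_mult(2)[OF t fd] by (simp add: mult.commute)
 also have "... = (LI x. f x * cgrad ph x $ i) + (LI x. cgrad f x $ i * ph x)"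
  by (rule Bochner_Integration.integral_add[OF L2_mult_integrable[OF lf(1) lp(2)] L2_mult_integrable[OF lf(2) lp(1)]])
 finally show "(LI x. f x * cgrad ph x $ i) = - (LI x. cgrad f x $ i * ph x)" by linarith
qed

subsection \<open>Translation estimates and the Gagliardo--Nirenberg inequality\<close>

lemma C1_increment_sq:
 fixes f :: "R2 => real"
 assumes d: "!!x. (f has_derivative (%h. ga x \<bullet> h)) (at x)" and c: "continuous_on UNIV ga"
 shows "ennreal ((f (x + w) - f x)^2) <= (\<integral>\<^sup>+t. indicator {0..1} t * ennreal ((ga (x + t *r w) \<bullet> w)^2) \<partial>lborel)"
proof -
 let ?a = "%t. ga (x + t *r w) \<bullet> w"
 define A where "A = f (x + w) - f x"
 have ca: "continuous_on {0..1} ?a" by (intro continuous_intros continuous_on_compose2[OF c]) auto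
 have "(?a has_integral (f (x + 1 *r w) - f (x + 0 *r w))) {0..1}"
 proof (rule fundamental_theorem_of_calculus)
  fix t :: real
  have "((%t. f (x + t *r w)) has_derivative (%s. ga (x + t *r w) \<bullet> (s *r w))) (at t within {0..1})"
   by (rule has_derivative_compose[OF _ d]) (auto intro!: derivative_eq_intros)
  then show "((%t. f (x + t *r w)) has_vector_derivative ?a t) (at t within {0..1})"
   unfolding has_vector_derivative_def by (rule has_derivative_eq_rhs) auto
 qed simp
 then have A: "(?a has_integral A) {0..1}" by (simp add: A_def)
 define Q where "Q = integral {0..1} (%t. (?a t)^2)"
 have Q: "((%t. (?a t)^2) has_integral Q) {0..1}" unfolding Q_def
  by (intro integrable_integral integrable_continuous_interval continuous_on_power ca)
 \<comment> \<open>Integrating \<open>(?a t - A)^2 >= 0\<close> over the unit interval is Jensen's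
   inequality in the form \<open>A^2 <= Q\<close>.\<close>
 have H: "((%t. (?a t)^2 - 2 * A * ?a t + A^2) has_integral (Q - 2 * A * A + A^2)) {0..1}"
  using has_integral_add[OF has_integral_diff[OF Q has_integral_mult_right[OF A, of "2 * A"]] has_integral_const_real[of "A^2" 0 1]] by simp
 have nn: "0 <= (?a t)^2 - 2 * A * ?a t + A^2" for t
  using zero_le_power2[of "?a t - A"] by (simp add: power2_eq_square algebra_simps)
 have "0 <= Q - 2 * A * A + A^2" by (rule has_integral_nonneg[OF H]) (rule nn)
 then have "A^2 <= Q" by (simp add: power2_eq_square)
 moreover have "(\<integral>\<^sup>+t. indicator {0..1} t * ennreal ((?a t)^2) \<partial>lborel) = ennreal Q"
 proof -
  have "(\<integral>\<^sup>+t. ennreal (indicator {0..1} t * (?a t)^2) \<partial>lborel) = ennreal Q"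
   by (rule nn_integral_has_integral_lebesgue[OF _ Q, simplified])
  then show ?thesis by (simp add: ennreal_mult ennreal_indicator)
 qed
 ultimately show ?thesis by (simp add: ennreal_leI A_def)
qed

lemma nn_integral_lebesgue_lborel: "f : borel_measurable borel ==> (\<integral>\<^sup>+x. f x \<partial>lebesgue) = (\<integral>\<^sup>+x. f x \<partial>lborel)"
 by (simp add: nn_integral_completion)

lemma C1_translation:
 fixes f :: "R2 => real"
 assumes d: "!!x. (f has_derivative (%h. ga x \<bullet> h)) (at x)" and c: "continuous_on UNIV ga" and L: "L2 ga"
 shows "(\<integral>\<^sup>+x. ennreal ((f (x + h) - f x)^2) \<partial>lebesgue) <= ennreal ((norm h * n2 ga)^2)"
proof -
 let ?F = "%x t. indicator {0..1::real} t * ennreal ((ga (x + t *r h) \<bullet> h)^2)"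
 have fc: "continuous_on UNIV f" using d by (meson continuous_at_imp_continuous_on has_derivative_continuous)
 have cg: "continuous_on UNIV (%z::R2\<times>real. (ga (fst z + snd z *r h) \<bullet> h)^2)"
  by (intro continuous_intros continuous_on_compose2[OF c]) auto
 have [measurable]: "(%z. (ga (fst z + snd z *r h) \<bullet> h)^2) : borel_measurable (borel \<Otimes>\<^sub>M borel)"
  unfolding borel_prod by (rule borel_measurable_continuous_onI[OF cg])
 have [measurable]: "(%(x,t). ?F x t) : borel_measurable (lborel \<Otimes>\<^sub>M lborel)" unfolding split_beta by measurable
 have mx: "(%x. ennreal ((ga (x + t *r h) \<bullet> h)^2)) : borel_measurable borel" for t
  by (intro measurable_compose[OF _ measurable_ennreal] borel_measurable_continuous_onI continuous_intros continuous_on_compose2[OF c]) auto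
 have "(\<integral>\<^sup>+x. ennreal ((f (x + h) - f x)^2) \<partial>lebesgue) = (\<integral>\<^sup>+x. ennreal ((f (x + h) - f x)^2) \<partial>lborel)"
  by (intro nn_integral_lebesgue_lborel measurable_compose[OF _ measurable_ennreal] borel_measurable_continuous_onI continuous_intros continuous_on_compose2[OF fc]) auto
 also have "... <= (\<integral>\<^sup>+x. \<integral>\<^sup>+t. ?F x t \<partial>lborel \<partial>lborel)"
  by (intro nn_integral_mono C1_increment_sq[OF d c])
 also have "... = (\<integral>\<^sup>+t. \<integral>\<^sup>+x. ?F x t \<partial>lborel \<partial>lborel)" by (rule lborel_pair.Fubini'[symmetric]) measurable
 also have "... <= (\<integral>\<^sup>+t. indicator {0..1::real} t * ennreal ((norm h * n2 ga)^2) \<partial>lborel)"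
 proof (rule nn_integral_mono)
  fix t :: real
  have cs: "(v \<bullet> h)^2 <= (norm h)^2 * (norm v)^2" for v :: R2
   using power_mono[OF Cauchy_Schwarz_ineq2[of v h] abs_ge_zero, of 2] by (simp add: power_mult_distrib mult.commute)
  have "(\<integral>\<^sup>+x. ennreal ((ga (x + t *r h) \<bullet> h)^2) \<partial>lborel) = (\<integral>\<^sup>+x. ennreal ((ga (x + t *r h) \<bullet> h)^2) \<partial>lebesgue)"
   by (rule nn_integral_lebesgue_lborel[OF mx, symmetric])
  also have "... <= (\<integral>\<^sup>+x. ennreal ((norm h)^2 * (norm (ga (x + t *r h)))^2) \<partial>lebesgue)"
   by (intro nn_integral_mono ennreal_leI cs)
  also have "... = ennreal ((norm h)^2 * (n2 (%x. ga (x + t *r h)))^2)"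
   using L2_integrable[OF L2_shift[OF L, of "t *r h"]] by (subst nn_integral_eq_integral) (auto simp: n2_sq)
  finally have "(\<integral>\<^sup>+x. ennreal ((ga (x + t *r h) \<bullet> h)^2) \<partial>lborel) <= ennreal ((norm h * n2 ga)^2)"
   by (simp add: n2_shift[OF L] power_mult_distrib)
  then show "(\<integral>\<^sup>+x. ?F x t \<partial>lborel) <= indicator {0..1} t * ennreal ((norm h * n2 ga)^2)"
   by (auto simp: indicator_def)
 qed
 also have "... = ennreal ((norm h * n2 ga)^2)" by (subst nn_integral_multc) auto
 finally show ?thesis .
qed

text \<open>By Jensen the squared error at \<open>x\<close> is at most the kernel average of the
  squared increments over shifts \<open>z\<close>. After Fubini each shift costs at most |z| times
  the gradient norm, and the kernel only sees shifts with |z| < r.\<close>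

lemma C1_minus_conv:
 fixes f :: "R2 => real"
 assumes r: "r > 0" and d: "!!x. (f has_derivative (%h. ga x \<bullet> h)) (at x)" and c: "continuous_on UNIV ga" and L: "L2 ga" and f: "L2 f"
 shows "n2 (%x. f x - conv r f x) <= r * n2 ga"
proof -
 have fc: "continuous_on UNIV f" using d by (meson continuous_at_imp_continuous_on has_derivative_continuous)
 have lf: "loc_int f" by (rule L2_loc_int[OF f])
 let ?G = "%x z. ennreal (kern r z) * ennreal ((f (x + z) - f x)^2)"
 have le: "ennreal ((f x - conv r f x)^2) <= (\<integral>\<^sup>+z. ?G x z \<partial>lebesgue)" for x
 proof -
  let ?w = "%y. kern r (x - y) * (f x - f y)^2"
  have wc: "continuous_on UNIV ?w" by (intro continuous_intros continuous_on_compose2[OF continuous_kern[OF r]] fc) auto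
  have kc: "continuous_on UNIV (%y. (f x - f y)^2)" by (intro continuous_intros fc)
  have i: "li ?w" using integrable_conv[OF r loc_int_mult_continuous[OF loc_int_1 kc]] by simp
  have "abs (f x - conv r f x) <= (LI y. norm (kern r (x - y) *r (f x - f y)))"
   unfolding conv_const_diff(1)[OF r lf] real_norm_def[symmetric] by (rule integral_norm_bound)
  also have "... = (LI y. kern r (x - y) * abs (f x - f y))" by (simp add: abs_mult kern_nonneg)
  finally have "(abs (f x - conv r f x))^2 <= (LI y. kern r (x - y) * abs (f x - f y))^2" by (intro power_mono) auto
  also have "... <= (LI y. ?w y)"
   by (rule kern_Jensen(2)[OF r _ i]) (intro continuous_lebesgue_measurable continuous_intros fc)
  finally have "ennreal ((f x - conv r f x)^2) <= ennreal (LI y. ?w y)" by (intro ennreal_leI) simp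
  also have "... = (\<integral>\<^sup>+y. ennreal (?w y) \<partial>lebesgue)" by (subst nn_integral_eq_integral[OF i]) (auto simp: kern_nonneg)
  also have "... = (\<integral>\<^sup>+z. ennreal (?w (x + 1 *r z)) \<partial>lebesgue)"
   using nn_integral_affine_R2[of 1 "%y. ennreal (?w y)" x] continuous_lebesgue_measurable[OF wc] by simp
  also have "... = (\<integral>\<^sup>+z. ?G x z \<partial>lebesgue)"
   by (simp add: kern_minus ennreal_mult kern_nonneg power2_commute)
  finally show ?thesis .
 qed
 have [measurable]: "kern r : borel_measurable borel" by (rule borel_measurable_continuous_onI[OF continuous_kern[OF r]])
 have [measurable]: "f : borel_measurable borel" by (rule borel_measurable_continuous_onI[OF fc])
 have mz: "(%z. ?G x z) : borel_measurable borel" for x by measurable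
 have mxx: "(%x. \<integral>\<^sup>+z. ?G x z \<partial>lborel) : borel_measurable borel" by measurable
 have "(\<integral>\<^sup>+x. ennreal ((f x - conv r f x)^2) \<partial>lebesgue) <= (\<integral>\<^sup>+x. \<integral>\<^sup>+z. ?G x z \<partial>lebesgue \<partial>lebesgue)"
  by (intro nn_integral_mono le)
 also have "... = (\<integral>\<^sup>+x. \<integral>\<^sup>+z. ?G x z \<partial>lborel \<partial>lborel)"
  by (simp add: nn_integral_lebesgue_lborel[OF mz] nn_integral_lebesgue_lborel[OF mxx])
 also have "... = (\<integral>\<^sup>+z. \<integral>\<^sup>+x. ?G x z \<partial>lborel \<partial>lborel)" by (rule lborel_pair.Fubini'[symmetric]) measurable
 also have "... <= (\<integral>\<^sup>+z. ennreal (kern r z) * ennreal ((r * n2 ga)^2) \<partial>lborel)"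
 proof (rule nn_integral_mono)
  fix z
  have m: "(%x. ennreal ((f (x + z) - f x)^2)) : borel_measurable borel" by measurable
  have "(\<integral>\<^sup>+x. ?G x z \<partial>lborel) = ennreal (kern r z) * (\<integral>\<^sup>+x. ennreal ((f (x + z) - f x)^2) \<partial>lebesgue)"
   unfolding nn_integral_lebesgue_lborel[OF m] by (rule nn_integral_cmult) (use m in simp)
  also have "... <= ennreal (kern r z) * ennreal ((norm z * n2 ga)^2)"
   by (intro mult_left_mono C1_translation[OF d c L]) auto
  also have "... <= ennreal (kern r z) * ennreal ((r * n2 ga)^2)"
  proof (cases "norm z >= r")
   case False
   then show ?thesis by (intro mult_left_mono ennreal_leI power_mono mult_right_mono) auto
  qed (simp add: kern_eq_0[OF r])
  finally show "(\<integral>\<^sup>+x. ?G x z \<partial>lborel) <= ennreal (kern r z) * ennreal ((r * n2 ga)^2)" .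
 qed
 also have "... = ennreal ((r * n2 ga)^2)"
 proof -
  have "(\<integral>\<^sup>+z. ennreal (kern r z) \<partial>lborel) = 1"
   using nn_integral_eq_integral[OF kern_integrable[OF r]] kern_integral[OF r] nn_integral_lebesgue_lborel[of "%z. ennreal (kern r z)"]
   by (simp add: kern_nonneg)
  then show ?thesis by (subst nn_integral_multc) auto
 qed
 finally have le2: "(\<integral>\<^sup>+x. ennreal ((f x - conv r f x)^2) \<partial>lebesgue) <= ennreal ((r * n2 ga)^2)" .
 have Ld: "L2 (%x. f x - conv r f x)" by (intro L2_diff f L2_conv[OF r])
 have "(n2 (%x. f x - conv r f x))^2 <= (r * n2 ga)^2"
  using le2 nn_integral_eq_integral[OF L2_integrable[OF Ld]] by (simp add: n2_sq[of "%x. f x - conv r f x"])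
 then show ?thesis by (rule power2_le_imp_le) (use r in simp)
qed

text \<open>The estimate for C^1 functions is applied to mollifications of \<open>u\<close>, whose
  gradients are the mollified weak gradients and do not exceed \<open>g\<close> in norm.\<close>

lemma n2_minus_conv:
 assumes r: "r > 0" and u: "L2 u" and w: "weak_grad u g" and g: "L2 g"
 shows "n2 (%x. u x - conv r u x) <= r * n2 g"
proof -
 define f where "f k = conv (1 / real (Suc k)) u" for k
 have s: "1 / real (Suc k) > 0" for k by simp
 have fL: "L2 (f k)" for k unfolding f_def by (rule L2_conv[OF s u])
 have cg: "cgrad (f k) = conv (1 / real (Suc k)) g" for k unfolding f_def by (rule ext) (rule cgrad_conv_weak[OF s w])
 have fd: "(f k has_derivative (%h. cgrad (f k) x \<bullet> h)) (at x)" for k x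
  using conv_has_derivative[OF s[of k] L2_loc_int[OF u], of x] cgrad_eqI[OF conv_has_derivative[OF s[of k] L2_loc_int[OF u], of x]]
  unfolding f_def by simp
 have b: "n2 (%x. u x - conv r u x) <= 2 * n2 (%x. f k x - u x) + r * n2 g" for k
 proof -
  have "n2 (%x. f k x - conv r (f k) x) <= r * n2 (cgrad (f k))"
   by (rule C1_minus_conv[OF r fd _ _ fL]) (unfold cg, rule continuous_conv[OF s L2_loc_int[OF g]], rule L2_conv[OF s g])
  also have "... <= r * n2 g" unfolding cg using r by (intro mult_left_mono n2_conv_le[OF s g]) auto
  finally have 1: "n2 (%x. f k x - conv r (f k) x) <= r * n2 g" .
  have "conv r (%y. f k y - u y) = (%x. conv r (f k) x - conv r u x)"
   by (rule ext) (rule conv_diff[OF r L2_loc_int[OF fL] L2_loc_int[OF u]])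
  then have 2: "n2 (%x. conv r (f k) x - conv r u x) <= n2 (%x. f k x - u x)"
   using n2_conv_le[OF r L2_diff[OF fL u], of k] by simp
  show ?thesis
   using n2_triangle3[OF u fL L2_conv[OF r u], of k] n2_triangle3[OF fL L2_conv[OF r fL] L2_conv[OF r u], of k k] 1 2 n2_commute[of u "f k"]
   by simp
 qed
 have "(%k. 2 * n2 (%x. f k x - u x) + r * n2 g) ---> 2 * 0 + r * n2 g"
  unfolding f_def by (intro tendsto_intros conv_L2_tendsto[OF u])
 then show ?thesis using LIMSEQ_le_const b by force
qed

definition kconst :: real where "kconst = n2 bump / bumpc"

lemma conv_sup_le:
 fixes u :: "R2 => 'a::euclidean_space"
 assumes r: "r > 0" and u: "L2 u" shows "norm (conv r u x) <= kconst / r * n2 u"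
proof -
 have c: "- 1 / r ~= 0" using r by simp
 have e: "(%y. kern r (x - y)) = (%y. 1 / (bumpc * r^2) * bump (x /\<^sub>R r + (- 1 / r) *r y))"
  by (rule ext) (simp add: kern_def scaleR_diff_right divide_inverse mult.commute)
 have L: "L2 (%y. kern r (x - y))" unfolding e by (intro L2_cmult L2_affine[OF c] L2_bump)
 have n: "n2 (%y. kern r (x - y)) = kconst / r"
  unfolding e n2_cmult n2_affine[OF c L2_bump] using r bumpc_pos by (simp add: kconst_def power2_eq_square)
 have "norm (conv r u x) <= (LI y. norm (kern r (x - y) *r u y))" unfolding conv_def by (rule integral_norm_bound)
 also have "... = (LI y. norm (kern r (x - y)) * norm (u y))" by simp
 also have "... <= kconst / r * n2 u" using L2_Cauchy_Schwarz[OF L u] unfolding n .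
 finally show ?thesis .
qed

lemma kconst_nonneg: "0 <= kconst" using bumpc_pos by (simp add: kconst_def)

lemma n2_eq_0: "L2 u ==> n2 u = 0 ==> AE x in lebesgue. u x = 0"
 using integral_nonneg_eq_0_iff_AE[OF L2_integrable[of u]] by (auto simp: n2_def)

text \<open>At height \<open>2^k K\<close> compare \<open>u\<close> with its average at scale \<open>r\<^sub>k \<sim> n2 u / (2^k K)\<close>: the average is at
 most half of the height, so \<open>\<bar>u\<bar>\<close> is controlled there by \<open>u - conv r\<^sub>k u\<close>.\<close>

lemma Gagliardo_Nirenberg:
 assumes p: "2 < p" "p < 4"
 obtains C where "C > 0" "!!u g K. L2 u ==> weak_grad u g ==> L2 g ==> K > 0 ==>
  li (%x. abs (u x) powr p) \<and> (LI x. abs (u x) powr p) <= C * (n2 u)^2 * (K powr (p - 2) + K powr (p - 4) * (n2 g)^2)"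
proof -
 define ka where "ka = kconst + 1"
 have k1: "ka > 0" using kconst_nonneg by (simp add: ka_def)
 \<comment> \<open>On level \<open>k\<close> the height contributes 2^(k (p - 2)) and the squared
   mollification error, of order \<open>r k ^ 2\<close>, contributes 4^(-k). The product is
   geometric with ratio 2^(p - 4); its convergence is where \<open>p < 4\<close> enters.\<close>
 define q where "q = 2 powr (p - 4)"
 have q: "0 < q" "q < 1" using p by (auto simp: q_def powr_less_one)
 define C where "C = 1 + 16 * ka^2 * 2 powr (p - 2) / (1 - q)"
 have C1: "C >= 1" using q by (simp add: C_def)
 have main: "li (%x. abs (u x) powr p) \<and> (LI x. abs (u x) powr p) <= C * (n2 u)^2 * (K powr (p - 2) + K powr (p - 4) * (n2 g)^2)"
  if u: "L2 u" and w: "weak_grad u g" and g: "L2 g" and K: "K > 0" for u g K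
 proof (cases "n2 u = 0")
  case True
  have 0: "AE x in lebesgue. 0 = abs (u x) powr p" using n2_eq_0[OF u True] by eventually_elim simp
  have um: "lm (%x. abs (u x) powr p)" using u by auto
  have "li (%x. abs (u x) powr p)" using integrable_cong_AE_imp[OF _ um 0] by simp
  moreover have "(LI x. abs (u x) powr p) = 0" using integral_cong_AE[OF _ um 0] by simp
  ultimately show ?thesis by (simp add: True)
 next
  case False
  define m where "m = n2 u"
  have m: "m > 0" using False by (simp add: m_def less_le)
  define r where "r k = 2 * ka * m / (2 ^ k * K)" for k :: nat
  have r: "r k > 0" for k using k1 m K by (simp add: r_def)
  define a where "a k = 4 * (2 ^ Suc k * K) powr (p - 2)" for k :: nat
  have a: "a k >= 0" for k by (simp add: a_def)
  have pw: "ennreal (abs (u x) powr p) <= ennreal (K powr (p - 2) * (u x)^2) + (\<Sum>k. ennreal (a k * (u x - conv (r k) u x)^2))" for x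
  proof (cases "abs (u x) <= K")
   case True
   have "abs (u x) powr p = abs (u x) powr (p - 2) * (u x)^2"
    by (cases "u x = 0") (auto simp: powr_diff powr_numeral)
   also have "... <= K powr (p - 2) * (u x)^2" using True p by (intro mult_right_mono powr_mono2) auto
   finally have h: "abs (u x) powr p <= K powr (p - 2) * (u x)^2" .
   show ?thesis by (rule order_trans[OF ennreal_leI[OF h]]) (intro add_increasing2 order_refl zero_le)
  next
   case False
   obtain n where "abs (u x) / K < 2 ^ n" using real_arch_pow[of 2] by auto
   then have ex: "EX n. abs (u x) < 2 ^ n * K" using K by (auto simp: field_simps)
   define N where "N = (LEAST n. abs (u x) < 2 ^ n * K)"
   have N: "abs (u x) < 2 ^ N * K" unfolding N_def using ex by (rule LeastI_ex)
   have "N ~= 0" using N False by (intro notI) simp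
   then obtain k where k: "N = Suc k" using not0_implies_Suc by blast
   have lo: "2 ^ k * K <= abs (u x)" using not_less_Least[of k "%n. abs (u x) < 2 ^ n * K"] k N_def by simp
   have "abs (conv (r k) u x) <= kconst / r k * m" using conv_sup_le[OF r u] by (simp add: m_def)
   also have "... <= ka / r k * m" using r[of k] m by (intro mult_right_mono divide_right_mono) (auto simp: ka_def)
   also have "... = 2 ^ k * K / 2" using k1 m K by (simp add: r_def)
   finally have "abs (conv (r k) u x) <= abs (u x) / 2" using lo by simp
   then have "abs (u x) <= 2 * abs (u x - conv (r k) u x)" using abs_triangle_ineq2[of "u x" "conv (r k) u x"] by simp
   then have h: "(u x)^2 <= 4 * (u x - conv (r k) u x)^2" using power_mono[of "abs (u x)" "2 * abs (u x - conv (r k) u x)" 2] by (simp add: power_mult_distrib)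
   have "u x ~= 0" using False K by auto
   then have "abs (u x) powr p = abs (u x) powr (p - 2) * (u x)^2" by (auto simp: powr_diff powr_numeral)
   also have "... <= (2 ^ Suc k * K) powr (p - 2) * (4 * (u x - conv (r k) u x)^2)"
    using N k p h by (intro mult_mono powr_mono2) auto
   finally have "ennreal (abs (u x) powr p) <= sum (%k. ennreal (a k * (u x - conv (r k) u x)^2)) {k}"
    by (simp add: a_def mult_ac ennreal_leI)
   also have "... <= (\<Sum>k. ennreal (a k * (u x - conv (r k) u x)^2))" by (intro sum_le_suminf) auto
   finally show ?thesis by (rule order_trans) (intro add_increasing order_refl zero_le)
  qed
  have Ld: "L2 (%x. u x - conv (r k) u x)" for k by (intro L2_diff u L2_conv[OF r])
  have [measurable]: "lm (%x. u x - conv (r k) u x)" for k using Ld by (rule L2_measurable)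
  have [measurable]: "lm u" using u by (rule L2_measurable)
  have trm: "(\<integral>\<^sup>+x. ennreal (a k * (u x - conv (r k) u x)^2) \<partial>lebesgue) <= ennreal ((C - 1) * (1 - q) * m^2 * (K powr (p - 4) * (n2 g)^2) * q ^ k)" for k
  proof -
   have "(\<integral>\<^sup>+x. ennreal (a k * (u x - conv (r k) u x)^2) \<partial>lebesgue) = ennreal (a k * (n2 (%x. u x - conv (r k) u x))^2)"
    using L2_integrable[OF Ld, of k] a[of k] by (subst nn_integral_eq_integral) (auto simp: n2_sq)
   also have "... <= ennreal (a k * (r k * n2 g)^2)"
    by (intro ennreal_leI mult_left_mono power_mono n2_minus_conv[OF r u w g] a) auto
   also have "a k * (r k * n2 g)^2 = (C - 1) * (1 - q) * m^2 * (K powr (p - 4) * (n2 g)^2) * q ^ k"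
   proof -
    have e1: "(2 ^ Suc k * K) powr (p - 2) = 2 powr (p - 2) * ((2 powr (p - 2)) ^ k * K powr (p - 2))"
     using K by (simp add: powr_mult powr_realpow[symmetric] powr_powr mult.commute)
    have e2: "K powr (p - 2) = K powr (p - 4) * K^2" using K by (simp add: powr_diff powr_numeral powr_realpow[symmetric] field_simps eval_nat_numeral)
    have e3: "(2 powr (p - 2)) ^ k = q ^ k * (2 ^ k)^2"
    proof -
     have "2 powr (p - 2) = q * 4" using powr_add[of 2 "p - 4" 2] by (simp add: q_def)
     moreover have "(4::real) ^ k = (2 ^ k)^2" by (simp add: power2_eq_square power_mult_distrib[symmetric])
     ultimately show ?thesis by (simp add: power_mult_distrib)
    qed
    have "C - 1 = 16 * ka^2 * 2 powr (p - 2) / (1 - q)" by (simp add: C_def)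
    then have e4: "(C - 1) * (1 - q) = 16 * ka^2 * 2 powr (p - 2)" using q by simp
    show ?thesis unfolding e4 a_def e1 e2 e3 r_def using K by (simp add: field_simps power2_eq_square)
   qed
   finally show ?thesis .
  qed
  have "(\<integral>\<^sup>+x. (\<Sum>k. ennreal (a k * (u x - conv (r k) u x)^2)) \<partial>lebesgue) = (\<Sum>k. \<integral>\<^sup>+x. ennreal (a k * (u x - conv (r k) u x)^2) \<partial>lebesgue)"
   by (rule nn_integral_suminf) measurable
  also have "... <= (\<Sum>k. ennreal ((C - 1) * (1 - q) * m^2 * (K powr (p - 4) * (n2 g)^2) * q ^ k))"
   by (intro suminf_le allI trm) auto
  also have "... = ennreal (\<Sum>k. (C - 1) * (1 - q) * m^2 * (K powr (p - 4) * (n2 g)^2) * q ^ k)"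
   using q C1 by (intro suminf_ennreal2 summable_mult summable_geometric) auto
  also have "(\<Sum>k. (C - 1) * (1 - q) * m^2 * (K powr (p - 4) * (n2 g)^2) * q ^ k) = (C - 1) * m^2 * (K powr (p - 4) * (n2 g)^2)"
   using q by (simp add: suminf_mult suminf_geometric summable_geometric)
  finally have ser: "(\<integral>\<^sup>+x. (\<Sum>k. ennreal (a k * (u x - conv (r k) u x)^2)) \<partial>lebesgue) <= ennreal ((C - 1) * m^2 * (K powr (p - 4) * (n2 g)^2))" .
  have "(\<integral>\<^sup>+x. ennreal (abs (u x) powr p) \<partial>lebesgue) <= (\<integral>\<^sup>+x. (ennreal (K powr (p - 2) * (u x)^2) + (\<Sum>k. ennreal (a k * (u x - conv (r k) u x)^2))) \<partial>lebesgue)"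
   by (intro nn_integral_mono pw)
  also have "... = (\<integral>\<^sup>+x. ennreal (K powr (p - 2) * (u x)^2) \<partial>lebesgue) + (\<integral>\<^sup>+x. (\<Sum>k. ennreal (a k * (u x - conv (r k) u x)^2)) \<partial>lebesgue)"
   by (rule nn_integral_add) measurable
  also have "(\<integral>\<^sup>+x. ennreal (K powr (p - 2) * (u x)^2) \<partial>lebesgue) = ennreal (K powr (p - 2) * m^2)"
   using L2_integrable[OF u] by (subst nn_integral_eq_integral) (auto simp: n2_sq m_def)
  also have "ennreal (K powr (p - 2) * m^2) + (\<integral>\<^sup>+x. (\<Sum>k. ennreal (a k * (u x - conv (r k) u x)^2)) \<partial>lebesgue)
   <= ennreal (K powr (p - 2) * m^2) + ennreal ((C - 1) * m^2 * (K powr (p - 4) * (n2 g)^2))"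
   by (intro add_left_mono ser)
  also have "... = ennreal (K powr (p - 2) * m^2 + (C - 1) * m^2 * (K powr (p - 4) * (n2 g)^2))"
   using C1 by (intro ennreal_plus[symmetric]) auto
  also have "... <= ennreal (C * m^2 * (K powr (p - 2) + K powr (p - 4) * (n2 g)^2))"
  proof (rule ennreal_leI)
   have "0 <= (C - 1) * (K powr (p - 2) * m^2)" "0 <= m^2 * (K powr (p - 4) * (n2 g)^2)" using C1 by auto
   then show "K powr (p - 2) * m^2 + (C - 1) * m^2 * (K powr (p - 4) * (n2 g)^2) <= C * m^2 * (K powr (p - 2) + K powr (p - 4) * (n2 g)^2)"
    by (simp add: algebra_simps add_increasing2)
  qed
  finally have le: "(\<integral>\<^sup>+x. ennreal (abs (u x) powr p) \<partial>lebesgue) <= ennreal (C * m^2 * (K powr (p - 2) + K powr (p - 4) * (n2 g)^2))" .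
  have i: "li (%x. abs (u x) powr p)" by (rule integrableI_bounded) (use le_less_trans[OF le] in auto)
  moreover have "(LI x. abs (u x) powr p) <= C * m^2 * (K powr (p - 2) + K powr (p - 4) * (n2 g)^2)"
   using le C1 by (subst (asm) nn_integral_eq_integral[OF i]) (auto simp: ennreal_le_iff)
  ultimately show ?thesis by (simp add: m_def)
 qed
 show ?thesis by (rule that[of C]) (use C1 main in auto)
qed

subsection \<open>Compactness in \<open>L^2\<close>\<close>

lemma n2_indicator_split:
 assumes f: "L2 f" and A: "A : sets lebesgue"
 shows "L2 (%x. indicator A x *r f x)" "n2 f <= n2 (%x. indicator A x *r f x) + n2 (%x. indicator (- A) x *r f x)"
proof -
 have L: "L2 (%x. indicator B x *r f x)" if B: "B : sets lebesgue" for B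
  by (rule L2_bound[OF f]) (use f B in \<open>auto intro!: borel_measurable_scaleR borel_measurable_indicator simp: indicator_def\<close>)
 show "L2 (%x. indicator A x *r f x)" by (rule L[OF A])
 have "(%x. indicator A x *r f x + indicator (- A) x *r f x) = f" by (auto simp: indicator_def)
 then show "n2 f <= n2 (%x. indicator A x *r f x) + n2 (%x. indicator (- A) x *r f x)"
  using n2_triangle[OF L[OF A] L[of "- A"]] A sets.compl_sets[OF A] by (simp add: Compl_eq_Diff_UNIV)
qed

text \<open>Outside a large ball three cases are possible: where \<open>V > K\<close> the potential
  energy pays for the mass; where \<open>V <= K\<close> and \<open>|u| > t\<close> the cube of
  \<open>u\<close> pays; what remains has values at most \<open>t\<close> on a set whose measure
  tends to 0, because the sublevel set has finite measure. The bound is uniform because only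
  \<open>M\<close> enters.\<close>

lemma uniform_tail:
 fixes V :: "R2 => real"
 assumes V: "lm V" "!!x. V x >= 0" "!!M. M > 0 ==> emeasure lebesgue {x. V x <= M} < \<infinity>" and e: "e > 0"
 obtains R where "R > 0" "!!u g. L2 u ==> weak_grad u g ==> L2 g ==> n2 u <= M ==> n2 g <= M ==>
  li (%x. V x * (u x)^2) ==> (LI x. V x * (u x)^2) <= M ==> n2 (%x. indicator (- cball 0 R) x *r u x) <= e"
proof -
 obtain C where C: "C > 0" "!!u g K. L2 u ==> weak_grad u g ==> L2 g ==> K > 0 ==>
  li (%x. abs (u x) powr 3) \<and> (LI x. abs (u x) powr 3) <= C * (n2 u)^2 * (K powr (3 - 2) + K powr (3 - 4) * (n2 g)^2)"
  by (rule Gagliardo_Nirenberg[of 3]) auto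
 define D where "D = C * M^2 * (1 + M^2)"
 have D0: "D >= 0" using C by (simp add: D_def)
 \<comment> \<open>\<open>K\<close>, \<open>t\<close> and later the radius are chosen so that each
   of the three contributions is at most e^2 / 3. The added 1 keeps the constants positive when the
   bounds vanish.\<close>
 define K where "K = 3 * (abs M + 1) / e^2"
 define t where "t = 3 * (D + 1) / e^2"
 have K: "K > 0" and t: "t > 0" using e D0 by (auto simp: K_def t_def)
 define A where "A n = {x. V x <= K} - cball 0 (real n)" for n :: nat
 have Vs: "{x. V x <= K} : sets lebesgue" using V(1) borel_measurable_le[of V lebesgue "%_. K"] by simp
 have As: "A n : sets lebesgue" for n using Vs by (auto simp: A_def)
 have "(%n. measure lebesgue (A n)) ---> measure lebesgue (\<Inter>n. A n)"
 proof (rule Lim_measure_decseq)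
  show "range A \<subseteq> sets lebesgue" using As by auto
  show "decseq A" by (auto simp: decseq_def A_def)
  show "emeasure lebesgue (A n) ~= \<infinity>" for n
   using emeasure_mono[of "A n" "{x. V x <= K}" lebesgue] V(3)[OF K] Vs by (auto simp: A_def top_unique)
 qed
 moreover have "(\<Inter>n. A n) = {}" using real_arch_simple by (fastforce simp: A_def)
 ultimately have "(%n. measure lebesgue (A n)) ---> 0" by simp
 then have "\<forall>\<^sub>F n in sequentially. measure lebesgue (A n) < e^2 / (3 * t^2)" using e t by (intro order_tendstoD) auto
 then obtain n where "measure lebesgue (A (Suc n)) < e^2 / (3 * t^2)" unfolding eventually_sequentially using le_Suc_eq by blast
 define R where "R = real (Suc n)"
 have mA: "measure lebesgue (A (Suc n)) < e^2 / (3 * t^2)" by fact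
 show ?thesis
 proof (rule that[of R])
  show "R > 0" by (simp add: R_def)
  fix u g assume u: "L2 u" "weak_grad u g" "L2 g" "n2 u <= M" "n2 g <= M" and Vu: "li (%x. V x * (u x)^2)" "(LI x. V x * (u x)^2) <= M"
  have u3: "li (%x. abs (u x) powr 3)" "(LI x. abs (u x) powr 3) <= D"
  proof -
   show "li (%x. abs (u x) powr 3)" using C(2)[OF u(1-3), of 1] by simp
   have "(LI x. abs (u x) powr 3) <= C * (n2 u)^2 * (1 + (n2 g)^2)" using C(2)[OF u(1-3), of 1] by simp
   also have "... <= D" unfolding D_def using C u by (intro mult_mono add_left_mono power_mono) auto
   finally show "(LI x. abs (u x) powr 3) <= D" .
  qed
  have iA: "li (indicator (A (Suc n)) :: R2 => real)"
   using emeasure_mono[of "A (Suc n)" "{x. V x <= K}" lebesgue] V(3)[OF K] Vs As by (auto simp: A_def integrable_indicator_iff top_unique less_top)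
  let ?f = "%x. indicator (- cball 0 R) x *r u x"
  have pw: "(norm (?f x))^2 <= V x * (u x)^2 / K + t^2 * indicator (A (Suc n)) x + abs (u x) powr 3 / t" for x
  proof (cases "x : cball 0 R")
   case True then show ?thesis using V(2)[of x] K t by (intro order_trans[OF _ add_nonneg_nonneg[OF add_nonneg_nonneg]]) auto
  next
   case F: False
   show ?thesis
   proof (cases "V x <= K")
    case False
    then have "(u x)^2 <= V x * (u x)^2 / K" using K mult_right_mono[of K "V x" "(u x)^2"] by (simp add: field_simps)
    moreover have "0 <= t^2 * indicat_real (A (Suc n)) x" "0 <= abs (u x) powr 3 / t" using t by auto
    moreover have "(norm (?f x))^2 = (u x)^2" using F by (simp add: indicator_def)
    ultimately show ?thesis by linarith
   next
    case True
    then have "x : A (Suc n)" using F by (simp add: A_def R_def)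
    moreover have "(u x)^2 <= t^2 + abs (u x) powr 3 / t"
    proof (cases "abs (u x) <= t")
     case True then show ?thesis using power_mono[OF True, of 2] t by (simp add: add_increasing2)
    next
     case False
     then have "(u x)^2 * t <= (u x)^2 * abs (u x)" by (intro mult_left_mono) auto
     also have "... = abs (u x) powr 3" using False t by (simp add: powr_numeral power3_eq_cube power2_eq_square abs_mult_self_eq)
     finally show ?thesis using t by (simp add: field_simps add_increasing)
    qed
    moreover have "0 <= V x * (u x)^2 / K" using V(2)[of x] K by auto
    ultimately show ?thesis using F by (auto simp: indicator_def)
   qed
  qed
  have Lf: "L2 ?f" by (rule n2_indicator_split(1)[OF u(1)]) (simp add: Compl_eq_Diff_UNIV)
  have "(n2 ?f)^2 <= (LI x. V x * (u x)^2 / K + t^2 * indicator (A (Suc n)) x + abs (u x) powr 3 / t)"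
   unfolding n2_sq by (intro integral_mono L2_integrable[OF Lf] pw bint Vu u3 iA)
  also have "... = (LI x. V x * (u x)^2) / K + t^2 * measure lebesgue (A (Suc n)) + (LI x. abs (u x) powr 3) / t"
   using Vu u3 iA As by simp
  also have "... <= e^2 / 3 + e^2 / 3 + e^2 / 3"
  proof (intro add_mono)
   have aux: "I / (3 * (J + 1) / e^2) <= e^2 / 3" if "I <= J" "J >= 0" for I J :: real
   proof -
    have "I / (3 * (J + 1) / e^2) <= (J + 1) / (3 * (J + 1) / e^2)" using that by (intro divide_right_mono) auto
    also have "... = e^2 / 3" using that e by (simp add: field_simps)
    finally show ?thesis .
   qed
   show "(LI x. V x * (u x)^2) / K <= e^2 / 3" unfolding K_def by (rule aux) (use Vu(2) in auto)
   show "t^2 * measure lebesgue (A (Suc n)) <= e^2 / 3" using mA t by (simp add: field_simps)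
   show "(LI x. abs (u x) powr 3) / t <= e^2 / 3" unfolding t_def by (rule aux[OF u3(2) D0])
  qed
  finally have "(n2 ?f)^2 <= e^2" by simp
  then show "n2 ?f <= e" by (rule power2_le_imp_le) (use e in simp)
 qed
qed

lemma conv_Lipschitz:
 assumes r: "r > 0" and u: "L2 u" "weak_grad u g" "L2 g"
 shows "abs (conv r u x - conv r u y) <= kconst / r * n2 g * norm (x - y)"
proof -
 let ?f = "conv r u"
 have d: "(?f has_derivative (%h. conv r g x \<bullet> h)) (at x within UNIV)" for x
  using conv_has_derivative[OF r L2_loc_int[OF u(1)], of x] cgrad_eqI[OF conv_has_derivative[OF r L2_loc_int[OF u(1)], of x]]
   cgrad_conv_weak[OF r u(2), of x] by simp
 have "onorm (%h. conv r g x \<bullet> h) <= kconst / r * n2 g" for x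
  by (rule onorm_le) (unfold real_norm_def, rule order_trans[OF Cauchy_Schwarz_ineq2 mult_right_mono[OF conv_sup_le[OF r u(3)] norm_ge_zero]])
 then show ?thesis using differentiable_bound[of UNIV ?f "%x h. conv r g x \<bullet> h" "kconst / r * n2 g" x y] d by auto
qed

text \<open>The mass outside a ball is uniformly small, and mollification changes a function by at
  most \<open>rh\<close> times its gradient norm, uniformly along the sequence. The mollified
  functions are equibounded and equi-Lipschitz, so Arzela-Ascoli applies to them on the ball.
  Diagonal extraction needs a property inherited by subsequences, hence \<open>P n\<close> bounds
  the distance of all pairs.\<close>

lemma Rellich:
 fixes V :: "R2 => real"
 assumes V: "lm V" "!!x. V x >= 0" "!!M. M > 0 ==> emeasure lebesgue {x. V x <= M} < \<infinity>"
  and u: "!!n. L2 (u n)" "!!n. weak_grad (u n) (g n)" "!!n. L2 (g n)" "!!n. n2 (u n) <= M" "!!n. n2 (g n) <= M"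
   "!!n. li (%x. V x * (u n x)^2)" "!!n. (LI x. V x * (u n x)^2) <= M"
 obtains r v where "strict_mono (r::nat=>nat)" "L2 v" "(%n. n2 (%x. u (r n) x - v x)) ---> 0"
proof -
 define P where "P n s \<longleftrightarrow> (ALL i j. n2 (%x. u (s i) x - u (s j) x) <= 1 / real (Suc n))" for n and s :: "nat => nat"
 have M0: "M >= 0" using u(4)[of 0] n2_nonneg order_trans by blast
 interpret subseqs P
 proof
  fix n and s :: "nat => nat" assume "strict_mono s"
  \<comment> \<open>Five errors add up to 1 / (n + 1): the tails of the two functions, their two
    mollification errors, and the distance of the mollifications on the ball.\<close>
  define e where "e = 1 / (5 * real (Suc n))"
  have e: "e > 0" by (simp add: e_def)
  obtain R where R: "R > 0" "!!u g. L2 u ==> weak_grad u g ==> L2 g ==> n2 u <= M ==> n2 g <= M ==>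
   li (%x. V x * (u x)^2) ==> (LI x. V x * (u x)^2) <= M ==> n2 (%x. indicator (- cball 0 R) x *r u x) <= e"
   by (rule uniform_tail[of V e M, OF V(1,2) V(3) e]) (assumption, rule that)
  define rh where "rh = e / (M + 1)"
  have rh: "rh > 0" "rh * M <= e" using e M0 by (auto simp: rh_def field_simps)
  define F where "F k = conv rh (u (s k))" for k
  let ?c = "kconst / rh * M"
  have c0: "?c >= 0" using kconst_nonneg rh M0 by simp
  have lip: "abs (F k x - F k y) <= ?c * norm (x - y)" for k x y
  proof -
   have "abs (F k x - F k y) <= kconst / rh * n2 (g (s k)) * norm (x - y)" unfolding F_def by (rule conv_Lipschitz[OF rh(1) u(1,2,3)])
   also have "... <= ?c * norm (x - y)" using kconst_nonneg rh u(5) by (intro mult_right_mono mult_left_mono) auto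
   finally show ?thesis .
  qed
  obtain w k where k: "strict_mono (k :: nat => nat)" and un: "!!e. 0 < e ==> EX N. ALL n x. n >= N \<and> x : cball 0 R --> norm (F (k n) x - w x) < e"
  proof (rule Arzela_Ascoli[of "cball (0::R2) R" F ?c])
   show "norm (F k x) <= ?c" for k x
   proof -
    have "norm (F k x) <= kconst / rh * n2 (u (s k))" unfolding F_def by (rule conv_sup_le[OF rh(1) u(1)])
    also have "... <= ?c" using kconst_nonneg rh u(4) by (intro mult_left_mono) auto
    finally show ?thesis .
   qed
   show "EX d. 0 < d \<and> (ALL n y. y : cball 0 R \<and> norm (x - y) < d --> norm (F n x - F n y) < epp)" if "0 < epp" for x epp
   proof (intro exI conjI allI impI)
    show "0 < epp / (?c + 1)" using that c0 by simp
    fix n y assume "y : cball 0 R \<and> norm (x - y) < epp / (?c + 1)"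
    then have "norm (x - y) * (?c + 1) < epp" using c0 by (simp add: pos_less_divide_eq)
    moreover have "?c * norm (x - y) <= norm (x - y) * (?c + 1)" by (simp add: algebra_simps)
    ultimately show "norm (F n x - F n y) < epp" using lip[of n x y] by simp
   qed
  qed auto
  have wR: "L2 (%x::R2. 1 * indicat_real (cball 0 R) x)"
   by (rule L2_bounded_support[where K=1 and n=R]) (auto simp: indicator_def)
  define A where "A = n2 (%x::R2. 1 * indicat_real (cball 0 R) x)"
  have A0: "A >= 0" by (simp add: A_def)
  obtain N where N: "!!n x. n >= N ==> x : cball 0 R ==> norm (F (k n) x - w x) < e / (A + 1) / 2"
   using un[of "e / (A + 1) / 2"] e A0 by auto
  have "n2 (%x. u (s (k i)) x - u (s (k j)) x) <= 1 / real (Suc n)" if ij: "i >= N" "j >= N" for i j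
  proof -
   let ?u = "%i. u (s (k i))"
   let ?B = "cball (0::R2) R"
   have Bs: "?B : sets lebesgue" "- ?B : sets lebesgue" by (auto simp: Compl_eq_Diff_UNIV)
   have FL: "L2 (F (k i))" for i unfolding F_def by (rule L2_conv[OF rh(1) u(1)])
   have tail: "n2 (%x. indicator (- ?B) x *r (?u i x - ?u j x)) <= 2 * e"
    using n2_triangle_diff[OF n2_indicator_split(1)[OF u(1) Bs(2)] n2_indicator_split(1)[OF u(1) Bs(2)], of "s (k i)" "s (k j)"]
     R(2)[OF u(1,2,3,4,5,6,7), of "s (k i)"] R(2)[OF u(1,2,3,4,5,6,7), of "s (k j)"] by (simp add: right_diff_distrib)
   have mol: "n2 (%x. indicator ?B x *r (?u i x - F (k i) x)) <= e" for i
   proof -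
    have L: "L2 (%x. ?u i x - F (k i) x)" by (intro L2_diff u(1) FL)
    have "n2 (%x. indicator ?B x *r (?u i x - F (k i) x)) <= n2 (%x. ?u i x - F (k i) x)"
     by (rule n2_mono[OF L]) (use n2_indicator_split(1)[OF L Bs(1)] in \<open>auto simp: indicator_def\<close>)
    also have "... <= rh * n2 (g (s (k i)))" unfolding F_def by (rule n2_minus_conv[OF rh(1) u(1,2,3)])
    also have "... <= rh * M" using rh u(5) by (intro mult_left_mono) auto
    finally show ?thesis using rh by simp
   qed
   have tri: "abs (a - b) <= E" if "abs (a - c) < E / 2" "abs (b - c) < E / 2" for a b c E :: real using that by linarith
   have uni: "n2 (%x. indicator ?B x *r (F (k i) x - F (k j) x)) <= e"
   proof -
    have "n2 (%x. indicator ?B x *r (F (k i) x - F (k j) x)) <= n2 (%x. e / (A + 1) * (1 * indicat_real ?B x))"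
    proof (rule n2_mono[OF L2_cmult[OF wR]])
     show "lm (%x. indicator ?B x *r (F (k i) x - F (k j) x))"
      using n2_indicator_split(1)[OF L2_diff[OF FL FL] Bs(1), of i j] by (rule L2_measurable)
     show "AE x in lebesgue. norm (indicat_real ?B x *r (F (k i) x - F (k j) x)) <= norm (e / (A + 1) * (1 * indicat_real ?B x))"
     proof (rule AE_I2)
      fix x show "norm (indicat_real ?B x *r (F (k i) x - F (k j) x)) <= norm (e / (A + 1) * (1 * indicat_real ?B x))"
      proof (cases "x : ?B")
       case True
       have "abs (F (k i) x - F (k j) x) <= e / (A + 1)"
        by (rule tri[OF N[OF ij(1) True, unfolded real_norm_def] N[OF ij(2) True, unfolded real_norm_def]])
       then show ?thesis using True e A0 by (simp add: indicator_def)
      qed (simp add: indicator_def)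
     qed
    qed
    also have "... = abs (e / (A + 1)) * A" unfolding A_def by (rule n2_cmult)
    also have "... <= e" using e A0 by (simp add: field_simps)
    finally show ?thesis .
   qed
   define a b where "a = (%x. indicator ?B x *r (?u i x - F (k i) x))" and "b = (%x. indicator ?B x *r (?u j x - F (k j) x))"
   define c where "c = (%x. indicator ?B x *r (F (k i) x - F (k j) x))"
   have Labc: "L2 a" "L2 b" "L2 c" unfolding a_def b_def c_def by (intro n2_indicator_split(1)[OF L2_diff Bs(1)] u(1) FL)+
   have "n2 (%x. indicator ?B x *r (?u i x - ?u j x)) = n2 (%x. (a x + c x) - b x)"
    by (simp add: a_def b_def c_def algebra_simps)
   also have "... <= n2 a + n2 c + n2 b"
    using n2_triangle_diff[OF L2_add(1)[OF Labc(1,3)] Labc(2)] n2_triangle[OF Labc(1,3)] by simp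
   also have "... <= e + e + e" unfolding a_def b_def c_def by (intro add_mono mol uni)
   finally have "n2 (%x. ?u i x - ?u j x) <= 5 * e"
    using n2_indicator_split(2)[OF L2_diff[OF u(1) u(1)] Bs(1), of "s (k i)" "s (k j)"] tail by simp
   moreover have "5 * e = 1 / real (Suc n)" by (simp add: e_def del: of_nat_Suc)
   ultimately show ?thesis by simp
  qed
  then have "P n (s \<circ> (k \<circ> (%i. i + N)))" by (simp add: P_def)
  moreover have "strict_mono (k \<circ> (%i. i + N))" using k by (intro strict_mono_o) (auto simp: strict_mono_def)
  ultimately show "EX r'. strict_mono r' \<and> P n (s \<circ> r')" by blast
 qed
 have cl: "P n (diagseq \<circ> ((+) (Suc n)))" for n
  by (rule diagseq_holds) (auto simp: P_def)
 have cau: "EX N. ALL m>=N. ALL n>=N. n2 (%x. u (diagseq m) x - u (diagseq n) x) < e" if e: "e > 0" for e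
 proof -
  obtain n where n: "1 / real (Suc n) < e" using nat_approx_posE[OF e] by blast
  have "n2 (%x. u (diagseq i) x - u (diagseq j) x) < e" if "i >= Suc n" "j >= Suc n" for i j
   using cl[of n, THEN iffD1[OF P_def], rule_format, of "i - Suc n" "j - Suc n"] that n by simp
  then show ?thesis by blast
 qed
 obtain v where "L2 v" "(%n. n2 (%x. u (diagseq n) x - v x)) ---> 0"
  using L2_complete[of "%n. u (diagseq n)", OF u(1) cau] by blast
 then show ?thesis using that[of diagseq v] subseq_diagseq by blast
qed

subsection \<open>Dilations\<close>

lemma L2_dilation_continuous:
 fixes F :: "R2 => 'a::euclidean_space"
 assumes F: "L2 F" and l: "l ---> 1" "!!k::nat. l k >= 1 / 2"
 shows "(%k. n2 (%x. F (l k *r x) - F x)) ---> 0"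
proof (rule LIMSEQ_I)
 fix e :: real assume e: "e > 0"
 obtain g R where g: "continuous_on UNIV g" "!!x. norm x >= R ==> g x = 0" "L2 g" "n2 (%x. F x - g x) < e / 4"
  using L2_dense[OF F, of "e/4"] e by auto
 have lp: "l k ~= 0" for k using l(2)[of k] by auto
 have gl: "L2 (%x. g (l k *r x))" and Fl: "L2 (%x. F (l k *r x))" for k
  using L2_affine[OF lp[of k] g(3), of 0] L2_affine[OF lp[of k] F, of 0] by auto
 have "bounded (g ` cball 0 (abs R))" by (intro compact_imp_bounded compact_continuous_image continuous_on_subset[OF g(1)]) auto
 then have "EX B. ALL x. norm x <= abs R --> norm (g x) <= B" by (auto simp: bounded_iff, metis mem_cball_0)
 then obtain B where B: "!!x. norm x <= abs R ==> norm (g x) <= B" by blast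
 have gB: "norm (g x) <= abs B" for x using B[of x] g(2)[of x] by (cases "norm x <= abs R") auto
 have w: "L2 (%x::R2. (2 * abs B) * indicat_real (cball 0 (2 * abs R)) x)"
  by (rule L2_bounded_support[where K="2 * abs B" and n="2 * abs R"]) (auto simp: indicator_def)
 have "(%k. n2 (%x. g (l k *r x) - g x)) ---> 0"
 proof (rule n2_dominated[OF L2_measurable[OF gl] L2_measurable[OF g(3)] _ w])
  have "(%k. g (l k *r x)) ---> g (1 *r x)" for x
   by (rule continuous_on_tendsto_compose[OF g(1) tendsto_scaleR[OF l(1) tendsto_const]]) auto
  then show "AE x in lebesgue. (%k. g (l k *r x)) ---> g x" by simp
  show "AE x in lebesgue. norm (g (l k *r x) - g x) <= 2 * abs B * indicat_real (cball 0 (2 * abs R)) x" for k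
  proof (rule AE_I2)
   fix x show "norm (g (l k *r x) - g x) <= 2 * abs B * indicat_real (cball 0 (2 * abs R)) x"
   proof (cases "norm x <= 2 * abs R")
    case False
    have "1 / 2 * norm x <= l k * norm x" using l(2)[of k] by (intro mult_right_mono) auto
    then have "norm (l k *r x) >= R" "norm x >= R" using False l(2)[of k] by auto
    then show ?thesis using g(2) by simp
   next
    case True then show ?thesis using norm_triangle_ineq4[of "g (l k *r x)" "g x"] gB[of x] gB[of "l k *r x"] by simp
   qed
  qed
 qed
 then have "\<forall>\<^sub>F k in sequentially. n2 (%x. g (l k *r x) - g x) < e / 4" using e by (intro order_tendstoD) auto
 then obtain N where N: "!!k. k >= N ==> n2 (%x. g (l k *r x) - g x) < e / 4" by (auto simp: eventually_sequentially)
 have "n2 (%x. F (l k *r x) - F x) < e" if k: "k >= N" for k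
 proof -
  have "n2 (%x. F (l k *r x) - g (l k *r x)) = n2 (%x. F x - g x) / abs (l k)"
   using n2_affine[OF lp[of k] L2_diff[OF F g(3)], of 0] by simp
  also have "... <= n2 (%x. F x - g x) / (1 / 2)" using l(2)[of k] by (intro divide_left_mono) auto
  finally have "n2 (%x. F (l k *r x) - g (l k *r x)) <= 2 * n2 (%x. F x - g x)" by simp
  then show ?thesis using n2_triangle3[OF Fl gl F, of k k] n2_triangle3[OF gl g(3) F, of k] N[OF k] g(4) n2_commute[of F g] by simp
 qed
 then show "EX no. ALL n>=no. norm (n2 (%x. F (l n *r x) - F x) - 0) < e" by auto
qed

lemma test_fun_dilate:
 assumes t: "test_fun ph" and c: "c ~= 0"
 shows "test_fun (%y. ph (y /\<^sub>R c))" "cgrad (%y. ph (y /\<^sub>R c)) y = cgrad ph (y /\<^sub>R c) /\<^sub>R c"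
proof -
 obtain R B where R: "R > 0" "continuous_on UNIV ph" "continuous_on UNIV (cgrad ph)" "!!x. abs (ph x) <= B" "!!x. norm (cgrad ph x) <= B"
  "!!x. norm x >= R ==> ph x = 0" "!!x. norm x >= R ==> cgrad ph x = 0" "!!x. (ph has_derivative (%h. cgrad ph x \<bullet> h)) (at x)"
  using test_fun_bounds[OF t] by metis
 have d: "((%y. ph (y /\<^sub>R c)) has_derivative (%h. (cgrad ph (y /\<^sub>R c) /\<^sub>R c) \<bullet> h)) (at y)" for y
  by (rule has_derivative_eq_rhs[OF has_derivative_compose[OF has_derivative_scaleR_right[OF has_derivative_ident] R(8)]]) auto
 show cg: "cgrad (%y. ph (y /\<^sub>R c)) y = cgrad ph (y /\<^sub>R c) /\<^sub>R c" for y by (rule cgrad_eqI[OF d])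
 show "test_fun (%y. ph (y /\<^sub>R c))" unfolding test_fun_def
 proof (intro conjI allI)
  show "(%y. ph (y /\<^sub>R c)) differentiable (at x)" for x using d by (auto simp: differentiable_def)
  show "continuous_on UNIV (cgrad (%y. ph (y /\<^sub>R c)))" unfolding cg by (intro continuous_intros continuous_on_compose2[OF R(3)]) auto
  have "ph (x /\<^sub>R c) = 0" if "norm (x - 0) >= abs c * R" for x
   by (rule R(6)) (use that c in \<open>simp add: field_simps\<close>)
  then show "bounded {x. ph (x /\<^sub>R c) ~= 0}" by (rule bounded_ball_support)
 qed
qed

text \<open>The weak gradient is tested in direction \<open>i\<close> with
  \<open>y $ i * ps y\<close> and the results are summed. The factor 2 is the divergence of the
  field \<open>y\<close> in the plane.\<close>

lemma weak_divergence:
 assumes w: "weak_grad U g" and t: "test_fun ps"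
 shows "(LI y. U y * (cgrad ps y \<bullet> y)) = - (LI y. (2 * U y + g y \<bullet> y) * ps y)"
  "li (%y. U y * (cgrad ps y \<bullet> y))" "li (%y. (2 * U y + g y \<bullet> y) * ps y)"
proof -
 note l = weak_gradD(1,2)[OF w]
 have e: "((%y::R2. y $ i) has_derivative (%h. axis i 1 \<bullet> h)) (at x)" for i :: 2 and x
  by (rule has_derivative_eq_rhs[OF bounded_linear.has_derivative[OF bounded_linear_vec_nth has_derivative_ident]]) (auto simp: inner_axis')
 have cc: "continuous_on UNIV (%y::R2. axis i (1::real) :: R2)" for i :: 2 by (intro continuous_intros)
 note tm = test_fun_mult[OF t e cc]
 have a: "U y * cgrad (%y. y $ i * ps y) y $ i = U y * (cgrad ps y $ i * y $ i) + U y * ps y" for i :: 2 and y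
  unfolding tm(2) by (simp add: algebra_simps)
 have iU: "li (%y. U y * ps y)" by (rule loc_int_test_integrable[OF t l(1)])
 have i1: "li (%y. U y * cgrad (%y. y $ i * ps y) y $ i)" for i by (rule loc_int_cgrad_integrable[OF tm(1) l(1)])
 have i2: "li (%y. g y $ i * (y $ i * ps y))" for i by (rule loc_int_test_integrable[OF tm(1) loc_int_component[OF l(2)]])
 have i3: "li (%y. U y * (cgrad ps y $ i * y $ i))" for i
  using Bochner_Integration.integrable_diff[OF i1[of i] iU] unfolding a by simp
 have s1: "U y * (cgrad ps y \<bullet> y) = (SUM i:UNIV. U y * (cgrad ps y $ i * y $ i))" for y by (simp add: inner_vec_def sum_distrib_left)
 have s2: "(2 * U y + g y \<bullet> y) * ps y = 2 * (U y * ps y) + (SUM i:UNIV. g y $ i * (y $ i * ps y))" for y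
  by (simp add: inner_vec_def sum_distrib_right sum_distrib_left algebra_simps)
 show "li (%y. U y * (cgrad ps y \<bullet> y))" unfolding s1 by (intro Bochner_Integration.integrable_sum i3)
 show "li (%y. (2 * U y + g y \<bullet> y) * ps y)" unfolding s2 by (intro Bochner_Integration.integrable_sum bint i2 iU)
 have e1: "(LI y. U y * (cgrad ps y $ i * y $ i)) = - (LI y. g y $ i * (y $ i * ps y)) - (LI y. U y * ps y)" for i
  using weak_gradD(3)[OF w tm(1), of i i] i3[of i] iU unfolding a by simp
 have "(LI y. U y * (cgrad ps y \<bullet> y)) = (SUM i:UNIV. LI y. U y * (cgrad ps y $ i * y $ i))"
  unfolding s1 by (rule Bochner_Integration.integral_sum[OF i3])
 also have "... = - (2 * (LI y. U y * ps y) + (SUM i:UNIV. LI y. g y $ i * (y $ i * ps y)))"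
  unfolding e1 by (simp add: sum_subtractf sum_negf)
 also have "... = - (LI y. (2 * U y + g y \<bullet> y) * ps y)"
  unfolding s2 using iU i2 by (simp add: Bochner_Integration.integral_sum Bochner_Integration.integrable_sum)
 finally show "(LI y. U y * (cgrad ps y \<bullet> y)) = - (LI y. (2 * U y + g y \<bullet> y) * ps y)" .
qed

text \<open>After the change of variables the dilation acts on the test function, which is Lipschitz
  and C^1, so the derivative in \<open>l\<close> is taken there by dominated convergence; the
  divergence identity then returns it to \<open>U\<close>.\<close>

lemma dilated_test_derivative:
 assumes w: "weak_grad U g" and t: "test_fun ph" and l: "l > 0"
 shows "((%l. LI y. U y * ph (y /\<^sub>R l)) has_real_derivative (LI y. (2 * U y + g y \<bullet> y) * ph (y /\<^sub>R l)) / l) (at l)"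
proof -
 obtain R B where R: "R > 0" "continuous_on UNIV ph" "continuous_on UNIV (cgrad ph)" "!!x. abs (ph x) <= B" "!!x. norm (cgrad ph x) <= B"
  "!!x. norm x >= R ==> ph x = 0" "!!x. norm x >= R ==> cgrad ph x = 0" "!!x. (ph has_derivative (%h. cgrad ph x \<bullet> h)) (at x)"
  using test_fun_bounds[OF t] by metis
 have B0: "B >= 0" using R(4)[of 0] by linarith
 have lU: "loc_int U" by (rule weak_gradD(1)[OF w])
 have ne: "l ~= 0" using l by simp
 note td = test_fun_dilate[OF t ne]
 have lip: "abs (ph x - ph y) <= B * norm (x - y)" for x y
 proof -
  have "onorm (%h. cgrad ph x \<bullet> h) <= B" for x
   by (rule onorm_le) (unfold real_norm_def, rule order_trans[OF Cauchy_Schwarz_ineq2 mult_right_mono[OF R(5) norm_ge_zero]])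
  then show ?thesis using differentiable_bound[of UNIV ph "%x h. cgrad ph x \<bullet> h" B x y] R(8) by auto
 qed
 let ?D = "%y. - (U y * (cgrad (%y. ph (y /\<^sub>R l)) y \<bullet> y)) / l"
 have D: "(LI y. ?D y) = (LI y. (2 * U y + g y \<bullet> y) * ph (y /\<^sub>R l)) / l"
  using weak_divergence(1)[OF w td(1)] by simp
 have iU: "li (%y. U y * ph (y /\<^sub>R c))" if "c ~= 0" for c by (rule loc_int_test_integrable[OF test_fun_dilate(1)[OF t that] lU])
 have "(%s. ((LI y. U y * ph (y /\<^sub>R (l + s))) - (LI y. U y * ph (y /\<^sub>R l))) / s) \<midarrow>0\<rightarrow> (LI y. ?D y)"
 proof (rule iffD2[OF tendsto_at_iff_sequentially], intro allI impI)
  fix X :: "nat => real" assume X0: "ALL i. X i : UNIV - {0}" and X: "X ---> 0"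
  have "\<forall>\<^sub>F i in sequentially. abs (X i) < l / 2"
   using X l by (intro order_tendstoD(2)[OF tendsto_rabs_zero]) auto
  then obtain N where N: "!!i. i >= N ==> abs (X i) < l / 2" by (auto simp: eventually_sequentially)
  \<comment> \<open>Dropping finitely many terms keeps \<open>l + s i\<close> between
    \<open>l / 2\<close> and \<open>2 * l\<close>; hence all quotients share one bounded support and
    one bound.\<close>
  define s where "s i = X (i + N)" for i
  have s: "s i ~= 0" "abs (s i) < l / 2" for i using X0 N by (auto simp: s_def)
  have pos: "l + s i > l / 2" "l + s i < 2 * l" for i using s(2)[of i] l by auto
  have sl: "s ---> 0" unfolding s_def by (rule LIMSEQ_ignore_initial_segment[OF X])
  define Q where "Q i y = U y * ((ph (y /\<^sub>R (l + s i)) - ph (y /\<^sub>R l)) / s i)" for i y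
  have Qe: "Q i y = (U y * ph (y /\<^sub>R (l + s i)) - U y * ph (y /\<^sub>R l)) / s i" for i y by (simp add: Q_def algebra_simps diff_divide_distrib)
  have lne: "l + s i ~= 0" for i using pos(1)[of i] l by auto
  have Qi: "li (Q i)" for i unfolding Qe[abs_def] by (intro integrable_divide Bochner_Integration.integrable_diff iU lne ne)
  have "(%i. LI y. Q i y) ---> (LI y. ?D y)"
  proof (rule integral_dominated_convergence)
   let ?K = "cball (0::R2) (2 * l * R)"
   show "li (%y. B * (2 * l * R) * (2 / l^2) * norm (indicator ?K y *r U y))"
    using lU by (intro integrable_mult_right integrable_norm) (auto simp: loc_int_def set_integrable_def)
   show "lm ?D" using weak_divergence(2)[OF w td(1)] by (intro borel_measurable_divide borel_measurable_uminus) auto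
   show "lm (Q i)" for i using Qi by (rule borel_measurable_integrable)
   show "AE y in lebesgue. norm (Q i y) <= B * (2 * l * R) * (2 / l^2) * norm (indicator ?K y *r U y)" for i
   proof (rule AE_I2)
    fix y show "norm (Q i y) <= B * (2 * l * R) * (2 / l^2) * norm (indicator ?K y *r U y)"
    proof (cases "norm y <= 2 * l * R")
     case False
     have "(l + s i) * R <= 2 * l * R" "l * R <= 2 * l * R" using pos(2)[of i] R(1) l by (auto intro!: mult_right_mono)
     then have "norm (y /\<^sub>R (l + s i)) >= R" "norm (y /\<^sub>R l) >= R" using False pos(1)[of i] l by (auto simp: field_simps)
     then show ?thesis using R(6) False by (simp add: Q_def)
    next
     case True
     have "abs (ph (y /\<^sub>R (l + s i)) - ph (y /\<^sub>R l)) <= B * norm (y /\<^sub>R (l + s i) - y /\<^sub>R l)" by (rule lip)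
     also have "y /\<^sub>R (l + s i) - y /\<^sub>R l = (- s i / (l * (l + s i))) *r y"
      using ne lne[of i] by (simp add: scaleR_diff_left[symmetric] field_simps)
     also have "norm ... = abs (s i) * (1 / (l * (l + s i)) * norm y)" using l pos(1)[of i] by (simp add: abs_mult)
     also have "... <= abs (s i) * (2 / l^2 * (2 * l * R))"
     proof (intro mult_left_mono mult_mono)
      have "l * (l / 2) <= l * (l + s i)" using l pos(1)[of i] by (intro mult_left_mono) auto
      then have "1 / (l * (l + s i)) <= 1 / (l * (l / 2))" using l pos(1)[of i] by (intro divide_left_mono) auto
      then show "1 / (l * (l + s i)) <= 2 / l^2" by (simp add: power2_eq_square)
     qed (use True l in auto)
     finally have "abs (ph (y /\<^sub>R (l + s i)) - ph (y /\<^sub>R l)) <= B * (abs (s i) * (2 / l^2 * (2 * l * R)))" using B0 by (simp add: mult_left_mono)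
     then have "abs ((ph (y /\<^sub>R (l + s i)) - ph (y /\<^sub>R l)) / s i) <= B * (2 * l * R) * (2 / l^2)"
      using s(1)[of i] by (simp add: field_simps)
     then have "abs (U y) * abs ((ph (y /\<^sub>R (l + s i)) - ph (y /\<^sub>R l)) / s i) <= abs (U y) * (B * (2 * l * R) * (2 / l^2))" by (rule mult_left_mono) simp
     then show ?thesis using True by (simp add: Q_def abs_mult mult.commute)
    qed
   qed
   show "AE y in lebesgue. (%i. Q i y) ---> ?D y"
   proof (rule AE_I2)
    fix y
    have "((%c. ph (inverse c *r y)) has_derivative (%h. cgrad ph (inverse l *r y) \<bullet> ((- (inverse l * h * inverse l)) *r y))) (at l)"
     by (rule has_derivative_compose[OF _ R(8)]) (use l in \<open>auto intro!: derivative_eq_intros\<close>)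
    then have "((%c. ph (y /\<^sub>R c)) has_real_derivative (- (cgrad (%y. ph (y /\<^sub>R l)) y \<bullet> y) / l)) (at l)"
     unfolding has_field_derivative_def td(2) by (rule has_derivative_eq_rhs) (use l in \<open>auto simp: field_simps fun_eq_iff\<close>)
    then have "(%h. (ph (y /\<^sub>R (l + h)) - ph (y /\<^sub>R l)) / h) \<midarrow>0\<rightarrow> - (cgrad (%y. ph (y /\<^sub>R l)) y \<bullet> y) / l" by (simp add: DERIV_def)
    moreover have "filterlim s (at 0) sequentially" using sl s(1) by (simp add: filterlim_at)
    ultimately have "(%i. (ph (y /\<^sub>R (l + s i)) - ph (y /\<^sub>R l)) / s i) ---> - (cgrad (%y. ph (y /\<^sub>R l)) y \<bullet> y) / l" by (rule filterlim_compose)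
    then have "(%i. Q i y) ---> U y * (- (cgrad (%y. ph (y /\<^sub>R l)) y \<bullet> y) / l)" unfolding Q_def by (rule tendsto_mult_left)
    then show "(%i. Q i y) ---> ?D y" by simp
   qed
  qed
  moreover have "(LI y. Q i y) = ((LI y. U y * ph (y /\<^sub>R (l + s i))) - (LI y. U y * ph (y /\<^sub>R l))) / s i" for i
   unfolding Qe using iU[OF lne] iU[OF ne] by simp
  ultimately have "(%i. ((LI y. U y * ph (y /\<^sub>R (l + X (i + N)))) - (LI y. U y * ph (y /\<^sub>R l))) / X (i + N)) ---> (LI y. ?D y)"
   by (simp add: s_def)
  then show "((%s. ((LI y. U y * ph (y /\<^sub>R (l + s))) - (LI y. U y * ph (y /\<^sub>R l))) / s) \<circ> X) ---> (LI y. ?D y)"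
   unfolding o_def by (rule LIMSEQ_offset)
 qed
 then show ?thesis unfolding D by (simp add: DERIV_def)
qed

lemma conv_tendsto_continuous:
 assumes U: "continuous_on UNIV (U :: R2 => real)" shows "(%k. conv (1 / real (Suc k)) U x) ---> U x"
proof (rule LIMSEQ_I)
 fix e :: real assume e: "e > 0"
 have lU: "loc_int U" using loc_int_mult_continuous[OF loc_int_1 U] by simp
 obtain d where d: "d > 0" "!!y. dist y x < d ==> dist (U y) (U x) < e / 2"
  using U e unfolding continuous_on_iff by (metis UNIV_I half_gt_zero)
 obtain N where N: "1 / real (Suc N) < d" using nat_approx_posE[OF d(1)] by blast
 have "norm (conv (1 / real (Suc k)) U x - U x) < e" if k: "k >= N" for k
 proof -
  have r: "1 / real (Suc k) > 0" by simp
  have "1 / real (Suc k) <= 1 / real (Suc N)" using k by (intro divide_left_mono) auto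
  then have rd: "1 / real (Suc k) < d" using N by linarith
  have "norm (U x - conv (1 / real (Suc k)) U x) <= e / 2"
  proof (rule norm_conv_le[OF r lU])
   fix y assume "norm (y - x) <= 1 / real (Suc k)"
   then have "dist y x < d" using rd by (simp add: dist_norm)
   from d(2)[OF this] show "norm (U x - U y) <= e / 2" by (simp add: dist_norm abs_minus_commute)
  qed
  then show ?thesis using e by (simp add: abs_minus_commute)
 qed
 then show "EX no. ALL n>=no. norm (conv (1 / real (Suc n)) U x - U x) < e" by blast
qed

text \<open>The hypothesis is an inequality almost everywhere and says nothing about a single ray.
  It is therefore integrated first: the average of \<open>U (l *r y)\<close> against a kernel around
  \<open>x\<close>, multiplied by \<open>l powr ka\<close>, has a nonnegative derivative in
  \<open>l\<close>. Letting the kernel shrink and using continuity of \<open>U\<close> gives the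
  statement at every point.\<close>

lemma ray_mono:
 assumes U: "continuous_on UNIV U" and w: "weak_grad U g" and k: "AE x in lebesgue. ka * U x + g x \<bullet> x >= 0"
  and l: "0 < l1" "l1 <= l2"
 shows "l1 powr ka * U (l1 *r x) <= l2 powr ka * U (l2 *r x)"
proof -
 have Ul: "continuous_on UNIV (%y. U (l *r y))" for l by (intro continuous_on_compose2[OF U] continuous_intros) auto
 have "l1 powr ka * conv r (%y. U (l1 *r y)) x <= l2 powr ka * conv r (%y. U (l2 *r y)) x" if r: "r > 0" for r
 proof -
  let ?ph = "%y. kern r (x - y)"
  have t: "test_fun ?ph" by (rule test_fun_kern[OF r])
  \<comment> \<open>The exponent is lowered by 2 to compensate the Jacobian of the substitution that
    moves the dilation from \<open>U\<close> to the kernel.\<close>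
  let ?M = "%l. l powr (ka - 2) * (LI y. U y * ?ph (y /\<^sub>R l))"
  have e: "?M l = l powr ka * conv r (%y. U (l *r y)) x" if l: "l > 0" for l
  proof -
   have ne: "l ~= 0" using l by simp
   have m: "lm (%y. U y * ?ph (y /\<^sub>R l))"
    by (rule borel_measurable_integrable[OF loc_int_test_integrable[OF test_fun_dilate(1)[OF t ne] weak_gradD(1)[OF w]]])
   have "conv r (%y. U (l *r y)) x = (LI y. U (0 + l *r y) * ?ph ((0 + l *r y) /\<^sub>R l))"
    unfolding conv_def using ne by (simp add: mult.commute)
   also have "... = (LI y. U y * ?ph (y /\<^sub>R l)) /\<^sub>R (l^2)" by (rule integral_affine_R2[OF ne m])
   finally show ?thesis using l by (simp add: powr_diff powr_numeral field_simps)
  qed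
  have "?M l1 <= ?M l2"
  proof (rule DERIV_nonneg_imp_nondecreasing[OF l(2)])
   fix c assume c: "l1 <= c" "c <= l2"
   then have c0: "c > 0" using l by simp
   let ?G = "LI y. U y * ?ph (y /\<^sub>R c)" and ?H = "LI y. (2 * U y + g y \<bullet> y) * ?ph (y /\<^sub>R c)"
   have ne: "c ~= 0" using c0 by simp
   note td = test_fun_dilate(1)[OF t ne]
   have d: "(?M has_real_derivative ((ka - 2) * c powr (ka - 2 - 1) * ?G + ?H / c * c powr (ka - 2))) (at c)"
    using DERIV_mult[OF has_real_derivative_powr[OF c0, of "ka - 2"] dilated_test_derivative[OF w t c0]] by simp
   have "(LI y. (ka - 2) * (U y * ?ph (y /\<^sub>R c)) + (2 * U y + g y \<bullet> y) * ?ph (y /\<^sub>R c)) = (ka - 2) * ?G + ?H"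
    using loc_int_test_integrable[OF td weak_gradD(1)[OF w]] weak_divergence(3)[OF w td] by simp
   moreover have "0 <= (LI y. (ka - 2) * (U y * ?ph (y /\<^sub>R c)) + (2 * U y + g y \<bullet> y) * ?ph (y /\<^sub>R c))"
   proof (rule integral_nonneg_AE)
    show "AE y in lebesgue. 0 <= (ka - 2) * (U y * ?ph (y /\<^sub>R c)) + (2 * U y + g y \<bullet> y) * ?ph (y /\<^sub>R c)"
     using k
    proof eventually_elim
     case (elim y)
     have "(ka - 2) * (U y * ?ph (y /\<^sub>R c)) + (2 * U y + g y \<bullet> y) * ?ph (y /\<^sub>R c) = (ka * U y + g y \<bullet> y) * ?ph (y /\<^sub>R c)"
      by (simp add: algebra_simps)
     then show ?case using elim kern_nonneg[of r] by simp
    qed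
   qed
   ultimately have "0 <= c powr (ka - 3) * ((ka - 2) * ?G + ?H)" by simp
   also have "... = (ka - 2) * c powr (ka - 2 - 1) * ?G + ?H / c * c powr (ka - 2)"
    using c0 by (simp add: powr_diff powr_numeral field_simps power3_eq_cube power2_eq_square)
   finally show "EX y. (?M has_real_derivative y) (at c) \<and> 0 <= y" using d by blast
  qed
  then show ?thesis using e[of l1] e[of l2] l by simp
 qed
 from this[of "1 / real (Suc k)" for k] show ?thesis
  by (intro LIMSEQ_le[OF tendsto_mult_left[OF conv_tendsto_continuous[OF Ul]] tendsto_mult_left[OF conv_tendsto_continuous[OF Ul]]]) auto
qed

subsection \<open>The logarithmic kernel\<close>

definition lgp :: "R2 => real" where "lgp z = ln (max 1 (norm z))"
definition lgm :: "R2 => real" where "lgm z = max 0 (- ln (norm z))"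
definition lw :: "R2 => real" where "lw x = ln (1 + norm x)"

lemma ln_norm_split: "ln (norm z) = lgp z - lgm z"
proof (cases "norm z >= 1")
 case True
 then show ?thesis by (simp add: lgp_def lgm_def max_absorb1 max_absorb2)
next
 case False then show ?thesis by (cases "z = 0") (auto simp: lgp_def lgm_def max_def)
qed

lemma lgp_nonneg: "0 <= lgp z" and lgm_nonneg: "0 <= lgm z" and lw_nonneg: "0 <= lw x"
 by (auto simp: lgp_def lgm_def lw_def)

lemma lgp_minus: "lgp (- z) = lgp z" and lgm_minus: "lgm (- z) = lgm z"
 by (auto simp: lgp_def lgm_def)

lemma lgp_le: "lgp (x - y) <= lw x + lw y"
proof -
 have "max 1 (norm (x - y)) <= (1 + norm x) * (1 + norm y)"
 proof -
  have e: "(1 + norm x) * (1 + norm y) = 1 + norm x + norm y + norm x * norm y" by (simp add: algebra_simps)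
  have n: "0 <= norm x * norm y" by simp
  show ?thesis unfolding e using n norm_triangle_ineq4[of x y] norm_ge_zero[of x] norm_ge_zero[of y]
   by (intro max.boundedI) linarith+
 qed
 then have "lgp (x - y) <= ln ((1 + norm x) * (1 + norm y))" unfolding lgp_def by (intro ln_mono) auto
 also have "... = lw x + lw y" unfolding lw_def by (rule ln_mult_pos) (auto intro: add_pos_nonneg)
 finally show ?thesis .
qed

text \<open>This bound lets the positive part of the kernel control logarithmic moments: if one
  density has mass in a fixed ball, then \<open>lw x\<close> is bounded there, and the interaction
  bounds the moment of the other density. The term \<open>ln 2\<close> comes from 1 + r <= 2 max(1,
  r).\<close>

lemma lgp_ge: "lw y - lw x - ln 2 <= lgp (x - y)"
proof -
 have "norm y <= norm x + norm (x - y)" using norm_triangle_ineq4[of x "x - y"] by simp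
 moreover have "(1 + norm x) * (1 + norm (x - y)) = 1 + norm x + norm (x - y) + norm x * norm (x - y)" by (simp add: algebra_simps)
 moreover have "0 <= norm x * norm (x - y)" by simp
 ultimately have "1 + norm y <= (1 + norm x) * (1 + norm (x - y))" by linarith
 also have "... <= (1 + norm x) * (2 * max 1 (norm (x - y)))" by (intro mult_left_mono) auto
 finally have "lw y <= ln ((1 + norm x) * (2 * max 1 (norm (x - y))))" unfolding lw_def by (intro ln_mono) (auto intro: add_pos_nonneg)
 also have "... = lw x + (ln 2 + lgp (x - y))" unfolding lw_def lgp_def
  using ln_mult_pos[of "1 + norm x" "2 * max 1 (norm (x - y))"] ln_mult_pos[of 2 "max 1 (norm (x - y))"]
  by (simp add: add_pos_nonneg max.strict_coboundedI1)
 finally show ?thesis by simp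
qed

lemma borel_lg [measurable]: "lgp : borel_measurable borel" "lgm : borel_measurable borel" "lw : borel_measurable borel"
 unfolding lgp_def lgm_def lw_def by measurable

lemma lm_borel: "f : borel_measurable borel ==> lm f"
 by (rule measurable_compose[OF borel_lebesgue_id])

text \<open>From ln s <= 3 s^(1/3) the cube is at most 27 / |z|. On the dyadic shell of radius about
  2^-j this is at most 54 * 2^j, while the disc has area of order 4^-j, so the series of dyadic
  contributions converges.\<close>

lemma lgm_cube_integrable: "li (%z. (lgm z) ^ 3)"
proof (rule integrableI_bounded)
 define c where "c = measure lebesgue (cball (0::R2) 1)"
 have em: "emeasure lebesgue (cball (0::R2) r) = ennreal (c * r^2)" if "r >= 0" for r
  using that emeasure_cball[OF that, of "0::R2"] by (simp add: c_def content_cball)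
 have pw: "ennreal ((lgm z) ^ 3) <= (\<Sum>j. ennreal (54 * 2 ^ j) * indicator (cball (0::R2) ((1/2) ^ j)) z)" for z
 proof (cases "z = 0 \<or> norm z >= 1")
  case True then show ?thesis by (auto simp: lgm_def)
 next
  case False
  then have z: "norm z > 0" "norm z < 1" by auto
  have "EX n. (1/2) ^ n < norm z" using real_arch_pow_inv[of "norm z" "1/2"] z by auto
  define N where "N = (LEAST n. (1/2::real) ^ n < norm z)"
  have N: "(1/2) ^ N < norm z" unfolding N_def by (rule LeastI_ex) fact
  have "N ~= 0" using N z by (intro notI) simp
  then obtain j where j: "N = Suc j" using not0_implies_Suc by blast
  have hi: "norm z <= (1/2) ^ j" using not_less_Least[of j "%n. (1/2::real) ^ n < norm z"] j N_def by simp
  have "lgm z = ln (1 / norm z)" using z by (simp add: lgm_def ln_div max_def)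
  also have "... <= (1 / norm z) powr (1/3) / (1/3)" using z by (intro ln_powr_bound) auto
  finally have "(lgm z) ^ 3 <= (3 * (1 / norm z) powr (1/3)) ^ 3" using lgm_nonneg by (intro power_mono) auto
  also have "... = 27 * (1 / norm z)" using z by (simp add: power_mult_distrib powr_realpow[symmetric] powr_powr)
  also have "1 / norm z <= 1 / ((1/2) ^ Suc j)" using N z j by (intro divide_left_mono) auto
  finally have "(lgm z) ^ 3 <= 54 * 2 ^ j" by (simp add: power_divide)
  then have "ennreal ((lgm z) ^ 3) <= (SUM j:{j}. ennreal (54 * 2 ^ j) * indicator (cball (0::R2) ((1/2) ^ j)) z)"
   using hi by (simp add: ennreal_leI)
  also have "... <= (\<Sum>j. ennreal (54 * 2 ^ j) * indicator (cball (0::R2) ((1/2) ^ j)) z)" by (intro sum_le_suminf) auto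
  finally show ?thesis .
 qed
 have "(\<integral>\<^sup>+z. ennreal ((lgm z) ^ 3) \<partial>lebesgue) <= (\<integral>\<^sup>+z. (\<Sum>j. ennreal (54 * 2 ^ j) * indicator (cball (0::R2) ((1/2) ^ j)) z) \<partial>lebesgue)"
  by (intro nn_integral_mono pw)
 also have "... = (\<Sum>j. \<integral>\<^sup>+z. ennreal (54 * 2 ^ j) * indicator (cball (0::R2) ((1/2) ^ j)) z \<partial>lebesgue)"
 proof (rule nn_integral_suminf)
  have [measurable]: "cball (0::R2) r : sets lebesgue" for r by simp
  show "(%z. ennreal (54 * 2 ^ j) * indicator (cball (0::R2) ((1/2) ^ j)) z) : borel_measurable lebesgue" for j by measurable
 qed
 also have "... = (\<Sum>j. ennreal (54 * c * (1/2) ^ j))"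
 proof (rule suminf_cong)
  fix j :: nat
  have "(\<integral>\<^sup>+z. ennreal (54 * 2 ^ j) * indicator (cball (0::R2) ((1/2) ^ j)) z \<partial>lebesgue) = ennreal (54 * 2 ^ j) * ennreal (c * ((1/2) ^ j)^2)"
   using em[of "(1/2) ^ j"] by (subst nn_integral_cmult_indicator) auto
  also have "... = ennreal (54 * 2 ^ j * (c * ((1/2) ^ j)^2))" by (rule ennreal_mult[symmetric]) (auto simp: c_def)
  also have "54 * 2 ^ j * (c * ((1/2) ^ j)^2) = 54 * c * (1/2) ^ j" by (simp add: power2_eq_square power_divide)
  finally show "(\<integral>\<^sup>+z. ennreal (54 * 2 ^ j) * indicator (cball (0::R2) ((1/2) ^ j)) z \<partial>lebesgue) = ennreal (54 * c * (1/2) ^ j)" .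
 qed
 also have "... = ennreal (\<Sum>j. 54 * c * (1/2) ^ j)" by (intro suminf_ennreal2 summable_mult summable_geometric) (auto simp: c_def)
 also have "... < \<infinity>" by simp
 finally show "(\<integral>\<^sup>+z. ennreal (norm ((lgm z) ^ 3)) \<partial>lebesgue) < \<infinity>" using lgm_nonneg by simp
 show "lm (%z. (lgm z) ^ 3)" by (intro borel_measurable_power lm_borel borel_lg)
qed

definition lgc :: real where "lgc = (LI z. (lgm z) ^ 3)"

lemma lgm_shift: "li (%y. (lgm (x - y)) ^ 3)" "(LI y. (lgm (x - y)) ^ 3) = lgc"
proof -
 have m: "lm (%z. (lgm z) ^ 3)" by (rule borel_measurable_integrable[OF lgm_cube_integrable])
 show "li (%y. (lgm (x - y)) ^ 3)" "(LI y. (lgm (x - y)) ^ 3) = lgc"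
  using integrable_affine_R2[OF _ m, of "- 1" x] integral_affine_R2[OF _ m, of "- 1" x] lgm_cube_integrable by (auto simp: lgc_def)
qed

text \<open>The class of densities on which the logarithmic form is absolutely convergent; products
  of two functions of E belong to it. The exponent 3/2 is dual to the power 3 in which the singular
  part \<open>lgm\<close> is integrable.\<close>

definition Dl :: "(R2 => real) => bool" where
 "Dl f \<longleftrightarrow> lm f \<and> li f \<and> li (%x. lw x * f x) \<and> li (%x. abs (f x) powr (3/2))"
definition s1 :: "(R2 => real) => real" where "s1 f = (LI x. abs (f x))"
definition sL :: "(R2 => real) => real" where "sL f = (LI x. lw x * abs (f x))"
definition sQ :: "(R2 => real) => real" where "sQ f = (LI x. abs (f x) powr (3/2)) powr (2/3)"

lemma Dl_abs: "Dl f ==> Dl (%x. abs (f x))"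
 unfolding Dl_def by (auto simp: abs_mult lw_nonneg dest: integrable_abs)

lemma powr_sum_le: "(a + b) powr (3/2) <= 3 * (a powr (3/2) + b powr (3/2))" if "a >= 0" "b >= 0" for a b :: real
proof -
 have "(a + b) powr (3/2) <= (2 * max a b) powr (3/2)" using that by (intro powr_mono2) auto
 also have "... = 2 powr (3/2) * max a b powr (3/2)" using that by (intro powr_mult)
 also have "... <= 3 * (a powr (3/2) + b powr (3/2))"
 proof (rule mult_mono)
  have "(2 powr (3/2))^2 = (8::real)" by (simp add: powr_power)
  then have "(2 powr (3/2))^2 <= (3::real)^2" by simp
  then show "2 powr (3/2) <= (3::real)" by (rule power2_le_imp_le) simp
  show "max a b powr (3/2) <= a powr (3/2) + b powr (3/2)" by (auto simp: max_def)
 qed auto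
 finally show ?thesis .
qed

lemma Dl_lincomb: assumes f: "Dl f" and g: "Dl g" shows "Dl (%x. a * f x + c * g x)"
proof -
 have m: "lm f" "lm g" using f g by (auto simp: Dl_def)
 have "li (%x. a * f x + c * g x)" using f g by (auto simp: Dl_def)
 moreover have "li (%x. a * (lw x * f x) + c * (lw x * g x))" using f g by (auto simp: Dl_def)
 then have "li (%x. lw x * (a * f x + c * g x))" by (simp add: algebra_simps)
 moreover have "li (%x. abs (a * f x + c * g x) powr (3/2))"
 proof (rule Bochner_Integration.integrable_bound)
  show "li (%x. 3 * (abs a powr (3/2) * abs (f x) powr (3/2) + abs c powr (3/2) * abs (g x) powr (3/2)))"
   using f g by (intro integrable_mult_right Bochner_Integration.integrable_add) (auto simp: Dl_def)
  have "abs (a * f x + c * g x) powr (3/2) <= 3 * (abs a powr (3/2) * abs (f x) powr (3/2) + abs c powr (3/2) * abs (g x) powr (3/2))" for x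
   using powr_mono2[OF _ _ abs_triangle_ineq[of "a * f x" "c * g x"], of "3/2"] powr_sum_le[of "abs (a * f x)" "abs (c * g x)"]
   by (simp add: abs_mult powr_mult)
  then show "AE x in lebesgue. norm (abs (a * f x + c * g x) powr (3/2)) <= norm (3 * (abs a powr (3/2) * abs (f x) powr (3/2) + abs c powr (3/2) * abs (g x) powr (3/2)))"
   by (intro AE_I2) (auto intro: order_trans[OF _ abs_ge_self])
 qed (use m in auto)
 ultimately show ?thesis using m by (auto simp: Dl_def)
qed

text \<open>Hoelder with exponents 3 and 3/2, obtained from a Young inequality with free parameter
  \<open>muu\<close>. The choice \<open>muu = Q powr (1/3)\<close> makes both terms proportional to
  \<open>Q powr (2/3)\<close>, whence the constant \<open>lgc + 1\<close>; if \<open>Q = 0\<close>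
  the parameter tends to 0 instead.\<close>

lemma lgm_potential:
 assumes f: "lm f" "li (%x. abs (f x) powr (3/2))"
 shows "li (%y. lgm (x - y) * f y)" "(LI y. lgm (x - y) * abs (f y)) <= (lgc + 1) * sQ f"
proof -
 define Q where "Q = (LI x. abs (f x) powr (3/2))"
 have Q0: "Q >= 0" by (simp add: Q_def)
 have young: "a * c <= muu^2 * a ^ 3 + c powr (3/2) / muu" if "muu > 0" "a >= 0" "c >= 0" for a c muu :: real
 proof (cases "sqrt c <= muu * a")
  case True
  then have "(sqrt c)^2 <= (muu * a)^2" using that by (intro power_mono) auto
  then have "a * c <= a * (muu * a)^2" using that by (intro mult_left_mono) auto
  then show ?thesis using that by (simp add: power2_eq_square power3_eq_cube mult_ac add_increasing2)
 next
  case False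
  then have "a * c <= sqrt c / muu * c" using that by (intro mult_right_mono) (auto simp: field_simps)
  also have "sqrt c * c = c powr (3/2)" using that powr_add[of c "1/2" 1] by (cases "c = 0") (auto simp: powr_half_sqrt)
  then have "sqrt c / muu * c = c powr (3/2) / muu" by simp
  finally show ?thesis using that by (simp add: add_increasing)
 qed
 have m: "lm (%y. lgm (x - y))"
  by (rule lm_borel) (rule measurable_compose[OF _ borel_lg(2)], simp)
 have ib: "li (%y. muu^2 * (lgm (x - y)) ^ 3 + abs (f y) powr (3/2) / muu)" for muu
  using lgm_shift(1)[of x] f by (intro bint) auto
 show i: "li (%y. lgm (x - y) * f y)"
  by (rule Bochner_Integration.integrable_bound[OF ib[of 1]])
   (use m f young[of 1] lgm_nonneg in \<open>auto simp: abs_mult intro!: AE_I2 order_trans[OF _ abs_ge_self]\<close>)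
 then have i': "li (%y. lgm (x - y) * abs (f y))" using integrable_abs[OF i] by (simp add: abs_mult lgm_nonneg)
 have le: "(LI y. lgm (x - y) * abs (f y)) <= muu^2 * lgc + Q / muu" if "muu > 0" for muu
 proof -
  have "(LI y. lgm (x - y) * abs (f y)) <= (LI y. muu^2 * (lgm (x - y)) ^ 3 + abs (f y) powr (3/2) / muu)"
   by (intro integral_mono i' ib young that lgm_nonneg) auto
  also have "... = muu^2 * lgc + Q / muu" using lgm_shift[of x] f by (simp add: Q_def)
  finally show ?thesis .
 qed
 show "(LI y. lgm (x - y) * abs (f y)) <= (lgc + 1) * sQ f"
 proof (cases "Q = 0")
  case True
  have "((%muu. muu^2 * lgc + Q / muu) \<longlongrightarrow> 0^2 * lgc + 0) (at_right 0)" unfolding True by (auto intro!: tendsto_eq_intros)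
  then have "(LI y. lgm (x - y) * abs (f y)) <= 0^2 * lgc + 0"
   by (rule tendsto_lowerbound) (auto simp: eventually_at_filter intro!: always_eventually le)
  then show ?thesis using True by (simp add: sQ_def Q_def[symmetric])
 next
  case False
  then have Qp: "Q > 0" using Q0 by simp
  have e1: "(Q powr (1/3))^2 = Q powr (2/3)" using Qp by (simp add: powr_power)
  have "Q / Q powr (1/3) = Q powr (1 - 1/3)" using Qp by (simp only: powr_diff powr_one)
  then have e2: "Q / Q powr (1/3) = Q powr (2/3)" by simp
  show ?thesis using le[of "Q powr (1/3)"] Qp unfolding e1 e2 by (simp add: sQ_def Q_def[symmetric] algebra_simps)
 qed
qed

definition Bk :: "(R2 => real) => (R2 => real) => (R2 => real) => real" where
 "Bk k f g = (\<integral>z. k (fst z - snd z) * f (fst z) * g (snd z) \<partial>(LL))"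

lemma measurable_Bk:
 fixes k f g :: "R2 => real"
 assumes "k : borel_measurable borel" "lm f" "lm g"
 shows "(%z. k (fst z - snd z) * f (fst z) * g (snd z)) : borel_measurable (LL)"
proof -
 have [measurable]: "fst : LL \<rightarrow>\<^sub>M (borel :: R2 measure)" "snd : LL \<rightarrow>\<^sub>M (borel :: R2 measure)"
  using measurable_compose[OF measurable_fst borel_lebesgue_id] measurable_compose[OF measurable_snd borel_lebesgue_id] by auto
 have a: "(%z. fst z - snd z) : LL \<rightarrow>\<^sub>M (borel :: R2 measure)" by measurable
 show ?thesis 
  by (intro borel_measurable_times measurable_compose[OF a assms(1)] measurable_compose[OF measurable_fst assms(2)] measurable_compose[OF measurable_snd assms(3)])
qed

lemma integrable_pair_prod:
 fixes f g :: "R2 => real"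
 assumes f: "li f" and g: "li g"
 shows "integrable (LL) (%z. f (fst z) * g (snd z))"
  "(\<integral>z. f (fst z) * g (snd z) \<partial>(LL)) = (LI x. f x) * (LI y. g y)"
proof -
 have m: "(%z. f (fst z) * g (snd z)) : borel_measurable (LL)"
  using f g by (intro borel_measurable_times measurable_compose[OF measurable_fst] measurable_compose[OF measurable_snd]) auto
 show i: "integrable (LL) (%z. f (fst z) * g (snd z))"
  by (rule lebp.Fubini_integrable[OF m]) (use f g in \<open>auto simp: abs_mult\<close>)
 show "(\<integral>z. f (fst z) * g (snd z) \<partial>(LL)) = (LI x. f x) * (LI y. g y)"
  using lebp.integral_fst'[OF i] by simp
qed

lemma Bk_lgp:
 assumes f: "Dl f" and g: "Dl g"
 shows "integrable (LL) (%z. lgp (fst z - snd z) * f (fst z) * g (snd z))"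
  "abs (Bk lgp f g) <= sL f * s1 g + s1 f * sL g"
proof -
 note F = Dl_abs[OF f] and G = Dl_abs[OF g]
 have d: "li (%x. abs (f x))" "li (%x. lw x * abs (f x))" "li (%x. abs (g x))" "li (%x. lw x * abs (g x))"
  using F G by (auto simp: Dl_def)
 have mm: "lm f" "lm g" using f g by (auto simp: Dl_def)
 let ?w = "%z. (lw (fst z) * abs (f (fst z))) * abs (g (snd z)) + abs (f (fst z)) * (lw (snd z) * abs (g (snd z)))"
 have iw: "integrable (LL) ?w"
  using integrable_pair_prod(1)[OF d(2,3)] integrable_pair_prod(1)[OF d(1,4)] by (rule Bochner_Integration.integrable_add)
 have le: "abs (lgp (fst z - snd z) * f (fst z) * g (snd z)) <= ?w z" for z
  using mult_right_mono[OF lgp_le[of "fst z" "snd z"], of "abs (f (fst z)) * abs (g (snd z))"] lgp_nonneg[of "fst z - snd z"]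
  by (simp add: abs_mult algebra_simps)
 show i: "integrable (LL) (%z. lgp (fst z - snd z) * f (fst z) * g (snd z))"
  by (rule Bochner_Integration.integrable_bound[OF iw measurable_Bk[OF borel_lg(1) mm]])
   (use le in \<open>auto intro!: AE_I2 order_trans[OF _ abs_ge_self]\<close>)
 have "norm (Bk lgp f g) <= (\<integral>z. ?w z \<partial>(LL))"
  unfolding Bk_def by (rule Bochner_Integration.integral_norm_bound_integral[OF i iw]) (use le in simp)
 also have "... = sL f * s1 g + s1 f * sL g"
  using integrable_pair_prod[OF d(2,3)] integrable_pair_prod[OF d(1,4)] by (simp add: sL_def s1_def)
 finally show "abs (Bk lgp f g) <= sL f * s1 g + s1 f * sL g" by simp
qed

text \<open>The estimate is asymmetric on purpose. The potential of \<open>g\<close> is bounded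
  uniformly in \<open>x\<close>, so \<open>f\<close> enters only through its mass; in the
  applications \<open>f\<close> is the factor that is small in L^2.\<close>

lemma Bk_lgm:
 assumes f: "Dl f" and g: "Dl g"
 shows "integrable (LL) (%z. lgm (fst z - snd z) * f (fst z) * g (snd z))"
  "abs (Bk lgm f g) <= (lgc + 1) * s1 f * sQ g"
proof -
 have fi: "li f" "lm f" and gi: "lm g" "li (%x. abs (g x) powr (3/2))" using f g by (auto simp: Dl_def)
 note pot = lgm_potential[OF gi]
 note m = measurable_Bk[OF borel_lg(2) fi(2) gi(1)]
 have e: "(LI y. norm (lgm (fst (x, y) - snd (x, y)) * f (fst (x, y)) * g (snd (x, y)))) = abs (f x) * (LI y. lgm (x - y) * abs (g y))" for x
  by (simp add: abs_mult lgm_nonneg mult_ac flip: integral_mult_right_zero)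
 have Pn: "0 <= (LI y. lgm (x - y) * abs (g y))" for x by (intro integral_nonneg_AE) (simp add: lgm_nonneg)
 have mn: "(%z. norm (lgm (fst z - snd z) * f (fst z) * g (snd z))) : borel_measurable (LL)" using m by auto
 have mP: "lm (%x. abs (f x) * (LI y. lgm (x - y) * abs (g y)))"
  using sigma_finite_measure.borel_measurable_lebesgue_integral[OF sigma_finite_lebesgue, of "%x y. norm (lgm (x - y) * f x * g y)" lebesgue] mn unfolding split_beta e[unfolded fst_conv snd_conv] by simp
 have iP: "li (%x. abs (f x) * (LI y. lgm (x - y) * abs (g y)))"
 proof (rule Bochner_Integration.integrable_bound[OF _ mP])
  show "li (%x. abs (f x) * ((lgc + 1) * sQ g))" using fi by simp
  show "AE x in lebesgue. norm (abs (f x) * (LI y. lgm (x - y) * abs (g y))) <= norm (abs (f x) * ((lgc + 1) * sQ g))"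
   unfolding norm_mult[of "abs (f _)"] using order_trans[OF pot(2) abs_ge_self] Pn by (intro AE_I2 mult_left_mono) auto
 qed
 show i: "integrable (LL) (%z. lgm (fst z - snd z) * f (fst z) * g (snd z))"
 proof (rule lebp.Fubini_integrable[OF m])
  show "li (%x. LI y. norm (lgm (fst (x, y) - snd (x, y)) * f (fst (x, y)) * g (snd (x, y))))" unfolding e by (rule iP)
  show "AE x in lebesgue. li (%y. lgm (fst (x, y) - snd (x, y)) * f (fst (x, y)) * g (snd (x, y)))"
   using integrable_mult_right[OF pot(1)] by (intro AE_I2) (simp add: mult_ac)
 qed
 have "abs (Bk lgm f g) <= (\<integral>z. norm (lgm (fst z - snd z) * f (fst z) * g (snd z)) \<partial>(LL))"
  unfolding Bk_def real_norm_def[symmetric] by (rule integral_norm_bound)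
 also have "... = (LI x. abs (f x) * (LI y. lgm (x - y) * abs (g y)))"
  using lebp.integral_fst'[OF integrable_norm[OF i]] unfolding e by simp
 also have "... <= (LI x. abs (f x) * ((lgc + 1) * sQ g))"
  using fi by (intro integral_mono iP mult_left_mono pot(2)) auto
 also have "... = (lgc + 1) * s1 f * sQ g" by (simp add: s1_def mult_ac)
 finally show "abs (Bk lgm f g) <= (lgc + 1) * s1 f * sQ g" .
qed

text \<open>The logarithmic form as a difference of two forms that converge absolutely on the
  product space. Bilinearity, symmetry and Fubini are available for each of them, and signs can be
  exploited separately.\<close>

definition BB :: "(R2 => real) => (R2 => real) => real" where "BB f g = Bk lgp f g - Bk lgm f g"

lemma lgc_nonneg: "0 <= lgc" unfolding lgc_def by (intro integral_nonneg_AE) (simp add: lgm_nonneg)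

lemma Bk_linear:
 assumes i: "integrable (LL) (%z. k (fst z - snd z) * f (fst z) * h (snd z))"
  "integrable (LL) (%z. k (fst z - snd z) * g (fst z) * h (snd z))"
 shows "Bk k (%x. a * f x + c * g x) h = a * Bk k f h + c * Bk k g h"
proof -
 have "Bk k (%x. a * f x + c * g x) h = (\<integral>z. a * (k (fst z - snd z) * f (fst z) * h (snd z)) + c * (k (fst z - snd z) * g (fst z) * h (snd z)) \<partial>(LL))"
  unfolding Bk_def by (simp add: algebra_simps)
 also have "... = a * Bk k f h + c * Bk k g h" unfolding Bk_def using i by simp
 finally show ?thesis .
qed

lemma Bk_sym:
 assumes k: "!!z. k (- z) = k z" "k : borel_measurable borel" and m: "lm f" "lm g" shows "Bk k f g = Bk k g f"
proof -
 have "Bk k f g = (\<integral>(x,y). (%z. k (fst z - snd z) * f (fst z) * g (snd z)) (y, x) \<partial>(LL))"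
  unfolding Bk_def by (rule lebp.integral_product_swap[symmetric]) (rule measurable_Bk[OF k(2) m])
 also have "... = Bk k g f" unfolding Bk_def split_beta using k(1)[of "fst z - snd z" for z] by (simp add: mult_ac)
 finally show ?thesis .
qed

lemma BB_sym: "Dl f ==> Dl g ==> BB f g = BB g f"
 unfolding BB_def using Bk_sym[OF lgp_minus borel_lg(1)] Bk_sym[OF lgm_minus borel_lg(2)] by (auto simp: Dl_def)

lemma BB_lin1: "Dl f ==> Dl g ==> Dl h ==> BB (%x. a * f x + c * g x) h = a * BB f h + c * BB g h"
 unfolding BB_def using Bk_linear[OF Bk_lgp(1)[of f h] Bk_lgp(1)[of g h], where a=a and c=c] Bk_linear[OF Bk_lgm(1)[of f h] Bk_lgm(1)[of g h], where a=a and c=c]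
 by (simp add: algebra_simps)

lemma BB_lin2: "Dl f ==> Dl g ==> Dl h ==> BB h (%x. a * f x + c * g x) = a * BB h f + c * BB h g"
 using BB_lin1[of f g h a c] BB_sym[OF _ Dl_lincomb, of h f g a c] BB_sym[of h f] BB_sym[of h g] by simp

lemma BB_le: "Dl f ==> Dl g ==> abs (BB f g) <= sL f * s1 g + s1 f * sL g + (lgc + 1) * s1 f * sQ g"
 unfolding BB_def using Bk_lgp(2)[of f g] Bk_lgm(2)[of f g] by linarith

text \<open>The first density may be restricted to the ball because the kernel and both densities
  are nonnegative; there \<open>lw\<close> is at most \<open>ln (1 + R)\<close>, and
  \<open>lgp_ge\<close> transfers the weight to the second density.\<close>

lemma Bk_lgp_lower:
 assumes f: "Dl f" and g: "Dl g" and pos: "!!x. f x >= 0" "!!x. g x >= 0" and R: "R >= 0"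
 shows "Bk lgp f g >= (LI x. indicator (cball 0 R) x * f x) * (sL g - (ln (1 + R) + ln 2) * s1 g)"
proof -
 let ?f = "%x. indicat_real (cball 0 R) x * f x" and ?g = "%y. lw y * g y - (ln (1 + R) + ln 2) * g y"
 have fi: "li f" using f by (simp add: Dl_def)
 have if': "li ?f"
  using integrable_mult_indicator[OF _ fi, of "cball 0 R"] by simp
 have gi: "li (%y. lw y * g y)" "li g" using g by (auto simp: Dl_def)
 then have ig: "li ?g" by (intro bint)
 have "(LI x. ?f x) * (LI y. ?g y) = (\<integral>z. ?f (fst z) * ?g (snd z) \<partial>(LL))"
  using integrable_pair_prod(2)[OF if' ig] by simp
 also have "... <= Bk lgp f g" unfolding Bk_def
 proof (rule integral_mono[OF integrable_pair_prod(1)[OF if' ig] Bk_lgp(1)[OF f g]])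
  fix z :: "R2 \<times> R2"
  show "?f (fst z) * ?g (snd z) <= lgp (fst z - snd z) * f (fst z) * g (snd z)"
  proof (cases "fst z : cball 0 R")
   case True
   then have "lw (fst z) <= ln (1 + R)" unfolding lw_def by (intro ln_mono) (auto intro: add_pos_nonneg)
   then have "lw (snd z) - (ln (1 + R) + ln 2) <= lgp (fst z - snd z)" using lgp_ge[of "snd z" "fst z"] by simp
   from mult_right_mono[OF this, of "f (fst z) * g (snd z)"] show ?thesis using True pos by (simp add: algebra_simps)
  qed (use pos lgp_nonneg in simp)
 qed
 finally have "(LI x. ?f x) * (LI y. ?g y) <= Bk lgp f g" .
 moreover have "(LI y. ?g y) = sL g - (ln (1 + R) + ln 2) * s1 g" using gi pos(2) by (simp add: sL_def s1_def)
 ultimately show ?thesis by simp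
qed

lemma iterated_log:
 assumes f: "Dl f" shows "(LI x. LI y. ln (norm (x - y)) * f x * f y) = BB f f"
proof -
 have i: "integrable (LL) (%z. lgp (fst z - snd z) * f (fst z) * f (snd z) - lgm (fst z - snd z) * f (fst z) * f (snd z))"
  by (intro Bochner_Integration.integrable_diff Bk_lgp(1) Bk_lgm(1) f)
 have "BB f f = (\<integral>z. lgp (fst z - snd z) * f (fst z) * f (snd z) - lgm (fst z - snd z) * f (fst z) * f (snd z) \<partial>(LL))"
  unfolding BB_def Bk_def by (rule Bochner_Integration.integral_diff[symmetric]) (intro Bk_lgp(1) Bk_lgm(1) f)+
 also have "... = (LI x. LI y. ln (norm (x - y)) * f x * f y)"
  using lebp.integral_fst'[OF i] by (simp add: ln_norm_split left_diff_distrib)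
 finally show ?thesis ..
qed

subsection \<open>The energy space\<close>

locale choquard =
 fixes V :: "R2 => real" and b p V0 al bee :: real and gV :: "R2 => R2"
 assumes b: "b > 0" and p: "2 < p" "p < 4" and V0: "V0 > 0" "!!x. V0 <= V x" and Vc: "continuous_on UNIV V"
  and Vfin: "!!M. M > 0 ==> emeasure lebesgue {x. V x <= M} < \<infinity>" and wV: "weak_grad V gV" and ab: "al > 0" "bee > 0"
  and gV: "AE x in lebesgue. abs (gV x \<bullet> x) <= al * V x \<and> 2 * V x + gV x \<bullet> x >= - bee"
begin

abbreviation "E == EV V"
definition W :: "R2 => real" where "W x = V x + lw x"
text \<open>An isometric embedding of E into an L^2 space of vector-valued functions. The triangle
  inequality and completeness of E are inherited through it; linearity holds only almost everywhere
  because \<open>wgrad\<close> is a choice.\<close>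

definition Phi :: "(R2 => real) => R2 => R2 \<times> real" where "Phi u x = (wgrad u x, sqrt (W x) * u x)"
definition nE :: "(R2 => real) => real" where "nE u = n2 (Phi u)"

lemma Wpos: "V0 <= W x" "0 < W x" "lw x <= W x" "V x <= W x" "0 < V x"
 using V0(1) V0(2)[of x] lw_nonneg[of x] by (auto simp: W_def)

lemma lmV: "lm V" and lmlw: "lm lw" and lmW: "lm W"
 using continuous_lebesgue_measurable[OF Vc] lm_borel[OF borel_lg(3)] unfolding W_def by auto

lemma norm_Phi: "(norm (Phi u x))^2 = (norm (wgrad u x))^2 + W x * (u x)^2"
 using Wpos(2)[of x] by (simp add: Phi_def norm_Pair power_mult_distrib)

lemma li_lower:
 assumes "li (%x. W x * (u x)^2)" "lm u" "lm k" "!!x. 0 <= k x" "!!x. k x <= c * W x"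
 shows "li (%x. k x * (u x)^2)"
proof (rule Bochner_Integration.integrable_bound[OF integrable_mult_right[OF assms(1), of c]])
 have "k x * (u x)^2 <= c * (W x * (u x)^2)" for x using mult_right_mono[OF assms(5), of "(u x)^2" x] by (simp add: mult.assoc)
 then show "AE x in lebesgue. norm (k x * (u x)^2) <= norm (c * (W x * (u x)^2))"
  using assms(4) by (intro AE_I2) (auto intro: order_trans[OF _ abs_ge_self])
qed (use assms(2,3) in auto)

lemma E_intro:
 assumes u: "lm u" "weak_grad u g" "L2 g" "li (%x. W x * (u x)^2)" shows "u : E"
proof -
 have "li (%x. 1 * (u x)^2)" using Wpos(1) V0 by (intro li_lower[OF u(4,1), of "%_. 1" "1 / V0"]) (auto simp: field_simps)
 moreover have "li (%x. V x * (u x)^2)" using Wpos lmV by (intro li_lower[OF u(4,1), of V 1]) (auto intro: less_imp_le)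
 moreover have "li (%x. lw x * (u x)^2)" using Wpos lmlw lw_nonneg by (intro li_lower[OF u(4,1), of lw 1]) auto
 ultimately show ?thesis using u L2_integrable[OF u(3)] by (auto simp: EV_def HV_def H1_def lw_def)
qed

lemma E_dest:
 assumes u: "u : E"
 shows "lm u" "weak_grad u (wgrad u)" "L2 (wgrad u)" "li (%x. W x * (u x)^2)" "li (%x. V x * (u x)^2)" "li (%x. lw x * (u x)^2)"
  "L2 u" "L2 (Phi u)" "L2 (%x. sqrt (lw x) * u x)" "L2 (%x. sqrt (V x) * u x)"
proof -
 obtain g where g: "lm u" "li (%x. (u x)^2)" "weak_grad u g" "li (%x. (norm (g x))^2)" "li (%x. V x * (u x)^2)" "li (%x. lw x * (u x)^2)"
  using u by (auto simp: EV_def HV_def H1_def lw_def)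
 show um: "lm u" and "weak_grad u (wgrad u)" "li (%x. V x * (u x)^2)" "li (%x. lw x * (u x)^2)" using g wgrad by auto
 have gm: "lm g" "lm (wgrad u)" using g(3) wgrad[OF g(3)] by (auto simp: weak_grad_def loc_int_def)
 show Lg: "L2 (wgrad u)" by (rule L2_cong_AE[of g, OF _ gm(2) wgrad_AE[OF g(3)]]) (use g gm in \<open>simp add: L2_def\<close>)
 have "li (%x. V x * (u x)^2 + lw x * (u x)^2)" using g by auto
 then show iW: "li (%x. W x * (u x)^2)" by (simp add: W_def algebra_simps)
 show "L2 u" using g by (simp add: L2_def)
 have m: "lm (Phi u)" unfolding Phi_def using gm um lmW by (intro borel_measurable_Pair borel_measurable_times borel_measurable_sqrt) auto
 show "L2 (Phi u)" unfolding L2_def norm_Phi using m L2_integrable[OF Lg] iW by auto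
 show "L2 (%x. sqrt (lw x) * u x)" "L2 (%x. sqrt (V x) * u x)"
  using g um lmlw lmV Wpos(5) by (auto simp: L2_def power_mult_distrib lw_nonneg less_imp_le)
qed

lemma nE_sq: "u : E ==> (nE u)^2 = (n2 (wgrad u))^2 + (LI x. W x * (u x)^2)"
 using E_dest(3,4)[of u] unfolding nE_def n2_sq norm_Phi by (simp add: L2_integrable)

lemma nE_nonneg [simp]: "0 <= nE u" by (simp add: nE_def)

lemma nE_bounds:
 assumes u: "u : E"
 shows "n2 (wgrad u) <= nE u" "n2 u <= nE u / sqrt V0" "n2 (%x. sqrt (lw x) * u x) <= nE u" "n2 (%x. sqrt (V x) * u x) <= nE u"
proof -
 note d = E_dest[OF u]
 have W0: "0 <= (LI x. W x * (u x)^2)" using Wpos(2) by (intro integral_nonneg_AE) (auto simp: less_imp_le)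
 show "n2 (wgrad u) <= nE u" by (rule power2_le_imp_le) (use nE_sq[OF u] W0 in auto)
 have le: "(LI x. W x * (u x)^2) <= (nE u)^2" using nE_sq[OF u] by simp
 have "(LI x. lw x * (u x)^2) <= (LI x. W x * (u x)^2)" "(LI x. V x * (u x)^2) <= (LI x. W x * (u x)^2)"
  by (intro integral_mono d mult_right_mono Wpos; simp)+
 then have "(n2 (%x. sqrt (lw x) * u x))^2 <= (nE u)^2" "(n2 (%x. sqrt (V x) * u x))^2 <= (nE u)^2"
  using le Wpos(5) by (auto simp: n2_sq power_mult_distrib lw_nonneg less_imp_le)
 then show "n2 (%x. sqrt (lw x) * u x) <= nE u" "n2 (%x. sqrt (V x) * u x) <= nE u" by (auto intro: power2_le_imp_le)
 have "V0 * (n2 u)^2 = (LI x. V0 * (u x)^2)" by (simp add: n2_sq)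
 also have "... <= (LI x. W x * (u x)^2)" using L2_integrable[OF d(7)] by (intro integral_mono d mult_right_mono Wpos) auto
 finally have "(sqrt V0 * n2 u)^2 <= (nE u)^2" using le V0 by (simp add: power_mult_distrib)
 then have "sqrt V0 * n2 u <= nE u" by (rule power2_le_imp_le) simp
 then show "n2 u <= nE u / sqrt V0" using V0 by (simp add: field_simps)
qed

lemma
 assumes u: "u : E" and v: "v : E"
 shows E_lincomb: "(%x. a * u x + c * v x) : E"
  and Phi_lincomb: "AE x in lebesgue. Phi (%x. a * u x + c * v x) x = a *r Phi u x + c *r Phi v x"
  and wgrad_lincomb: "AE x in lebesgue. wgrad (%x. a * u x + c * v x) x = a *r wgrad u x + c *r wgrad v x"
proof -
 note du = E_dest[OF u] and dv = E_dest[OF v]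
 let ?w = "%x. a * u x + c * v x"
 have wg: "weak_grad ?w (%x. a *r wgrad u x + c *r wgrad v x)" by (rule weak_grad_lincomb[OF du(2) dv(2)])
 show ae: "AE x in lebesgue. wgrad ?w x = a *r wgrad u x + c *r wgrad v x" by (rule wgrad_AE[OF wg])
 then show "AE x in lebesgue. Phi ?w x = a *r Phi u x + c *r Phi v x"
  by eventually_elim (simp add: Phi_def algebra_simps)
 show "?w : E"
 proof (rule E_intro[OF _ wg])
  show "lm ?w" using du dv by auto
  show "L2 (%x. a *r wgrad u x + c *r wgrad v x)" by (intro L2_add(1) L2_scaleR du dv)
  have sq: "L2 (%x. sqrt (W x) * f x)" if "f : E" for f
   using E_dest(1,4)[OF that] lmW Wpos(2) by (auto simp: L2_def power_mult_distrib less_imp_le)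
  have "L2 (%x. a * (sqrt (W x) * u x) + c * (sqrt (W x) * v x))" by (intro L2_add(1) L2_cmult sq u v)
  then have "L2 (%x. sqrt (W x) * ?w x)" by (simp add: algebra_simps)
  from L2_integrable[OF this] show "li (%x. W x * (?w x)^2)" using Wpos(2) by (simp add: power_mult_distrib less_imp_le)
 qed
qed

lemma nE_lincomb:
 assumes "u : E" "v : E" shows "nE (%x. a * u x + c * v x) = n2 (%x. a *r Phi u x + c *r Phi v x)"
 unfolding nE_def using E_dest(8)[OF E_lincomb[OF assms]] E_dest(8)[OF assms(1)] E_dest(8)[OF assms(2)] Phi_lincomb[OF assms]
 by (intro n2_cong_AE) auto

lemma E_cmult: "u : E ==> (%x. c * u x) : E" and E_add: "u : E ==> v : E ==> (%x. u x + v x) : E"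
 and E_diff: "u : E ==> v : E ==> (%x. u x - v x) : E"
 using E_lincomb[of u u c 0] E_lincomb[of u v 1 1] E_lincomb[of u v 1 "-1"] by auto

lemma nE_cmult: "u : E ==> nE (%x. c * u x) = abs c * nE u"
 using nE_lincomb[of u u c 0] n2_scaleR[of c "Phi u"] by (simp add: nE_def)

lemma nE_add: "u : E ==> v : E ==> nE (%x. u x + v x) <= nE u + nE v"
 using nE_lincomb[of u v 1 1] n2_triangle[of "Phi u" "Phi v"] E_dest(8) by (simp add: nE_def)

lemma nE_diff_eq: "u : E ==> v : E ==> nE (%x. u x - v x) = n2 (%x. Phi u x - Phi v x)"
 using nE_lincomb[of u v 1 "-1"] by simp

lemma nE_diff: "u : E ==> v : E ==> nE (%x. u x - v x) <= nE u + nE v"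
 using nE_diff_eq[of u v] n2_triangle_diff[of "Phi u" "Phi v"] E_dest(8) by (simp add: nE_def)

lemma nE_triangle3:
 "u : E ==> v : E ==> w : E ==> nE (%x. u x - w x) <= nE (%x. u x - v x) + nE (%x. v x - w x)"
 by (simp add: nE_diff_eq n2_triangle3 E_dest(8))

lemma nE_commute: "u : E ==> v : E ==> nE (%x. u x - v x) = nE (%x. v x - u x)"
 by (simp add: nE_diff_eq) (rule n2_commute)

lemma nE_le_add_diff: "u : E ==> v : E ==> nE u <= nE v + nE (%x. u x - v x)"
 using nE_add[of v "%x. u x - v x"] E_diff by simp

lemma E_zero: "(%x. 0) : E" and nE_zero: "nE (%x. 0) = 0"
proof -
 have "weak_grad (%x. 0) (%x. 0)" by (auto simp: weak_grad_def loc_int_def set_integrable_def)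
 then show z: "(%x. 0) : E" by (intro E_intro) auto
 show "nE (%x. 0) = 0" using nE_cmult[OF z, of 0] by simp
qed

text \<open>The images under \<open>Phi\<close> converge in L^2. Dividing the last component of the
  limit by \<open>sqrt (W x)\<close>, which is bounded below by \<open>sqrt V0\<close>, gives the
  candidate \<open>v\<close>, and closedness of the weak gradient identifies the first component as
  its gradient.\<close>

lemma E_complete:
 assumes u: "!!n. u n : E" and cau: "!!e. e > 0 ==> EX N. ALL m>=N. ALL n>=N. nE (%x. u m x - u n x) < e"
 obtains v where "v : E" "(%n. nE (%x. u n x - v x)) ---> 0"
proof -
 have P: "L2 (Phi (u n))" for n by (rule E_dest(8)[OF u])
 obtain F where F: "L2 F" "(%n. n2 (%x. Phi (u n) x - F x)) ---> 0"
  using L2_complete[of "%n. Phi (u n)", OF P] cau by (auto simp: nE_diff_eq[OF u u])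
 define g where "g x = fst (F x)" for x
 define v where "v x = snd (F x) / sqrt (W x)" for x
 have Fm: "lm F" using F by auto
 have gm: "lm g" unfolding g_def by (rule measurable_compose[OF Fm]) (intro borel_measurable_continuous_onI continuous_intros)
 have sm: "lm (%x. snd (F x))" by (rule measurable_compose[OF Fm]) (intro borel_measurable_continuous_onI continuous_intros)
 have vm: "lm v" unfolding v_def using sm lmW by auto
 have fs: "norm (fst z) <= norm z" "norm (snd z) <= norm z" for z :: "R2 \<times> real"
  using norm_fst_le[of "fst z" "snd z"] norm_snd_le[of "snd z" "fst z"] by auto
 have Lg: "L2 g" by (rule L2_bound[OF F(1) gm AE_I2]) (simp add: g_def fs)
 have Ls: "L2 (%x. snd (F x))" by (rule L2_bound[OF F(1) sm AE_I2]) (rule fs)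
 have sW: "sqrt (W x) > 0" "sqrt (W x) >= sqrt V0" for x using Wpos[of x] by auto
 have vW: "sqrt (W x) * v x = snd (F x)" for x using sW[of x] by (simp add: v_def)
 have bd: "abs f <= abs (sqrt (W x) * f) / sqrt V0" for f x
  using mult_right_mono[OF sW(2)[of x], of "abs f"] V0 sW(1)[of x] by (simp add: abs_mult field_simps)
 have Lv: "L2 v"
 proof (rule L2_bound[OF L2_cmult[OF Ls, of "1 / sqrt V0"] vm AE_I2])
  show "norm (v x) <= norm (1 / sqrt V0 * snd (F x))" for x using bd[of "v x" x] V0 unfolding vW by (simp add: abs_mult)
 qed
 have c1: "(%n. n2 (%x. wgrad (u n) x - g x)) ---> 0"
 proof (rule Lim_null_comparison[OF always_eventually F(2)], rule allI)
  fix n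
  have "norm (wgrad (u n) x - g x) <= norm (Phi (u n) x - F x)" for x
   using fs(1)[of "Phi (u n) x - F x"] by (simp only: fst_diff) (simp add: Phi_def g_def)
  then show "norm (n2 (%x. wgrad (u n) x - g x)) <= n2 (%x. Phi (u n) x - F x)"
   using n2_mono[OF L2_diff[OF P F(1)], of "%x. wgrad (u n) x - g x" n] L2_diff[OF E_dest(3)[OF u] Lg] by auto
 qed
 have c2: "(%n. n2 (%x. u n x - v x)) ---> 0"
 proof (rule Lim_null_comparison[OF always_eventually], rule allI)
  fix n
  have "norm (u n x - v x) <= norm ((1 / sqrt V0) *r (Phi (u n) x - F x))" for x
  proof -
   have "abs (u n x - v x) <= abs (sqrt (W x) * (u n x - v x)) / sqrt V0" by (rule bd)
   also have "sqrt (W x) * (u n x - v x) = snd (Phi (u n) x - F x)" by (simp add: right_diff_distrib vW Phi_def)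
   also have "abs (snd (Phi (u n) x - F x)) / sqrt V0 <= norm (Phi (u n) x - F x) / sqrt V0"
    using fs(2)[of "Phi (u n) x - F x"] V0 by (intro divide_right_mono) auto
   finally show ?thesis using V0 by (simp add: divide_right_mono)
  qed
  then have "n2 (%x. u n x - v x) <= n2 (%x. (1 / sqrt V0) *r (Phi (u n) x - F x))"
   using L2_diff[OF E_dest(7)[OF u] Lv] by (intro n2_mono[OF L2_scaleR[OF L2_diff[OF P F(1)]]]) auto
  then show "norm (n2 (%x. u n x - v x)) <= 1 / sqrt V0 * n2 (%x. Phi (u n) x - F x)"
   using V0 unfolding n2_scaleR by simp
 next
  show "(%n. 1 / sqrt V0 * n2 (%x. Phi (u n) x - F x)) ---> 0" using tendsto_mult_left[OF F(2), of "1 / sqrt V0"] by simp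
 qed
 have wg: "weak_grad v g" by (rule weak_grad_closed[OF E_dest(2)[OF u] E_dest(7)[OF u] E_dest(3)[OF u] Lv Lg c2 c1])
 have "v : E"
 proof (rule E_intro[OF vm wg Lg])
  have "(%x. W x * (v x)^2) = (%x. (norm (snd (F x)))^2)"
   using Wpos(2) by (auto simp: vW[symmetric] power_mult_distrib less_imp_le)
  then show "li (%x. W x * (v x)^2)" using L2_integrable[OF Ls] by simp
 qed
 moreover have "nE (%x. u n x - v x) = n2 (%x. Phi (u n) x - F x)" for n
 proof -
  have "AE x in lebesgue. Phi (u n) x - Phi v x = Phi (u n) x - F x"
   using wgrad_AE[OF wg] by eventually_elim (simp add: Phi_def g_def vW prod_eq_iff)
  then show ?thesis unfolding nE_diff_eq[OF u \<open>v : E\<close>] using L2_diff[OF P E_dest(8)[OF \<open>v : E\<close>]] L2_diff[OF P F(1)] by (intro n2_cong_AE) auto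
 qed
 ultimately show ?thesis using that F(2) by simp
qed

subsection \<open>The terms of the functional\<close>

text \<open>Taking the free height in the Gagliardo-Nirenberg inequality equal to a bound
  \<open>N\<close> of the gradient norm makes its two terms comparable.\<close>

lemma Lp_bound:
 assumes "2 < q" "q < 4"
 obtains C where "C > 0" "!!u N. u : E ==> N > 0 ==> n2 (wgrad u) <= N ==> li (%x. abs (u x) powr q) \<and> (LI x. abs (u x) powr q) <= C * (n2 u)^2 * N powr (q - 2)"
proof (rule Gagliardo_Nirenberg[OF assms], goal_cases)
 case (1 C)
 note C = 1(2-)
 show ?thesis
 proof (rule that[of "2 * C"])
  show "2 * C > 0" using C by simp
  fix u N assume u: "u : E" and N: "N > 0" "n2 (wgrad u) <= N"
  note c = C(2)[OF E_dest(7,2,3)[OF u] N(1)]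
  have "N powr (q - 4) * (n2 (wgrad u))^2 <= N powr (q - 4) * N^2" using N by (intro mult_left_mono power_mono) auto
  also have "... = N powr (q - 2)" using N powr_add[of N "q - 4" 2] by (simp add: powr_numeral)
  finally have "C * (n2 u)^2 * (N powr (q - 2) + N powr (q - 4) * (n2 (wgrad u))^2) <= C * (n2 u)^2 * (2 * N powr (q - 2))"
   using C(1) by (intro mult_left_mono) auto
  then show "li (%x. abs (u x) powr q) \<and> (LI x. abs (u x) powr q) <= 2 * C * (n2 u)^2 * N powr (q - 2)" using c by auto
 qed
qed

definition l3 :: "(R2 => real) => real" where "l3 u = (LI x. abs (u x) powr 3) powr (1/3)"

lemma Lq_integrable: assumes "2 < q" "q < 4" "u : E" shows "li (%x. abs (u x) powr q)"
proof -
 obtain C where "C > 0" "!!u N. u : E ==> N > 0 ==> n2 (wgrad u) <= N ==> li (%x. abs (u x) powr q) \<and> (LI x. abs (u x) powr q) <= C * (n2 u)^2 * N powr (q - 2)"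
  by (rule Lp_bound[OF assms(1,2)]) (rule that)
 from this(2)[OF assms(3), of "n2 (wgrad u) + 1"] show ?thesis by (simp add: add_nonneg_pos)
qed

lemmas Lp_integrable = Lq_integrable[OF p] and L3_integrable = Lq_integrable[of 3, simplified]

text \<open>Each of the three seminorms of a product splits by Cauchy-Schwarz: applied to the
  functions themselves, to the functions weighted by \<open>sqrt (lw x)\<close>, and to their
  absolute values raised to the power 3/2.\<close>

lemma Dl_mult:
 assumes u: "u : E" and v: "v : E"
 shows "Dl (%x. u x * v x)" "s1 (%x. u x * v x) <= n2 u * n2 v"
  "sL (%x. u x * v x) <= n2 (%x. sqrt (lw x) * u x) * n2 (%x. sqrt (lw x) * v x)" "sQ (%x. u x * v x) <= l3 u * l3 v"
proof -
 note du = E_dest[OF u] and dv = E_dest[OF v]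
 have q: "L2 (%x. abs (f x) powr (3/2))" "(n2 (%x. abs (f x) powr (3/2)))^2 = (LI x. abs (f x) powr 3)" if "f : E" for f
 proof -
  have e: "(a powr (3/2))^2 = a powr 3" if "a >= 0" for a :: real
   using that by (simp only: power2_eq_square powr_add[symmetric]) simp
  show "L2 (%x. abs (f x) powr (3/2))" "(n2 (%x. abs (f x) powr (3/2)))^2 = (LI x. abs (f x) powr 3)"
   using E_dest(1)[OF that] L3_integrable[OF that] unfolding L2_def n2_sq by (auto simp: e)
 qed
 have i1: "li (%x. u x * v x)" by (rule L2_mult_integrable[OF du(7) dv(7)])
 have e: "(sqrt (lw x) * u x) * (sqrt (lw x) * v x) = lw x * (u x * v x)" for x
 proof -
  have "(s * a) * (s * c) = (s * s) * (a * c)" for s a c :: real by (simp add: mult_ac)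
  then have "(sqrt (lw x) * u x) * (sqrt (lw x) * v x) = (sqrt (lw x) * sqrt (lw x)) * (u x * v x)" .
  then show ?thesis by (simp add: lw_nonneg)
 qed
 have i2: "li (%x. lw x * (u x * v x))" using L2_mult_integrable[OF du(9) dv(9)] unfolding e .
 have e3: "abs (u x * v x) powr (3/2) = abs (u x) powr (3/2) * abs (v x) powr (3/2)" for x by (simp add: abs_mult powr_mult)
 have i3: "li (%x. abs (u x * v x) powr (3/2))" using L2_mult_integrable[OF q(1)[OF u] q(1)[OF v]] unfolding e3 .
 show "Dl (%x. u x * v x)" using i1 i2 i3 du dv by (auto simp: Dl_def)
 show "s1 (%x. u x * v x) <= n2 u * n2 v" unfolding s1_def by (rule L2_abs_mult_le[OF du(7) dv(7)])
 show "sL (%x. u x * v x) <= n2 (%x. sqrt (lw x) * u x) * n2 (%x. sqrt (lw x) * v x)"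
  using L2_abs_mult_le[OF du(9) dv(9)] unfolding sL_def e by (simp add: abs_mult lw_nonneg)
 have "(LI x. abs (u x * v x) powr (3/2)) <= n2 (%x. abs (u x) powr (3/2)) * n2 (%x. abs (v x) powr (3/2))"
  using L2_abs_mult_le[OF q(1)[OF u] q(1)[OF v]] unfolding e3 by simp
 then have "sQ (%x. u x * v x) <= (n2 (%x. abs (u x) powr (3/2)) * n2 (%x. abs (v x) powr (3/2))) powr (2/3)"
  unfolding sQ_def by (intro powr_mono2) auto
 also have "... = l3 u * l3 v"
 proof -
  have "a powr (2/3) = (a^2) powr (1/3)" if "a >= 0" for a :: real using that by (cases "a = 0") (auto simp: powr_powr powr_numeral[symmetric] simp del: powr_numeral)
  then show ?thesis unfolding l3_def q(2)[OF u, symmetric] q(2)[OF v, symmetric] by (simp add: powr_mult)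
 qed
 finally show "sQ (%x. u x * v x) <= l3 u * l3 v" .
qed

lemma Dl_sq: "u : E ==> Dl (%x. (u x)^2)" using Dl_mult(1)[of u u] by (simp add: power2_eq_square)

lemma Lp_nE:
 obtains C where "C > 0" "!!u t. u : E ==> nE u <= t ==> (LI x. abs (u x) powr p) <= C * t powr p"
  "!!u t. u : E ==> nE u <= t ==> l3 u <= C * t" "!!u t. u : E ==> nE u <= t ==> n2 u <= C * t"
proof -
 have aux: "EX C>0. ALL u t. u : E --> nE u <= t --> (LI x. abs (u x) powr q) <= C * t powr q" if q: "2 < q" "q < 4" for q
 proof -
  obtain C where C: "C > 0" "!!u N. u : E ==> N > 0 ==> n2 (wgrad u) <= N ==> li (%x. abs (u x) powr q) \<and> (LI x. abs (u x) powr q) <= C * (n2 u)^2 * N powr (q - 2)"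
   by (rule Lp_bound[OF q]) (rule that)
  have "(LI x. abs (u x) powr q) <= C / V0 * t powr q" if u: "u : E" "nE u <= t" for u t
  proof (cases "t = 0")
   case True
   then have "nE u = 0" using u(2) nE_nonneg[of u] by linarith
   then have "n2 u = 0" "n2 (wgrad u) <= 1" using nE_bounds(1,2)[OF u(1)] n2_nonneg[of u] by auto
   then have "(LI x. abs (u x) powr q) <= 0" using C(2)[OF u(1), of 1] by auto
   then show ?thesis using True by simp
  next
   case False
   then have t: "t > 0" using u(2) nE_nonneg[of u] by linarith
   have "(LI x. abs (u x) powr q) <= C * (n2 u)^2 * t powr (q - 2)" using C(2)[OF u(1) t] nE_bounds(1)[OF u(1)] u(2) by auto
   also have "... <= C * (t / sqrt V0)^2 * t powr (q - 2)"
    using C(1) nE_bounds(2)[OF u(1)] divide_right_mono[OF u(2), of "sqrt V0"] V0 by (intro mult_right_mono mult_left_mono power_mono) auto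
   also have "... = C / V0 * t powr q" using t V0 by (simp add: power_divide powr_diff powr_numeral field_simps)
   finally show ?thesis .
  qed
  then show ?thesis using C V0 by (intro exI[of _ "C / V0"]) auto
 qed
 obtain C1 where C1: "C1 > 0" "!!u t. u : E ==> nE u <= t ==> (LI x. abs (u x) powr p) <= C1 * t powr p" using aux[OF p] by blast
 obtain C3 where C3: "C3 > 0" "!!u t. u : E ==> nE u <= t ==> (LI x. abs (u x) powr 3) <= C3 * t powr 3" using aux[of 3] by auto
 define C where "C = C1 + C3 powr (1/3) + 1 / sqrt V0"
 show ?thesis
 proof (rule that[of C])
  show Cp: "C > 0" using C1 C3 V0 unfolding C_def by (intro add_pos_nonneg) auto
  fix u t assume u: "u : E" "nE u <= t"
  have t: "t >= 0" using u(2) nE_nonneg[of u] by linarith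
  have "C1 <= C" "C3 powr (1/3) <= C" "1 / sqrt V0 <= C" using C1 C3 V0 by (auto simp: C_def)
  note Cs = this
  show "(LI x. abs (u x) powr p) <= C * t powr p" using C1(2)[OF u] Cs(1) by (meson mult_right_mono order_trans powr_ge_zero)
  have "l3 u <= (C3 * t powr 3) powr (1/3)" unfolding l3_def by (intro powr_mono2 C3(2)[OF u]) auto
  also have "... = C3 powr (1/3) * t" using t C3 by (cases "t = 0") (simp_all add: powr_mult powr_powr del: powr_numeral)
  finally show "l3 u <= C * t" using mult_right_mono[OF Cs(2) t] by linarith
  have "n2 u <= 1 / sqrt V0 * t" using nE_bounds(2)[OF u(1)] u(2) V0 by (simp add: field_simps)
  then show "n2 u <= C * t" using mult_right_mono[OF Cs(3) t] by linarith
 qed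
qed

lemma BB_nE:
 obtains C where "C > 0" "!!u v w z a1 a2 a3 a4. u : E ==> v : E ==> w : E ==> z : E ==> nE u <= a1 ==> nE v <= a2 ==> nE w <= a3 ==> nE z <= a4 ==>
  abs (BB (%x. u x * v x) (%x. w x * z x)) <= C * (a1 * a2 * a3 * a4)"
proof (rule Lp_nE, goal_cases)
 case (1 C)
 note C = 1(2-)
 have l3n: "l3 u >= 0" for u by (simp add: l3_def)
 show ?thesis
 proof (rule that[of "2 * C^2 + (lgc + 1) * C ^ 4"])
  show "2 * C^2 + (lgc + 1) * C ^ 4 > 0" using C lgc_nonneg by (intro add_pos_nonneg) auto
  fix u v w z a1 a2 a3 a4
  assume E: "u : E" "v : E" "w : E" "z : E" and n: "nE u <= a1" "nE v <= a2" "nE w <= a3" "nE z <= a4"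
  have a: "a1 >= 0" "a2 >= 0" "a3 >= 0" "a4 >= 0" using n nE_nonneg order_trans by blast+
  let ?f = "%x. u x * v x" and ?g = "%x. w x * z x"
  have pm: "x * y <= (C * s) * (C * t)" if "x <= C * s" "y <= C * t" "0 <= x" "0 <= y" "0 <= s" "0 <= t" for x y s t :: real
   using that C by (intro mult_mono) auto
  have f1: "s1 ?f <= (C * a1) * (C * a2)" "s1 ?g <= (C * a3) * (C * a4)"
   using order_trans[OF Dl_mult(2) pm] E n a C(4) by auto
  have fL: "sL ?f <= a1 * a2" "sL ?g <= a3 * a4"
   by (rule order_trans[OF Dl_mult(3)[OF E(1,2)] mult_mono[OF order_trans[OF nE_bounds(3)[OF E(1)] n(1)] order_trans[OF nE_bounds(3)[OF E(2)] n(2)] a(1) n2_nonneg]],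
    rule order_trans[OF Dl_mult(3)[OF E(3,4)] mult_mono[OF order_trans[OF nE_bounds(3)[OF E(3)] n(3)] order_trans[OF nE_bounds(3)[OF E(4)] n(4)] a(3) n2_nonneg]])
  have fQ: "sQ ?g <= (C * a3) * (C * a4)" using order_trans[OF Dl_mult(4) pm] E n a C(3) l3n by auto
  have nn: "0 <= s1 ?f" "0 <= s1 ?g" "0 <= sL ?f" "0 <= sL ?g" "0 <= sQ ?g"
   unfolding s1_def sL_def sQ_def by (auto intro!: integral_nonneg_AE simp: lw_nonneg)
  have "abs (BB ?f ?g) <= sL ?f * s1 ?g + s1 ?f * sL ?g + (lgc + 1) * s1 ?f * sQ ?g" by (intro BB_le Dl_mult(1) E)
  also have "... <= (a1 * a2) * ((C * a3) * (C * a4)) + ((C * a1) * (C * a2)) * (a3 * a4) + (lgc + 1) * ((C * a1) * (C * a2)) * ((C * a3) * (C * a4))"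
   using nn f1 fL fQ a C(1) lgc_nonneg by (intro add_mono mult_mono) auto
  also have "... = (2 * C^2 + (lgc + 1) * C ^ 4) * (a1 * a2 * a3 * a4)" by (simp add: power2_eq_square eval_nat_numeral algebra_simps)
  finally show "abs (BB ?f ?g) <= (2 * C^2 + (lgc + 1) * C ^ 4) * (a1 * a2 * a3 * a4)" .
 qed
qed

lemma N0_eq: "u : E ==> N0 u = BB (%x. (u x)^2) (%x. (u x)^2) / (2 * pi)"
 unfolding N0_def using iterated_log[OF Dl_sq] by simp

end

subsection \<open>Taylor expansion of the functional\<close>

lemma abs_powr_sq: "abs t powr q = (t^2) powr (q / 2)" for t :: real
proof (cases "t = 0")
 case False
 have "(t^2) powr (q / 2) = (abs t powr 2) powr (q / 2)" using False by (simp add: powr_numeral)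
 then show ?thesis by (simp only: powr_powr) simp
qed simp

lemma abs_powr_deriv_nz:
 assumes t: "t ~= (0::real)" shows "((%t. abs t powr q) has_real_derivative q * abs t powr (q - 2) * t) (at t)"
proof -
 have "((%t::real. (t^2) powr (q / 2)) has_real_derivative (q / 2) * (t^2) powr (q / 2 - of_nat 1) * (2 * t)) (at t)"
  by (rule DERIV_fun_powr) (use t in \<open>auto intro!: derivative_eq_intros\<close>)
 moreover have "(t^2) powr (q / 2 - 1) = abs t powr (q - 2)" unfolding abs_powr_sq by (simp add: diff_divide_distrib)
 ultimately show ?thesis unfolding abs_powr_sq[of _ q] by (simp add: mult_ac)
qed

lemma abs_powr_tendsto_0: "r > 0 ==> ((%h::real. abs h powr r) \<longlongrightarrow> 0) (at 0)"
 by (rule tendsto_zero_powrI[OF _ tendsto_const]) (auto intro!: tendsto_eq_intros)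

lemma abs_powr_deriv:
 assumes q: "q > 1" shows "((%t. abs t powr q) has_real_derivative q * abs t powr (q - 2) * t) (at (t::real))"
proof (cases "t = 0")
 case True
 have "((%h. (abs (0 + h) powr q - abs 0 powr q) / h) \<longlongrightarrow> 0) (at (0::real))"
 proof (rule Lim_null_comparison[OF _ abs_powr_tendsto_0[of "q - 1"]])
  have "norm ((abs (0 + h) powr q - abs 0 powr q) / h) <= abs h powr (q - 1)" for h :: real
   by (cases "h = 0") (auto simp: powr_diff abs_divide)
  then show "\<forall>\<^sub>F h in at 0. norm ((abs (0 + h) powr q - abs 0 powr q) / h) <= abs (h::real) powr (q - 1)" by (rule always_eventually[OF allI])
 qed (use q in simp)
 then show ?thesis unfolding DERIV_def True by simp
qed (rule abs_powr_deriv_nz)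

lemma signed_powr_deriv:
 assumes r: "r > 0" shows "((%t. abs t powr r * t) has_real_derivative (r + 1) * abs t powr r) (at (t::real))"
proof (cases "t = 0")
 case True
 have "((%h. (abs (0 + h) powr r * (0 + h) - abs 0 powr r * 0) / h) \<longlongrightarrow> 0) (at (0::real))"
 proof (rule Lim_null_comparison[OF _ abs_powr_tendsto_0[OF r]])
  have "norm ((abs (0 + h) powr r * (0 + h) - abs 0 powr r * 0) / h) <= abs h powr r" for h :: real by (cases "h = 0") auto
  then show "\<forall>\<^sub>F h in at 0. norm ((abs (0 + h) powr r * (0 + h) - abs 0 powr r * 0) / h) <= abs (h::real) powr r" by (rule always_eventually[OF allI])
 qed
 then show ?thesis unfolding DERIV_def True by simp
next
 case False
 have "((%t. abs t powr r * t) has_real_derivative (r * abs t powr (r - 2) * t) * t + 1 * abs t powr r) (at t)"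
  by (rule DERIV_mult[OF abs_powr_deriv_nz[OF False] DERIV_ident])
 moreover have "abs t powr (r - 2) * t * t = abs t powr r"
  using False by (simp add: powr_diff powr_numeral power2_eq_square abs_mult_self_eq)
 ultimately show ?thesis by (simp add: algebra_simps)
qed

text \<open>The mean value theorem is applied twice, to |t|^p between \<open>a\<close> and
  \<open>a + h\<close> and to its derivative between \<open>a\<close> and the intermediate point.
  The derivative is again differentiable because \<open>p > 2\<close>. The factor 4 bounds 2^(p -
  2).\<close>

lemma powr_remainder:
 fixes a h :: real assumes p: "2 < p" "p < 4"
 shows "\<bar>\<bar>a + h\<bar> powr p - \<bar>a\<bar> powr p - p * (\<bar>a\<bar> powr (p - 2) * a * h)\<bar> <= 4 * p * (p - 1) * (\<bar>a\<bar> powr (p - 2) * h^2 + \<bar>h\<bar> powr p)"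
proof -
 let ?r = "p - 2"
 have lin: "((%s. a + s * k) has_real_derivative k) (at s)" for s k :: real by (auto intro!: derivative_eq_intros)
 have p1: "1 < p" using p by simp
 have "EX z. 0 < z \<and> z < 1 \<and> abs (a + 1 * h) powr p - abs (a + 0 * h) powr p = (1 - 0) * ((p * abs (a + z * h) powr ?r * (a + z * h)) * h)"
  by (rule MVT2) (auto intro!: DERIV_chain'[OF lin abs_powr_deriv] simp: p1)
 then obtain z where z: "0 < z" "z < 1" and 1: "abs (a + h) powr p - abs a powr p = p * (abs (a + z * h) powr ?r * (a + z * h)) * h" by (auto simp: mult_ac)
 have "EX y. 0 < y \<and> y < 1 \<and> abs (a + 1 * (z * h)) powr ?r * (a + 1 * (z * h)) - abs (a + 0 * (z * h)) powr ?r * (a + 0 * (z * h)) = (1 - 0) * (((?r + 1) * abs (a + y * (z * h)) powr ?r) * (z * h))"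
  by (rule MVT2) (simp, rule DERIV_chain'[OF lin signed_powr_deriv], use p in simp)
 then obtain y where y: "0 < y" "y < 1" and 2: "abs (a + z * h) powr ?r * (a + z * h) - abs a powr ?r * a = (p - 1) * abs (a + y * (z * h)) powr ?r * (z * h)" by auto
 have yz: "abs (a + y * (z * h)) <= abs a + abs h"
 proof -
  have "y * z <= 1 * 1" using y z by (intro mult_mono) auto
  then have "y * z * abs h <= 1 * abs h" by (intro mult_right_mono) auto
  then have "abs (y * (z * h)) <= abs h" using y z by (simp add: abs_mult mult.assoc)
  then show ?thesis using abs_triangle_ineq[of a "y * (z * h)"] by linarith
 qed
 have m4: "(abs a + abs h) powr ?r <= 4 * (abs a powr ?r + abs h powr ?r)"
 proof -
  have "(abs a + abs h) powr ?r <= (2 * max (abs a) (abs h)) powr ?r" using p by (intro powr_mono2) auto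
  also have "... = 2 powr ?r * max (abs a) (abs h) powr ?r" by (rule powr_mult)
  also have "... <= 4 * (abs a powr ?r + abs h powr ?r)"
  proof (rule mult_mono)
   have "2 powr ?r <= 2 powr 2" using p by (intro powr_mono) auto
   then show "2 powr ?r <= 4" by simp
  qed (auto simp: max_def)
  finally show ?thesis .
 qed
 have "abs (a + h) powr p - abs a powr p - p * (abs a powr ?r * a * h) = p * h * (abs (a + z * h) powr ?r * (a + z * h) - abs a powr ?r * a)"
  unfolding 1 by (simp add: algebra_simps)
 also have "... = (p * (p - 1) * z * abs (a + y * (z * h)) powr ?r) * h^2" unfolding 2 by (simp add: power2_eq_square)
 finally have "\<bar>\<bar>a + h\<bar> powr p - \<bar>a\<bar> powr p - p * (\<bar>a\<bar> powr ?r * a * h)\<bar> = (p * (p - 1) * z * \<bar>a + y * (z * h)\<bar> powr ?r) * h^2"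
  using p z by simp
 also have "... <= (p * (p - 1) * 1 * (4 * (abs a powr ?r + abs h powr ?r))) * h^2"
  using p z order_trans[OF powr_mono2[OF _ _ yz, of ?r] m4] by (intro mult_right_mono mult_mono) auto
 also have "... = 4 * p * (p - 1) * (abs a powr ?r * h^2 + abs h powr ?r * h^2)" by (simp add: algebra_simps)
 also have "abs h powr ?r * h^2 = abs h powr p" by (cases "h = 0") (auto simp: powr_diff powr_numeral)
 finally show ?thesis .
qed

text \<open>Proved by comparing \<open>c\<close> with \<open>e * a\<close>. The parameter shifts the
  cost between the two functions: it makes the coefficient of the fixed function small and charges
  the increment, whose power \<open>p\<close> is of higher order.\<close>

lemma young_powr:
 fixes a c e :: real assumes "0 <= a" "0 <= c" "0 < e" "2 < p"
 shows "a powr (p - 2) * c^2 <= e^2 * a powr p + e powr (2 - p) * c powr p"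
proof -
 have pw: "s powr (p - 2) * s^2 = s powr p" if "s >= 0" for s :: real using that by (cases "s = 0") (auto simp: powr_diff powr_numeral)
 show ?thesis
 proof (cases "c <= e * a")
  case True
  have "a powr (p - 2) * c^2 <= a powr (p - 2) * (e * a)^2" using True assms by (intro mult_left_mono power_mono) auto
  also have "... = e^2 * (a powr (p - 2) * a^2)" by (simp add: power_mult_distrib)
  finally show ?thesis using assms by (simp add: pw add_increasing2)
 next
  case False
  have "a powr (p - 2) * c^2 <= (c / e) powr (p - 2) * c^2" using False assms by (intro mult_right_mono powr_mono2) (auto simp: field_simps)
  also have "... = e powr (2 - p) * (c powr (p - 2) * c^2)" using assms by (simp add: powr_divide powr_diff field_simps)
  finally show ?thesis using assms by (simp add: pw add_increasing)
 qed
qed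

lemma young_powr1: "a powr (p - 1) * c <= a powr p + c powr p" if "0 <= a" "0 <= c" "2 < p" for a c p :: real
proof -
 have pw: "s powr (p - 1) * s = s powr p" if "s >= 0" for s :: real using that by (cases "s = 0") (auto simp: powr_diff)
 show ?thesis
 proof (cases "a <= c")
  case True
  then have "a powr (p - 1) * c <= c powr (p - 1) * c" using that by (intro mult_right_mono powr_mono2) auto
  then show ?thesis using that by (simp add: pw add_increasing)
 next
  case False
  then have "a powr (p - 1) * c <= a powr (p - 1) * a" using that by (intro mult_left_mono) auto
  then show ?thesis using that by (simp add: pw add_increasing2)
 qed
qed

context choquard
begin

abbreviation "II == Ifun V b p"
definition Lq :: "(R2 => real) => real" where "Lq u = Lp_pow p u"
definition qV :: "(R2 => real) => (R2 => real) => real" where "qV u w = (LI x. wgrad u x \<bullet> wgrad w x + V x * (u x * w x))"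
definition B4 :: "(R2 => real) => (R2 => real) => (R2 => real) => real" where "B4 u v w = BB (%x. (u x)^2) (%x. v x * w x)"
definition Ap :: "(R2 => real) => (R2 => real) => real" where "Ap u w = (LI x. abs (u x) powr (p - 2) * u x * w x)"
definition dI :: "(R2 => real) => (R2 => real) => real" where "dI u w = qV u w + B4 u u w / (2 * pi) - b * Ap u w"

lemma Lq_eq: "Lq u = (LI x. abs (u x) powr p)" by (simp add: Lq_def Lp_pow_def)

lemma Lq_nonneg: "0 <= Lq u" by (simp add: Lq_eq)

lemma normV_sq_eq: "normV_sq V u = qV u u"
 by (simp add: normV_sq_def qV_def power2_norm_eq_inner power2_eq_square[of "u _"])

lemma VV_integrable: "u : E ==> w : E ==> li (%x. V x * (u x * w x))"
proof -
 assume u: "u : E" and w: "w : E"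
 have "(s * a) * (s * c) = (s * s) * (a * c)" for s a c :: real by (simp add: mult_ac)
 then have e: "(sqrt (V x) * u x) * (sqrt (V x) * w x) = V x * (u x * w x)" for x using Wpos(5)[of x] by (simp add: less_imp_le)
 show ?thesis using L2_mult_integrable[OF E_dest(10)[OF u] E_dest(10)[OF w]] unfolding e .
qed

lemma qV_integrable: "u : E ==> w : E ==> li (%x. wgrad u x \<bullet> wgrad w x + V x * (u x * w x))"
 by (intro bint L2_inner_integrable E_dest(3) VV_integrable)

lemma qV_sym: "qV u w = qV w u" by (simp add: qV_def inner_commute mult.commute)

lemma qV_lin:
 assumes u: "u : E" and v: "v : E" and w: "w : E"
 shows "qV u (%x. a * v x + c * w x) = a * qV u v + c * qV u w"
proof -
 let ?z = "%x. a * v x + c * w x"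
 have z: "?z : E" by (rule E_lincomb[OF v w])
 have "qV u ?z = (LI x. a * (wgrad u x \<bullet> wgrad v x + V x * (u x * v x)) + c * (wgrad u x \<bullet> wgrad w x + V x * (u x * w x)))"
  unfolding qV_def
 proof (rule integral_cong_AE)
  show "AE x in lebesgue. wgrad u x \<bullet> wgrad ?z x + V x * (u x * ?z x) = a * (wgrad u x \<bullet> wgrad v x + V x * (u x * v x)) + c * (wgrad u x \<bullet> wgrad w x + V x * (u x * w x))"
   using wgrad_lincomb[OF v w, of a c] by eventually_elim (simp add: inner_add_right algebra_simps)
 qed (use borel_measurable_integrable[OF qV_integrable[OF u z]] borel_measurable_integrable[OF qV_integrable[OF u v]] borel_measurable_integrable[OF qV_integrable[OF u w]] in auto)
 also have "... = a * qV u v + c * qV u w" unfolding qV_def using qV_integrable u v w by simp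
 finally show ?thesis .
qed

lemma qV_nonneg: "0 <= qV u u"
 unfolding qV_def using Wpos(5) by (intro integral_nonneg_AE AE_I2) (auto intro!: add_nonneg_nonneg mult_nonneg_nonneg simp: less_imp_le)

lemma qV_nE: "u : E ==> qV u u = (n2 (wgrad u))^2 + (LI x. V x * (u x)^2)" "u : E ==> qV u u <= (nE u)^2"
proof -
 assume u: "u : E"
 show e: "qV u u = (n2 (wgrad u))^2 + (LI x. V x * (u x)^2)"
  unfolding qV_def n2_sq using L2_integrable[OF E_dest(3)[OF u]] E_dest(5)[OF u] by (simp add: power2_norm_eq_inner power2_eq_square[of "u _"])
 have "(LI x. V x * (u x)^2) <= (LI x. W x * (u x)^2)" by (intro integral_mono E_dest(4,5)[OF u] mult_right_mono Wpos) auto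
 then show "qV u u <= (nE u)^2" using e nE_sq[OF u] by simp
qed

lemma qV_le:
 assumes u: "u : E" "nE u <= s" and w: "w : E" "nE w <= t"
 shows "abs (qV u w) <= 2 * (s * t)"
proof -
 have st: "0 <= s" "0 <= t" using u w nE_nonneg order_trans by blast+
 have "(c * a) * (c * d) = (c * c) * (a * d)" for c a d :: real by (simp add: mult_ac)
 then have e: "(sqrt (V x) * u x) * (sqrt (V x) * w x) = V x * (u x * w x)" for x using Wpos(5)[of x] by (simp add: less_imp_le)
 have 1: "abs (LI x. wgrad u x \<bullet> wgrad w x) <= s * t"
  using L2_inner_le[OF E_dest(3)[OF u(1)] E_dest(3)[OF w(1)]] mult_mono[OF order_trans[OF nE_bounds(1)[OF u(1)] u(2)] order_trans[OF nE_bounds(1)[OF w(1)] w(2)] st(1) n2_nonneg] by linarith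
 have 2: "abs (LI x. V x * (u x * w x)) <= s * t"
  using L2_mult_le[OF E_dest(10)[OF u(1)] E_dest(10)[OF w(1)]] mult_mono[OF order_trans[OF nE_bounds(4)[OF u(1)] u(2)] order_trans[OF nE_bounds(4)[OF w(1)] w(2)] st(1) n2_nonneg] unfolding e by linarith
 have "qV u w = (LI x. wgrad u x \<bullet> wgrad w x) + (LI x. V x * (u x * w x))"
  unfolding qV_def by (rule Bochner_Integration.integral_add[OF L2_inner_integrable[OF E_dest(3)[OF u(1)] E_dest(3)[OF w(1)]] VV_integrable[OF u(1) w(1)]])
 then show ?thesis using 1 2 by linarith
qed

lemma Ap_integrable: assumes u: "u : E" and w: "w : E" shows "li (%x. abs (u x) powr (p - 2) * u x * w x)" "abs (Ap u w) <= Lq u + Lq w"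
proof -
 have e: "\<bar>\<bar>u x\<bar> powr (p - 2) * u x * w x\<bar> <= \<bar>u x\<bar> powr p + \<bar>w x\<bar> powr p" for x
 proof -
  have "abs (u x) powr (p - 2) * abs (u x) = abs (u x) powr (p - 1)" using powr_add[of "abs (u x)" "p - 2" 1] by simp
  then show ?thesis using young_powr1[of "abs (u x)" "abs (w x)" p] p by (simp add: abs_mult)
 qed
 have i: "li (%x. abs (u x) powr p + abs (w x) powr p)" using Lp_integrable u w by auto
 show i2: "li (%x. abs (u x) powr (p - 2) * u x * w x)"
  by (rule Bochner_Integration.integrable_bound[OF i]) (use E_dest(1)[OF u] E_dest(1)[OF w] e in \<open>auto intro!: AE_I2 order_trans[OF _ abs_ge_self]\<close>)
 have "norm (Ap u w) <= (LI x. abs (u x) powr p + abs (w x) powr p)" unfolding Ap_def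
  by (rule Bochner_Integration.integral_norm_bound_integral[OF i2 i]) (use e in simp)
 then show "abs (Ap u w) <= Lq u + Lq w" using Lp_integrable u w by (simp add: Lq_eq)
qed

definition Rp :: "(R2 => real) => (R2 => real) => real" where "Rp u h = Lq (%x. u x + h x) - Lq u - p * Ap u h"

lemma Rp_le:
 assumes u: "u : E" and h: "h : E" and e: "e > 0"
 shows "abs (Rp u h) <= 4 * p * (p - 1) * (e^2 * Lq u + (e powr (2 - p) + 1) * Lq h)"
proof -
 let ?c = "4 * p * (p - 1)"
 note uh = E_add[OF u h]
 have i: "li (%x. abs (u x) powr p)" "li (%x. abs (h x) powr p)" "li (%x. abs (u x + h x) powr p)" using Lp_integrable u h uh by auto
 let ?R = "%x. abs (u x + h x) powr p - abs (u x) powr p - p * (abs (u x) powr (p - 2) * u x * h x)"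
 have iR: "li ?R" by (intro bint i Ap_integrable u h)
 have pw: "abs (?R x) <= ?c * (e^2 * abs (u x) powr p + (e powr (2 - p) + 1) * abs (h x) powr p)" for x
 proof -
  have "abs (?R x) <= ?c * (abs (u x) powr (p - 2) * (h x)^2 + abs (h x) powr p)" by (rule powr_remainder[OF p])
  also have "... <= ?c * (e^2 * abs (u x) powr p + (e powr (2 - p) + 1) * abs (h x) powr p)"
   using young_powr[of "abs (u x)" "abs (h x)" e p] e p by (intro mult_left_mono) (auto simp: algebra_simps)
  finally show ?thesis .
 qed
 have "norm (LI x. ?R x) <= (LI x. ?c * (e^2 * abs (u x) powr p + (e powr (2 - p) + 1) * abs (h x) powr p))"
  by (rule Bochner_Integration.integral_norm_bound_integral[OF iR]) (use i pw in \<open>auto intro!: bint\<close>)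
 also have "... = ?c * (e^2 * Lq u + (e powr (2 - p) + 1) * Lq h)" using i by (simp add: Lq_eq)
 also have "(LI x. ?R x) = Rp u h" unfolding Rp_def Lq_eq Ap_def using i Ap_integrable(1)[OF u h] by simp
 finally show ?thesis by simp
qed

text \<open>With the increment d = h (2 u + h) of the square, 2 pi times the increment of
  \<open>N0\<close> is 2 BB(u^2, d) + BB(d, d). Removing the part \<open>4 * B4 u u h\<close> that
  is linear in \<open>h\<close> leaves this expression, so the quadratic terms are contained in
  it.\<close>

definition Rn :: "(R2 => real) => (R2 => real) => real" where
 "Rn u h = 2 * B4 u h h + BB (%x. h x * (2 * u x + h x)) (%x. h x * (2 * u x + h x))"

lemma N0_expand:
 assumes u: "u : E" and h: "h : E"
 shows "N0 (%x. u x + h x) = N0 u + (4 * B4 u u h + Rn u h) / (2 * pi)"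
proof -
 let ?U = "%x. (u x)^2" and ?d = "%x. h x * (2 * u x + h x)"
 have w: "(%x. 2 * u x + h x) : E" using E_lincomb[OF u h, of 2 1] by simp
 note D = Dl_sq[OF u] Dl_mult(1)[OF h w] Dl_mult(1)[OF u h] Dl_mult(1)[OF h h]
 have e: "(%x. (u x + h x)^2) = (%x. 1 * ?U x + 1 * ?d x)" by (auto simp: power2_eq_square algebra_simps)
 have e2: "?d = (%x. 2 * (u x * h x) + 1 * (h x * h x))" by (auto simp: algebra_simps)
 have D12: "Dl (%x. 1 * ?U x + 1 * ?d x)" by (rule Dl_lincomb[OF D(1,2)])
 have "BB (%x. 1 * ?U x + 1 * ?d x) (%x. 1 * ?U x + 1 * ?d x) = BB ?U ?U + 2 * BB ?U ?d + BB ?d ?d"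
  unfolding BB_lin1[OF D(1,2) D12] BB_lin2[OF D(1,2,1)] BB_lin2[OF D(1,2,2)] using BB_sym[OF D(2,1)] by simp
 moreover have "BB ?U ?d = 2 * BB ?U (%x. u x * h x) + BB ?U (%x. h x * h x)" unfolding e2 BB_lin2[OF D(3,4,1)] by simp
 ultimately show ?thesis unfolding N0_eq[OF u] N0_eq[OF E_add[OF u h]] e B4_def Rn_def by (simp add: add_divide_distrib)
qed

lemma I_expand:
 assumes u: "u : E" and h: "h : E"
 shows "II (%x. u x + h x) = II u + dI u h + qV h h / 2 + Rn u h / (8 * pi) - b / p * Rp u h"
proof -
 have s: "(%x. 1 * u x + 1 * h x) : E" by (rule E_lincomb[OF u h])
 have "qV (%x. u x + h x) (%x. u x + h x) = qV u u + 2 * qV u h + qV h h"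
  using qV_lin[OF s u h, of 1 1] qV_lin[OF u u h, of 1 1] qV_lin[OF h u h, of 1 1]
   qV_sym[of "%x. 1 * u x + 1 * h x" u] qV_sym[of "%x. 1 * u x + 1 * h x" h] qV_sym[of h u] by simp
 moreover have "Lp_pow p (%x. u x + h x) = Lp_pow p u + p * Ap u h + Rp u h" by (simp add: Rp_def Lq_def)
 moreover have "b / p * (L + p * A + R) = b / p * L + b * A + b / p * R" for L A R using p by (simp add: distrib_left)
 ultimately show ?thesis unfolding Ifun_def normV_sq_eq N0_expand[OF u h] dI_def
  by (simp add: add_divide_distrib)
qed

lemma B4_lin: "u : E ==> z : E ==> v : E ==> w : E ==> B4 u z (%x. a * v x + c * w x) = a * B4 u z v + c * B4 u z w"
 using BB_lin2[OF Dl_mult(1)[of z v] Dl_mult(1)[of z w] Dl_sq[of u], of a c] by (simp add: B4_def algebra_simps)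

lemma Ap_lin: assumes "u : E" "v : E" "w : E" shows "Ap u (%x. a * v x + c * w x) = a * Ap u v + c * Ap u w"
proof -
 have "Ap u (%x. a * v x + c * w x) = (LI x. a * (abs (u x) powr (p - 2) * u x * v x) + c * (abs (u x) powr (p - 2) * u x * w x))"
  unfolding Ap_def by (simp add: algebra_simps)
 also have "... = a * Ap u v + c * Ap u w" unfolding Ap_def using Ap_integrable(1) assms by simp
 finally show ?thesis .
qed

lemma dI_lin: "u : E ==> v : E ==> w : E ==> dI u (%x. a * v x + c * w x) = a * dI u v + c * dI u w"
 unfolding dI_def by (simp add: qV_lin B4_lin Ap_lin add_divide_distrib algebra_simps)

lemma dI_cmult: "u : E ==> v : E ==> dI u (%x. a * v x) = a * dI u v"
 and dI_add: "u : E ==> v : E ==> w : E ==> dI u (%x. v x + w x) = dI u v + dI u w"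
 and dI_diff: "u : E ==> v : E ==> w : E ==> dI u (%x. v x - w x) = dI u v - dI u w"
 using dI_lin[of u v v a 0] dI_lin[of u v w 1 1] dI_lin[of u v w 1 "-1"] by auto

text \<open>One constant for all first and second order estimates on a ball. The size of
  \<open>h\<close> enters through an upper bound \<open>t > 0\<close>, so that the remainder of the
  power term can be estimated with parameter \<open>t\<close> even for \<open>h = 0\<close>.\<close>

lemma local_bounds:
 assumes R: "R > 0"
 obtains C where "C > 0"
  "!!u h t. u : E ==> h : E ==> nE u <= R ==> nE h <= t ==> 0 < t ==> t <= R ==> abs (II (%x. u x + h x) - II u - dI u h) <= C * t^2"
  "!!u h t. u : E ==> h : E ==> nE u <= R ==> nE h <= t ==> 0 < t ==> abs (dI u h) <= C * t"
  "!!u h t. u : E ==> h : E ==> nE u <= R ==> nE h <= t ==> 0 < t ==> t <= R ==> abs (N0 (%x. u x + h x) - N0 u) <= C * t"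
  "!!u h t. u : E ==> h : E ==> nE u <= R ==> nE h <= t ==> 0 < t ==> t <= R ==> abs (Lq (%x. u x + h x) - Lq u) <= C * t"
  "!!u. u : E ==> nE u <= R ==> abs (N0 u) <= C" "!!u. u : E ==> nE u <= R ==> Lq u <= C"
proof (rule Lp_nE, rule BB_nE, goal_cases)
 case (1 C1 C2)
 note C1 = 1(2-5) and C2 = 1(6,7)
 have Lqb: "Lq u <= C1 * t powr p" if "u : E" "nE u <= t" for u t using C1(2) that by (simp add: Lq_eq)
 have Rnb: "abs (Rn u h) <= 11 * C2 * R^2 * t^2" "abs (B4 u u h) <= C2 * R ^ 3 * t'"
  if u: "u : E" "nE u <= R" and h: "h : E" "nE h <= t" "t <= R" "0 < t" "nE h <= t'" for u h t t'
 proof -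
  have w: "(%x. 2 * u x + h x) : E" using E_lincomb[OF u(1) h(1), of 2 1] by simp
  have "nE (%x. 2 * u x + h x) <= 2 * nE u + nE h" using nE_add[OF E_cmult[OF u(1), of 2] h(1)] nE_cmult[OF u(1), of 2] by simp
  then have wn: "nE (%x. 2 * u x + h x) <= 3 * R" using u h by linarith
  have "abs (B4 u h h) <= C2 * (R * R * t * t)" using C2(2)[OF u(1) u(1) h(1) h(1) u(2) u(2) h(2) h(2)] by (simp add: B4_def power2_eq_square)
  moreover have "abs (BB (%x. h x * (2 * u x + h x)) (%x. h x * (2 * u x + h x))) <= C2 * (t * (3 * R) * t * (3 * R))"
   by (rule C2(2)[OF h(1) w h(1) w h(2) wn h(2) wn])
  ultimately show "abs (Rn u h) <= 11 * C2 * R^2 * t^2" unfolding Rn_def by (simp add: power2_eq_square algebra_simps)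
  show "abs (B4 u u h) <= C2 * R ^ 3 * t'" using C2(2)[OF u(1) u(1) u(1) h(1) u(2) u(2) u(2) h(5)] by (simp add: B4_def power2_eq_square power3_eq_cube mult_ac)
 qed
 define K where "K = 4 * p * (p - 1) * (C1 * R powr p + C1 + C1 * R powr (p - 2))"
 have K0: "K >= 0" using p C1 by (simp add: K_def)
 have Rpb: "abs (Rp u h) <= K * t^2" if u: "u : E" "nE u <= R" and h: "h : E" "nE h <= t" "0 < t" "t <= R" for u h t
 proof -
  \<comment> \<open>With the Young parameter equal to \<open>t\<close> both parts are of order t^2:
    the first has the factor t^2, and in the second t^(2 - p) meets t^p.\<close>
  have "abs (Rp u h) <= 4 * p * (p - 1) * (t^2 * Lq u + (t powr (2 - p) + 1) * Lq h)" by (rule Rp_le[OF u(1) h(1,3)])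
  also have "... <= 4 * p * (p - 1) * (t^2 * (C1 * R powr p) + (t powr (2 - p) + 1) * (C1 * t powr p))"
   using p Lqb[OF u] Lqb[OF h(1,2)] by (intro mult_left_mono add_mono) auto
  also have "(t powr (2 - p) + 1) * (C1 * t powr p) = t^2 * (C1 + C1 * t powr (p - 2))"
   using h(3) by (simp add: algebra_simps powr_diff powr_numeral flip: powr_add)
  also have "4 * p * (p - 1) * (t^2 * (C1 * R powr p) + t^2 * (C1 + C1 * t powr (p - 2))) <= 4 * p * (p - 1) * (t^2 * (C1 * R powr p) + t^2 * (C1 + C1 * R powr (p - 2)))"
   using p C1 h by (intro mult_left_mono add_left_mono powr_mono2) auto
  also have "... = K * t^2" by (simp add: K_def algebra_simps)
  finally show ?thesis .
 qed
 define A where "A = 2 * R + C2 * R ^ 3 / (2 * pi) + b * (C1 * R powr p + C1)"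
 have A0: "A >= 0" using R C1 C2 b by (simp add: A_def)
 have Apb: "abs (Ap u h) <= (C1 * R powr p + C1) * t" if u: "u : E" "nE u <= R" and h: "h : E" "nE h <= t" "0 < t" for u h t
 proof -
  \<comment> \<open>The bound \<open>Lq u + Lq w\<close> for \<open>Ap u w\<close> is not
    homogeneous in \<open>w\<close>. Applying it to the normalised direction and scaling back makes
    it linear in \<open>t\<close>.\<close>
  let ?v = "%x. 1 / t * h x"
  have "nE ?v = nE h / t" using nE_cmult[OF h(1), of "1/t"] h(3) by simp
  then have v: "?v : E" "nE ?v <= 1" using E_cmult[OF h(1), of "1/t"] h by (auto simp: divide_le_eq)
  have "abs (Ap u ?v) <= C1 * R powr p + C1" using Ap_integrable(2)[OF u(1) v(1)] Lqb[OF u] Lqb[OF v] by simp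
  moreover have "Ap u ?v = 1 / t * Ap u h" using Ap_lin[OF u(1) h(1) h(1), of "1/t" 0] by simp
  then have "abs (Ap u h) = abs (Ap u ?v) * t" using h(3) by (simp add: abs_mult)
  ultimately show ?thesis using h(3) by (simp only: mult_right_mono less_imp_le)
 qed
 have dIb: "abs (dI u h) <= A * t" if u: "u : E" "nE u <= R" and h: "h : E" "nE h <= t" "0 < t" for u h t
 proof -
  have B: "abs (B4 u u h) <= C2 * R ^ 3 * t"
   using C2(2)[OF u(1) u(1) u(1) h(1) u(2) u(2) u(2) h(2)] by (simp add: B4_def power2_eq_square power3_eq_cube mult_ac)
  have "abs (dI u h) <= abs (qV u h) + abs (B4 u u h) / (2 * pi) + b * abs (Ap u h)"
   unfolding dI_def using b by (intro order_trans[OF abs_triangle_ineq4] add_mono order_trans[OF abs_triangle_ineq]) (auto simp: abs_mult)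
  also have "... <= 2 * (R * t) + C2 * R ^ 3 * t / (2 * pi) + b * ((C1 * R powr p + C1) * t)"
   using b qV_le[OF u h(1,2)] B Apb[OF u h] by (intro add_mono mult_left_mono divide_right_mono) auto
  also have "... = A * t" by (simp add: A_def algebra_simps)
  finally show ?thesis .
 qed
 define C where "C = 1 + A + (1/2 + 11 * C2 * R^2 / (8 * pi) + b / p * K) + (4 * C2 * R ^ 3 + 11 * C2 * R ^ 3) / (2 * pi) + (p * (C1 * R powr p + C1) + K * R) + C2 * R ^ 4 / (2 * pi) + C1 * R powr p"
 have pos: "0 <= 1/2 + 11 * C2 * R^2 / (8 * pi) + b / p * K" "0 <= (4 * C2 * R ^ 3 + 11 * C2 * R ^ 3) / (2 * pi)" "0 <= p * (C1 * R powr p + C1) + K * R"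
  "0 <= C2 * R ^ 4 / (2 * pi)" "0 <= C1 * R powr p" using C1 C2 R K0 b p by auto
 have AC: "A <= C" unfolding C_def using pos by linarith
 show ?thesis
 proof (rule that[of C])
  show "C > 0" using pos A0 by (simp add: C_def)
  fix u h :: "R2 => real" and t assume u: "u : E" and h: "h : E" and nu: "nE u <= R" and nh: "nE h <= t" "0 < t"
  show "abs (dI u h) <= C * t" using dIb[OF u nu h nh] mult_right_mono[OF AC, of t] nh by linarith
  assume tR: "t <= R"
  have "abs (II (%x. u x + h x) - II u - dI u h) = abs (qV h h / 2 + Rn u h / (8 * pi) - b / p * Rp u h)" unfolding I_expand[OF u h] by simp
  also have "... <= qV h h / 2 + abs (Rn u h) / (8 * pi) + b / p * abs (Rp u h)"
   using b p qV_nonneg[of h] by (intro order_trans[OF abs_triangle_ineq4] add_mono order_trans[OF abs_triangle_ineq]) (auto simp: abs_mult)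
  also have "... <= t^2 / 2 + 11 * C2 * R^2 * t^2 / (8 * pi) + b / p * (K * t^2)"
   using b p order_trans[OF qV_nE(2)[OF h] power_mono[OF nh(1), of 2]] Rnb(1)[OF u nu h nh(1) tR nh(2) nh(1)] Rpb[OF u nu h nh tR]
   by (intro add_mono divide_right_mono mult_left_mono) auto
  also have "... = (1/2 + 11 * C2 * R^2 / (8 * pi) + b / p * K) * t^2" by (simp add: algebra_simps)
  also have "... <= C * t^2" using pos A0 by (intro mult_right_mono) (auto simp: C_def)
  finally show "abs (II (%x. u x + h x) - II u - dI u h) <= C * t^2" .
  have tt: "t^2 <= R * t" using tR nh(2) by (simp add: power2_eq_square)
  have "abs (4 * B4 u u h + Rn u h) <= 4 * (C2 * R ^ 3 * t) + 11 * C2 * R^2 * (R * t)"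
  proof -
   have "11 * C2 * R^2 * t^2 <= 11 * C2 * R^2 * (R * t)" using tt C2(1) by (intro mult_left_mono) auto
   then show ?thesis using Rnb[OF u nu h nh(1) tR nh(2) nh(1)] by linarith
  qed
  also have "... = (4 * C2 * R ^ 3 + 11 * C2 * R ^ 3) * t" by (simp add: power2_eq_square power3_eq_cube algebra_simps)
  finally have "abs (N0 (%x. u x + h x) - N0 u) <= (4 * C2 * R ^ 3 + 11 * C2 * R ^ 3) * t / (2 * pi)"
   unfolding N0_expand[OF u h] by (simp add: divide_right_mono)
  also have "... = ((4 * C2 * R ^ 3 + 11 * C2 * R ^ 3) / (2 * pi)) * t" by simp
  also have "... <= C * t" unfolding C_def using pos A0 nh(2) by (intro mult_right_mono) linarith+
  finally show "abs (N0 (%x. u x + h x) - N0 u) <= C * t" .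
  have "abs (Lq (%x. u x + h x) - Lq u) <= p * abs (Ap u h) + abs (Rp u h)"
   using p abs_triangle_ineq[of "p * Ap u h" "Rp u h"] by (simp add: Rp_def abs_mult)
  also have "... <= p * ((C1 * R powr p + C1) * t) + K * (R * t)"
   using p Apb[OF u nu h nh] order_trans[OF Rpb[OF u nu h nh tR] mult_left_mono[OF tt K0]] by (intro add_mono mult_left_mono) auto
  also have "... = (p * (C1 * R powr p + C1) + K * R) * t" by (simp add: algebra_simps)
  also have "... <= C * t" unfolding C_def using pos A0 nh(2) by (intro mult_right_mono) linarith+
  finally show "abs (Lq (%x. u x + h x) - Lq u) <= C * t" .
 next
  fix u assume u: "u : E" "nE u <= R"
  have "abs (N0 u) <= C2 * R ^ 4 / (2 * pi)" unfolding N0_eq[OF u(1)]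
   using C2(2)[OF u(1) u(1) u(1) u(1) u(2) u(2) u(2) u(2)] by (simp add: power2_eq_square eval_nat_numeral mult_ac divide_right_mono)
  then show "abs (N0 u) <= C" using pos A0 unfolding C_def by linarith
  show "Lq u <= C" using Lqb[OF u] pos A0 unfolding C_def by linarith
 qed
qed


lemma II_derivative:
 assumes u: "u : E" and w: "w : E"
 shows "((%t. II (%x. u x + t * w x)) has_real_derivative dI u w) (at 0)"
proof -
 define R where "R = nE u + nE w + 1"
 have R: "R > 0" by (simp add: R_def add_nonneg_pos)
 obtain C where C: "C > 0" "!!u h t. u : E ==> h : E ==> nE u <= R ==> nE h <= t ==> 0 < t ==> t <= R ==> abs (II (%x. u x + h x) - II u - dI u h) <= C * t^2"
  by (rule local_bounds[OF R]) (rule that)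
 have le: "abs ((II (%x. u x + t * w x) - II u) / t - dI u w) <= C * R^2 * abs t" if t: "t ~= 0" "abs t <= 1" for t
 proof -
  have "abs t * nE w <= abs t * R" by (intro mult_left_mono) (auto simp: R_def)
  moreover have "abs t * R <= 1 * R" using t R by (intro mult_right_mono) auto
  ultimately have "abs (II (%x. u x + t * w x) - II u - dI u (%x. t * w x)) <= C * (abs t * R)^2"
   using t R by (intro C(2) u E_cmult w) (auto simp: nE_cmult[OF w] R_def)
  then have "abs (II (%x. u x + t * w x) - II u - t * dI u w) <= (C * R^2 * abs t) * abs t"
   by (simp add: dI_cmult[OF u w] power_mult_distrib power2_eq_square mult_ac abs_mult_self_eq)
  moreover have "(II (%x. u x + t * w x) - II u) / t - dI u w = (II (%x. u x + t * w x) - II u - t * dI u w) / t" using t by (simp add: field_simps)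
  ultimately show ?thesis using t by (simp add: abs_divide divide_le_eq)
 qed
 have "((%t. (II (%x. u x + t * w x) - II u) / t - dI u w) \<longlongrightarrow> 0) (at 0)"
 proof (rule Lim_null_comparison)
  show "\<forall>\<^sub>F t in at 0. norm ((II (%x. u x + t * w x) - II u) / t - dI u w) <= C * R^2 * abs t"
   unfolding eventually_at by (intro exI[of _ 1]) (use le in auto)
  have "((%t. C * R^2 * abs t) \<longlongrightarrow> C * R^2 * abs 0) (at 0)" by (intro tendsto_intros)
  then show "((%t. C * R^2 * abs t) \<longlongrightarrow> 0) (at 0)" by simp
 qed
 then show ?thesis unfolding DERIV_def by (simp add: LIM_zero_iff)
qed

lemma crit_iff: "crit_point V b p u \<longleftrightarrow> u : E \<and> (ALL w:E. dI u w = 0)"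
proof
 assume c: "crit_point V b p u"
 then show "u : E \<and> (ALL w:E. dI u w = 0)" using DERIV_unique II_derivative unfolding crit_point_def by blast
next
 assume c: "u : E \<and> (ALL w:E. dI u w = 0)"
 show "crit_point V b p u" unfolding crit_point_def
 proof (intro conjI ballI)
  show "u : E" using c by simp
  fix ph assume f: "ph : E"
  then have "dI u ph = 0" using c by simp
  then show "((%t. II (%x. u x + t * ph x)) has_real_derivative 0) (at 0)" using II_derivative[of u ph] c f by simp
 qed
qed

text \<open>No second derivative is used. The value at \<open>u + z\<close> is expanded around
  \<open>u\<close> and around \<open>v\<close>; if \<open>u - v\<close> and \<open>z\<close> are
  both of size \<open>s\<close>, the two expansions differ by O(s^2), which bounds the difference of
  the derivatives on \<open>z\<close>. Scaling \<open>z = (s / t) * w\<close> gives the general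
  direction. The 6 is 1 + 4 + 1, one expansion having increment \<open>2 * s\<close>.\<close>

lemma dI_Lipschitz:
 assumes R: "R > 0"
 obtains C where "C > 0" "!!u v w s t. u : E ==> v : E ==> w : E ==> nE u <= R ==> nE v <= R ==> nE (%x. u x - v x) <= s ==> nE w <= t ==> 0 < s ==> s <= R ==> 0 < t ==> abs (dI u w - dI v w) <= C * s * t"
proof -
 have R2: "2 * R > 0" using R by simp
 obtain C where C: "C > 0" "!!u h t. u : E ==> h : E ==> nE u <= 2 * R ==> nE h <= t ==> 0 < t ==> t <= 2 * R ==> abs (II (%x. u x + h x) - II u - dI u h) <= C * t^2"
  by (rule local_bounds[OF R2]) (rule that)
 show ?thesis
 proof (rule that[of "6 * C"])
  show "6 * C > 0" using C by simp
  fix u v w s t assume u: "u : E" and v: "v : E" and w: "w : E" and n: "nE u <= R" "nE v <= R" and s: "nE (%x. u x - v x) <= s" and t: "nE w <= t" "0 < s" "s <= R" "0 < t"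
  define z where "z = (%x. s / t * w x)"
  define h where "h = (%x. u x - v x)"
  have z: "z : E" unfolding z_def by (rule E_cmult[OF w])
  have h: "h : E" "nE h <= s" unfolding h_def using E_diff[OF u v] s by auto
  have "nE z = s / t * nE w" unfolding z_def using nE_cmult[OF w, of "s/t"] t by simp
  also have "... <= s / t * t" using t by (intro mult_left_mono) auto
  finally have zn: "nE z <= s" using t by simp
  have hz: "(%x. h x + z x) : E" "nE (%x. h x + z x) <= 2 * s" using E_add[OF h(1) z] nE_add[OF h(1) z] h(2) zn by auto
  have e: "(%x. v x + h x) = u" "(%x. v x + (h x + z x)) = (%x. u x + z x)" by (auto simp: h_def)
  have 1: "abs (II (%x. u x + z x) - II u - dI u z) <= C * s^2" using n t by (intro C(2) u z zn) auto
  have 2: "abs (II (%x. u x + z x) - II v - (dI v h + dI v z)) <= C * (2 * s)^2"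
   using C(2)[OF v hz(1) _ hz(2)] n t dI_add[OF v h(1) z] unfolding e by auto
  have 3: "abs (II u - II v - dI v h) <= C * s^2" using C(2)[OF v h(1) _ h(2)] n t unfolding e by auto
  have "C * (2 * s)^2 = 4 * (C * s^2)" by (simp add: power_mult_distrib)
  then have "abs (dI u z - dI v z) <= 6 * (C * s^2)" using 1 2 3 by linarith
  moreover have "dI u z = s / t * dI u w" "dI v z = s / t * dI v w" unfolding z_def by (rule dI_cmult[OF u w], rule dI_cmult[OF v w])
  then have "dI u z - dI v z = s / t * (dI u w - dI v w)" by (simp add: algebra_simps)
  ultimately have "s / t * abs (dI u w - dI v w) <= 6 * (C * s^2)" using t by (simp add: abs_mult)
  then have "s * abs (dI u w - dI v w) <= s * (6 * C * s * t)" using t by (simp add: field_simps power2_eq_square)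
  then show "abs (dI u w - dI v w) <= 6 * C * s * t" using t by simp
 qed
qed

lemma II_Lipschitz:
 assumes R: "R > 0"
 obtains C where "C > 0" "!!u v s. u : E ==> v : E ==> nE v <= R ==> nE (%x. u x - v x) <= s ==> 0 < s ==> s <= R ==> abs (II u - II v) <= C * s"
proof (rule local_bounds[OF R], goal_cases)
 case (1 C)
 note C = 1(2-4)
 show ?thesis
 proof (rule that[of "C * R + C"])
  show "C * R + C > 0" using C R by (simp add: add_pos_pos)
  fix u v s assume u: "u : E" and v: "v : E" "nE v <= R" and s: "nE (%x. u x - v x) <= s" "0 < s" "s <= R"
  have "abs (II u - II v - dI v (%x. u x - v x)) <= C * s^2" using C(2)[OF v(1) E_diff[OF u v(1)] v(2) s] by simp
  moreover have "C * s^2 <= C * R * s" using C(1) s by (simp add: power2_eq_square)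
  ultimately show "abs (II u - II v) <= (C * R + C) * s"
   using C(3)[OF v(1) E_diff[OF u v(1)] v(2) s(1,2)] by (simp add: distrib_right)
 qed
qed

subsection \<open>Dilations in the energy space\<close>

lemma weak_grad_const: "weak_grad (%x. 1) (%x. 0)"
 by (rule weak_gradI) (auto simp: loc_int_1 integral_cgrad_zero loc_int_def set_integrable_def)

text \<open>Three applications of the monotonicity along rays: to V + bee / 2 with exponent 2, to V
  with exponent \<open>al\<close>, and to - V with exponent - \<open>al\<close>. In each case (V1)
  is exactly the required differential inequality.\<close>

lemma V_rays:
 assumes l: "0 < l" "l <= 1"
 shows "l^2 * V (l *r x) <= V x + bee / 2 * (1 - l^2)" "V (l *r x) <= l powr (- al) * V x" "V x <= l powr (- al) * V (l *r x)"
proof -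
 have w1: "weak_grad (%x. 1 * V x + bee / 2 * 1) (%x. 1 *r gV x + (bee / 2) *r 0)" by (rule weak_grad_lincomb[OF wV weak_grad_const])
 have a1: "AE x in lebesgue. 2 * (1 * V x + bee / 2 * 1) + (1 *r gV x + (bee / 2) *r 0) \<bullet> x >= 0" using gV by eventually_elim simp
 have "l powr 2 * (1 * V (l *r x) + bee / 2 * 1) <= 1 powr 2 * (1 * V (1 *r x) + bee / 2 * 1)"
  by (rule ray_mono[OF _ w1 a1 l]) (intro continuous_intros Vc)
 then show "l^2 * V (l *r x) <= V x + bee / 2 * (1 - l^2)" using l by (simp add: powr_numeral algebra_simps)
 have a2: "AE x in lebesgue. al * V x + gV x \<bullet> x >= 0" using gV by eventually_elim linarith
 have "l powr al * V (l *r x) <= 1 powr al * V (1 *r x)" by (rule ray_mono[OF Vc wV a2 l])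
 then show "V (l *r x) <= l powr (- al) * V x" using l by (simp add: powr_minus field_simps)
 have w3: "weak_grad (%x. (-1) * V x + 0 * 1) (%x. (-1) *r gV x + 0 *r 0)" by (rule weak_grad_lincomb[OF wV weak_grad_const])
 have a3: "AE x in lebesgue. (- al) * ((-1) * V x + 0 * 1) + ((-1) *r gV x + 0 *r 0) \<bullet> x >= 0" using gV by eventually_elim (simp add: abs_le_iff)
 have "l powr (- al) * ((-1) * V (l *r x) + 0 * 1) <= 1 powr (- al) * ((-1) * V (1 *r x) + 0 * 1)"
  by (rule ray_mono[OF _ w3 a3 l]) (intro continuous_intros Vc)
 then show "V x <= l powr (- al) * V (l *r x)" by simp
qed

definition KW :: real where "KW = 2 powr al + 2"

lemma KW: "KW > 0" by (simp add: KW_def add_pos_pos)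

lemma W_compare: assumes c: "1 / 2 <= c" "c <= 2" shows "W x <= KW * W (c *r x)"
proof -
 have lp: "l powr (- al) <= KW" if "1/2 <= l" "l <= 1" for l
 proof -
  have "l powr (- al) <= (1/2) powr (- al)" using that ab by (intro powr_mono2') auto
  also have "... = 2 powr al" by (simp add: powr_minus powr_divide)
  finally show ?thesis by (simp add: KW_def)
 qed
 have Vle: "V x <= KW * V (c *r x)"
 proof (cases "c <= 1")
  case True
  have "V x <= c powr (- al) * V (c *r x)" using c True by (intro V_rays(3)) auto
  also have "... <= KW * V (c *r x)" using c True Wpos(5)[of "c *r x"] by (intro mult_right_mono lp) auto
  finally show ?thesis .
 next
  case False
  then have "V ((1/c) *r (c *r x)) <= (1/c) powr (- al) * V (c *r x)" using c by (intro V_rays(2)) auto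
  also have "... <= KW * V (c *r x)" using c False Wpos(5)[of "c *r x"] by (intro mult_right_mono lp) (auto simp: field_simps)
  finally show ?thesis using False by simp
 qed
 \<comment> \<open>For \<open>c >= 1/2\<close> the dilation is absorbed by a square, which the
   logarithm turns into the factor 2.\<close>
 have "1 + norm x <= (1 + c * norm x)^2"
 proof -
  have "norm x <= 2 * (c * norm x)" using mult_right_mono[OF c(1), of "norm x"] by simp
  moreover have "(1 + c * norm x)^2 = 1 + 2 * (c * norm x) + (c * norm x)^2" by (simp add: power2_eq_square algebra_simps)
  moreover have "0 <= (c * norm x)^2" by simp
  ultimately show ?thesis by linarith
 qed
 then have "lw x <= ln ((1 + c * norm x)^2)" unfolding lw_def by (intro ln_mono) (auto intro: add_pos_nonneg)
 also have "... = 2 * lw (c *r x)" unfolding lw_def using c by (simp add: ln_realpow add_pos_nonneg)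
 also have "... <= KW * lw (c *r x)" using lw_nonneg[of "c *r x"] by (intro mult_right_mono) (auto simp: KW_def)
 finally show ?thesis using Vle by (simp add: W_def distrib_left)
qed

definition dil :: "real => (R2 => real) => R2 => real" where "dil c u = (%x. u (c *r x))"

lemma LI_dilate: "c ~= 0 ==> lm f ==> (LI x. f (c *r x)) = (LI x. f x) / c^2" "c ~= 0 ==> lm f ==> li (%x. f (c *r x)) \<longleftrightarrow> li f"
 for f :: "R2 => real"
 using integral_affine_R2[of c f 0] integrable_affine_R2[of c f 0] by (auto simp: divide_inverse mult.commute)

lemma
 assumes u: "u : E" and c: "1 / 2 <= c" "c <= 2"
 shows dil_E: "dil c u : E" and wgrad_dil: "AE x in lebesgue. wgrad (dil c u) x = c *r wgrad u (c *r x)"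
  and n2_wgrad_dil: "n2 (wgrad (dil c u)) = n2 (wgrad u)" and nE_dil: "nE (dil c u) <= (1 + 4 * KW) * nE u"
  and n2_dil: "n2 (dil c u) = n2 u / c" and Lq_dil: "Lq (dil c u) = Lq u / c^2"
proof -
 note d = E_dest[OF u]
 have cn: "c ~= 0" "c > 0" using c by auto
 have wg: "weak_grad (dil c u) (%x. c *r wgrad u (c *r x))" unfolding dil_def by (rule weak_grad_dilate[OF d(2) cn(1)])
 show ae: "AE x in lebesgue. wgrad (dil c u) x = c *r wgrad u (c *r x)" by (rule wgrad_AE[OF wg])
 have Lg: "L2 (%x. wgrad u (c *r x))" and ng: "n2 (%x. wgrad u (c *r x)) = n2 (wgrad u) / c"
  using L2_affine[OF cn(1) d(3), of 0] n2_affine[OF cn(1) d(3), of 0] cn by auto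
 have um: "lm (dil c u)" unfolding dil_def using measurable_comp_affine[OF cn(1) d(1), of 0] by simp
 have mW: "lm (%x. W x * (u x)^2)" using d lmW by auto
 have i1: "li (%x. W (c *r x) * (u (c *r x))^2)" using LI_dilate(2)[OF cn(1) mW] d(4) by simp
 have le: "W x * (dil c u x)^2 <= KW * (W (c *r x) * (u (c *r x))^2)" for x
  using mult_right_mono[OF W_compare[OF c, of x], of "(u (c *r x))^2"] by (simp add: dil_def mult.assoc)
 have i2: "li (%x. W x * (dil c u x)^2)"
  by (rule Bochner_Integration.integrable_bound[OF integrable_mult_right[OF i1, of KW]])
   (use um lmW le Wpos(2) in \<open>auto intro!: AE_I2 order_trans[OF _ abs_ge_self] simp: less_imp_le\<close>)
 show dE: "dil c u : E" by (rule E_intro[OF um wg L2_scaleR[OF Lg] i2])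
 have "n2 (wgrad (dil c u)) = n2 (%x. c *r wgrad u (c *r x))"
  using E_dest(3)[OF dE] L2_scaleR[OF Lg, of c] ae by (intro n2_cong_AE) auto
 then show ngd: "n2 (wgrad (dil c u)) = n2 (wgrad u)" unfolding n2_scaleR ng using cn by simp
 have W0: "0 <= (LI x. W x * (u x)^2)" using Wpos(2) by (intro integral_nonneg_AE) (auto simp: less_imp_le)
 have "(LI x. W x * (dil c u x)^2) <= (LI x. KW * (W (c *r x) * (u (c *r x))^2))" by (intro integral_mono i2 integrable_mult_right i1 le)
 also have "... = KW * ((LI x. W x * (u x)^2) / c^2)" using LI_dilate(1)[OF cn(1) mW] by simp
 also have "... <= KW * (4 * (LI x. W x * (u x)^2))"
 proof -
  have "1 / 4 <= c^2" using power_mono[OF c(1), of 2] by (simp add: power_divide)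
  then have "(LI x. W x * (u x)^2) * 1 <= (LI x. W x * (u x)^2) * (4 * c^2)" by (intro mult_left_mono W0) auto
  then show ?thesis using KW cn by (intro mult_left_mono) (auto simp: field_simps)
 qed
 finally have "(nE (dil c u))^2 <= (n2 (wgrad u))^2 + 4 * KW * (LI x. W x * (u x)^2)" unfolding nE_sq[OF dE] ngd by simp
 also have "... <= (1 + 4 * KW) * (nE u)^2" unfolding nE_sq[OF u] using W0 KW by (simp add: algebra_simps)
 also have "... <= ((1 + 4 * KW) * nE u)^2" unfolding power_mult_distrib using KW by (intro mult_right_mono) (auto simp: power2_eq_square algebra_simps)
 finally show "nE (dil c u) <= (1 + 4 * KW) * nE u" by (rule power2_le_imp_le) (use KW in auto)
 show "n2 (dil c u) = n2 u / c" unfolding dil_def using n2_affine[OF cn(1) d(7), of 0] cn by simp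
 have "lm (%x. abs (u x) powr p)" using d(1) by auto
 then show "Lq (dil c u) = Lq u / c^2" unfolding Lq_eq dil_def using LI_dilate(1)[OF cn(1), of "%x. abs (u x) powr p"] by simp
qed

text \<open>Rescaling both variables shifts the kernel by - ln c and costs the Jacobian c^-4. The
  additive shift, of size (mass)^2, makes the form negative under repeated compression and produces
  the quartic mass term of \<open>PP\<close>.\<close>

lemma N0_dil:
 assumes u: "u : E" and c: "1 / 2 <= c" "c <= 2"
 shows "N0 (dil c u) = (N0 u - ln c * (n2 u) ^ 4 / (2 * pi)) / c ^ 4"
proof -
 let ?f = "%x. (u x)^2"
 have cn: "c ~= 0" "c > 0" using c by auto
 have D: "Dl ?f" by (rule Dl_sq[OF u])
 have fm: "lm ?f" "li ?f" using D by (auto simp: Dl_def)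
 let ?H = "%z. (lgp (fst z - snd z) * ?f (fst z) * ?f (snd z) - lgm (fst z - snd z) * ?f (fst z) * ?f (snd z)) - ln c * (?f (fst z) * ?f (snd z))"
 have iH: "integrable (LL) ?H"
  by (intro Bochner_Integration.integrable_diff Bk_lgp(1) Bk_lgm(1) D integrable_mult_right integrable_pair_prod(1) fm)
 have "(\<integral>z. ?H z \<partial>(LL)) = BB ?f ?f - ln c * (n2 u) ^ 4"
  unfolding BB_def Bk_def using Bk_lgp(1)[OF D D] Bk_lgm(1)[OF D D] integrable_pair_prod[OF fm(2,2)]
  by (simp add: n2_sq[of u, symmetric, simplified] power2_eq_square[of "(n2 u)^2", symmetric])
 then have H: "(LI x. LI y. ?H (x, y)) = BB ?f ?f - ln c * (n2 u) ^ 4" using lebp.integral_fst'[OF iH] by simp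
 have kc: "ln (norm ((1/c) *r x - (1/c) *r y)) = ln (norm (x - y)) - ln c" if "x ~= y" for x y :: R2
 proof -
  have "norm ((1/c) *r x - (1/c) *r y) = norm (x - y) / c" using cn by (simp add: scaleR_diff_right[symmetric])
  then show ?thesis using that cn by (simp add: ln_div)
 qed
 have mk: "lm (%y. ln (norm (x - (1/c) *r y)) * ?f z * ?f y)" for x z
  by (rule borel_measurable_times[OF borel_measurable_times[OF lm_borel borel_measurable_const] fm(1)]) simp
 have inner: "(LI y. ln (norm ((1/c) *r x - (1/c) *r y)) * ?f x * ?f y) = (LI y. ?H (x, y))" for x
 proof (rule integral_cong_AE)
  show "lm (%y. ln (norm ((1/c) *r x - (1/c) *r y)) * ?f x * ?f y)" by (rule mk)
  have "lm (%y. ln (norm (x - y)) * ?f x * ?f y - ln c * (?f x * ?f y))" 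
   by (rule borel_measurable_diff[OF borel_measurable_times[OF borel_measurable_times[OF lm_borel borel_measurable_const] fm(1)]])
    (use fm(1) in auto)
  then show "lm (%y. ?H (x, y))" by (simp add: ln_norm_split left_diff_distrib)
  \<comment> \<open>On the diagonal the norm is 0 and its logarithm does not scale, so the identity
    for the kernel holds only off this null set.\<close>
  have "AE y in lebesgue. y ~= x" by (rule AE_not_in[of "{x}", simplified]) simp
  then show "AE y in lebesgue. ln (norm ((1/c) *r x - (1/c) *r y)) * ?f x * ?f y = ?H (x, y)"
  proof eventually_elim
   case (elim y)
   have k: "ln (norm ((1/c) *r x - (1/c) *r y)) = lgp (x - y) - lgm (x - y) - ln c" using kc[of x y] elim by (auto simp: ln_norm_split)
   show ?case unfolding k by (simp add: algebra_simps)
  qed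
 qed
 have mH: "lm (%x. LI y. ?H (x, y))" using borel_measurable_integrable[OF lebp.integrable_fst'[OF iH]] .
 have "(LI x. LI y. ln (norm (x - y)) * (dil c u x)^2 * (dil c u y)^2) = (LI x. (LI y. ln (norm (x - (1/c) *r y)) * ?f (c *r x) * ?f y) / c^2)"
 proof (rule Bochner_Integration.integral_cong[OF refl])
  fix x
  show "(LI y. ln (norm (x - y)) * (dil c u x)^2 * (dil c u y)^2) = (LI y. ln (norm (x - (1/c) *r y)) * ?f (c *r x) * ?f y) / c^2"
   using LI_dilate(1)[OF cn(1) mk[of x "c *r x"]] cn by (simp add: dil_def)
 qed
 also have "... = (LI x. (LI y. ?H (c *r x, y)) / c^2)" using inner[of "c *r x" for x] cn by simp
 also have "... = (LI x. (LI y. ?H (x, y)) / c^2) / c^2"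
  using LI_dilate(1)[OF cn(1), of "%x. (LI y. ?H (x, y)) / c^2"] mH by simp
 also have "... = (BB ?f ?f - ln c * (n2 u) ^ 4) / c ^ 4" using H by (simp add: power2_eq_square eval_nat_numeral)
 finally show ?thesis unfolding N0_eq[OF u] unfolding N0_def by (simp add: diff_divide_distrib mult.commute[of "c ^ 4"])
qed

text \<open>Up to \<open>O(s\<^sup>2)\<close>, \<open>- s * PP u\<close> bounds the change of energy under the dilation \<open>T s\<close> defined next.\<close>

definition PP :: "(R2 => real) => real" where
 "PP u = N0 u + (n2 u) ^ 4 / (8 * pi) - bee * (n2 u)^2 / 2 - 2 * b * Lq u / p"

definition T :: "real => (R2 => real) => R2 => real" where "T s u = dil (1 / (1 - s)) u"

lemma T_range: "0 <= s ==> s <= 1 / 2 ==> 1 / 2 <= 1 / (1 - s)" "0 <= s ==> s <= 1 / 2 ==> 1 / (1 - s) <= 2" for s :: real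
 by (auto simp: field_simps)

text \<open>Both claims come from \<open>l^2 * V (l *r x) <= V x + bee / 2 * (1 - l^2)\<close> after
  the substitution x -> l x. The factor in the second tends to 1 with \<open>s\<close>, unlike the
  fixed factor in \<open>nE_dil\<close>; this is what keeps the radius of the deformed chains under
  exponential control.\<close>

lemma V_T_le:
 assumes u: "u : E" and s: "0 <= s" "s <= 1 / 2"
 shows "(LI x. V x * (T s u x)^2) <= (LI x. V x * (u x)^2) + s * bee * (n2 u)^2" "nE (T s u) <= (1 + bee / V0 * s) * nE u"
proof -
 define l where "l = 1 - s"
 have l: "0 < l" "l <= 1" "1/2 <= l" using s by (auto simp: l_def)
 note TE = dil_E[OF u T_range[OF s], folded T_def] and d = E_dest[OF u]
 have l2: "1 - l^2 <= 2 * s" by (simp add: l_def power2_eq_square algebra_simps)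
 have "l^2 <= 1" using l by (simp add: power_le_one)
 \<comment> \<open>Stated for a general weight because it is used for \<open>V\<close> and for
   \<open>W\<close>; the logarithmic weight is increasing along rays, so it only helps.\<close>
 have gen: "(LI x. f x * (T s u x)^2) <= (LI x. f x * (u x)^2) + s * bee * (n2 u)^2"
  if f: "lm f" "!!x. l^2 * f (l *r x) <= f x + bee / 2 * (1 - l^2)" "!!x. 0 <= f x" "li (%x. f x * (T s u x)^2)" "li (%x. f x * (u x)^2)" for f
 proof -
  have m: "lm (%x. f x * (T s u x)^2)" using f(4) by (rule borel_measurable_integrable)
  have e: "f (l *r x) * (T s u (l *r x))^2 = f (l *r x) * (u x)^2" for x using l by (simp add: T_def dil_def l_def)
  have i: "li (%x. f (l *r x) * (u x)^2)" using LI_dilate(2)[OF _ m, of l] f(4) l unfolding e by simp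
  have "(LI x. f x * (T s u x)^2) = l^2 * (LI x. f (l *r x) * (u x)^2)" using LI_dilate(1)[OF _ m, of l] l unfolding e by simp
  also have "... = (LI x. l^2 * f (l *r x) * (u x)^2)" by (simp add: mult.assoc)
  also have "... <= (LI x. f x * (u x)^2 + s * bee * (u x)^2)"
  proof (rule integral_mono)
   show "li (%x. l^2 * f (l *r x) * (u x)^2)" using i by (simp add: mult.assoc)
   show "li (%x. f x * (u x)^2 + s * bee * (u x)^2)" using L2_integrable[OF d(7)] by (intro bint f) simp
   fix x
   have "bee / 2 * (1 - l^2) <= bee / 2 * (2 * s)" using ab l2 by (intro mult_left_mono) auto
   then have "l^2 * f (l *r x) <= f x + s * bee" using f(2)[of x] by (simp add: mult.commute)
   from mult_right_mono[OF this, of "(u x)^2"] show "l^2 * f (l *r x) * (u x)^2 <= f x * (u x)^2 + s * bee * (u x)^2" by (simp add: distrib_right)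
  qed
  also have "... = (LI x. f x * (u x)^2) + s * bee * (n2 u)^2" using f(5) L2_integrable[OF d(7)] by (simp add: n2_sq)
  finally show ?thesis .
 qed
 show "(LI x. V x * (T s u x)^2) <= (LI x. V x * (u x)^2) + s * bee * (n2 u)^2"
  by (rule gen[OF lmV V_rays(1)[OF l(1,2)]]) (use E_dest(5)[OF TE] d Wpos(5) in \<open>auto simp: less_imp_le\<close>)
 have lwl: "l^2 * lw (l *r x) <= lw x" for x
 proof -
  have "l * norm x <= 1 * norm x" using l by (intro mult_right_mono) auto
  then have "lw (l *r x) <= lw x" unfolding lw_def using l by (intro ln_mono) (auto intro: add_pos_nonneg)
  moreover have "l^2 * lw (l *r x) <= 1 * lw (l *r x)" using \<open>l^2 <= 1\<close> lw_nonneg by (intro mult_right_mono) auto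
  ultimately show ?thesis by simp
 qed
 have "(LI x. W x * (T s u x)^2) <= (LI x. W x * (u x)^2) + s * bee * (n2 u)^2"
 proof (rule gen[OF lmW])
  show "l^2 * W (l *r x) <= W x + bee / 2 * (1 - l^2)" for x using V_rays(1)[OF l(1,2), of x] lwl[of x] by (simp add: W_def distrib_left)
 qed (use E_dest(4)[OF TE] d Wpos(2) in \<open>auto simp: less_imp_le\<close>)
 moreover have "V0 * (n2 u)^2 <= (nE u)^2"
  using power_mono[OF nE_bounds(2)[OF u], of 2] V0 by (simp add: power_divide field_simps)
 then have "s * bee * (n2 u)^2 <= bee / V0 * s * (nE u)^2"
  using V0 ab s mult_left_mono[of "V0 * (n2 u)^2" "(nE u)^2" "bee / V0 * s"] by (simp add: field_simps)
 ultimately have "(nE (T s u))^2 <= (1 + bee / V0 * s) * (nE u)^2"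
  unfolding nE_sq[OF TE] nE_sq[OF u] using n2_wgrad_dil[OF u T_range[OF s], folded T_def] by (simp add: algebra_simps)
 also have "... <= ((1 + bee / V0 * s) * nE u)^2" unfolding power_mult_distrib
 proof (intro mult_right_mono)
  have "0 <= bee / V0 * s" using V0 ab s by simp
  then show "1 + bee / V0 * s <= (1 + bee / V0 * s)^2" by (intro self_le_power) auto
 qed simp
 finally show "nE (T s u) <= (1 + bee / V0 * s) * nE u" by (rule power2_le_imp_le) (use V0 ab s in auto)
qed

text \<open>With \<open>l = 1 - s\<close> the gradient term is invariant, the potential term grows
  by at most \<open>s * bee * (n2 u)^2\<close>, \<open>N0 u\<close> becomes
  \<open>l^4 * N0 u + l^4 * ln l * (n2 u)^4 / (2 * pi)\<close>, and \<open>Lq u\<close> gets the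
  factor \<open>l^2\<close>. The first-order coefficients, with the weights 1/2, 1/4 and - b / p of
  the energy, add up to \<open>- PP u\<close>.\<close>

lemma II_T_le:
 assumes u: "u : E" and s: "0 <= s" "s <= 1 / 2"
 shows "II (T s u) <= II u - s * PP u + s^2 * (3 * abs (N0 u) + (n2 u) ^ 4)"
proof -
 define l where "l = 1 - s"
 have l: "0 < l" "l <= 1" using s by (auto simp: l_def)
 note TR = T_range[OF s]
 note TE = dil_E[OF u TR, folded T_def]
 define m where "m = n2 u"
 have m0: "0 <= m ^ 4 / (8 * pi)" by simp
 have "qV (T s u) (T s u) <= qV u u + s * bee * m^2"
  unfolding qV_nE(1)[OF TE] qV_nE(1)[OF u] using V_T_le(1)[OF u s] n2_wgrad_dil[OF u TR, folded T_def] by (simp add: m_def)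
 moreover have N: "N0 (T s u) = l ^ 4 * N0 u + (l ^ 4 * ln l) * (4 * (m ^ 4 / (8 * pi)))"
  unfolding T_def N0_dil[OF u TR] using l by (simp add: l_def[symmetric] power_divide ln_div m_def field_simps)
 moreover have "l ^ 4 * ln l <= - s + 4 * s^2"
 proof -
  \<comment> \<open>The logarithm is at most - s and Bernoulli gives l^4 >= 1 - 4 s; only an upper
    bound is required because the coefficient is nonnegative.\<close>
  have "ln l <= l - 1" using l by (intro ln_le_minus_one)
  then have "l ^ 4 * ln l <= l ^ 4 * (- s)" using l by (intro mult_left_mono) (auto simp: l_def)
  also have "... <= (1 - 4 * s) * (- s)"
  proof (rule mult_right_mono_neg)
   show "1 - 4 * s <= l ^ 4" unfolding l_def using Bernoulli_inequality[of "- s" 4] s by simp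
  qed (use s in simp)
  finally show ?thesis by (simp add: power2_eq_square algebra_simps)
 qed
 then have "(l ^ 4 * ln l) * (4 * (m ^ 4 / (8 * pi))) <= (- s + 4 * s^2) * (4 * (m ^ 4 / (8 * pi)))" using m0 by (intro mult_right_mono) auto
 moreover have "l ^ 4 * N0 u <= N0 u - 4 * s * N0 u + 11 * s^2 * abs (N0 u)"
 proof -
  have e: "l ^ 4 = 1 - 4 * s + s^2 * (6 - 4 * s + s^2)" by (simp add: l_def eval_nat_numeral algebra_simps)
  have "s^2 <= 1" using s by (simp add: power_le_one)
  then have "abs (6 - 4 * s + s^2) <= 11" using s zero_le_power2[of s] by (simp add: abs_le_iff)
  then have "abs (s^2 * (6 - 4 * s + s^2) * N0 u) <= s^2 * 11 * abs (N0 u)" unfolding abs_mult by (intro mult_right_mono mult_mono) auto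
  then show ?thesis unfolding e by (simp add: algebra_simps abs_le_iff)
 qed
 moreover have "Lq (T s u) = l^2 * Lq u" unfolding T_def Lq_dil[OF u TR] using l by (simp add: l_def[symmetric] power_divide)
 moreover have "b / p * ((1 - 2 * s) * Lq u) <= b / p * (l^2 * Lq u)"
  using b p Lq_nonneg[of u] by (intro mult_left_mono mult_right_mono) (auto simp: l_def power2_eq_square algebra_simps)
 moreover have "q' / 2 + N' / 4 - bl <= q / 2 + (x1 + y1) / 4 - L1" if q: "q' <= q" "N' = x + y" "y <= y1" "x <= x1" "L1 <= bl" for q q' N' x y x1 y1 L1 bl :: real
 proof -
  have "N' / 4 <= (x1 + y1) / 4" using q by simp
  then show ?thesis using q(1,5) by (intro diff_mono add_mono) (auto intro: divide_right_mono)
 qed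
 ultimately have "II (T s u) <= (qV u u + s * bee * m^2) / 2 + (N0 u - 4 * s * N0 u + 11 * s^2 * abs (N0 u) + (- s + 4 * s^2) * (4 * (m ^ 4 / (8 * pi)))) / 4 - b / p * ((1 - 2 * s) * Lq u)"
  unfolding Ifun_def normV_sq_eq Lq_def[symmetric] by presburger
 also have "... = II u - s * PP u + s^2 * (11 / 4 * abs (N0 u) + 4 * (m ^ 4 / (8 * pi)))"
  unfolding Ifun_def normV_sq_eq Lq_def[symmetric] PP_def m_def[symmetric] 
  by (simp add: add_divide_distrib diff_divide_distrib algebra_simps)
 also have "... <= II u - s * PP u + s^2 * (3 * abs (N0 u) + m ^ 4)"
 proof -
  have "1 * m ^ 4 <= (2 * pi) * m ^ 4" using pi_gt3 by (intro mult_right_mono) auto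
  then have "4 * (m ^ 4 / (8 * pi)) <= m ^ 4" by (simp add: field_simps)
  then show ?thesis by (intro add_left_mono mult_left_mono add_mono) auto
 qed
 finally show ?thesis by (simp add: m_def)
qed

text \<open>Continuity of dilations in L^2 does not apply to the weighted part directly, because the
  unbounded weight is evaluated at \<open>x\<close> while the function is evaluated at
  \<open>l x\<close>. The ratio \<open>rh\<close> of the square roots of the weights is bounded by
  \<open>W_compare\<close> and tends to 1, so the weighted function \<open>sqrt W * u\<close> can be
  dilated instead and the ratio handled by dominated convergence.\<close>

lemma dil_continuous:
 assumes u: "u : E" and l: "l ---> 1" "!!k::nat. 1 / 2 <= l k" "!!k. l k <= 2"
 shows "(%k. nE (%x. dil (l k) u x - u x)) ---> 0"
proof -
 note d = E_dest[OF u]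
 let ?F = "%x. sqrt (W x) * u x"
 have FL: "L2 ?F" using d lmW Wpos(2) by (auto simp: L2_def power_mult_distrib less_imp_le)
 have ln: "l k ~= 0" for k using l(2)[of k] by auto
 have Fl: "L2 (%x. ?F (l k *r x))" and gl: "L2 (%x. wgrad u (l k *r x))" for k
  using L2_affine[OF ln[of k] FL, of 0] L2_affine[OF ln[of k] d(3), of 0] by auto
 define rh where "rh k x = sqrt (W x / W (l k *r x))" for k x
 have rhb: "0 <= rh k x" "rh k x <= sqrt KW" for k x
  using W_compare[OF l(2)[of k] l(3)[of k], of x] Wpos(2)[of x] Wpos(2)[of "l k *r x"] by (auto simp: rh_def field_simps less_imp_le)
 have Wc: "continuous_on UNIV W" unfolding W_def lw_def by (intro continuous_intros Vc) (auto simp: add_nonneg_eq_0_iff)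
 have rhm: "lm (rh k)" for k unfolding rh_def using Wpos(2)
  by (intro continuous_lebesgue_measurable continuous_intros continuous_on_compose2[OF Wc]) (auto simp: less_imp_neq[symmetric])
 have key: "sqrt (W x) * (dil (l k) u x - u x) = rh k x * (?F (l k *r x) - ?F x) + (rh k x - 1) * ?F x" for k x
 proof -
  have "rh k x * sqrt (W (l k *r x)) = sqrt (W x)" using Wpos(2)[of "l k *r x"] by (simp add: rh_def real_sqrt_divide)
  then have "rh k x * (sqrt (W (l k *r x)) * u (l k *r x)) = sqrt (W x) * u (l k *r x)" by (simp add: mult.assoc[symmetric])
  then show ?thesis by (simp only: dil_def right_diff_distrib left_diff_distrib)
 qed
 have La: "L2 (%x. rh k x * (?F (l k *r x) - ?F x))" "n2 (%x. rh k x * (?F (l k *r x) - ?F x)) <= sqrt KW * n2 (%x. ?F (l k *r x) - ?F x)" for k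
 proof -
  have m: "lm (%x. rh k x * (?F (l k *r x) - ?F x))" using rhm L2_measurable[OF L2_diff[OF Fl FL, of k]] by auto
  have le: "norm (rh k x * (?F (l k *r x) - ?F x)) <= norm (sqrt KW * (?F (l k *r x) - ?F x))" for x
   unfolding norm_mult using rhb[of k x] KW by (intro mult_right_mono) auto
  show "L2 (%x. rh k x * (?F (l k *r x) - ?F x))" "n2 (%x. rh k x * (?F (l k *r x) - ?F x)) <= sqrt KW * n2 (%x. ?F (l k *r x) - ?F x)"
   using L2_bound[OF L2_cmult[OF L2_diff[OF Fl[of k] FL], of "sqrt KW"] m AE_I2[OF le]] n2_mono[OF L2_cmult[OF L2_diff[OF Fl[of k] FL], of "sqrt KW"] m AE_I2[OF le]] KW n2_cmult[of "sqrt KW"] by auto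
 qed
 have rh1: "abs (rh k x - 1) <= sqrt KW + 1" for k x using rhb[of k x] by linarith
 have Lb: "L2 (%x. (rh k x - 1) * ?F x)" for k
 proof (rule L2_bound[OF L2_cmult[OF FL, of "sqrt KW + 1"]])
  show "lm (%x. (rh k x - 1) * ?F x)" using rhm FL by auto
  show "AE x in lebesgue. norm ((rh k x - 1) * ?F x) <= norm ((sqrt KW + 1) * ?F x)"
   unfolding real_norm_def abs_mult[of _ "sqrt _ * _"] using order_trans[OF rh1 abs_ge_self] by (intro AE_I2 mult_right_mono) auto
 qed
 have "(%k. n2 (%x. (rh k x - 1) * ?F x - 0)) ---> 0"
 proof (rule n2_dominated[where w="%x. (sqrt KW + 1) * abs (?F x)"])
  show "L2 (%x. (sqrt KW + 1) * abs (?F x))" using L2_cmult[OF L2_norm[OF FL]] by simp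
  show "AE x in lebesgue. (%k. (rh k x - 1) * ?F x) ---> 0"
  proof (rule AE_I2)
   fix x
   have "(%k. W (l k *r x)) ---> W (1 *r x)" by (rule continuous_on_tendsto_compose[OF Wc tendsto_scaleR[OF l(1) tendsto_const]]) auto
   then have "(%k. (rh k x - 1) * ?F x) ---> (sqrt (W x / W (1 *r x)) - 1) * ?F x"
    unfolding rh_def using Wpos(2)[of x] by (intro tendsto_intros) auto
   then show "(%k. (rh k x - 1) * ?F x) ---> 0" using Wpos(2)[of x] by simp
  qed
  show "AE x in lebesgue. norm ((rh k x - 1) * ?F x - 0) <= (sqrt KW + 1) * abs (?F x)" for k
   unfolding diff_zero real_norm_def abs_mult[of _ "sqrt _ * _"] using rh1 by (intro AE_I2 mult_right_mono) auto
 qed (use Lb in auto)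
 then have c2: "(%k. n2 (%x. (rh k x - 1) * ?F x)) ---> 0" by simp
 have c1: "(%k. n2 (%x. ?F (l k *r x) - ?F x)) ---> 0" by (rule L2_dilation_continuous[OF FL l(1,2)])
 have c3: "(%k. n2 (%x. wgrad u (l k *r x) - wgrad u x)) ---> 0" by (rule L2_dilation_continuous[OF d(3) l(1,2)])
 have le: "nE (%x. dil (l k) u x - u x) <= 2 * abs (l k - 1) * n2 (wgrad u) + n2 (%x. wgrad u (l k *r x) - wgrad u x)
   + (sqrt KW * n2 (%x. ?F (l k *r x) - ?F x) + n2 (%x. (rh k x - 1) * ?F x))" for k
 proof -
  note DE = dil_E[OF u l(2)[of k] l(3)[of k]]
  let ?h = "%x. dil (l k) u x - u x"
  have hE: "?h : E" by (rule E_diff[OF DE u])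
  have Wn: "(LI x. W x * (?h x)^2) = (n2 (%x. sqrt (W x) * ?h x))^2" unfolding n2_sq using Wpos(2) by (simp add: power_mult_distrib less_imp_le)
  have "(nE ?h)^2 <= (n2 (wgrad ?h) + n2 (%x. sqrt (W x) * ?h x))^2"
   unfolding nE_sq[OF hE] Wn power2_sum by simp
  then have 1: "nE ?h <= n2 (wgrad ?h) + n2 (%x. sqrt (W x) * ?h x)" by (rule power2_le_imp_le) (simp add: add_nonneg_nonneg)
  have 2: "n2 (%x. sqrt (W x) * ?h x) <= sqrt KW * n2 (%x. ?F (l k *r x) - ?F x) + n2 (%x. (rh k x - 1) * ?F x)"
   unfolding key using n2_triangle[OF La(1) Lb, of k k] La(2)[of k] by linarith
  have "n2 (wgrad ?h) = n2 (%x. (l k - 1) *r wgrad u (l k *r x) + (wgrad u (l k *r x) - wgrad u x))"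
  proof (rule n2_cong_AE)
   show "AE x in lebesgue. wgrad ?h x = (l k - 1) *r wgrad u (l k *r x) + (wgrad u (l k *r x) - wgrad u x)"
    using wgrad_lincomb[OF DE u, of 1 "-1"] wgrad_dil[OF u l(2)[of k] l(3)[of k]] by eventually_elim (simp add: algebra_simps)
  qed (use E_dest(3)[OF hE] L2_add(1)[OF L2_scaleR[OF gl] L2_diff[OF gl d(3)]] in auto)
  also have "... <= abs (l k - 1) * n2 (%x. wgrad u (l k *r x)) + n2 (%x. wgrad u (l k *r x) - wgrad u x)"
   using n2_triangle[OF L2_scaleR[OF gl] L2_diff[OF gl d(3)], of "l k - 1" k k] by (simp add: n2_scaleR)
  also have "n2 (%x. wgrad u (l k *r x)) <= 2 * n2 (wgrad u)"
  proof -
   have "1 * n2 (wgrad u) <= (l k * 2) * n2 (wgrad u)" using l(2)[of k] by (intro mult_right_mono) auto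
   then show ?thesis using n2_affine[OF ln[of k] d(3), of 0] l(2)[of k] by (simp add: divide_le_eq mult_ac)
  qed
  finally have 3: "n2 (wgrad ?h) <= abs (l k - 1) * (2 * n2 (wgrad u)) + n2 (%x. wgrad u (l k *r x) - wgrad u x)" by (simp add: mult_left_mono)
  show ?thesis using 1 2 3 by (simp add: mult_ac)
 qed
 have "(%k. 2 * abs (l k - 1) * n2 (wgrad u) + n2 (%x. wgrad u (l k *r x) - wgrad u x)
   + (sqrt KW * n2 (%x. ?F (l k *r x) - ?F x) + n2 (%x. (rh k x - 1) * ?F x))) ---> 2 * abs (1 - 1) * n2 (wgrad u) + 0 + (sqrt KW * 0 + 0)"
  by (intro tendsto_intros l c1 c2 c3)
 then have z: "(%k. 2 * abs (l k - 1) * n2 (wgrad u) + n2 (%x. wgrad u (l k *r x) - wgrad u x)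
   + (sqrt KW * n2 (%x. ?F (l k *r x) - ?F x) + n2 (%x. (rh k x - 1) * ?F x))) ---> 0" by simp
 show ?thesis by (rule tendsto_sandwich[OF always_eventually always_eventually tendsto_const z]) (intro allI nE_nonneg, intro allI le)
qed


lemma PP_Lipschitz:
 assumes R: "R > 0"
 obtains C where "C > 0" "!!u h t. u : E ==> h : E ==> nE u <= R ==> nE h <= t ==> 0 < t ==> t <= R ==> abs (PP (%x. u x + h x) - PP u) <= C * t"
proof (rule local_bounds[OF R], goal_cases)
 case (1 C)
 note C = 1(2,5,6)
 define K where "K = 2 * R / sqrt V0"
 have K: "K > 0" using R V0 by (simp add: K_def)
 show ?thesis
 proof (rule that[of "C + 2 * K^2 * (2 * K) / (8 * pi) / sqrt V0 + bee / 2 * (2 * K) / sqrt V0 + 2 * b / p * C"])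
  show "C + 2 * K^2 * (2 * K) / (8 * pi) / sqrt V0 + bee / 2 * (2 * K) / sqrt V0 + 2 * b / p * C > 0"
   using C(1) K V0 ab b p by (intro add_pos_nonneg) auto
  fix u h t assume u: "u : E" and h: "h : E" and n: "nE u <= R" "nE h <= t" and t: "0 < t" "t <= R"
  let ?v = "%x. u x + h x"
  define x y where "x = n2 ?v" and "y = n2 u"
  have nn: "n2 h <= t / sqrt V0" using nE_bounds(2)[OF h] n(2) V0 divide_right_mono[OF n(2), of "sqrt V0"] by simp
  have y: "0 <= y" "y <= R / sqrt V0" unfolding y_def using nE_bounds(2)[OF u] divide_right_mono[OF n(1), of "sqrt V0"] V0 by auto
  have xy: "abs (x - y) <= t / sqrt V0"
  proof -
   have "n2 ?v <= n2 u + n2 h" by (rule n2_triangle) (use E_dest(7) u h in auto)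
   moreover have "n2 u <= n2 ?v + n2 h" using n2_triangle_diff[OF E_dest(7)[OF E_add[OF u h]] E_dest(7)[OF h]] by simp
   ultimately show ?thesis using nn unfolding x_def y_def by linarith
  qed
  have "t / sqrt V0 <= R / sqrt V0" using divide_right_mono[OF t(2), of "sqrt V0"] V0 by simp
  then have x: "0 <= x" "x <= K" "y <= K" using xy y K unfolding K_def x_def by auto
  have s2: "abs (x^2 - y^2) <= 2 * K * (t / sqrt V0)"
  proof -
   have "x^2 - y^2 = (x + y) * (x - y)" by (simp add: power2_eq_square algebra_simps)
   then have "abs (x^2 - y^2) = (x + y) * abs (x - y)" using x y by (simp add: abs_mult)
   also have "... <= 2 * K * (t / sqrt V0)" using x y xy by (intro mult_mono) auto
   finally show ?thesis .
  qed
  have s4: "abs (x ^ 4 - y ^ 4) <= 2 * K^2 * (2 * K * (t / sqrt V0))"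
  proof -
   have "x ^ 4 - y ^ 4 = (x^2 + y^2) * (x^2 - y^2)" by (simp add: eval_nat_numeral algebra_simps)
   then have "abs (x ^ 4 - y ^ 4) = (x^2 + y^2) * abs (x^2 - y^2)" by (simp add: abs_mult)
   also have "... <= (2 * K^2) * (2 * K * (t / sqrt V0))" using power_mono[OF x(2) x(1), of 2] power_mono[OF x(3) y(1), of 2] by (intro mult_mono s2) auto
   finally show ?thesis .
  qed
  have e: "PP ?v - PP u = (N0 ?v - N0 u) + (x ^ 4 - y ^ 4) / (8 * pi) - bee / 2 * (x^2 - y^2) - 2 * b / p * (Lq ?v - Lq u)"
   unfolding PP_def x_def y_def by (simp add: diff_divide_distrib right_diff_distrib)
  have "abs ((x ^ 4 - y ^ 4) / (8 * pi)) <= 2 * K^2 * (2 * K * (t / sqrt V0)) / (8 * pi)" unfolding abs_divide using divide_right_mono[OF s4, of "8 * pi"] by simp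
  moreover have "abs (bee / 2 * (x^2 - y^2)) <= bee / 2 * (2 * K * (t / sqrt V0))" unfolding abs_mult using s2 ab by (intro mult_mono) auto
  moreover have "abs (2 * b / p * (Lq ?v - Lq u)) <= 2 * b / p * (C * t)" unfolding abs_mult[of "2 * b / p"] using C(3)[OF u h n t] b p by (intro mult_mono) auto
  ultimately have "abs (PP ?v - PP u) <= C * t + 2 * K^2 * (2 * K * (t / sqrt V0)) / (8 * pi) + bee / 2 * (2 * K * (t / sqrt V0)) + 2 * b / p * (C * t)"
   unfolding e using C(2)[OF u h n t] by linarith
  then show "abs (PP ?v - PP u) <= (C + 2 * K^2 * (2 * K) / (8 * pi) / sqrt V0 + bee / 2 * (2 * K) / sqrt V0 + 2 * b / p * C) * t"
   by (simp add: algebra_simps)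
 qed
qed

subsection \<open>Mountain pass\<close>

text \<open>Chains of small steps replace continuous paths: a step of the deformation may then move each node independently,
and only the segments between images of neighbouring nodes have to be refined.\<close>

definition stp :: "real => real => real => (R2 => real) => (R2 => real) => bool" where
 "stp d M R u v \<longleftrightarrow> u : E \<and> v : E \<and> II u <= M \<and> II v <= M \<and> nE u <= R \<and> nE v <= R \<and> nE (%x. u x - v x) <= d"

lemma stp_sym: "stp d M R u v ==> stp d M R v u"
 unfolding stp_def using nE_commute[of u v] by auto

text \<open>Being linked by a chain is an equivalence relation on the parameter interval. Continuity
  of the path makes the relation hold near each parameter, and the interval is connected.\<close>

lemma path_chain:
 assumes g: "!!t. t : {0..1} ==> g t : E \<and> II (g t) <= M \<and> nE (g t) <= R"
  and c: "!!X t. (!!n. X n : {0..1}) ==> t : {0..1::real} ==> X ---> t ==> (%n. nE (%x. g (X n) x - g t x)) ---> 0"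
  and d: "d > 0"
 shows "(stp d M R)\<^sup>*\<^sup>* (g 0) (g 1)"
proof (rule connected_equivalence_relation[where S="{0..1::real}" and R="%s t. (stp d M R)\<^sup>*\<^sup>* (g s) (g t)"])
 show "(stp d M R)\<^sup>*\<^sup>* (g y) (g x)" if "(stp d M R)\<^sup>*\<^sup>* (g x) (g y)" for x y
  using symp_rtranclp[of "stp d M R"] stp_sym that unfolding symp_def by blast
 show "EX T. openin (top_of_set {0..1}) T \<and> a : T \<and> (ALL x:T. (stp d M R)\<^sup>*\<^sup>* (g a) (g x))" if a: "a : {0..1}" for a
 proof -
  have "((%t. nE (%x. g t x - g a x)) \<longlongrightarrow> 0) (at a within {0..1})"
   unfolding tendsto_at_iff_sequentially comp_def using c a by auto
  then have "\<forall>\<^sub>F t in at a within {0..1}. nE (%x. g t x - g a x) < d" using d by (rule order_tendstoD)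
  then obtain e where e: "e > 0" "!!t. t : {0..1} ==> t ~= a ==> dist t a < e ==> nE (%x. g t x - g a x) < d"
   unfolding eventually_at by auto
  have "(stp d M R)\<^sup>*\<^sup>* (g a) (g x)" if x: "x : {0..1} \<inter> ball a e" for x
  proof (cases "x = a")
   case False
   then have "nE (%y. g x y - g a y) < d" using e(2)[of x] x by (auto simp: dist_commute)
   then have "stp d M R (g a) (g x)" unfolding stp_def using g[of a] g[of x] a x nE_commute[of "g a" "g x"] by auto
   then show ?thesis by simp
  qed simp
  then show ?thesis using a e(1) by (intro exI[of _ "{0..1} \<inter> ball a e"]) (auto intro: openin_open_Int)
 qed
qed (auto intro: rtranclp_trans)

text \<open>Dilations are uniformly bounded on E but depend only strongly continuously on the
  parameter. So the change of the function is estimated first, under the moving dilation, and then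
  the dilation changes on the fixed function \<open>Y t\<close>, through the quotient
  \<open>l\<close> of the two parameters.\<close>

lemma T_path_continuous:
 fixes X :: "nat => real"
 assumes y: "y0 : E" "y1 : E" and s: "sa : {0..1/2}" "sb : {0..1/2}"
  and X: "!!n. X n : {0..1}" "t : {0..1}" "X ---> t"
 defines "g == %t. T ((1 - t) * sa + t * sb) (%x. (1 - t) * y0 x + t * y1 x)"
 shows "(%n. nE (%x. g (X n) x - g t x)) ---> 0"
proof -
 define c where "c t = 1 / (1 - ((1 - t) * sa + t * sb))" for t
 define Y where "Y t = (%x. (1 - t) * y0 x + t * y1 x)" for t
 have cr: "1 <= c t \<and> c t <= 2 \<and> 0 < 1 - ((1 - t) * sa + t * sb)" if t: "t : {0..1}" for t
 proof -
  have "(1 - t) * sa + t * sb <= (1 - t) * (1/2) + t * (1/2)" using t s by (intro add_mono mult_left_mono) auto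
  moreover have "0 <= (1 - t) * sa + t * sb" using t s by auto
  ultimately show ?thesis unfolding c_def by (auto simp: field_simps)
 qed
 have YE: "Y t : E" for t unfolding Y_def by (rule E_lincomb[OF y])
 have gd: "g t = dil (c t) (Y t)" for t unfolding g_def T_def c_def Y_def ..
 define l where "l n = c (X n) / c t" for n
 have ct: "c t ~= 0" "1/2 <= c t" "c t <= 2" using cr[OF X(2)] by auto
 have l: "1 / 2 <= l n" "l n <= 2" for n using cr[OF X(2)] cr[OF X(1)[of n]] by (auto simp: l_def field_simps)
 have "(%n. c (X n)) ---> c t" unfolding c_def using cr[OF X(2)] by (intro tendsto_intros X) auto
 then have "l ---> c t / c t" unfolding l_def using ct(1) by (intro tendsto_intros) auto
 then have l1: "l ---> 1" using ct by simp
 have z1: "(%n. nE (%x. dil (l n) (Y t) x - Y t x)) ---> 0" by (rule dil_continuous[OF YE l1 l])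
 have z2: "(%n. abs (X n - t) * nE (%x. y1 x - y0 x)) ---> abs (t - t) * nE (%x. y1 x - y0 x)" by (intro tendsto_intros X)
 have le: "nE (%x. g (X n) x - g t x) <= (1 + 4 * KW) * (abs (X n - t) * nE (%x. y1 x - y0 x)) + (1 + 4 * KW) * nE (%x. dil (l n) (Y t) x - Y t x)" for n
 proof -
  have cn: "1/2 <= c (X n)" "c (X n) <= 2" using cr[OF X(1)[of n]] by auto
  have lE: "dil (l n) (Y t) : E" by (rule dil_E[OF YE l])
  have e1: "(%x. g (X n) x - dil (c (X n)) (Y t) x) = dil (c (X n)) (%x. Y (X n) x - Y t x)" unfolding gd by (simp add: dil_def)
  have e2: "(%x. dil (c (X n)) (Y t) x - g t x) = dil (c t) (%x. dil (l n) (Y t) x - Y t x)"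
   unfolding gd l_def using ct(1) by (simp add: dil_def)
  have e3: "(%x. Y (X n) x - Y t x) = (%x. (X n - t) * (y1 x - y0 x))" unfolding Y_def by (simp add: algebra_simps)
  have n3: "nE (%x. Y (X n) x - Y t x) = abs (X n - t) * nE (%x. y1 x - y0 x)" unfolding e3 by (rule nE_cmult[OF E_diff[OF y(2,1)]])
  have "nE (%x. g (X n) x - g t x) <= nE (%x. g (X n) x - dil (c (X n)) (Y t) x) + nE (%x. dil (c (X n)) (Y t) x - g t x)"
   by (rule nE_triangle3) (use dil_E[OF YE cn] dil_E[OF YE ct(2,3)] gd in auto)
  also have "... <= (1 + 4 * KW) * nE (%x. Y (X n) x - Y t x) + (1 + 4 * KW) * nE (%x. dil (l n) (Y t) x - Y t x)"
   unfolding e1 e2 by (intro add_mono nE_dil E_diff YE lE cn ct(2,3))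
  finally show ?thesis unfolding n3 .
 qed
 have "(%n. (1 + 4 * KW) * (abs (X n - t) * nE (%x. y1 x - y0 x)) + (1 + 4 * KW) * nE (%x. dil (l n) (Y t) x - Y t x)) ---> (1 + 4 * KW) * (abs (t - t) * nE (%x. y1 x - y0 x)) + (1 + 4 * KW) * 0"
  by (intro tendsto_add tendsto_mult_left z1 z2)
 then have z: "(%n. (1 + 4 * KW) * (abs (X n - t) * nE (%x. y1 x - y0 x)) + (1 + 4 * KW) * nE (%x. dil (l n) (Y t) x - Y t x)) ---> 0" by simp
 show ?thesis by (rule tendsto_sandwich[OF always_eventually always_eventually tendsto_const z]) (intro allI nE_nonneg, intro allI le)
qed

text \<open>First-order expansion of the energy on the segment joining the images of two
  neighbouring nodes \<open>u\<close> and \<open>v\<close>, each moved in its own direction and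
  dilated at its own rate. Since the nodes are \<open>h^2\<close> close, replacing one base point by
  the other costs O(h^2) in every term, so the rates of the two nodes simply interpolate.\<close>

lemma descent:
 assumes R: "R >= 1"
 obtains C where "C > 0" "!!u v w z h a a' t. u : E ==> v : E ==> w : E ==> z : E ==> nE u <= R ==> nE v <= R ==> nE (%x. u x - v x) <= h^2 ==>
  nE w <= 1 + R ==> nE z <= 1 + R ==> 0 < h ==> h <= 1/2 ==> a : {0..1::real} ==> a' : {0..1::real} ==> t : {0..1} ==>
  II (T ((1 - t) * (h * a) + t * (h * a')) (%x. (1 - t) * (u x + h * w x) + t * (v x + h * z x)))
   <= II u + h * ((1 - t) * (dI u w - a * PP u) + t * (dI v z - a' * PP v)) + C * h^2 \<and> abs (II u - II v) <= C * h^2"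
proof -
 \<comment> \<open>This radius contains the nodes, the directions and all intermediate functions, so
   the local estimates need only one ball.\<close>
 define Q where "Q = 4 * R + 4"
 have Q: "Q > 0" "1 <= Q" "R <= Q" "R + 2 * (1 + R) <= Q" "2 + R <= Q" "1 + R <= Q" using R by (auto simp: Q_def)
 obtain C1 where C1: "C1 > 0"
  "!!u h t. u : E ==> h : E ==> nE u <= Q ==> nE h <= t ==> 0 < t ==> t <= Q ==> abs (II (%x. u x + h x) - II u - dI u h) <= C1 * t^2"
  "!!u h t. u : E ==> h : E ==> nE u <= Q ==> nE h <= t ==> 0 < t ==> abs (dI u h) <= C1 * t"
  "!!u. u : E ==> nE u <= Q ==> abs (N0 u) <= C1"
  by (rule local_bounds[OF Q(1)]) (rule that)
 obtain C2 where C2: "C2 > 0" "!!u v w s t. u : E ==> v : E ==> w : E ==> nE u <= Q ==> nE v <= Q ==> nE (%x. u x - v x) <= s ==> nE w <= t ==> 0 < s ==> s <= Q ==> 0 < t ==> abs (dI u w - dI v w) <= C2 * s * t"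
  by (rule dI_Lipschitz[OF Q(1)]) (rule that)
 obtain C3 where C3: "C3 > 0" "!!u h t. u : E ==> h : E ==> nE u <= Q ==> nE h <= t ==> 0 < t ==> t <= Q ==> abs (PP (%x. u x + h x) - PP u) <= C3 * t"
  by (rule PP_Lipschitz[OF Q(1)]) (rule that)
 obtain C4 where C4: "C4 > 0" "!!u v s. u : E ==> v : E ==> nE v <= Q ==> nE (%x. u x - v x) <= s ==> 0 < s ==> s <= Q ==> abs (II u - II v) <= C4 * s"
  by (rule II_Lipschitz[OF Q(1)]) (rule that)
 define K where "K = 3 * C1 + (Q / sqrt V0) ^ 4"
 have K0: "K >= 0" using C1 by (simp add: K_def)
 define C where "C = C1 * Q^2 + C1 + C2 * Q + 2 * C3 * Q + K + C4"
 show ?thesis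
 proof (rule that[of C])
  show "C > 0" unfolding C_def using C1 C2 C3 C4 K0 Q by (intro add_nonneg_pos add_nonneg_nonneg) auto
  fix u v w z h a a' t
  assume u: "u : E" and v: "v : E" and w: "w : E" and z: "z : E" and n: "nE u <= R" "nE v <= R" "nE (%x. u x - v x) <= h^2"
   "nE w <= 1 + R" "nE z <= 1 + R" and h: "0 < h" "h <= 1/2" and a: "a : {0..1::real}" "a' : {0..1::real}" and t: "t : {0..(1::real)}"
  have hh: "h^2 <= h" "0 < h^2" "h^2 <= 1" "h^2 <= Q" using h Q by (auto simp: power2_eq_square mult_le_one intro: mult_left_le order_trans[of _ 1])
  have nQ: "nE u <= Q" "nE v <= Q" "nE z <= Q" using n Q by auto
  define k where "k = (%x. (1 - t) * w x + t * z x)"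
  define m where "m = (%x. v x - u x)"
  define d where "d = (%x. t * m x + h * k x)"
  define y where "y = (%x. u x + d x)"
  have kE: "k : E" unfolding k_def by (rule E_lincomb[OF w z])
  have mE: "m : E" unfolding m_def by (rule E_diff[OF v u])
  have dE: "d : E" unfolding d_def by (rule E_lincomb[OF mE kE])
  have yE: "y : E" unfolding y_def by (rule E_add[OF u dE])
  have mn: "nE m <= h^2" unfolding m_def using n(3) nE_commute[OF u v] by simp
  have "nE k <= nE (%x. (1 - t) * w x) + nE (%x. t * z x)" unfolding k_def by (intro nE_add E_cmult w z)
  also have "... = (1 - t) * nE w + t * nE z" using t by (simp add: nE_cmult[OF w] nE_cmult[OF z])
  also have "... <= (1 - t) * (1 + R) + t * (1 + R)" using t n by (intro add_mono mult_left_mono) auto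
  finally have kn: "nE k <= 1 + R" by (simp add: algebra_simps)
  have "nE d <= nE (%x. t * m x) + nE (%x. h * k x)" unfolding d_def by (intro nE_add E_cmult mE kE)
  also have "... = t * nE m + h * nE k" using t h by (simp add: nE_cmult[OF mE] nE_cmult[OF kE])
  also have "... <= 1 * h + h * (1 + R)" using t h mn hh(1) kn by (intro add_mono mult_mono) (auto simp: less_imp_le)
  also have "... = h * (2 + R)" by (simp add: algebra_simps)
  also have "... <= h * Q" using h Q by (intro mult_left_mono) auto
  finally have dn: "nE d <= h * Q" .
  have hQ: "0 < h * Q" "h * Q <= Q" using h Q by (auto simp: mult_left_le_one_le)
  have "nE y <= nE u + nE d" unfolding y_def by (rule nE_add[OF u dE])
  moreover have "h * Q <= 1/2 * Q" using h Q by (intro mult_right_mono) auto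
  ultimately have yn: "nE y <= Q" using n(1) dn R unfolding Q_def by argo
  have 1: "II y <= II u + dI u d + C1 * (h * Q)^2" using C1(2)[OF u dE nQ(1) dn hQ] unfolding y_def by linarith
  have 2: "dI u d = t * dI u m + h * ((1 - t) * dI u w + t * dI u z)"
   unfolding d_def dI_lin[OF u mE kE] unfolding k_def dI_lin[OF u w z] ..
  have "abs (dI u m) <= C1 * h^2" by (rule C1(3)[OF u mE nQ(1) mn hh(2)])
  then have "t * dI u m <= 1 * (C1 * h^2)" using t by (intro order_trans[OF mult_left_mono mult_right_mono]) (auto simp: abs_le_iff)
  then have 3: "t * dI u m <= C1 * h^2" by simp
  have "abs (dI u z - dI v z) <= C2 * h^2 * Q" by (rule C2(2)[OF u v z nQ(1,2) n(3) nQ(3) hh(2,4) Q(1)])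
  then have "h * (t * (dI u z - dI v z)) <= 1 * (1 * (C2 * h^2 * Q))" using t h C2 Q
   by (intro order_trans[OF mult_left_mono[OF mult_left_mono] mult_mono[OF _ mult_right_mono]]) (auto simp: abs_le_iff)
  then have 4: "h * ((1 - t) * dI u w + t * dI u z) <= h * ((1 - t) * dI u w + t * dI v z) + C2 * h^2 * Q" by (simp add: algebra_simps)
  define s where "s = (1 - t) * (h * a) + t * (h * a')"
  have s: "0 <= s" "s <= h"
  proof -
   show "0 <= s" using t h a by (simp add: s_def)
   have "s <= (1 - t) * (h * 1) + t * (h * 1)" unfolding s_def using t h a by (intro add_mono mult_left_mono) auto
   then show "s <= h" by (simp add: algebra_simps)
  qed
  have ny: "(n2 y) ^ 4 <= (Q / sqrt V0) ^ 4"
   using nE_bounds(2)[OF yE] divide_right_mono[OF yn, of "sqrt V0"] V0 by (intro power_mono) auto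
  have "s^2 * (3 * abs (N0 y) + (n2 y) ^ 4) <= h^2 * K"
   using s C1(4)[OF yE yn] ny unfolding K_def by (intro mult_mono power_mono) auto
  then have 5: "II (T s y) <= II y - s * PP y + h^2 * K" using II_T_le[OF yE s(1)] s h by linarith
  have p1: "PP u - C3 * (h * Q) <= PP y" using C3(2)[OF u dE nQ(1) dn hQ] unfolding y_def by linarith
  have "abs (PP (%x. u x + m x) - PP u) <= C3 * h^2" by (rule C3(2)[OF u mE nQ(1) mn hh(2,4)])
  moreover have "(%x. u x + m x) = v" by (simp add: m_def)
  moreover have "C3 * h^2 <= C3 * (h * Q)" using C3 hh h Q by (intro mult_left_mono) (auto simp: power2_eq_square)
  ultimately have p2: "PP v - 2 * (C3 * (h * Q)) <= PP y" using p1 by simp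
  have cQ: "0 <= C3 * (h * Q)" using C3 hQ by simp
  have "(1 - t) * (h * a) * (PP u - 2 * (C3 * (h * Q))) <= (1 - t) * (h * a) * PP y" using t h a p1 cQ by (intro mult_left_mono) auto
  moreover have "t * (h * a') * (PP v - 2 * (C3 * (h * Q))) <= t * (h * a') * PP y" using t h a p2 by (intro mult_left_mono) auto
  ultimately have "(1 - t) * (h * a) * PP u + t * (h * a') * PP v - s * (2 * (C3 * (h * Q))) <= s * PP y" unfolding s_def by (simp add: algebra_simps)
  moreover have "s * (2 * (C3 * (h * Q))) <= h * (2 * (C3 * (h * Q)))" using s cQ by (intro mult_right_mono) auto
  ultimately have 6: "(1 - t) * (h * a) * PP u + t * (h * a') * PP v - h * (2 * (C3 * (h * Q))) <= s * PP y" by linarith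
  have 7: "II (T s y) <= II u + h * ((1 - t) * dI u w + t * dI v z) - ((1 - t) * (h * a) * PP u + t * (h * a') * PP v)
    + (C1 * (h * Q)^2 + C1 * h^2 + C2 * h^2 * Q + h * (2 * (C3 * (h * Q))) + h^2 * K)"
   using 1 2 3 4 5 6 by linarith
  have 8: "C1 * (h * Q)^2 + C1 * h^2 + C2 * h^2 * Q + h * (2 * (C3 * (h * Q))) + h^2 * K = (C - C4) * h^2"
   unfolding C_def by (simp add: power2_eq_square algebra_simps)
  have 9: "0 <= C4 * h^2" using C4 by simp
  have ye: "(%x. (1 - t) * (u x + h * w x) + t * (v x + h * z x)) = y" unfolding y_def d_def k_def m_def by (simp add: algebra_simps)
  have "II (T s y) <= II u + h * ((1 - t) * (dI u w - a * PP u) + t * (dI v z - a' * PP v)) + C * h^2"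
   using 7 9 unfolding 8 by (simp add: algebra_simps)
  moreover have "abs (II u - II v) <= C * h^2"
  proof -
   have "0 <= (C - C4) * h^2" unfolding C_def using C1 C2 C3 K0 Q by (intro mult_nonneg_nonneg) auto
   then show ?thesis using C4(2)[OF u v nQ(2) n(3) hh(2,4)] by (simp add: algebra_simps)
  qed
  ultimately show "II (T ((1 - t) * (h * a) + t * (h * a')) (%x. (1 - t) * (u x + h * w x) + t * (v x + h * z x)))
   <= II u + h * ((1 - t) * (dI u w - a * PP u) + t * (dI v z - a' * PP v)) + C * h^2 \<and> abs (II u - II v) <= C * h^2" unfolding ye s_def by simp
 qed
qed

text \<open>One step of the deformation. \<open>NG\<close> denies almost critical points between
  \<open>al0\<close> and \<open>M\<close>, so every node at these levels has a descent direction or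
  a large \<open>PP\<close>, and its energy drops at rate more than \<open>epp\<close>. Half of the
  gain \<open>h * epp\<close> pays for the second-order error. Nodes below \<open>al0\<close> are
  not moved, which fixes both endpoints.\<close>

lemma chain_descent:
 assumes eps: "epp > 0" and a0: "al0 > 0" and R: "R >= 1"
  and NG: "!!u. u : E ==> al0 <= II u ==> II u <= M ==> (EX w:E. nE w <= 1 + nE u \<and> dI u w < - epp) \<or> PP u > epp"
  and e: "e : E" "II e < al0"
 obtains h0 where "h0 > 0" "h0 <= 1/2" "!!h M' r. 0 < h ==> h <= h0 ==> M' <= M ==> r <= R ==> (!!d. d > 0 ==> (stp d M' r)\<^sup>*\<^sup>* (%x. 0) e) ==>
  (!!d. d > 0 ==> (stp d (max (M' - h * epp / 2) (2 * al0)) ((1 + bee / V0 * h) * (r + h * (1 + r))))\<^sup>*\<^sup>* (%x. 0) e)"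
proof (rule descent[OF R], goal_cases)
 case (1 C)
 note C = 1(2-)
 \<comment> \<open>These bounds make the error \<open>C * h^2\<close> at most half of the gain, and
   at most \<open>al0 / 2\<close> for the transition across the level \<open>al0\<close>.\<close>
 define h0 where "h0 = min (1/2) (min (epp / (2 * C)) (al0 / (2 * C)))"
 have h0: "h0 > 0" "h0 <= 1/2" "h0 <= epp / (2 * C)" "h0 <= al0 / (2 * C)" using eps a0 C by (auto simp: h0_def)
 \<comment> \<open>A node gets a direction and a dilation rate: rate 0 if a descent direction
   exists, no direction and rate 1 if \<open>PP u\<close> is large, and neither below
   \<open>al0\<close>.\<close>
 have "EX wa. u : E \<and> II u <= M --> fst wa : E \<and> nE (fst wa) <= 1 + nE u \<and> snd wa : {0..1::real} \<and>
   dI u (fst wa) - snd wa * PP u <= (if II u < al0 then 0 else - epp) \<and> (II u < al0 --> wa = (%x. 0, 0))" for u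
 proof (cases "u : E \<and> al0 <= II u \<and> II u <= M")
  case True
  have d0: "dI u (%x. 0) = 0" using dI_cmult[OF _ E_zero, of u 0] True by simp
  from True consider w where "w : E" "nE w <= 1 + nE u" "dI u w < - epp" | "PP u > epp" using NG by blast
  then show ?thesis
  proof cases
   case 1
   then show ?thesis using True by (intro exI[of _ "(w, 0)"]) auto
  next
   case 2
   then show ?thesis using True E_zero nE_zero d0 by (intro exI[of _ "(%x. 0, 1)"]) auto
  qed
 next
  case False
  have "u : E ==> dI u (%x. 0) = 0" using dI_cmult[OF _ E_zero, of u 0] by simp
  then show ?thesis using False E_zero nE_zero by (intro exI[of _ "(%x. 0, 0)"]) (auto simp: add_nonneg_nonneg)
 qed
 then obtain wa where wa: "!!u. u : E \<and> II u <= M --> fst (wa u) : E \<and> nE (fst (wa u)) <= 1 + nE u \<and> snd (wa u) : {0..1::real} \<and>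
   dI u (fst (wa u)) - snd (wa u) * PP u <= (if II u < al0 then 0 else - epp) \<and> (II u < al0 --> wa u = (%x. 0, 0))" by metis
 define w a where "w u = fst (wa u)" and "a u = snd (wa u)" for u
 have W: "w u : E" "nE (w u) <= 1 + nE u" "a u : {0..1}" "dI u (w u) - a u * PP u <= (if II u < al0 then 0 else - epp)" if "u : E" "II u <= M" for u
  using wa[of u] that by (auto simp: w_def a_def)
 show ?thesis
 proof (rule that[OF h0(1,2)])
  fix h M' r and d :: real
  assume h: "0 < h" "h <= h0" and M': "M' <= M" and r: "r <= R" and ch: "!!d. d > 0 ==> (stp d M' r)\<^sup>*\<^sup>* (%x. 0) e" and d: "d > 0"
  define ph where "ph u = T (h * a u) (%x. u x + h * w u x)" for u
  define M1 where "M1 = max (M' - h * epp / 2) (2 * al0)"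
  define r1 where "r1 = (1 + bee / V0 * h) * (r + h * (1 + r))"
  have h12: "h <= 1/2" using h h0 by simp
  have Ch: "C * h^2 <= h * epp / 2" "C * h^2 <= al0 / 2"
  proof -
   have "C * h <= C * (epp / (2 * C))" "C * h <= C * (al0 / (2 * C))" using h h0 C(1) by (intro mult_left_mono; simp)+
   then have c: "C * h <= epp / 2" "C * h <= al0 / 2" using C(1) by auto
   have "h * (C * h) <= h * (epp / 2)" using c(1) h by (intro mult_left_mono) auto
   then show "C * h^2 <= h * epp / 2" by (simp add: power2_eq_square mult_ac)
   have "h * (C * h) <= 1 * (al0 / 2)" using c(2) h h12 C(1) by (intro mult_mono) auto
   then show "C * h^2 <= al0 / 2" by (simp add: power2_eq_square mult_ac)
  qed
  have idle: "ph u = u" if "u : E" "II u < al0" "II u <= M" for u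
   using wa[of u] that by (simp add: ph_def w_def a_def T_def dil_def)
  have seg: "(stp d M1 r1)\<^sup>*\<^sup>* (ph u) (ph v)" if uv: "stp (h^2) M' r u v" for u v
  proof -
   have u: "u : E" "II u <= M" "II u <= M'" "nE u <= r" "nE u <= R" and v: "v : E" "II v <= M" "II v <= M'" "nE v <= r" "nE v <= R" and uvd: "nE (%x. u x - v x) <= h^2"
    using uv M' r unfolding stp_def by auto
   note Wu = W[OF u(1,2)] and Wv = W[OF v(1,2)]
   let ?ya = "%x. u x + h * w u x" and ?yb = "%x. v x + h * w v x"
   have y: "?ya : E" "?yb : E" using E_add[OF u(1) E_cmult[OF Wu(1)]] E_add[OF v(1) E_cmult[OF Wv(1)]] by auto
   have s: "h * a u : {0..1/2}" "h * a v : {0..1/2}" using h h12 Wu(3) Wv(3) mult_mono[of h "1/2" "a u" 1] mult_mono[of h "1/2" "a v" 1] by auto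
   define g where "g = (%t. T ((1 - t) * (h * a u) + t * (h * a v)) (%x. (1 - t) * ?ya x + t * ?yb x))"
   have g01: "g 0 = ph u" "g 1 = ph v" by (auto simp: g_def ph_def)
   have gt: "g t : E \<and> II (g t) <= M1 \<and> nE (g t) <= r1" if t: "t : {0..1}" for t
   proof -
    define sg where "sg = (1 - t) * (h * a u) + t * (h * a v)"
    let ?yt = "%x. (1 - t) * ?ya x + t * ?yb x"
    have yE: "?yt : E" by (rule E_lincomb[OF y])
    have sgh: "0 <= sg" "sg <= h"
    proof -
     show "0 <= sg" using t s by (simp add: sg_def)
     have "sg <= (1 - t) * (h * 1) + t * (h * 1)" unfolding sg_def using t h Wu(3) Wv(3) by (intro add_mono mult_left_mono) auto
     then show "sg <= h" by (simp add: algebra_simps)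
    qed
    then have sg: "0 <= sg" "sg <= 1/2" using h12 by auto
    have n0: "nE ?ya <= r + h * (1 + r)"
    proof -
     have "nE ?ya <= nE u + h * nE (w u)" using nE_add[OF u(1) E_cmult[OF Wu(1)], of h] nE_cmult[OF Wu(1), of h] h by simp
     also have "... <= r + h * (1 + r)" using u(4) Wu(2) h by (intro add_mono mult_left_mono) auto
     finally show ?thesis .
    qed
    have n1: "nE ?yb <= r + h * (1 + r)"
    proof -
     have "nE ?yb <= nE v + h * nE (w v)" using nE_add[OF v(1) E_cmult[OF Wv(1)], of h] nE_cmult[OF Wv(1), of h] h by simp
     also have "... <= r + h * (1 + r)" using v(4) Wv(2) h by (intro add_mono mult_left_mono) auto
     finally show ?thesis .
    qed
    have "nE ?yt <= nE (%x. (1 - t) * ?ya x) + nE (%x. t * ?yb x)" by (intro nE_add E_cmult y)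
    also have "... = (1 - t) * nE ?ya + t * nE ?yb" using t by (simp add: nE_cmult[OF y(1)] nE_cmult[OF y(2)])
    also have "... <= (1 - t) * (r + h * (1 + r)) + t * (r + h * (1 + r))" using t n0 n1 by (intro add_mono mult_left_mono) auto
    finally have ny: "nE ?yt <= r + h * (1 + r)" by (simp add: algebra_simps)
    have gE: "g t : E" unfolding g_def sg_def[symmetric] using dil_E[OF yE T_range[OF sg]] by (simp add: T_def)
    have "nE (g t) <= (1 + bee / V0 * sg) * nE ?yt" unfolding g_def sg_def[symmetric] by (rule V_T_le(2)[OF yE sg])
    also have "... <= r1" unfolding r1_def using ny sgh ab V0 by (intro mult_mono add_mono mult_left_mono) auto
    finally have gn: "nE (g t) <= r1" .
    have wR: "nE (w u) <= 1 + R" "nE (w v) <= 1 + R" using Wu(2) Wv(2) u(5) v(5) by auto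
    define Du Dv where "Du = dI u (w u) - a u * PP u" and "Dv = dI v (w v) - a v * PP v"
    have key: "II (g t) <= II u + h * ((1 - t) * Du + t * Dv) + C * h^2" "abs (II u - II v) <= C * h^2"
     using C(2)[OF u(1) v(1) Wu(1) Wv(1) u(5) v(5) uvd wR h(1) h12 Wu(3) Wv(3) t] unfolding g_def Du_def Dv_def by auto
    have "II (g t) <= M1"
    proof (cases "II u < al0 \<or> II v < al0")
     case True
     \<comment> \<open>One of the two nodes may be idle, so no gain can be claimed on this segment.
       But then its energy is already close to \<open>al0\<close>, and it stays below
       \<open>2 * al0\<close>.\<close>
     have "Du <= 0" "Dv <= 0" using Wu(4) Wv(4) eps unfolding Du_def Dv_def by (auto split: if_splits)
     then have "h * ((1 - t) * Du + t * Dv) <= 0" using h t by (intro mult_nonneg_nonpos add_nonpos_nonpos) auto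
     moreover have "II u <= al0 + C * h^2" using True key(2) C(1) by auto
     ultimately have "II (g t) <= 2 * al0" using key(1) Ch(2) by linarith
     then show ?thesis by (simp add: M1_def)
    next
     case False
     then have "Du <= - epp" "Dv <= - epp" using Wu(4) Wv(4) unfolding Du_def Dv_def by auto
     then have "(1 - t) * Du + t * Dv <= (1 - t) * (- epp) + t * (- epp)" using t by (intro add_mono mult_left_mono) auto
     then have "h * ((1 - t) * Du + t * Dv) <= h * (- epp)" using h by (intro mult_left_mono) (auto simp: algebra_simps)
     then have "II (g t) <= M' - h * epp / 2" using key(1) Ch(1) u(3) by simp
     then show ?thesis by (simp add: M1_def)
    qed
    then show ?thesis using gE gn by simp
   qed
   have "(stp d M1 r1)\<^sup>*\<^sup>* (g 0) (g 1)"
   proof (rule path_chain[OF gt])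
    fix X and t :: real assume X: "!!n. X n : {0..1}" "t : {0..1}" "X ---> t"
    show "(%n. nE (%x. g (X n) x - g t x)) ---> 0" unfolding g_def by (rule T_path_continuous[OF y s X])
   qed (use d in auto)
   then show ?thesis by (simp add: g01)
  qed
  have hp: "h^2 > 0" using h by simp
  have "(stp d M1 r1)\<^sup>*\<^sup>* (ph (%x. 0)) (ph v)" if "(stp (h^2) M' r)\<^sup>*\<^sup>* (%x. 0) v" for v
   using that by (induction rule: rtranclp_induct) (auto intro: rtranclp_trans seg)
  from this[OF ch[OF hp]] have c: "(stp d M1 r1)\<^sup>*\<^sup>* (ph (%x. 0)) (ph e)" .
  have z: "II (%x. 0) = 0"
  proof -
   have "dI (%x. 0) (%x. 0) = 0" using dI_cmult[OF E_zero E_zero, of 0] by simp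
   moreover have "qV (%x. 0) (%x. 0) = 0" using qV_nonneg[of "%x. 0"] qV_nE(2)[OF E_zero] nE_zero by simp
   ultimately show ?thesis using p unfolding Ifun_def normV_sq_eq by (simp add: N0_def Lp_pow_def)
  qed
  show "(stp d (max (M' - h * epp / 2) (2 * al0)) ((1 + bee / V0 * h) * (r + h * (1 + r))))\<^sup>*\<^sup>* (%x. 0) e"
  proof (cases "0 <= M \<and> II e <= M")
   case True
   then show ?thesis using c idle[OF E_zero] idle[OF e] z a0 unfolding M1_def r1_def by simp
  next
   case False
   \<comment> \<open>The nodes of a nontrivial chain have energy at most \<open>M'\<close>, hence at
     most \<open>M\<close>; so in this case the chain must be empty and its endpoints
     coincide.\<close>
   from ch[OF hp] have "(%x. 0) = e \<or> (EX v. stp (h^2) M' r (%x. 0) v) \<and> (EX v. stp (h^2) M' r v e)"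
    by (metis converse_rtranclpE rtranclp.cases)
   then show ?thesis
   proof
    assume "(EX v. stp (h^2) M' r (%x. 0) v) \<and> (EX v. stp (h^2) M' r v e)"
    then have "II (%x. 0) <= M'" "II e <= M'" unfolding stp_def by auto
    then show ?thesis using False M' z by simp
   qed simp
  qed
 qed
qed


section \<open>Mountain pass geometry and the almost critical points\<close>

lemma qV_dest:
 assumes u: "u : E" and t: "qV u u <= t^2" "0 <= t"
 shows "n2 (wgrad u) <= t" "n2 u <= t / sqrt V0" "V0 * (n2 u)^2 <= qV u u"
proof -
 note d = E_dest[OF u]
 have v: "0 <= (LI x. V x * (u x)^2)" using Wpos(5) by (intro integral_nonneg_AE) (auto simp: less_imp_le)
 have "(n2 (wgrad u))^2 <= t^2" using t(1) v unfolding qV_nE(1)[OF u] by simp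
 then show "n2 (wgrad u) <= t" by (rule power2_le_imp_le[OF _ t(2)])
 have "V0 * (n2 u)^2 = (LI x. V0 * (u x)^2)" by (simp add: n2_sq)
 also have "... <= (LI x. V x * (u x)^2)" using d L2_integrable[OF d(7)] V0(2) by (intro integral_mono mult_right_mono) auto
 also have "... <= qV u u" unfolding qV_nE(1)[OF u] by simp
 finally show v0: "V0 * (n2 u)^2 <= qV u u" .
 then have "(n2 u)^2 <= (t / sqrt V0)^2" using V0 t(1) by (simp add: power_divide field_simps)
 then show "n2 u <= t / sqrt V0" by (rule power2_le_imp_le) (use t V0 in auto)
qed

lemma s1_sq: "s1 (%x. (u x)^2) = (n2 u)^2" by (simp add: s1_def n2_sq)

text \<open>All these quantities are controlled by the norm of \<open>H_V\<close> alone. The part of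
  the kernel that would require the logarithmic weight is nonnegative, and is dropped in the lower
  bound for \<open>N0\<close>.\<close>

lemma V_bounds:
 obtains C where "C > 0" "!!u t. u : E ==> qV u u <= t^2 ==> 0 < t ==> Lq u <= C * (n2 u)^2 * t powr (p - 2)"
  "!!u t. u : E ==> qV u u <= t^2 ==> 0 < t ==> l3 u <= C * t"
  "!!u t. u : E ==> qV u u <= t^2 ==> 0 < t ==> abs (Bk lgm (%x. (u x)^2) (%x. (u x)^2)) <= C * t ^ 4"
  "!!u t. u : E ==> qV u u <= t^2 ==> 0 < t ==> - C * t ^ 4 <= N0 u"
proof (rule Lp_bound[OF p], goal_cases)
 case (1 C)
 note C = 1(2-)
 have p3: "2 < (3::real)" "3 < (4::real)" by auto
 obtain C3 where C3: "C3 > 0" "!!u N. u : E ==> N > 0 ==> n2 (wgrad u) <= N ==> li (%x. abs (u x) powr 3) \<and> (LI x. abs (u x) powr 3) <= C3 * (n2 u)^2 * N powr (3 - 2)"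
  by (rule Lp_bound[OF p3]) (rule that)
 define K where "K = (C3 / V0) powr (1/3)"
 have K: "K > 0" using C3 V0 by (simp add: K_def)
 have l3: "l3 u <= K * t" if u: "u : E" "qV u u <= t^2" "0 < t" for u t
 proof -
  note q = qV_dest[OF u(1,2) less_imp_le[OF u(3)]]
  have "(n2 u)^2 <= t^2 / V0" using q(3) u(2) V0 by (simp add: field_simps)
  then have "C3 * (n2 u)^2 * t <= C3 * (t^2 / V0) * t" using C3(1) u(3) by (intro mult_right_mono mult_left_mono) auto
  then have "(LI x. abs (u x) powr 3) <= (C3 / V0) * t powr 3" using C3(2)[OF u(1,3) q(1)] u(3) by (simp add: powr_numeral power2_eq_square eval_nat_numeral mult_ac)
  then have "l3 u <= ((C3 / V0) * t powr 3) powr (1/3)" unfolding l3_def by (intro powr_mono2) (auto intro!: integral_nonneg_AE)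
  also have "... = K * (t powr 3) powr (1/3)" unfolding K_def using C3(1) V0(1) u(3) by (intro powr_mult)
  also have "(t powr 3) powr (1/3) = t" unfolding powr_powr using u(3) by simp
  finally show ?thesis .
 qed
 define D where "D = (lgc + 1) * (1 / V0) * K^2"
 have D: "D > 0" unfolding D_def using lgc_nonneg K V0 by (simp add: add_nonneg_pos)
 have B: "abs (Bk lgm (%x. (u x)^2) (%x. (u x)^2)) <= D * t ^ 4" if u: "u : E" "qV u u <= t^2" "0 < t" for u t
 proof -
  note q = qV_dest[OF u(1,2) less_imp_le[OF u(3)]]
  have n: "(n2 u)^2 <= t^2 / V0" using q(3) u(2) V0 by (simp add: field_simps)
  have l30: "0 <= l3 u" by (simp add: l3_def)
  have "sQ (%x. (u x)^2) <= l3 u * l3 u" using Dl_mult(4)[OF u(1) u(1)] by (simp add: power2_eq_square)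
  also have "... <= (K * t) * (K * t)" using l3[OF u] l30 by (intro mult_mono) auto
  finally have sq: "sQ (%x. (u x)^2) <= (K * t) * (K * t)" .
  have "abs (Bk lgm (%x. (u x)^2) (%x. (u x)^2)) <= (lgc + 1) * s1 (%x. (u x)^2) * sQ (%x. (u x)^2)" by (rule Bk_lgm(2)[OF Dl_sq[OF u(1)] Dl_sq[OF u(1)]])
  also have "... <= (lgc + 1) * (t^2 / V0) * ((K * t) * (K * t))" unfolding s1_sq
   using lgc_nonneg n sq V0 by (intro mult_mono) (auto simp: sQ_def)
  also have "... = D * t ^ 4" unfolding D_def by (simp add: eval_nat_numeral)
  finally show ?thesis .
 qed
 show ?thesis
 proof (rule that[of "C + K + D"])
  show "C + K + D > 0" using C K D by simp
  fix u t assume u: "u : E" "qV u u <= t^2" "0 < t"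
  note q = qV_dest[OF u(1,2) less_imp_le[OF u(3)]]
  have "Lq u <= C * (n2 u)^2 * t powr (p - 2)" using C(2)[OF u(1,3) q(1)] by (simp add: Lq_eq)
  also have "... <= (C + K + D) * (n2 u)^2 * t powr (p - 2)" using K D by (intro mult_right_mono) auto
  finally show "Lq u <= (C + K + D) * (n2 u)^2 * t powr (p - 2)" .
  have "K * t <= (C + K + D) * t" using C D u by (intro mult_right_mono) auto
  then show "l3 u <= (C + K + D) * t" using l3[OF u] by linarith
  have "D * t ^ 4 <= (C + K + D) * t ^ 4" using C K by (intro mult_right_mono) auto
  then show b: "abs (Bk lgm (%x. (u x)^2) (%x. (u x)^2)) <= (C + K + D) * t ^ 4" using B[OF u] by linarith
  have "0 <= Bk lgp (%x. (u x)^2) (%x. (u x)^2)" unfolding Bk_def by (intro integral_nonneg_AE) (auto simp: lgp_nonneg)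
  then have "- ((C + K + D) * t ^ 4) <= BB (%x. (u x)^2) (%x. (u x)^2)" unfolding BB_def using b by linarith
  then have "- ((C + K + D) * t ^ 4) / (2 * pi) <= N0 u" unfolding N0_eq[OF u(1)] by (rule divide_right_mono) simp
  moreover have "(C + K + D) * t ^ 4 / (2 * pi) <= (C + K + D) * t ^ 4 / 1" using C K D u(3) pi_gt3 by (intro divide_left_mono) auto
  ultimately show "- (C + K + D) * t ^ 4 <= N0 u" unfolding minus_mult_left[symmetric] by simp
 qed
qed

lemma dI_self: "u : E ==> dI u u = qV u u + N0 u - b * Lq u"
proof -
 have "abs t powr (p - 2) * t * t = abs t powr p" for t :: real
 proof (cases "t = 0")
  case False
  then have "abs t powr p = abs t powr (p - 2) * abs t powr 2" unfolding powr_add[symmetric] by simp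
  also have "abs t powr 2 = t * t" using False by (simp add: powr_numeral power2_eq_square)
  finally show ?thesis by simp
 qed simp
 then show "u : E ==> dI u u = qV u u + N0 u - b * Lq u"
  unfolding dI_def B4_def Ap_def Lq_eq by (simp add: N0_eq power2_eq_square)
qed

text \<open>The small ball is taken in the norm of \<open>H_V\<close>, where \<open>N0\<close> is
  bounded below by a quartic and the power term is of order \<open>p > 2\<close>. No smallness of
  the logarithmic moment is required.\<close>

lemma geometry:
 obtains r where "r > 0" "!!u. u : E ==> qV u u <= r^2 ==> 0 < qV u u ==> qV u u / 4 <= II u"
  "!!u. u : E ==> qV u u <= r^2 ==> 0 < qV u u ==> 0 < dI u u"
proof (rule V_bounds, goal_cases)
 case (1 C)
 note C = 1(2,3,6)
 define K where "K = b / p * C / V0"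
 have K: "K > 0" using b p C V0 by (simp add: K_def)
 \<comment> \<open>The first bound gives \<open>N0 u >= - A / 2\<close>, the second gives
   \<open>b / p * Lq u <= A / 8\<close>. So the energy is at least A/2 - A/8 - A/8, and the Nehari
   quantity at least A - A/2 - p A / 8, positive because \<open>p < 4\<close>.\<close>
 define r where "r = min (sqrt (1 / (2 * C))) ((1 / (8 * K)) powr (1 / (p - 2)))"
 have r: "r > 0" using C K by (simp add: r_def)
 have "r^2 <= (sqrt (1 / (2 * C)))^2" using r by (intro power_mono) (auto simp: r_def)
 then have r2: "r^2 <= 1 / (2 * C)" using C by simp
 have "r powr (p - 2) <= ((1 / (8 * K)) powr (1 / (p - 2))) powr (p - 2)" using r p by (intro powr_mono2) (auto simp: r_def)
 also have "... = 1 / (8 * K)" using p K by (simp add: powr_powr)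
 finally have rp: "r powr (p - 2) <= 1 / (8 * K)" .
 show ?thesis
 proof (rule that[OF r])
  fix u assume u: "u : E" "qV u u <= r^2" "0 < qV u u"
  define A where "A = qV u u"
  define t where "t = sqrt A"
  have t: "0 < t" "t^2 = A" "qV u u <= t^2" using u(3) by (auto simp: t_def A_def)
  have "t^2 <= r^2" using t u(2) by (simp add: A_def)
  then have tr: "t <= r" by (rule power2_le_imp_le) (use r in simp)
  have "C * t ^ 4 = C * (t^2 * A)" using t(2)[symmetric] by (simp add: eval_nat_numeral)
  also have "... <= C * (1 / (2 * C) * A)" using \<open>t^2 <= r^2\<close> r2 C u(3) by (intro mult_left_mono mult_right_mono) (auto simp: A_def)
  finally have 1: "C * t ^ 4 <= A / 2" using C by simp
  have n: "(n2 u)^2 <= A / V0" using qV_dest(3)[OF u(1) t(3)] t V0 by (simp add: A_def field_simps)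
  have "t powr (p - 2) <= 1 / (8 * K)" using powr_mono2[of "p - 2" t r] t tr p rp by simp
  then have "C * (n2 u)^2 * t powr (p - 2) <= C * (A / V0) * (1 / (8 * K))" using n C V0 u(3) by (intro mult_mono) (auto simp: A_def)
  then have "b / p * Lq u <= b / p * (C * (A / V0) * (1 / (8 * K)))" using C(2)[OF u(1) t(3) t(1)] b p by (intro mult_left_mono) auto
  also have "... = K * A / (8 * K)" by (simp add: K_def)
  also have "... = A / 8" using K by simp
  finally have 2: "b / p * Lq u <= A / 8" .
  have 3: "- (A / 2) <= N0 u" using C(3)[OF u(1) t(3) t(1)] 1 by simp
  show "qV u u / 4 <= II u" unfolding Ifun_def normV_sq_eq Lq_def[symmetric] A_def[symmetric] using 2 3 by linarith
  have "b * Lq u = p * (b / p * Lq u)" using p by simp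
  also have "... <= p * (A / 8)" using p 2 by (intro mult_left_mono) auto
  also have "... < 4 * (A / 8)" using p u(3) by (intro mult_strict_right_mono) (auto simp: A_def)
  finally show "0 < dI u u" unfolding dI_self[OF u(1)] A_def[symmetric] using 3 by linarith
 qed
qed

lemma II_scale:
 assumes u: "u : E" and t: "0 <= t"
 shows "II (%x. t * u x) = t^2 * qV u u / 2 + t ^ 4 * N0 u / 4 - b / p * (t powr p * Lq u)" "qV (%x. t * u x) (%x. t * u x) = t^2 * qV u u"
proof -
 have q1: "qV v (%x. t * u x) = t * qV v u" if "v : E" for v using qV_lin[OF that u u, of t 0] by simp
 show q: "qV (%x. t * u x) (%x. t * u x) = t^2 * qV u u"
  using q1[OF E_cmult[OF u, of t]] q1[OF u] qV_sym[of "%x. t * u x" u] by (simp add: power2_eq_square)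
 have "N0 (%x. t * u x) = (1 / (2 * pi)) * (LI x. LI y. t ^ 4 * (ln (norm (x - y)) * (u x)^2 * (u y)^2))"
  unfolding N0_def by (simp add: power_mult_distrib eval_nat_numeral mult_ac)
 then have N: "N0 (%x. t * u x) = t ^ 4 * N0 u" by (simp add: N0_def)
 have L: "Lq (%x. t * u x) = t powr p * Lq u" unfolding Lq_eq using t by (simp add: abs_mult powr_mult)
 show "II (%x. t * u x) = t^2 * qV u u / 2 + t ^ 4 * N0 u / 4 - b / p * (t powr p * Lq u)"
  unfolding Ifun_def normV_sq_eq Lq_def[symmetric] q N L ..
qed

lemma E_test_fun:
 assumes f: "test_fun f" shows "f : E"
proof -
 obtain R B where R: "R > 0" "continuous_on UNIV f" "!!x. norm x >= R ==> f x = 0" by (rule test_fun_bounds[OF f]) (rule that)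
 have Wc: "continuous_on UNIV W" unfolding W_def lw_def by (intro continuous_intros Vc) (auto simp: add_nonneg_eq_0_iff)
 have c: "continuous_on UNIV (%x. sqrt (W x) * f x)" by (intro continuous_intros Wc R(2))
 have "compact ((%x. norm (sqrt (W x) * f x)) ` cball 0 R)" by (intro compact_continuous_image continuous_intros continuous_on_subset[OF Wc] continuous_on_subset[OF R(2)]) auto
 then have "bdd_above ((%x. norm (sqrt (W x) * f x)) ` cball 0 R)" by (intro bounded_imp_bdd_above compact_imp_bounded)
 then obtain B where "ALL y:(%x. norm (sqrt (W x) * f x)) ` cball 0 R. y <= B" unfolding bdd_above_def by blast
 then have B: "!!x. x : cball 0 R ==> norm (sqrt (W x) * f x) <= B" by simp
 have "L2 (%x. sqrt (W x) * f x)"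
 proof (rule L2_bounded_support[of _ "max 0 B" R])
  show "lm (%x. sqrt (W x) * f x)" by (rule continuous_lebesgue_measurable[OF c])
  show "norm (sqrt (W x) * f x) <= max 0 B" for x using B[of x] R(3)[of x] by (cases "norm x <= R") (auto simp: max_def)
 qed (use R(3) in auto)
 then have "li (%x. W x * (f x)^2)" using Wpos(2) by (auto simp: L2_def power_mult_distrib less_imp_le)
 moreover have "lm f" by (rule continuous_lebesgue_measurable[OF R(2)])
 ultimately show ?thesis by (intro E_intro[OF _ weak_grad_test_fun[OF f] L2_test_fun_cgrad[OF f]])
qed

text \<open>Compressing by 2 divides \<open>N0\<close> by 16 after subtracting a multiple of
  (mass)^2, and that multiple scales by 16^-k as well. So \<open>16^k * N0\<close> falls by the same
  amount \<open>c\<close> at every step and eventually becomes negative.\<close>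

lemma N0_negative:
 obtains u where "u : E" "n2 u > 0" "N0 u < 0"
proof -
 define f where "f = (%y. kern 1 ((0::R2) - y))"
 have f: "f : E" unfolding f_def by (rule E_test_fun[OF test_fun_kern]) simp
 have n: "n2 f > 0"
 proof (rule ccontr)
  assume "\<not> n2 f > 0"
  then have "n2 f = 0" using n2_nonneg[of f] by linarith
  then have "AE x in lebesgue. f x = 0" using n2_eq_0[OF E_dest(7)[OF f]] by simp
  then have "(LI x. f x) = 0" by (rule integral_eq_zero_AE)
  then have "bumpc / bumpc = 0" by (simp add: f_def kern_def bump_minus bumpc_def)
  then show False using bumpc_pos by simp
 qed
 define c where "c = ln 2 / (2 * pi) * (n2 f) ^ 4"
 have c: "c > 0" using n by (simp add: c_def)
 have "EX u:E. n2 u = n2 f / 2 ^ k \<and> N0 u = (N0 f - real k * c) / 16 ^ k" for k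
 proof (induction k)
  case 0
  then show ?case using f by auto
 next
  case (Suc k)
  then obtain u where u: "u : E" "n2 u = n2 f / 2 ^ k" "N0 u = (N0 f - real k * c) / 16 ^ k" by auto
  have e: "(2 ^ k) ^ 4 = (16::real) ^ k" by (simp add: power_mult[symmetric] mult.commute[of k]) (simp add: power_mult)
  have "N0 (dil 2 u) = (N0 u - ln 2 * (n2 u) ^ 4 / (2 * pi)) / 2 ^ 4" by (rule N0_dil[OF u(1)]) auto
  also have "... = (N0 f - real (Suc k) * c) / 16 ^ Suc k" unfolding u c_def power_divide e by (simp add: field_simps)
  finally show ?case using dil_E[OF u(1), of 2] n2_dil[OF u(1), of 2] u(2) by (intro bexI[of _ "dil 2 u"]) auto
 qed
 moreover obtain k :: nat where k: "N0 f < real k * c" using reals_Archimedean3[OF c] by blast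
 ultimately obtain u where u: "u : E" "n2 u = n2 f / 2 ^ k" "N0 u = (N0 f - real k * c) / 16 ^ k" by blast
 show ?thesis by (rule that[OF u(1)]) (use u n k in \<open>auto simp: divide_less_0_iff\<close>)
qed

text \<open>Because \<open>p < 4\<close> the quartic term decides for large amplitudes, so a
  multiple of a function with negative \<open>N0\<close> is taken; the power term has a favourable
  sign and is discarded.\<close>

lemma II_negative:
 obtains e where "e : E" "II e < 0" "0 < qV e e"
proof -
 obtain u where u: "u : E" "n2 u > 0" "N0 u < 0" by (rule N0_negative) (rule that)
 define A where "A = qV u u"
 have A: "A > 0" using qV_dest(3)[OF u(1), of "sqrt (qV u u)"] qV_nonneg[of u] u(2) V0 unfolding A_def
  by (metis (no_types) order_refl real_sqrt_pow2 real_sqrt_ge_zero order_less_le_trans mult_pos_pos zero_less_power)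
 \<comment> \<open>Chosen so that t^2 N0 = t N0 - 2 A t: the last part cancels the quadratic term
   \<open>t * A / 2\<close> and leaves \<open>t * N0 / 4 < 0\<close>.\<close>
 define t where "t = 1 - 2 * A / N0 u"
 have t: "t > 1" using A u by (simp add: t_def divide_less_0_iff mult_pos_neg)
 have "t * N0 u = N0 u - 2 * A" using u by (simp add: t_def left_diff_distrib)
 then have "t * (t * N0 u) = t * (N0 u - 2 * A)" by simp
 then have tn: "t^2 * N0 u = t * N0 u - 2 * A * t" by (simp add: power2_eq_square algebra_simps)
 show ?thesis
 proof (rule that[of "%x. sqrt t * u x"])
  show "(%x. sqrt t * u x) : E" by (rule E_cmult[OF u(1)])
  have s: "(sqrt t)^2 = t" "sqrt t ^ 4 = t^2" using t by (auto simp: eval_nat_numeral)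
  show "0 < qV (%x. sqrt t * u x) (%x. sqrt t * u x)" using II_scale(2)[OF u(1), of "sqrt t"] t A s by (simp add: A_def)
  have "0 <= b / p * (sqrt t powr p * Lq u)" using b p Lq_nonneg[of u] by simp
  moreover have "t * N0 u < 0" using t u by (simp add: mult_pos_neg)
  moreover have "t * A / 2 + (t * N0 u - 2 * A * t) / 4 = t * N0 u / 4" by (simp add: field_simps)
  ultimately show "II (%x. sqrt t * u x) < 0" using II_scale(1)[OF u(1), of "sqrt t"] t unfolding s tn A_def[symmetric] by (simp only: real_sqrt_ge_0_iff)
 qed
qed

lemma stp_mono: "(stp d M r)\<^sup>*\<^sup>* x y ==> M <= M' ==> r <= r' ==> (stp d M' r')\<^sup>*\<^sup>* x y"
 by (rule rtranclp_mono[THEN predicate2D]) (auto simp: stp_def)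

text \<open>Otherwise finitely many descent steps would bring a chain from 0 to \<open>e\<close>
  below the level \<open>2 * al0\<close> while keeping it in a fixed ball. Such a chain cannot leave
  the region \<open>qV < r^2 / 4\<close>: its steps are too short to jump over the shell, and inside
  the shell the energy bound forces \<open>qV <= r^2 / 8\<close>. But \<open>e\<close>, having
  negative energy, lies outside.\<close>

lemma mountain_pass:
 obtains M al0 where "al0 > 0" "!!epp. epp > 0 ==> EX u:E. al0 <= II u \<and> II u <= M \<and> PP u <= epp \<and> (ALL w:E. nE w <= 1 + nE u --> - epp <= dI u w)"
proof -
 obtain r where r: "r > 0" "!!u. u : E ==> qV u u <= r^2 ==> 0 < qV u u ==> qV u u / 4 <= II u" by (rule geometry) (rule that)
 have r2: "r^2 > 0" using r(1) by simp
 obtain e where e: "e : E" "II e < 0" "0 < qV e e" by (rule II_negative) (rule that)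
 \<comment> \<open>On the small ball \<open>qV / 4 <= II\<close>, so energy at most
   \<open>2 * al0\<close> means \<open>qV <= r^2 / 8\<close>, strictly inside the barrier
   \<open>r^2 / 4\<close>.\<close>
 define al0 where "al0 = r^2 / 64"
 have a0: "al0 > 0" using r by (simp add: al0_def)
 define M where "M = qV e e / 2 + abs (N0 e) / 4 + 2 * al0"
 have M: "2 * al0 <= M" using e(3) by (simp add: M_def)
 have start: "(stp d M (nE e))\<^sup>*\<^sup>* (%x. 0) e" if d: "d > 0" for d
 proof -
  define g where "g = (%t. T ((1 - t) * 0 + t * 0) (%x. (1 - t) * 0 + t * e x))"
  have ge: "g t = (%x. t * e x)" for t by (simp add: g_def T_def dil_def)
  have "(stp d M (nE e))\<^sup>*\<^sup>* (g 0) (g 1)"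
  proof (rule path_chain)
   fix t :: real assume t: "t : {0..1}"
   have "t^2 * qV e e <= 1 * qV e e" using t qV_nonneg by (intro mult_right_mono) (auto simp: power_le_one)
   moreover have "t ^ 4 * N0 e <= 1 * abs (N0 e)" using t by (intro order_trans[OF mult_left_mono[OF abs_ge_self] mult_right_mono]) (auto simp: power_le_one)
   moreover have "0 <= b / p * (t powr p * Lq e)" using b p Lq_nonneg[of e] by simp
   ultimately have "II (g t) <= M" unfolding ge M_def using II_scale(1)[OF e(1), of t] t a0 by simp
   moreover have "nE (g t) <= nE e" unfolding ge nE_cmult[OF e(1)] using t by (simp add: mult_left_le_one_le)
   ultimately show "g t : E \<and> II (g t) <= M \<and> nE (g t) <= nE e" unfolding ge using E_cmult[OF e(1)] by simp
  next
   fix X and t :: real assume X: "!!n. X n : {0..1}" "t : {0..1}" "X ---> t"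
   show "(%n. nE (%x. g (X n) x - g t x)) ---> 0" unfolding g_def by (rule T_path_continuous[OF E_zero e(1) _ _ X]) auto
  qed (rule d)
  then show ?thesis by (simp add: ge)
 qed
 show ?thesis
 proof (rule that[OF a0], rule ccontr)
  fix epp :: real assume eps: "epp > 0" and "\<not> (EX u:E. al0 <= II u \<and> II u <= M \<and> PP u <= epp \<and> (ALL w:E. nE w <= 1 + nE u --> - epp <= dI u w))"
  then have NG: "(EX w:E. nE w <= 1 + nE u \<and> dI u w < - epp) \<or> PP u > epp" if "u : E" "al0 <= II u" "II u <= M" for u using that by (meson not_le)
  define ka where "ka = bee / V0 + 1"
  have k: "ka > 0" using ab V0 by (simp add: ka_def add_pos_pos)
  \<comment> \<open>The admissible step \<open>h\<close> depends on the ball, so the radius must be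
    known beforehand. It depends only on the total time \<open>N * h <= 2 * M / epp + 1\<close>: one
    step multiplies 1 + radius by at most \<open>exp (ka * h)\<close>, the two summands of
    \<open>ka\<close> coming from the dilation and from the direction.\<close>
  define R where "R = exp (ka * (2 * M / epp + 1)) * (nE e + 1)"
  have M0: "0 <= M" using M a0 by simp
  have R1: "1 <= R" unfolding R_def using mult_mono[of 1 "exp (ka * (2 * M / epp + 1))" 1 "nE e + 1"] k M0 eps by simp
  have e0: "II e < al0" using e(2) a0 by simp
  obtain h where h: "h > 0" "h <= 1/2" and st: "!!M' r d. M' <= M ==> r <= R ==> ALL d>0. (stp d M' r)\<^sup>*\<^sup>* (%x. 0) e ==> d > 0 ==>
   (stp d (max (M' - h * epp / 2) (2 * al0)) ((1 + bee / V0 * h) * (r + h * (1 + r))))\<^sup>*\<^sup>* (%x. 0) e"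
  proof (rule chain_descent[OF eps a0 R1 NG e(1) e0])
   fix h0 assume a: "0 < h0" "h0 <= 1/2" and s: "!!h' M' r d. 0 < h' ==> h' <= h0 ==> M' <= M ==> r <= R ==> (!!d. d > 0 ==> (stp d M' r)\<^sup>*\<^sup>* (%x. 0) e) ==>
    d > 0 ==> (stp d (max (M' - h' * epp / 2) (2 * al0)) ((1 + bee / V0 * h') * (r + h' * (1 + r))))\<^sup>*\<^sup>* (%x. 0) e"
   show thesis by (rule that[OF a]) (rule s[OF a(1) order_refl]; simp)
  qed
  define N where "N = nat \<lceil>2 * M / (h * epp)\<rceil>"
  have N: "2 * M / (h * epp) <= real N" "real N <= 2 * M / (h * epp) + 1" using M0 h eps by (auto simp: N_def)
  define rr where "rr k = exp (ka * h * real k) * (nE e + 1) - 1" for k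
  have rR: "rr k <= R" if "k <= N" for k
  proof -
   have "h * real k <= h * (2 * M / (h * epp) + 1)" using that N h by (intro mult_left_mono) auto
   also have "... = 2 * M / epp + h" using h by (simp add: distrib_left)
   finally have "h * real k <= 2 * M / epp + 1" using h by simp
   then have "ka * h * real k <= ka * (2 * M / epp + 1)" using k by (simp add: mult.assoc mult_left_mono)
   then have "exp (ka * h * real k) * (nE e + 1) <= R" unfolding R_def by (intro mult_right_mono) (auto simp: add_nonneg_nonneg)
   then show ?thesis by (simp add: rr_def)
  qed
  have "(ALL d>0. (stp d (max (M - real k * (h * epp / 2)) (2 * al0)) (rr k))\<^sup>*\<^sup>* (%x. 0) e)" if "k <= N" for k using that
  proof (induction k)
   case 0
   then show ?case using start M by (auto simp: rr_def max_absorb1)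
  next
   case (Suc k)
   show ?case
   proof (intro allI impI)
    fix d :: real assume d: "d > 0"
    let ?M = "max (M - real k * (h * epp / 2)) (2 * al0)"
    have c1: "(stp d ?M (rr k))\<^sup>*\<^sup>* (%x. 0) e" if "d > 0" for d using Suc that by simp
    have he: "0 <= h * epp / 2" using h eps by simp
    then have "real k * (h * epp / 2) >= 0" by simp
    then have MM: "?M <= M" using M by simp
    have kN: "rr k <= R" using rR Suc by simp
    have c2: "(stp d (max (?M - h * epp / 2) (2 * al0)) ((1 + bee / V0 * h) * (rr k + h * (1 + rr k))))\<^sup>*\<^sup>* (%x. 0) e"
     by (rule st[OF MM kN _ d]) (use c1 in simp)
    show "(stp d (max (M - real (Suc k) * (h * epp / 2)) (2 * al0)) (rr (Suc k)))\<^sup>*\<^sup>* (%x. 0) e"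
    proof (rule stp_mono[OF c2])
     have "M - real (Suc k) * (h * epp / 2) = M - real k * (h * epp / 2) - h * epp / 2" by (simp add: algebra_simps)
     then show "max (?M - h * epp / 2) (2 * al0) <= max (M - real (Suc k) * (h * epp / 2)) (2 * al0)" using he by (auto simp: max_def)
     define Y where "Y = exp (ka * h * real k) * (nE e + 1)"
     have Y: "Y >= 0" by (simp add: Y_def add_nonneg_nonneg)
     have bh: "0 <= bee / V0 * h" using ab V0 h by simp
     have "(1 + bee / V0 * h) * (rr k + h * (1 + rr k)) = (1 + bee / V0 * h) * ((1 + h) * Y) - (1 + bee / V0 * h)"
      unfolding rr_def Y_def[symmetric] by (simp add: algebra_simps)
     also have "... <= exp (bee / V0 * h) * (exp h * Y) - 1"
      using bh h Y exp_ge_add_one_self[of "bee / V0 * h"] exp_ge_add_one_self[of h] by (intro diff_mono mult_mono) auto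
     also have "... = rr (Suc k)" 
     proof -
      have "ka * h * real (Suc k) = bee / V0 * h + (h + ka * h * real k)" by (simp add: ka_def algebra_simps add_divide_distrib)
      then have "exp (ka * h * real (Suc k)) = exp (bee / V0 * h) * (exp h * exp (ka * h * real k))" by (simp only: exp_add)
      then show ?thesis unfolding rr_def Y_def by simp
     qed
     finally show "(1 + bee / V0 * h) * (rr k + h * (1 + rr k)) <= rr (Suc k)" .
    qed
   qed
  qed
  note ch = this[of N, OF order_refl, rule_format]
  have "M - real N * (h * epp / 2) <= 0" using N(1) h eps by (simp add: field_simps)
  then have mx: "max (M - real N * (h * epp / 2)) (2 * al0) <= 2 * al0" using a0 by simp
  \<comment> \<open>A step of length \<open>d\<close> in a ball of radius \<open>R\<close> changes
    \<open>qV\<close> by at most \<open>4 * R * d = r^2 / 2\<close>, so from below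
    \<open>r^2 / 4\<close> it stays within the ball \<open>qV <= r^2\<close> where the geometry
    applies.\<close>
  define d where "d = r^2 / (8 * R)"
  have d: "d > 0" using r R1 by (simp add: d_def)
  have c: "(stp d (2 * al0) R)\<^sup>*\<^sup>* (%x. 0) e" by (rule stp_mono[OF ch[OF d] mx rR]) simp
  have "qV v v < r^2 / 4" if "(stp d (2 * al0) R)\<^sup>*\<^sup>* (%x. 0) v" for v using that
  proof (induction rule: rtranclp_induct)
   case base
   have "qV (%x. 0) (%x. 0) <= 0" using qV_nE(2)[OF E_zero] nE_zero by simp
   then show ?case using r2 by linarith
  next
   case (step u v)
   have u: "u : E" "nE u <= R" and v: "v : E" "nE v <= R" "II v <= 2 * al0" and uv: "nE (%x. u x - v x) <= d" using step(2) unfolding stp_def by auto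
   let ?m = "%x. v x - u x"
   have m: "?m : E" "nE ?m <= d" using E_diff[OF v(1) u(1)] uv nE_commute[OF u(1) v(1)] by auto
   have "qV v v = qV v u + qV v ?m" using qV_lin[OF v(1) u(1) m(1), of 1 1] by simp
   moreover have "qV u v = qV u u + qV u ?m" using qV_lin[OF u(1) u(1) m(1), of 1 1] by simp
   ultimately have "qV v v = qV u u + qV u ?m + qV v ?m" using qV_sym[of v u] by simp
   moreover have "abs (qV u ?m) <= 2 * (R * d)" "abs (qV v ?m) <= 2 * (R * d)" by (intro qV_le u v m)+
   moreover have "R * d = r^2 / 8" using R1 by (simp add: d_def)
   ultimately have le: "qV v v <= r^2" using step(3) by linarith
   show ?case
   proof (cases "0 < qV v v")
    case True
    then have "qV v v / 4 <= 2 * al0" using r(2)[OF v(1) le] v(3) by simp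
    then have "qV v v <= r^2 / 8" by (simp add: al0_def)
    then show ?thesis using r2 by linarith
   next
    case False
    then show ?thesis using r2 by linarith
   qed
  qed
  from this[OF c] have "qV e e <= r^2" using r2 by linarith
  then have "qV e e / 4 <= II e" by (rule r(2)[OF e(1) _ e(3)])
  then show False using e by simp
 qed
qed


section \<open>A priori bounds from the energy, Nehari and Pohozaev relations\<close>

lemma le_powr_inverse:
 fixes Z :: real
 assumes "1 <= Z" "0 < e" "Z powr e <= Y" shows "Z <= Y powr (1 / e)"
proof -
 have "(Z powr e) powr (1 / e) <= Y powr (1 / e)" using assms by (intro powr_mono2) auto
 then show ?thesis using assms by (simp add: powr_powr)
qed

text \<open>With q = (n2 u)^2 and c = b * Lq u, eliminating \<open>qV\<close> and \<open>N0\<close>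
  from the energy, \<open>dI u u\<close> and \<open>PP\<close> leaves q^2 / (8 pi) + (2 - 6/p) c <=
  const + bee q / 2. Gagliardo-Nirenberg supplies the second relation: Z = 1 + c satisfies Z^(1 -
  ka) <= K2 (1 + q) with ka = (p - 2) / 2, because \<open>qV\<close> itself is at most of order Z.
  The two relations together bound Z, and with it everything else.\<close>

lemma energy_bound:
 obtains K where "K > 0" "!!u. u : E ==> II u <= M ==> abs (dI u u) <= 1 ==> PP u <= 1 ==> qV u u <= K^2 \<and> N0 u <= K"
proof (rule V_bounds, goal_cases)
 case (1 C)
 note C = 1(2,3)
 define ka where "ka = (p - 2) / 2"
 have kp: "0 < ka" "ka < 1" using p by (auto simp: ka_def)
 define K1 where "K1 = 4 * abs M + 1"
 define K2 where "K2 = 1 + b * C * K1 powr ka"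
 have K1: "K1 >= 1" by (simp add: K1_def)
 have K2: "K2 >= 1" using b C by (simp add: K2_def)
 define X where "X = 8 * pi * (4 * abs M + 3)"
 define Y where "Y = 4 * pi * bee"
 have XY: "0 <= X" "0 <= Y" using ab by (auto simp: X_def Y_def)
 have main: "qV u u <= K1 * Z \<and> N0 u <= Z \<and> 1 <= Z \<and> Z powr (1 - ka) <= K2 * (1 + (n2 u)^2) \<and> ((n2 u)^2)^2 + 8 * pi * ((Z - 1) * (2 - 6 / p)) <= X + Y * (n2 u)^2"
  if u: "u : E" "II u <= M" "abs (dI u u) <= 1" "PP u <= 1" and Z: "Z = 1 + b * Lq u" for u Z
 proof -
  define A N c q where "A = qV u u" and "N = N0 u" and "c = b * Lq u" and "q = (n2 u)^2"
  have c0: "0 <= c" using b Lq_nonneg[of u] by (simp add: c_def)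
  have A0: "0 <= A" unfolding A_def by (rule qV_nonneg)
  have i: "A / 2 + N / 4 - c / p <= M" using u(2) unfolding Ifun_def normV_sq_eq Lq_def[symmetric] A_def N_def c_def by simp
  have d: "abs (A + N - c) <= 1" using u(3) unfolding dI_self[OF u(1)] A_def N_def c_def by simp
  have P: "N + q^2 / (8 * pi) - bee * q / 2 - 2 * (c / p) <= 1" using u(4) unfolding PP_def N_def c_def q_def by (simp add: power_mult[symmetric] mult.assoc)
  have cp: "4 * (c / p) - c <= c"
  proof -
   have "c * 2 <= c * p" using p c0 by (intro mult_left_mono) auto
   then show ?thesis using p by (simp add: field_simps)
  qed
  have a1: "A <= 4 * abs M + 1 + (4 * (c / p) - c)" using i d by linarith
  have "A <= K1 + 1 * c" unfolding K1_def mult_1 by (rule order_trans[OF a1 add_left_mono[OF cp]])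
  also have "... <= K1 + K1 * c" using K1 c0 by (intro add_left_mono mult_right_mono) auto
  finally have AZ: "A <= K1 * Z" unfolding Z c_def[symmetric] by (simp add: distrib_left)
  have NZ: "N <= Z" using d A0 unfolding Z c_def[symmetric] by linarith
  have Z1: "1 <= Z" unfolding Z c_def[symmetric] using c0 by simp
  define t where "t = sqrt (K1 * Z)"
  have t: "0 < t" "t^2 = K1 * Z" using K1 Z1 by (auto simp: t_def)
  have tp: "t powr (p - 2) = K1 powr ka * Z powr ka"
  proof -
   have "t = (K1 * Z) powr (1/2)" using K1 Z1 by (simp add: t_def powr_half_sqrt)
   then have "t powr (p - 2) = (K1 * Z) powr ka" by (simp add: powr_powr ka_def)
   then show ?thesis using K1 Z1 by (simp add: powr_mult)
  qed
  have "Lq u <= C * q * (K1 powr ka * Z powr ka)" using C(2)[OF u(1) _ t(1)] AZ unfolding t(2) tp A_def q_def by simp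
  then have "c <= b * (C * q * (K1 powr ka * Z powr ka))" unfolding c_def using b by (intro mult_left_mono) auto
  also have "... = (b * C * K1 powr ka) * q * Z powr ka" by simp
  finally have ce: "c <= (b * C * K1 powr ka) * q * Z powr ka" .
  have Zk: "1 <= Z powr ka" using Z1 kp by (simp add: ge_one_powr_ge_zero)
  have q0: "0 <= q" by (simp add: q_def)
  have bc: "0 <= b * C * K1 powr ka" using b C by simp
  have "Z powr ka * Z powr (1 - ka) = Z" using Z1 by (simp add: powr_add[symmetric])
  also have "Z <= Z powr ka + (b * C * K1 powr ka) * q * Z powr ka" unfolding Z c_def[symmetric] using ce Zk unfolding Z c_def[symmetric] by linarith
  also have "... <= Z powr ka * (K2 * (1 + q))"
  proof -
   have "1 + (b * C * K1 powr ka) * q <= K2 * (1 + q)" unfolding K2_def using bc q0 by (simp add: algebra_simps)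
   from mult_left_mono[OF this, of "Z powr ka"] show ?thesis by (simp add: algebra_simps)
  qed
  finally have Zq: "Z powr (1 - ka) <= K2 * (1 + q)" using Zk Z1 by (simp add: mult_le_cancel_left)
  have "q^2 / (8 * pi) + c * (2 - 6 / p) <= 4 * abs M + 3 + bee * q / 2"
  proof -
   have "c * (2 - 6 / p) = 2 * c - 6 * (c / p)" by (simp add: algebra_simps)
   then show ?thesis using i d P a1 by linarith
  qed
  then have "8 * pi * (q^2 / (8 * pi) + c * (2 - 6 / p)) <= 8 * pi * (4 * abs M + 3 + bee * q / 2)" by (intro mult_left_mono) auto
  moreover have "8 * pi * (q^2 / (8 * pi) + c * (2 - 6 / p)) = q^2 + 8 * pi * (c * (2 - 6 / p))" by (simp add: distrib_left)
  moreover have "8 * pi * (4 * abs M + 3 + bee * q / 2) = X + Y * q" by (simp add: X_def Y_def algebra_simps)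
  ultimately have "q^2 + 8 * pi * (c * (2 - 6 / p)) <= X + Y * q" by simp
  then show ?thesis using AZ NZ Z1 Zq unfolding A_def N_def q_def Z c_def by simp
 qed
 obtain B where B: "!!u. u : E ==> II u <= M ==> abs (dI u u) <= 1 ==> PP u <= 1 ==> 1 + b * Lq u <= B"
 \<comment> \<open>For \<open>p >= 3\<close> the coefficient 2 - 6/p is nonnegative, so the first
   relation alone bounds the mass and the second then bounds Z.\<close>
 proof (cases "3 <= p")
  case True
  show ?thesis
  proof (rule that)
   fix u assume u: "u : E" "II u <= M" "abs (dI u u) <= 1" "PP u <= 1"
   define Z q where "Z = 1 + b * Lq u" and "q = (n2 u)^2"
   note m = main[OF u Z_def, folded q_def]
   have q0: "0 <= q" by (simp add: q_def)
   have "0 <= 8 * pi * ((Z - 1) * (2 - 6 / p))" using m True by (intro mult_nonneg_nonneg) (auto simp: field_simps)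
   then have qq: "q^2 <= X + Y * q" using m by linarith
   have "q <= 1 + X + Y"
   proof (rule ccontr)
    assume n: "\<not> q <= 1 + X + Y"
    have "(1 + X + Y) * q <= q * q" using n q0 by (intro mult_right_mono) auto
    moreover have "X * 1 <= X * q" using n XY by (intro mult_left_mono) auto
    ultimately show False using qq n XY by (simp add: power2_eq_square distrib_right)
   qed
   then have "K2 * (1 + q) <= K2 * (2 + X + Y)" using K2 by (intro mult_left_mono) auto
   then have "Z powr (1 - ka) <= K2 * (2 + X + Y)" using m by linarith
   then show "1 + b * Lq u <= (K2 * (2 + X + Y)) powr (1 / (1 - ka))" unfolding Z_def[symmetric] using m kp by (intro le_powr_inverse) auto
  qed
 next
  case False
  \<comment> \<open>For \<open>p < 3\<close> the coefficient may be negative but is at least -1, so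
    q^2 is at most of order Z and 1 + q at most of order Z^(1/2). The second relation then bounds Z
    because 1 - ka > 1/2 is equivalent to \<open>p < 3\<close>.\<close>
  then have kh: "0 < 1/2 - ka" by (simp add: ka_def)
  define K3 where "K3 = 2 + 4 * X + 2 * Y^2 + 32 * pi"
  have K3: "K3 > 0" using XY by (simp add: K3_def add_pos_nonneg add_nonneg_pos)
  show ?thesis
  proof (rule that)
   fix u assume u: "u : E" "II u <= M" "abs (dI u u) <= 1" "PP u <= 1"
   define Z q where "Z = 1 + b * Lq u" and "q = (n2 u)^2"
   note m = main[OF u Z_def, folded q_def]
   have q0: "0 <= q" by (simp add: q_def)
   have "(Z - 1) * (-1) <= (Z - 1) * (2 - 6 / p)" using m p by (intro mult_left_mono) (auto simp: field_simps)
   from mult_left_mono[OF this, of "8 * pi"] have "- (8 * pi * (Z - 1)) <= 8 * pi * ((Z - 1) * (2 - 6 / p))" by (simp add: algebra_simps)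
   then have "q^2 <= X + Y * q + 8 * pi * (Z - 1)" using m by linarith
   moreover have "Y * q <= q^2 / 2 + Y^2 / 2" using zero_le_power2[of "q - Y"] by (simp add: power2_eq_square algebra_simps)
   ultimately have "2 + 2 * q^2 <= 2 + 4 * X + 2 * Y^2 + 32 * pi * (Z - 1)" by linarith
   also have "... <= K3 * Z"
   proof -
    have "(2 + 4 * X + 2 * Y^2) * 1 <= (2 + 4 * X + 2 * Y^2) * Z" using m XY by (intro mult_left_mono) auto
    then have h: "2 + 4 * X + 2 * Y^2 <= (2 + 4 * X + 2 * Y^2) * Z" by simp
    have k: "K3 * Z = (2 + 4 * X + 2 * Y^2) * Z + 32 * pi * (Z - 1) + 32 * pi" unfolding K3_def by (simp add: algebra_simps)
    show ?thesis unfolding k by (rule order_trans[OF add_right_mono[OF h]]) simp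
   qed
   finally have "(1 + q)^2 <= K3 * Z" using zero_le_power2[of "q - 1"] by (simp add: power2_eq_square algebra_simps)
   then have "1 + q <= sqrt (K3 * Z)" by (rule real_le_rsqrt)
   then have "1 + q <= sqrt K3 * Z powr (1/2)" using m by (simp add: real_sqrt_mult powr_half_sqrt)
   then have "K2 * (1 + q) <= K2 * (sqrt K3 * Z powr (1/2))" using K2 by (intro mult_left_mono) auto
   then have "Z powr (1 - ka) <= K2 * sqrt K3 * Z powr (1/2)" using m by (simp add: mult.assoc)
   moreover have "Z powr (1 - ka) = Z powr (1/2 - ka) * Z powr (1/2)" by (simp add: powr_add[symmetric])
   moreover have "0 < Z powr (1/2)" using m by simp
   ultimately have "Z powr (1/2 - ka) <= K2 * sqrt K3" by (simp add: mult_le_cancel_right)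
   then show "1 + b * Lq u <= (K2 * sqrt K3) powr (1 / (1/2 - ka))" unfolding Z_def[symmetric] using m kh by (intro le_powr_inverse) auto
  qed
 qed
 show ?thesis
 proof (rule that[of "K1 * abs B + abs B + 1"])
  show "K1 * abs B + abs B + 1 > 0" using K1 by (simp add: add_nonneg_pos)
  fix u assume u: "u : E" "II u <= M" "abs (dI u u) <= 1" "PP u <= 1"
  note m = main[OF u refl] and B' = B[OF u]
  let ?K = "K1 * abs B + abs B + 1"
  have "K1 * (1 + b * Lq u) <= K1 * abs B" using B' K1 by (intro mult_left_mono) auto
  then have "qV u u <= ?K" using m by linarith
  also have "?K <= ?K^2" using K1 by (intro self_le_power) auto
  finally have "qV u u <= ?K^2" .
  moreover have "0 <= K1 * abs B" using K1 by simp
  then have "N0 u <= ?K" using m B' by linarith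
  ultimately show "qV u u <= ?K^2 \<and> N0 u <= ?K" by simp
 qed
qed

section \<open>Monotonicity modulo L^2 and convergence in E\<close>

lemma Lq_scale: "0 <= t ==> Lq (%x. t * u x) = t powr p * Lq u"
 unfolding Lq_eq by (simp add: abs_mult powr_mult)

text \<open>Young's inequality with parameter \<open>ta\<close> gives a small multiple of
  \<open>Lq u\<close> plus a large multiple of \<open>Lq w\<close>; the latter is small because
  Gagliardo-Nirenberg bounds it by \<open>(n2 w)^2\<close> as long as the gradient stays
  bounded.\<close>

lemma Ap_small:
 assumes R: "R > 0" and e: "e > 0"
 obtains de where "de > 0" "!!u w. u : E ==> w : E ==> nE u <= R ==> nE w <= 2 * R ==> n2 w <= de ==> abs (Ap u w) <= e"
proof (rule local_bounds[OF R], rule Lp_bound[OF p], goal_cases)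
 case (1 L C)
 note L = 1(2,8) and C = 1(9,10)
 define ta where "ta = e / (2 * L)"
 have t: "ta > 0" using e L by (simp add: ta_def)
 define D where "D = ta * (1 / ta) powr p * (C * (2 * R) powr (p - 2))"
 have D: "D > 0" using t C R by (simp add: D_def)
 show ?thesis
 proof (rule that[of "sqrt (e / (2 * D))"])
  show "sqrt (e / (2 * D)) > 0" using e D by simp
  fix u w assume u: "u : E" and w: "w : E" and n: "nE u <= R" "nE w <= 2 * R" "n2 w <= sqrt (e / (2 * D))"
  let ?w = "%x. 1 / ta * w x"
  have wE: "?w : E" by (rule E_cmult[OF w])
  have "(%x. ta * ?w x + 0 * ?w x) = w" using t by simp
  then have "Ap u w = ta * Ap u ?w" using Ap_lin[OF u wE wE, of ta 0] by simp
  then have "abs (Ap u w) = ta * abs (Ap u ?w)" using t by (simp add: abs_mult)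
  also have "... <= ta * (Lq u + Lq ?w)" using Ap_integrable(2)[OF u wE] t by (intro mult_left_mono) auto
  also have "... = ta * Lq u + ta * (1 / ta) powr p * Lq w" unfolding Lq_scale[of "1 / ta" w, OF less_imp_le[OF divide_pos_pos[OF zero_less_one t]]] by (simp add: distrib_left)
  also have "... <= e / 2 + D * (n2 w)^2"
  proof (rule add_mono)
   have "ta * Lq u <= ta * L" using L(2)[OF u n(1)] t by (intro mult_left_mono) auto
   then show "ta * Lq u <= e / 2" using L by (simp add: ta_def)
   have "n2 (wgrad w) <= 2 * R" using nE_bounds(1)[OF w] n(2) by linarith
   then have "Lq w <= C * (n2 w)^2 * (2 * R) powr (p - 2)" using C(2)[OF w, of "2 * R"] R by (simp add: Lq_eq)
   then have "ta * (1 / ta) powr p * Lq w <= ta * (1 / ta) powr p * (C * (n2 w)^2 * (2 * R) powr (p - 2))" using t by (intro mult_left_mono) auto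
   then show "ta * (1 / ta) powr p * Lq w <= D * (n2 w)^2" by (simp add: D_def mult_ac)
  qed
  also have "D * (n2 w)^2 <= D * (sqrt (e / (2 * D)))^2" using D n(3) by (intro mult_left_mono power_mono) auto
  also have "D * (sqrt (e / (2 * D)))^2 = e / 2" using D e by simp
  finally show "abs (Ap u w) <= e" by simp
 qed
qed

definition ms :: "real => (R2 => real) => real" where "ms R u = (LI x. indicator (cball 0 R) x * (u x)^2)"

lemma nE_qV: "u : E ==> (nE u)^2 = qV u u + sL (%x. (u x)^2)"
proof -
 assume u: "u : E"
 note d = E_dest[OF u]
 have "(LI x. W x * (u x)^2) = (LI x. V x * (u x)^2 + lw x * (u x)^2)" by (simp add: W_def distrib_right)
 also have "... = (LI x. V x * (u x)^2) + (LI x. lw x * (u x)^2)" using d(5,6) by simp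
 finally show ?thesis unfolding nE_sq[OF u] qV_nE(1)[OF u] sL_def by simp
qed

lemma sL_sq: "sL (%x. (u x)^2) = (n2 (%x. sqrt (lw x) * u x))^2"
 unfolding sL_def n2_sq using lw_nonneg by (simp add: power_mult_distrib)

text \<open>With w = u - v and z = u + v the difference equals BB(u^2, w^2) + BB(w z, v w). In the
  first term the positive kernel part bounds the logarithmic moment of w^2 from below through the
  mass of \<open>u\<close> in the ball; every remaining piece contains a factor \<open>n2 w\<close>,
  and the other factors are bounded by the E-norms.\<close>

lemma B4_monotone:
 assumes R: "r > 0" "0 <= R"
 obtains C where "C > 0" "!!u v. u : E ==> v : E ==> nE u <= r ==> nE v <= r ==>
  ms R u * sL (%x. (u x - v x)^2) - C * n2 (%x. u x - v x) <= B4 u u (%x. u x - v x) - B4 v v (%x. u x - v x)"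
proof (rule Lp_nE, goal_cases)
 case (1 C)
 note C = 1(2,4,5)
 define B where "B = 2 * r + 2 * (C * r)"
 have B: "B > 0" using C R by (simp add: B_def add_pos_pos)
 define D where "D = B ^ 3 * (ln (1 + R) + ln 2) + (lgc + 1) * B ^ 3 + B ^ 3 + B ^ 3 + (lgc + 1) * B ^ 3"
 have D: "D > 0" unfolding D_def using B lgc_nonneg R by (intro add_nonneg_pos add_pos_pos add_nonneg_nonneg mult_pos_pos) auto
 show ?thesis
 proof (rule that[OF D])
  fix u v assume u: "u : E" and v: "v : E" and n: "nE u <= r" "nE v <= r"
  define w where "w = (%x. u x - v x)"
  define z where "z = (%x. u x + v x)"
  have w: "w : E" and z: "z : E" unfolding w_def z_def by (rule E_diff[OF u v], rule E_add[OF u v])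
  have nw: "nE w <= 2 * r" and nz: "nE z <= 2 * r" using nE_diff[OF u v] nE_add[OF u v] n unfolding w_def z_def by auto
  have bd: "n2 y <= B" "l3 y <= B" "n2 (%x. sqrt (lw x) * y x) <= B" if y: "y : E" "nE y <= 2 * r" for y
  proof -
   have "0 <= C * r" using C(1) R(1) by simp
   then show "n2 y <= B" "l3 y <= B" "n2 (%x. sqrt (lw x) * y x) <= B" using C(2,3)[OF y] nE_bounds(3)[OF y(1)] y(2) R(1) by (auto simp: B_def)
  qed
  have vr: "nE v <= 2 * r" and ur: "nE u <= 2 * r" using n R by auto
  note bw = bd[OF w nw] and bz = bd[OF z nz] and bv = bd[OF v vr] and bu = bd[OF u ur]
  define de where "de = n2 w"
  have d0: "0 <= de" by (simp add: de_def)
  have l0: "0 <= l3 y" for y by (simp add: l3_def)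
  have B3: "B * B * B = B ^ 3" by (simp add: eval_nat_numeral)
  have Du: "Dl (%x. (u x)^2)" and Dw: "Dl (%x. (w x)^2)" using Dl_sq u w by auto
  have s1w: "s1 (%x. (w x)^2) <= B * de" unfolding s1_sq de_def power2_eq_square[of "n2 w"] using bw by (intro mult_right_mono) auto
  have s1u: "s1 (%x. (u x)^2) <= B^2" unfolding s1_sq using bu by (intro power_mono) auto
  have e1: "B4 u u w = BB (%x. (u x)^2) (%x. (w x)^2) + BB (%x. (u x)^2) (%x. v x * w x)"
  proof -
   have "(%x. u x * w x) = (%x. 1 * (w x)^2 + 1 * (v x * w x))" by (auto simp: w_def power2_eq_square algebra_simps)
   then show ?thesis unfolding B4_def using BB_lin2[OF Dw Dl_mult(1)[OF v w] Du, of 1 1] by simp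
  qed
  have e2: "BB (%x. (u x)^2) (%x. v x * w x) - B4 v v w = BB (%x. w x * z x) (%x. v x * w x)"
  proof -
   have "(%x. w x * z x) = (%x. 1 * (u x)^2 + (-1) * (v x)^2)" by (auto simp: w_def z_def power2_eq_square algebra_simps)
   then show ?thesis unfolding B4_def using BB_lin1[OF Du Dl_sq[OF v] Dl_mult(1)[OF v w], of 1 "-1"] by simp
  qed
  have g1: "ms R u * (sL (%x. (w x)^2) - (ln (1 + R) + ln 2) * s1 (%x. (w x)^2)) <= Bk lgp (%x. (u x)^2) (%x. (w x)^2)"
   unfolding ms_def by (rule Bk_lgp_lower[OF Du Dw _ _ R(2)]) auto
  have "ms R u <= s1 (%x. (u x)^2)" unfolding ms_def s1_def
  proof (rule integral_mono)
   have i: "li (%x. (u x)^2)" using Du by (simp add: Dl_def)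
   then show "li (%x. abs ((u x)^2))" by simp
   show "li (%x. indicator (cball 0 R) x * (u x)^2)" using integrable_mult_indicator[OF _ i, of "cball 0 R"] by simp
  qed (auto simp: indicator_def)
  then have msB: "ms R u <= B^2" using s1u by linarith
  have ms0: "0 <= ms R u" unfolding ms_def by (intro integral_nonneg_AE) auto
  have k0: "0 <= ln (1 + R) + ln 2" using R by simp
  have g2: "ms R u * ((ln (1 + R) + ln 2) * s1 (%x. (w x)^2)) <= B^2 * ((ln (1 + R) + ln 2) * (B * de))"
   using msB s1w k0 ms0 d0 B by (intro mult_mono mult_left_mono mult_nonneg_nonneg) (auto simp: s1_def)
  have g3: "abs (Bk lgm (%x. (u x)^2) (%x. (w x)^2)) <= (lgc + 1) * B ^ 3 * de"
  proof -
   have "Bk lgm (%x. (u x)^2) (%x. (w x)^2) = Bk lgm (%x. (w x)^2) (%x. (u x)^2)" by (rule Bk_sym[OF lgm_minus borel_lg(2)]) (use Du Dw in \<open>auto simp: Dl_def\<close>)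
   moreover have "abs (Bk lgm (%x. (w x)^2) (%x. (u x)^2)) <= (lgc + 1) * s1 (%x. (w x)^2) * sQ (%x. (u x)^2)" by (rule Bk_lgm(2)[OF Dw Du])
   moreover have "sQ (%x. (u x)^2) <= B * B" using Dl_mult(4)[OF u u] mult_mono[OF bu(2) bu(2)] l0[of u] B by (simp add: power2_eq_square)
   then have "(lgc + 1) * s1 (%x. (w x)^2) * sQ (%x. (u x)^2) <= (lgc + 1) * (B * de) * (B * B)" using s1w lgc_nonneg B d0 by (intro mult_mono mult_nonneg_nonneg) (auto simp: sQ_def s1_def)
   moreover have "(lgc + 1) * (B * de) * (B * B) = (lgc + 1) * B ^ 3 * de" unfolding B3[symmetric] by simp
   ultimately show ?thesis by linarith
  qed
  have g4: "abs (BB (%x. w x * z x) (%x. v x * w x)) <= (B ^ 3 + B ^ 3 + (lgc + 1) * B ^ 3) * de"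
  proof -
   note D1 = Dl_mult[OF w z] and D2 = Dl_mult[OF v w]
   have a1: "s1 (%x. w x * z x) <= de * B" using order_trans[OF D1(2) mult_left_mono[OF bz(1)]] by (simp add: de_def)
   have a2: "s1 (%x. v x * w x) <= B * de" using order_trans[OF D2(2) mult_right_mono[OF bv(1)]] by (simp add: de_def)
   have a3: "sL (%x. w x * z x) <= B * B" by (rule order_trans[OF D1(3) mult_mono[OF bw(3) bz(3)]]) (use B in auto)
   have a4: "sL (%x. v x * w x) <= B * B" by (rule order_trans[OF D2(3) mult_mono[OF bv(3) bw(3)]]) (use B in auto)
   have a5: "sQ (%x. v x * w x) <= B * B" by (rule order_trans[OF D2(4) mult_mono[OF bv(2) bw(2)]]) (use B l0 in auto)
   have nn: "0 <= s1 f" "0 <= sL f" "0 <= sQ f" for f unfolding s1_def sL_def sQ_def using lw_nonneg by (auto intro!: integral_nonneg_AE)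
   have "abs (BB (%x. w x * z x) (%x. v x * w x)) <= sL (%x. w x * z x) * s1 (%x. v x * w x) + s1 (%x. w x * z x) * sL (%x. v x * w x) + (lgc + 1) * s1 (%x. w x * z x) * sQ (%x. v x * w x)"
    by (rule BB_le[OF D1(1) D2(1)])
   also have "... <= (B * B) * (B * de) + (de * B) * (B * B) + (lgc + 1) * (de * B) * (B * B)"
    using a1 a2 a3 a4 a5 nn lgc_nonneg B d0 by (intro add_mono mult_mono mult_nonneg_nonneg) auto
   also have "... = (B ^ 3 + B ^ 3 + (lgc + 1) * B ^ 3) * de" unfolding B3[symmetric] by (simp add: algebra_simps)
   finally show ?thesis .
  qed
  have "B^2 * ((ln (1 + R) + ln 2) * (B * de)) = B ^ 3 * (ln (1 + R) + ln 2) * de" by (simp add: eval_nat_numeral)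
  moreover have "D * de = B ^ 3 * (ln (1 + R) + ln 2) * de + (lgc + 1) * B ^ 3 * de + (B ^ 3 + B ^ 3 + (lgc + 1) * B ^ 3) * de" unfolding D_def by (simp add: distrib_right)
  moreover have "B4 u u w - B4 v v w = Bk lgp (%x. (u x)^2) (%x. (w x)^2) - Bk lgm (%x. (u x)^2) (%x. (w x)^2) + BB (%x. w x * z x) (%x. v x * w x)"
   using e1 e2 unfolding BB_def[of "%x. (u x)^2" "%x. (w x)^2"] by linarith
  ultimately have "ms R u * sL (%x. (w x)^2) - D * de <= B4 u u w - B4 v v w" using g1 g2 g3 g4 unfolding right_diff_distrib by linarith
  then show "ms R u * sL (%x. (u x - v x)^2) - D * n2 (%x. u x - v x) <= B4 u u (%x. u x - v x) - B4 v v (%x. u x - v x)" unfolding w_def de_def .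
 qed
qed

text \<open>The quadratic form contributes \<open>qV w w\<close> exactly, the logarithmic form
  contributes the moment of \<open>w^2\<close>, and together they dominate
  \<open>c0 * (nE w)^2\<close>. The power term and the remaining logarithmic terms are small with
  \<open>n2 w\<close>. So closeness in L^2 together with small derivatives implies closeness in
  E.\<close>

lemma strong_monotone:
 assumes r: "r > 0" "0 <= R" and mu: "muu > 0" and e: "e > 0"
 obtains de where "de > 0" "!!u v. u : E ==> v : E ==> nE u <= r ==> nE v <= r ==> muu <= ms R u ==> n2 (%x. u x - v x) <= de ==>
  dI u (%x. u x - v x) - dI v (%x. u x - v x) <= de ==> nE (%x. u x - v x) < e"
proof (rule B4_monotone[OF r], goal_cases)
 case (1 C)
 note C = 1(2-)
 define c0 where "c0 = min 1 (muu / (2 * pi))"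
 have c0: "0 < c0" "c0 <= 1" "c0 <= muu / (2 * pi)" using mu by (auto simp: c0_def)
 define e1 where "e1 = c0 * e^2 / (8 * b)"
 have e1: "e1 > 0" using c0 e b by (simp add: e1_def)
 obtain d1 where d1: "d1 > 0" "!!u w. u : E ==> w : E ==> nE u <= r ==> nE w <= 2 * r ==> n2 w <= d1 ==> abs (Ap u w) <= e1"
  by (rule Ap_small[OF r(1) e1]) (rule that)
 define de where "de = min d1 (c0 * e^2 / (2 * (1 + C)))"
 have del: "de > 0" "de <= d1" "de <= c0 * e^2 / (2 * (1 + C))" using d1 c0 e C by (auto simp: de_def)
 show ?thesis
 proof (rule that[OF del(1)])
  fix u v assume u: "u : E" and v: "v : E" and n: "nE u <= r" "nE v <= r" and m: "muu <= ms R u" and w2: "n2 (%x. u x - v x) <= de"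
   and dd: "dI u (%x. u x - v x) - dI v (%x. u x - v x) <= de"
  define w where "w = (%x. u x - v x)"
  have w: "w : E" "nE w <= 2 * r" unfolding w_def using E_diff[OF u v] nE_diff[OF u v] n by auto
  have q: "qV u w - qV v w = qV w w" using qV_lin[OF w(1) u v, of 1 "-1"] qV_sym[of u w] qV_sym[of v w] unfolding w_def by simp
  have a: "abs (Ap u w) <= e1" "abs (Ap v w) <= e1" using w2 del(2) by (intro d1(2) u v w n; simp add: w_def)+
  have be: "b * e1 = c0 * e^2 / 8" using b by (simp add: e1_def)
  have "b * (Ap u w - Ap v w) <= b * (2 * e1)" using a b by (intro mult_left_mono) auto
  then have ab: "b * Ap u w - b * Ap v w <= c0 * e^2 / 4" using be by (simp add: right_diff_distrib)
  have sw: "0 <= sL (%x. (w x)^2)" unfolding sL_sq by simp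
  have "(ms R u * sL (%x. (w x)^2) - C * n2 w) / (2 * pi) <= (B4 u u w - B4 v v w) / (2 * pi)" using C(2)[OF u v n] unfolding w_def by (intro divide_right_mono) auto
  moreover have "(B4 u u w - B4 v v w) / (2 * pi) = B4 u u w / (2 * pi) - B4 v v w / (2 * pi)" by (rule diff_divide_distrib)
  moreover have "qV w w = dI u w - dI v w - (B4 u u w / (2 * pi) - B4 v v w / (2 * pi)) + (b * Ap u w - b * Ap v w)" using q unfolding dI_def by linarith
  ultimately have "qV w w + (ms R u * sL (%x. (w x)^2) - C * n2 w) / (2 * pi) <= de + c0 * e^2 / 4" using dd ab unfolding w_def by linarith
  then have "qV w w + ms R u / (2 * pi) * sL (%x. (w x)^2) <= de + C * n2 w / (2 * pi) + c0 * e^2 / 4" by (simp add: diff_divide_distrib)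
  moreover have "C * n2 w / (2 * pi) <= C * de / 1" using C(1) w2 pi_gt3 del(1) unfolding w_def by (intro frac_le mult_left_mono mult_nonneg_nonneg) auto
  moreover have "de * (1 + C) <= c0 * e^2 / 2" using del(3) C by (simp add: field_simps)
  moreover have "c0 * qV w w <= 1 * qV w w" using c0 qV_nonneg by (intro mult_right_mono) auto
  moreover have "c0 <= ms R u / (2 * pi)" using c0(3) divide_right_mono[OF m, of "2 * pi"] by simp
  then have "c0 * sL (%x. (w x)^2) <= ms R u / (2 * pi) * sL (%x. (w x)^2)" using sw by (intro mult_right_mono)
  moreover have "c0 * (nE w)^2 = c0 * qV w w + c0 * sL (%x. (w x)^2)" unfolding nE_qV[OF w(1)] by (simp add: distrib_left)
  moreover have "0 < c0 * e^2" using c0 e by simp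
  moreover have "de * (1 + C) = de + C * de" by (simp add: algebra_simps)
  ultimately have "c0 * (nE w)^2 < c0 * e^2" unfolding div_by_1 mult_1 by linarith
  then have "(nE w)^2 < e^2" using c0 by simp
  then show "nE (%x. u x - v x) < e" unfolding w_def using e by (meson less_imp_le power2_less_imp_less)
 qed
qed


text \<open>Only the singular kernel part and the power term can balance \<open>qV\<close> in the
  Nehari relation, and both carry a factor \<open>(n2 u)^2\<close> while \<open>qV\<close> is
  bounded. Hence a small mass forces a small \<open>qV\<close>, which excludes vanishing.\<close>

lemma mass_lower:
 assumes K: "K > 0"
 obtains C where "C > 0" "!!u. u : E ==> qV u u <= K^2 ==> qV u u <= dI u u + C * (n2 u)^2"
  "!!u. u : E ==> qV u u <= K^2 ==> Bk lgp (%x. (u x)^2) (%x. (u x)^2) <= 2 * pi * N0 u + C"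
proof (rule V_bounds, goal_cases)
 case (1 C)
 note C = 1(2-)
 define D where "D = (lgc + 1) * ((C * K) * (C * K)) + b * C * K powr (p - 2) + C * K ^ 4"
 have D: "D > 0" unfolding D_def using C K b lgc_nonneg by (intro add_nonneg_pos add_nonneg_nonneg mult_nonneg_nonneg) auto
 show ?thesis
 proof (rule that[OF D])
  fix u assume u: "u : E" "qV u u <= K^2"
  have l0: "0 <= l3 u" by (simp add: l3_def)
  have "sQ (%x. (u x)^2) <= l3 u * l3 u" using Dl_mult(4)[OF u(1) u(1)] by (simp add: power2_eq_square)
  also have "... <= (C * K) * (C * K)" using C(3)[OF u K] l0 by (intro mult_mono) auto
  finally have sq: "sQ (%x. (u x)^2) <= (C * K) * (C * K)" .
  have "abs (Bk lgm (%x. (u x)^2) (%x. (u x)^2)) <= (lgc + 1) * (n2 u)^2 * sQ (%x. (u x)^2)" using Bk_lgm(2)[OF Dl_sq[OF u(1)] Dl_sq[OF u(1)]] unfolding s1_sq .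
  also have "... <= (lgc + 1) * (n2 u)^2 * ((C * K) * (C * K))" using lgc_nonneg sq by (intro mult_left_mono mult_nonneg_nonneg) auto
  finally have B: "abs (Bk lgm (%x. (u x)^2) (%x. (u x)^2)) <= (lgc + 1) * ((C * K) * (C * K)) * (n2 u)^2" by (simp add: mult_ac)
  have lgp0: "0 <= Bk lgp (%x. (u x)^2) (%x. (u x)^2)" unfolding Bk_def by (intro integral_nonneg_AE) (auto simp: lgp_nonneg)
  have NB: "2 * pi * N0 u = Bk lgp (%x. (u x)^2) (%x. (u x)^2) - Bk lgm (%x. (u x)^2) (%x. (u x)^2)" unfolding N0_eq[OF u(1)] BB_def by simp
  have D0: "0 <= (lgc + 1) * ((C * K) * (C * K))" "0 <= b * C * K powr (p - 2)" "0 <= C * K ^ 4" using lgc_nonneg C(1) K b by auto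
  show "Bk lgp (%x. (u x)^2) (%x. (u x)^2) <= 2 * pi * N0 u + D" using NB C(4)[OF u K] D0 unfolding D_def by linarith
  let ?X = "(lgc + 1) * ((C * K) * (C * K)) * (n2 u)^2"
  have X0: "0 <= ?X" by (rule mult_nonneg_nonneg[OF D0(1)]) simp
  have "- ?X <= 2 * pi * N0 u" using NB B lgp0 by linarith
  then have N: "- ?X <= N0 u"
  proof (cases "0 <= N0 u")
   case False
   have "2 * pi * N0 u <= 1 * N0 u" using False pi_gt3 by (intro mult_right_mono_neg) auto
   then show ?thesis using \<open>- ?X <= 2 * pi * N0 u\<close> by linarith
  qed (use X0 in linarith)
  have "b * Lq u <= b * (C * (n2 u)^2 * K powr (p - 2))" using C(2)[OF u K] b by (intro mult_left_mono) auto
  then have L: "b * Lq u <= b * C * K powr (p - 2) * (n2 u)^2" by (simp add: mult_ac)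
  have "D * (n2 u)^2 = ?X + b * C * K powr (p - 2) * (n2 u)^2 + C * K ^ 4 * (n2 u)^2" unfolding D_def by (simp add: distrib_right)
  moreover have "0 <= C * K ^ 4 * (n2 u)^2" by (rule mult_nonneg_nonneg[OF D0(3)]) simp
  ultimately show "qV u u <= dI u u + D * (n2 u)^2" unfolding dI_self[OF u(1)] using N L by linarith
 qed
qed

lemma dI_scaled:
 assumes u: "u : E" and w: "w : E" and L: "1 <= L" "nE w <= L" and d: "!!w. w : E ==> nE w <= 1 + nE u ==> abs (dI u w) <= et"
 shows "abs (dI u w) <= L * et"
proof -
 let ?w = "%x. 1 / L * w x"
 have wE: "?w : E" by (rule E_cmult[OF w])
 have "nE ?w = nE w / L" using nE_cmult[OF w, of "1 / L"] L by simp
 also have "... <= 1" using L by simp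
 finally have "nE ?w <= 1 + nE u" using nE_nonneg[of u] by linarith
 then have "abs (dI u ?w) <= et" by (rule d[OF wE])
 moreover have "dI u w = L * dI u ?w" using dI_cmult[OF u w, of "1 / L"] L by simp
 ultimately show ?thesis using L by (simp add: abs_mult mult_left_mono)
qed

lemma ms_eq:
 assumes u: "u : E" shows "ms R u = (n2 u)^2 - (n2 (%x. indicator (- cball 0 R) x *r u x))^2"
proof -
 have i: "li (%x. (u x)^2)" using L2_integrable[OF E_dest(7)[OF u]] by simp
 have i1: "li (%x. indicator (cball 0 R) x * (u x)^2)" "li (%x. indicator (- cball 0 R) x * (u x)^2)"
  using integrable_mult_indicator[OF _ i, of "cball 0 R"] integrable_mult_indicator[OF _ i, of "- cball 0 R"] by auto
 have "(n2 u)^2 = (LI x. indicator (cball 0 R) x * (u x)^2 + indicator (- cball 0 R) x * (u x)^2)" unfolding n2_sq by (intro Bochner_Integration.integral_cong) (auto simp: indicator_def)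
 also have "... = ms R u + (LI x. indicator (- cball 0 R) x * (u x)^2)" unfolding ms_def using i1 by simp
 also have "(LI x. indicator (- cball 0 R) x * (u x)^2) = (n2 (%x. indicator (- cball 0 R) x *r u x))^2" unfolding n2_sq
  by (intro Bochner_Integration.integral_cong) (auto simp: indicator_def)
 finally show ?thesis by simp
qed

text \<open>No bound on the logarithmic moment is assumed. It is recovered: the lower bound on
  \<open>qV\<close> gives mass, the tail estimate places half of it in a fixed ball, and there the
  upper bound on \<open>N0\<close> limits the moment. Only then are the E-norms bounded and the
  monotonicity estimate applicable.\<close>

lemma compactness:
 fixes et :: "nat => real"
 assumes K: "K > 0" and d: "d > 0" and u: "!!n. u n : E" "!!n. qV (u n) (u n) <= K^2" "!!n. N0 (u n) <= K" "!!n. d <= qV (u n) (u n)"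
  and eta: "et ---> 0" and dI: "!!n w. w : E ==> nE w <= 1 + nE (u n) ==> abs (dI (u n) w) <= et n"
 obtains s v where "strict_mono (s :: nat => nat)" "v : E" "(%n. nE (%x. u (s n) x - v x)) ---> 0"
proof (rule mass_lower[OF K], goal_cases)
 case (1 C)
 note C = 1(2-)
 define muu where "muu = d / (2 * C)"
 have mu: "muu > 0" using d C by (simp add: muu_def)
 have "\<forall>\<^sub>F n in sequentially. et n < d / 2" using eta d by (intro order_tendstoD) auto
 then obtain n0 where n0: "!!n. n >= n0 ==> et n < d / 2" by (auto simp: eventually_sequentially)
 have mass: "muu <= (n2 (u n))^2" if "n >= n0" for n
 proof -
  have "dI (u n) (u n) <= et n" using dI[OF u(1), of n n] by auto
  then have "d / 2 <= C * (n2 (u n))^2" using C(2)[OF u(1,2), of n] u(4)[of n] n0[OF that] by linarith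
  then show ?thesis using C by (simp add: muu_def field_simps)
 qed
 define M where "M = K + K / sqrt V0 + K^2"
 have M: "K <= M" "K / sqrt V0 <= M" "K^2 <= M" using K V0 by (auto simp: M_def)
 note q = qV_dest[OF u(1,2) less_imp_le[OF K]]
 have b1: "n2 (u n) <= M" "n2 (wgrad (u n)) <= M" for n using q(1,2)[of n] M by auto
 have b2: "(LI x. V x * (u n x)^2) <= M" for n using u(2)[of n] M unfolding qV_nE(1)[OF u(1)] using zero_le_power2[of "n2 (wgrad (u n))"] by linarith
 have Vn: "0 <= V x" for x using Wpos(5)[of x] by simp
 \<comment> \<open>The mass is at least \<open>muu\<close>, so a tail with square at most
   \<open>muu / 2\<close> leaves at least \<open>muu / 2\<close> in the ball.\<close>
 have se: "sqrt (muu / 2) > 0" using mu by simp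
 obtain R where R: "R > 0" "!!u g. L2 u ==> weak_grad u g ==> L2 g ==> n2 u <= M ==> n2 g <= M ==>
  li (%x. V x * (u x)^2) ==> (LI x. V x * (u x)^2) <= M ==> n2 (%x. indicator (- cball 0 R) x *r u x) <= sqrt (muu / 2)"
  by (rule uniform_tail[OF lmV Vn Vfin se]) (assumption, rule that)
 have msl: "muu / 2 <= ms R (u n)" if "n >= n0" for n
 proof -
  note dn = E_dest[OF u(1)[of n]]
  have "n2 (%x. indicator (- cball 0 R) x *r u n x) <= sqrt (muu / 2)" by (rule R(2)[OF dn(7,2,3) b1 dn(5) b2])
  then have "(n2 (%x. indicator (- cball 0 R) x *r u n x))^2 <= (sqrt (muu / 2))^2" by (intro power_mono) auto
  then show ?thesis unfolding ms_eq[OF u(1)] using mass[OF that] mu by simp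
 qed
 define ka where "ka = ln (1 + R) + ln 2"
 have k0: "0 <= ka" using R by (simp add: ka_def)
 define S where "S = ka * M^2 + (2 * pi * K + C) / (muu / 2)"
 have SS: "sL (%x. (u n x)^2) <= S" if n: "n >= n0" for n
 proof -
  define X where "X = sL (%x. (u n x)^2) - ka * s1 (%x. (u n x)^2)"
  have "ms R (u n) * X <= Bk lgp (%x. (u n x)^2) (%x. (u n x)^2)"
   unfolding ms_def X_def ka_def using R by (intro Bk_lgp_lower Dl_sq u) auto
  also have "... <= 2 * pi * N0 (u n) + C" by (rule C(3)[OF u(1,2)])
  also have "... <= 2 * pi * K + C" by (intro add_right_mono mult_left_mono u) simp
  finally have mX: "ms R (u n) * X <= 2 * pi * K + C" .
  have "X <= (2 * pi * K + C) / (muu / 2)"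
  proof (cases "0 <= X")
   case True
   have "muu / 2 * X <= ms R (u n) * X" using msl[OF n] True by (intro mult_right_mono)
   then have "X * (muu / 2) <= 2 * pi * K + C" using mX by (simp add: mult.commute)
   then show ?thesis using mu by (subst pos_le_divide_eq) auto
  next
   case False
   moreover have "0 <= (2 * pi * K + C) / (muu / 2)" using K C mu by (intro divide_nonneg_nonneg add_nonneg_nonneg) auto
   ultimately show ?thesis by linarith
  qed
  moreover have "ka * s1 (%x. (u n x)^2) <= ka * M^2" unfolding s1_sq using k0 b1(1)[of n] by (intro mult_left_mono power_mono) auto
  ultimately show ?thesis unfolding X_def S_def by linarith
 qed
 define r where "r = sqrt (K^2 + abs S)"
 have r: "r > 0" unfolding r_def using K by (simp add: add_pos_nonneg)
 have nr: "nE (u n) <= r" if "n >= n0" for n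
 proof -
  have "(nE (u n))^2 <= K^2 + abs S" unfolding nE_qV[OF u(1)] using u(2)[of n] SS[OF that] by linarith
  then show ?thesis unfolding r_def by (rule real_le_rsqrt)
 qed
 obtain s v0 where s: "strict_mono (s::nat=>nat)" "L2 v0" "(%n. n2 (%x. u (s n) x - v0 x)) ---> 0"
  by (rule Rellich[OF lmV Vn Vfin E_dest(7)[OF u(1)] E_dest(2)[OF u(1)] E_dest(3)[OF u(1)] b1 E_dest(5)[OF u(1)] b2]) (assumption, rule that)
 define s' where "s' n = s (n + n0)" for n
 have s'0: "n0 <= s' n" "n <= s' n" for n using seq_suble[OF s(1), of "n + n0"] by (auto simp: s'_def)
 have s'm: "strict_mono s'" using s(1) by (auto simp: strict_mono_def s'_def)
 \<comment> \<open>Monotonicity is applied to pairs of members of the sequence, both almost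
   critical, so convergence in E follows from the Cauchy property and no weak limit has to be
   identified.\<close>
 have cau: "EX N. ALL m>=N. ALL n>=N. nE (%x. u (s' m) x - u (s' n) x) < e" if e: "e > 0" for e
 proof -
  have mu2: "muu / 2 > 0" and R0: "0 <= R" using mu R by auto
  obtain de where del: "de > 0" "!!u v. u : E ==> v : E ==> nE u <= r ==> nE v <= r ==> muu / 2 <= ms R u ==> n2 (%x. u x - v x) <= de ==>
   dI u (%x. u x - v x) - dI v (%x. u x - v x) <= de ==> nE (%x. u x - v x) < e"
   by (rule strong_monotone[OF r R0 mu2 e]) (rule that)
  define L where "L = 1 + 2 * r"
  have L: "L >= 1" using r by (simp add: L_def)
  have "\<forall>\<^sub>F n in sequentially. et n < de / (2 * L)" using eta del L by (intro order_tendstoD) auto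
  then obtain n1 where n1: "!!n. n >= n1 ==> et n < de / (2 * L)" by (auto simp: eventually_sequentially)
  have "\<forall>\<^sub>F n in sequentially. n2 (%x. u (s n) x - v0 x) < de / 2" using s(3) del by (intro order_tendstoD) auto
  then obtain n2' where n2': "!!n. n >= n2' ==> n2 (%x. u (s n) x - v0 x) < de / 2" by (auto simp: eventually_sequentially)
  have "nE (%x. u (s' m) x - u (s' n) x) < e" if mn: "m >= max n1 n2'" "n >= max n1 n2'" for m n
  proof (rule del(2)[OF u(1) u(1) nr nr msl])
   let ?w = "%x. u (s' m) x - u (s' n) x"
   have a: "n2 (%x. u (s' k) x - v0 x) < de / 2" "et (s' k) < de / (2 * L)" if "k >= max n1 n2'" for k
    using n2'[of "k + n0"] n1[of "s' k"] that s'0(2)[of k] by (auto simp: s'_def)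
   have "n2 ?w <= n2 (%x. u (s' m) x - v0 x) + n2 (%x. u (s' n) x - v0 x)"
    using n2_triangle_diff[OF L2_diff[OF E_dest(7)[OF u(1)] s(2)] L2_diff[OF E_dest(7)[OF u(1)] s(2)], of "s' m" "s' n"] by simp
   then show "n2 ?w <= de" using a(1)[OF mn(1)] a(1)[OF mn(2)] by linarith
   have w: "?w : E" "nE ?w <= L" using E_diff[OF u(1) u(1)] nE_diff[OF u(1) u(1), of "s' m" "s' n"] nr[OF s'0(1)[of m]] nr[OF s'0(1)[of n]] by (auto simp: L_def)
   have d1: "abs (dI (u (s' k)) ?w) <= L * et (s' k)" for k by (rule dI_scaled[OF u(1) w(1) L w(2) dI])
   have d2: "L * et (s' k) <= de / 2" if "k >= max n1 n2'" for k using a(2)[OF that] L by (simp add: field_simps)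
   show "dI (u (s' m)) ?w - dI (u (s' n)) ?w <= de" using d1[of m] d1[of n] d2[OF mn(1)] d2[OF mn(2)] by linarith
  qed (use s'0 in auto)
  then show ?thesis by blast
 qed
 obtain v where v: "v : E" "(%n. nE (%x. u (s' n) x - v x)) ---> 0" by (rule E_complete[of "%n. u (s' n)", OF u(1) cau]) (assumption, rule that)
 show ?thesis by (rule that[OF s'm v])
qed

lemma limit_critical:
 assumes u: "!!n::nat. u n : E" and v: "v : E" "(%n. nE (%x. u n x - v x)) ---> 0" and eta: "et ---> 0" and dI: "!!n w. w : E ==> nE w <= 1 + nE (u n) ==> abs (dI (u n) w) <= et n"
 shows "crit_point V b p v" "(%n. II (u n)) ---> II v" "(%n. qV (u n) (u n)) ---> qV v v"
proof -
 \<comment> \<open>The added 1 / (n + 1) makes the radius strictly positive, as the Lipschitz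
   estimates require, also when the distance is 0.\<close>
 define rh where "rh n = nE (%x. u n x - v x) + 1 / real (Suc n)" for n
 have rl: "rh ---> 0 + 0" unfolding rh_def by (intro tendsto_add v LIMSEQ_inverse_real_of_nat[unfolded inverse_eq_divide])
 have r0: "0 < rh n" "nE (%x. u n x - v x) <= rh n" for n by (auto simp: rh_def add_nonneg_pos)
 define R where "R = nE v + 1"
 have R: "R > 0" "nE v <= R" by (auto simp: R_def add_nonneg_pos)
 have "\<forall>\<^sub>F n in sequentially. rh n < 1" using rl by (intro order_tendstoD(2)[of _ 0]) auto
 then have ev: "\<forall>\<^sub>F n in sequentially. rh n <= 1" by eventually_elim simp
 have nu: "nE (u n) <= R" "rh n <= R" if "rh n <= 1" for n using nE_le_add_diff[OF u v(1), of n] r0(2)[of n] that by (auto simp: R_def add_increasing)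
 obtain C where C: "C > 0" "!!u v s. u : E ==> v : E ==> nE v <= R ==> nE (%x. u x - v x) <= s ==> 0 < s ==> s <= R ==> abs (II u - II v) <= C * s"
  by (rule II_Lipschitz[OF R(1)]) (rule that)
 have "(%n. II (u n) - II v) ---> 0"
 proof (rule Lim_null_comparison)
  show "\<forall>\<^sub>F n in sequentially. norm (II (u n) - II v) <= C * rh n" using ev by eventually_elim (simp add: C(2)[OF u v(1) R(2) r0(2) r0(1) nu(2)])
  show "(%n. C * rh n) ---> 0" using tendsto_mult_left[OF rl, of C] by simp
 qed
 then show "(%n. II (u n)) ---> II v" by (simp add: LIM_zero_iff)
 have "(%n. qV (u n) (u n) - qV v v) ---> 0"
 proof (rule Lim_null_comparison)
  have "abs (qV (u n) (u n) - qV v v) <= 4 * R * rh n" if "rh n <= 1" for n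
  proof -
   let ?m = "%x. u n x - v x"
   have m: "?m : E" by (rule E_diff[OF u v(1)])
   have "qV (u n) (u n) = qV (u n) v + qV (u n) ?m" using qV_lin[OF u[of n] v(1) m, of 1 1] by simp
   moreover have "qV v (u n) = qV v v + qV v ?m" using qV_lin[OF v(1) v(1) m, of 1 1] by simp
   ultimately have "qV (u n) (u n) = qV v v + qV v ?m + qV (u n) ?m" using qV_sym[of v "u n"] by simp
   moreover have "abs (qV v ?m) <= 2 * (R * rh n)" by (rule qV_le[OF v(1) R(2) m r0(2)])
   moreover have "abs (qV (u n) ?m) <= 2 * (R * rh n)" by (rule qV_le[OF u nu(1)[OF that] m r0(2)])
   ultimately show ?thesis by linarith
  qed
  then show "\<forall>\<^sub>F n in sequentially. norm (qV (u n) (u n) - qV v v) <= 4 * R * rh n" using ev by (auto elim: eventually_mono)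
  show "(%n. 4 * R * rh n) ---> 0" using tendsto_mult_left[OF rl, of "4 * R"] by simp
 qed
 then show "(%n. qV (u n) (u n)) ---> qV v v" by (simp add: LIM_zero_iff)
 obtain D where D: "D > 0" "!!u v w s t. u : E ==> v : E ==> w : E ==> nE u <= R ==> nE v <= R ==> nE (%x. u x - v x) <= s ==> nE w <= t ==> 0 < s ==> s <= R ==> 0 < t ==> abs (dI u w - dI v w) <= D * s * t"
  by (rule dI_Lipschitz[OF R(1)]) (rule that)
 have "dI v w = 0" if w: "w : E" for w
 proof -
  define L where "L = 1 + nE w"
  have L: "1 <= L" "nE w <= L" "0 < L" by (auto simp: L_def add_pos_nonneg)
  have "abs (dI v w) <= L * et n + D * rh n * L" if n: "rh n <= 1" for n
  proof -
   have "abs (dI (u n) w) <= L * et n" by (rule dI_scaled[OF u w L(1,2) dI])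
   moreover have "abs (dI (u n) w - dI v w) <= D * rh n * L" by (rule D(2)[OF u v(1) w nu(1)[OF n] R(2) r0(2) L(2) r0(1) nu(2)[OF n] L(3)])
   ultimately show ?thesis by linarith
  qed
  then have "\<forall>\<^sub>F n in sequentially. abs (dI v w) <= L * et n + D * rh n * L" using ev by (auto elim: eventually_mono)
  moreover have "(%n. L * et n + D * rh n * L) ---> L * 0 + D * (0 + 0) * L" by (intro tendsto_intros eta rl)
  ultimately have "abs (dI v w) <= L * 0 + D * (0 + 0) * L" by (intro tendsto_le[OF _ _ tendsto_const]) auto
  then show ?thesis by simp
 qed
 then show "crit_point V b p v" unfolding crit_iff using v by simp
qed

end

subsection \<open>Decay of critical points and the Pohozaev inequality\<close>

text \<open>The radial analogue of the translation estimate. The segment from \<open>x\<close> to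
  \<open>c *r x\<close> consists of points \<open>l *r x\<close> with 1 <= l <= 2, so the weight |x|
  can be replaced by the weight at the moved point, and the change of variables only helps. The
  balls of radius \<open>R\<close> and \<open>2 * R\<close> keep all integrals finite.\<close>

lemma C1_dilation:
 fixes f :: "R2 => real"
 assumes d: "!!x. (f has_derivative (%h. ga x \<bullet> h)) (at x)" and g: "continuous_on UNIV ga" and c: "1 <= c" "c <= 2" and R: "0 < R"
 defines "F == %x. (indicator (cball 0 (2 * R)) x * norm x) *r ga x"
 shows "L2 F" "L2 (%x. indicator (cball 0 R) x * (f (c *r x) - f x))" "n2 (%x. indicator (cball 0 R) x * (f (c *r x) - f x)) <= (c - 1) * n2 F"
proof -
 have fc: "continuous_on UNIV f" using d by (meson continuous_at_imp_continuous_on has_derivative_continuous)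
 have bd: "L2 (%x. indicator (cball 0 r) x *r k x)" if k: "continuous_on UNIV k" for k :: "R2 => 'a::euclidean_space" and r
 proof -
  have "compact (k ` cball 0 r)" by (intro compact_continuous_image continuous_on_subset[OF k]) auto
  then obtain B where B: "!!x. norm x <= r ==> norm (k x) <= B" by (metis bounded_iff compact_imp_bounded imageI mem_cball_0)
  have "lm k" by (rule continuous_lebesgue_measurable[OF k])
  then show ?thesis by (intro L2_bounded_support[of _ "max 0 B" r]) (use B in \<open>auto simp: indicator_def le_max_iff_disj\<close>)
 qed
 have "continuous_on UNIV (%x. norm x *r ga x)" by (intro continuous_intros g)
 from bd[OF this, of "2 * R"] show FL: "L2 F" by (simp add: F_def)
 let ?h = "%x. indicator (cball 0 R) x * (f (c *r x) - f x)"
 have "continuous_on UNIV (%x. f (c *r x) - f x)" by (intro continuous_intros continuous_on_compose2[OF fc]) auto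
 note hc = this
 from bd[OF hc, of R] show hL: "L2 ?h" by simp
 let ?G = "%z::R2\<times>real. indicator {0..1::real} (snd z) * ennreal (indicator (cball 0 R) (fst z) * (ga (fst z + snd z *r ((c - 1) *r fst z)) \<bullet> ((c - 1) *r fst z))^2)"
 have [measurable]: "(%z::R2\<times>real. (ga (fst z + snd z *r ((c - 1) *r fst z)) \<bullet> ((c - 1) *r fst z))^2) : borel_measurable (borel \<Otimes>\<^sub>M borel)"
  unfolding borel_prod by (intro borel_measurable_continuous_onI continuous_intros continuous_on_compose2[OF g]) auto
 have [measurable]: "cball (0::R2) R : sets borel" by simp
 have Gm: "?G : borel_measurable (lborel \<Otimes>\<^sub>M lborel)" by measurable
 have Gm': "(%(x, t). ?G (x, t)) : borel_measurable (lborel \<Otimes>\<^sub>M lborel)" using Gm by (simp add: split_beta')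
 have hm: "(%x. ennreal ((?h x)^2)) : borel_measurable borel"
 proof -
  note [measurable] = borel_measurable_continuous_onI[OF hc]
  show ?thesis by measurable
 qed
 have "ennreal ((n2 ?h)^2) = (\<integral>\<^sup>+x. ennreal ((?h x)^2) \<partial>lebesgue)" unfolding n2_sq using L2_integrable[OF hL] by (subst nn_integral_eq_integral) auto
 also have "... = (\<integral>\<^sup>+x. ennreal ((?h x)^2) \<partial>lborel)" by (rule nn_integral_lebesgue_lborel[OF hm])
 also have "... <= (\<integral>\<^sup>+x. \<integral>\<^sup>+t. ?G (x, t) \<partial>lborel \<partial>lborel)"
 proof (rule nn_integral_mono)
  fix x :: R2
  show "ennreal ((?h x)^2) <= (\<integral>\<^sup>+t. ?G (x, t) \<partial>lborel)"
   using C1_increment_sq[OF d g, of x "(c - 1) *r x"] by (cases "x : cball 0 R") (auto simp: algebra_simps)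
 qed
 also have "... = (\<integral>\<^sup>+t. \<integral>\<^sup>+x. ?G (x, t) \<partial>lborel \<partial>lborel)" by (rule lborel_pair.Fubini'[OF Gm', symmetric])
 also have "... <= (\<integral>\<^sup>+t. indicator {0..1::real} t * ennreal (((c - 1) * n2 F)^2) \<partial>lborel)"
 proof (rule nn_integral_mono)
  fix t :: real
  show "(\<integral>\<^sup>+x. ?G (x, t) \<partial>lborel) <= indicator {0..1} t * ennreal (((c - 1) * n2 F)^2)"
  proof (cases "t : {0..1}")
   case True
   define l where "l = 1 + t * (c - 1)"
   have l: "1 <= l" "l <= 2" "l ~= 0"
   proof -
    have "0 <= t * (c - 1)" "t * (c - 1) <= 1 * 1" using True c by (simp, intro mult_mono) auto
    then show "1 <= l" "l <= 2" "l ~= 0" unfolding l_def by linarith+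
   qed
   have le: "indicator (cball 0 R) x * (ga (x + t *r ((c - 1) *r x)) \<bullet> ((c - 1) *r x))^2 <= (c - 1)^2 * (norm (F (l *r x)))^2" for x
   proof (cases "x : cball 0 R")
    case x: True
    have e: "x + t *r ((c - 1) *r x) = l *r x" by (simp add: l_def algebra_simps)
    have "l * norm x <= 2 * R" using x l by (intro mult_mono) auto
    then have Fe: "norm (F (l *r x)) = (l * norm x) * norm (ga (l *r x))" using l by (simp add: F_def)
    have "abs (ga (l *r x) \<bullet> ((c - 1) *r x)) <= norm (ga (l *r x)) * ((c - 1) * norm x)" using Cauchy_Schwarz_ineq2[of "ga (l *r x)" "(c - 1) *r x"] c by simp
    also have "... <= norm (ga (l *r x)) * ((c - 1) * (l * norm x))" using l c mult_right_mono[of 1 l "norm x"] by (intro mult_left_mono) auto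
    also have "... = (c - 1) * norm (F (l *r x))" unfolding Fe by simp
    finally have "(abs (ga (l *r x) \<bullet> ((c - 1) *r x)))^2 <= ((c - 1) * norm (F (l *r x)))^2" by (intro power_mono) auto
    then show ?thesis using x unfolding e by (simp add: power_mult_distrib)
   qed simp
   have mt: "(%x. ennreal (indicator (cball 0 R) x * (ga (x + t *r ((c - 1) *r x)) \<bullet> ((c - 1) *r x))^2)) : borel_measurable borel"
   proof -
    have [measurable]: "(%x. (ga (x + t *r ((c - 1) *r x)) \<bullet> ((c - 1) *r x))^2) : borel_measurable borel"
     by (intro borel_measurable_continuous_onI continuous_intros continuous_on_compose2[OF g]) auto
    show ?thesis by measurable
   qed
   have Fl: "L2 (%x. F (l *r x))" "n2 (%x. F (l *r x)) = n2 F / l" using L2_affine[OF l(3) FL, of 0] n2_affine[OF l(3) FL, of 0] l by auto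
   have "(\<integral>\<^sup>+x. ?G (x, t) \<partial>lborel) = (\<integral>\<^sup>+x. ennreal (indicator (cball 0 R) x * (ga (x + t *r ((c - 1) *r x)) \<bullet> ((c - 1) *r x))^2) \<partial>lebesgue)"
    unfolding nn_integral_lebesgue_lborel[OF mt] using True by simp
   also have "... <= (\<integral>\<^sup>+x. ennreal ((c - 1)^2 * (norm (F (l *r x)))^2) \<partial>lebesgue)" by (intro nn_integral_mono ennreal_leI le)
   also have "... = ennreal ((c - 1)^2 * (n2 F / l)^2)" using L2_integrable[OF Fl(1)] unfolding Fl(2)[symmetric] n2_sq by (subst nn_integral_eq_integral) auto
   also have "... <= ennreal (((c - 1) * n2 F)^2)" unfolding power_mult_distrib
    using l by (intro ennreal_leI mult_left_mono power_mono) (auto simp: divide_le_eq mult_right_mono intro: mult_left_mono[of 1 l, simplified])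
   finally show ?thesis using True by simp
  qed simp
 qed
 also have "... = ennreal (((c - 1) * n2 F)^2)" by (subst nn_integral_multc) auto
 finally have "(n2 ?h)^2 <= ((c - 1) * n2 F)^2" by (simp add: ennreal_le_iff)
 then show "n2 ?h <= (c - 1) * n2 F" by (rule power2_le_imp_le) (use c in simp)
qed

text \<open>The mollified gradients converge in L^2, but without the weight |x|. On a ball the
  weight is bounded, so the mollification parameter can go to 0 first; the radius is then sent to
  infinity by Fatou.\<close>

lemma n2_dilation_increment:
 assumes u: "L2 u" "weak_grad u g" "L2 g" and G: "L2 (%x. norm x *r g x)" and c: "1 <= c" "c <= 2"
 shows "n2 (%x. u (c *r x) - u x) <= (c - 1) * n2 (%x. norm x *r g x)"
proof -
 have c0: "c ~= 0" using c by simp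
 define f where "f k = conv (1 / real (Suc k)) u" for k
 define ga where "ga k = conv (1 / real (Suc k)) g" for k
 have s: "1 / real (Suc k) > 0" for k by simp
 have fL: "L2 (f k)" and gL: "L2 (ga k)" for k unfolding f_def ga_def by (rule L2_conv[OF s u(1)], rule L2_conv[OF s u(3)])
 have gc: "continuous_on UNIV (ga k)" for k unfolding ga_def by (rule continuous_conv[OF s L2_loc_int[OF u(3)]])
 have cg: "cgrad (f k) = ga k" for k unfolding f_def ga_def by (rule ext) (rule cgrad_conv_weak[OF s u(2)])
 have fd: "(f k has_derivative (%h. ga k x \<bullet> h)) (at x)" for k x
  using conv_has_derivative[OF s[of k] L2_loc_int[OF u(1)], of x] cgrad_eqI[OF conv_has_derivative[OF s[of k] L2_loc_int[OF u(1)], of x]]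
  unfolding cg[symmetric] f_def by simp
 let ?h = "%x. u (c *r x) - u x"
 have uc: "L2 (%x. u (c *r x))" using L2_affine[OF c0 u(1), of 0] by simp
 have hL: "L2 ?h" by (rule L2_diff[OF uc u(1)])
 have ind: "L2 (%x. indicator (cball (0::R2) R) x *r v x)" "n2 (%x. indicator (cball (0::R2) R) x *r v x) <= n2 v" if "L2 v" for v :: "R2 => real" and R
  using that n2_indicator_split(1)[OF that, of "cball 0 R"] by (auto intro!: n2_mono simp: indicator_def)
 have ball: "n2 (%x. indicator (cball 0 R) x *r ?h x) <= (c - 1) * n2 (%x. norm x *r g x)" if R: "R > 0" for R
 proof -
  have le: "n2 (%x. indicator (cball 0 R) x *r ?h x) <= (c - 1) * (n2 (%x. norm x *r g x) + 2 * R * n2 (%x. ga k x - g x)) + 2 * n2 (%x. f k x - u x)" for k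
  proof -
   note C = C1_dilation[OF fd[of k] gc[of k] c R]
   let ?F = "%x. (indicator (cball 0 (2 * R)) x * norm x) *r ga k x"
   have "n2 ?F <= n2 (%x. norm (norm x *r g x) + 2 * R * norm (ga k x - g x))"
   proof (rule n2_mono)
    show "L2 (%x. norm (norm x *r g x) + 2 * R * norm (ga k x - g x))" by (intro L2_add(1) L2_cmult L2_norm G L2_diff gL u)
    show "AE x in lebesgue. norm (?F x) <= norm (norm (norm x *r g x) + 2 * R * norm (ga k x - g x))"
    proof (rule AE_I2)
     fix x
     have "norm (ga k x) <= norm (g x) + norm (ga k x - g x)" using norm_triangle_ineq[of "g x" "ga k x - g x"] by simp
     then have "norm x * norm (ga k x) <= norm x * norm (g x) + norm x * norm (ga k x - g x)" unfolding distrib_left[symmetric] by (rule mult_left_mono) simp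
     moreover have "norm x * norm (ga k x - g x) <= 2 * R * norm (ga k x - g x)" if "norm x <= 2 * R" using that by (intro mult_right_mono) auto
     ultimately show "norm (?F x) <= norm (norm (norm x *r g x) + 2 * R * norm (ga k x - g x))" using R by (auto simp: indicator_def)
    qed
   qed (use L2_measurable[OF C(1)] in simp)
   also have "... <= n2 (%x. norm x *r g x) + 2 * R * n2 (%x. ga k x - g x)"
    using n2_triangle[OF L2_norm[OF G] L2_cmult[OF L2_norm[OF L2_diff[OF gL[of k] u(3)]], of "2 * R"]] R unfolding n2_cmult n2_norm by simp
   finally have F: "(c - 1) * n2 ?F <= (c - 1) * (n2 (%x. norm x *r g x) + 2 * R * n2 (%x. ga k x - g x))" using c by (intro mult_left_mono) auto
   have d1: "L2 (%x. f k (c *r x) - u (c *r x))" "n2 (%x. f k (c *r x) - u (c *r x)) <= n2 (%x. f k x - u x)"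
    using L2_affine[OF c0 L2_diff[OF fL[of k] u(1)], of 0] n2_affine[OF c0 L2_diff[OF fL[of k] u(1)], of 0] c
    by (auto simp: divide_le_eq intro: mult_left_mono[of 1 c, simplified])
   have d2: "L2 (%x. f k x - u x)" by (rule L2_diff[OF fL u(1)])
   have e: "(%x. indicator (cball 0 R) x *r ?h x) = (%x. indicator (cball 0 R) x * (f k (c *r x) - f k x)
     - indicator (cball 0 R) x *r ((f k (c *r x) - u (c *r x)) - (f k x - u x)))" by (auto simp: algebra_simps)
   have "n2 (%x. indicator (cball 0 R) x *r ?h x) <= n2 (%x. indicator (cball 0 R) x * (f k (c *r x) - f k x)) + n2 (%x. (f k (c *r x) - u (c *r x)) - (f k x - u x))"
    unfolding e using n2_triangle_diff[OF C(2) ind(1)[OF L2_diff[OF d1(1) d2], of R]] ind(2)[OF L2_diff[OF d1(1) d2], of R] by linarith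
   then show ?thesis using n2_triangle_diff[OF d1(1) d2] d1(2) C(3) F by linarith
  qed
  have z: "(%k. (c - 1) * (n2 (%x. norm x *r g x) + 2 * R * n2 (%x. ga k x - g x)) + 2 * n2 (%x. f k x - u x)) ---> (c - 1) * (n2 (%x. norm x *r g x) + 2 * R * 0) + 2 * 0"
   unfolding f_def ga_def by (intro tendsto_intros conv_L2_tendsto u)
  have "n2 (%x. indicator (cball 0 R) x *r ?h x) <= (c - 1) * (n2 (%x. norm x *r g x) + 2 * R * 0) + 2 * 0" by (rule LIMSEQ_le_const[OF z]) (use le in blast)
  then show ?thesis by simp
 qed
 show ?thesis
 proof (rule L2_Fatou(2)[of "%k x. indicator (cball 0 (real (Suc k))) x *r ?h x"])
  show "L2 (%x. indicator (cball (0::R2) (real (Suc k))) x *r ?h x)" for k by (rule ind(1)[OF hL])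
  show "lm ?h" using hL by (rule L2_measurable)
  show "\<forall>\<^sub>F k in sequentially. n2 (%x. indicator (cball 0 (real (Suc k))) x *r ?h x) <= (c - 1) * n2 (%x. norm x *r g x)" by (intro always_eventually allI ball) simp
  show "AE x in lebesgue. (%k. indicator (cball 0 (real (Suc k))) x *r ?h x) ---> ?h x"
  proof (intro AE_I2 tendsto_eventually)
   fix x :: R2
   obtain N where "norm x <= real N" using real_arch_simple by blast
   then show "\<forall>\<^sub>F k in sequentially. indicator (cball 0 (real (Suc k))) x *r ?h x = ?h x"
    unfolding eventually_sequentially by (intro exI[of _ N]) (auto simp: indicator_def)
  qed
 qed
qed

text \<open>Bounded \<open>C\<^sup>1\<close> weights with gradient at most 1 that increase to \<open>sqrt (1 + |x|\<^sup>2)\<close> as \<open>epp\<close> tends to 0.\<close>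

definition wt :: "real => R2 => real" where "wt epp x = sqrt (1 + x \<bullet> x) / (1 + epp * sqrt (1 + x \<bullet> x))"

definition wtg :: "real => R2 => R2" where "wtg epp x = (1 / (sqrt (1 + x \<bullet> x) * (1 + epp * sqrt (1 + x \<bullet> x))^2)) *r x"

lemma wt:
 assumes e: "epp > 0"
 shows "(wt epp has_derivative (%h. wtg epp x \<bullet> h)) (at x)" "continuous_on UNIV (wt epp)" "continuous_on UNIV (wtg epp)" "0 < wt epp x" "wt epp x <= 1 / epp" "(wt epp x)^2 <= 1 + (norm x)^2" "norm (wtg epp x) <= 1"
proof -
 define q where "q = sqrt (1 + x \<bullet> x)"
 have q: "1 <= q" "q^2 = 1 + x \<bullet> x" by (auto simp: q_def add_nonneg_nonneg)
 have qe: "1 <= 1 + epp * q" using e q by simp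
 have nq: "norm x <= q" unfolding q_def norm_eq_sqrt_inner by simp
 have pos: "0 < 1 + epp * sqrt (1 + y \<bullet> y)" "0 < 1 + y \<bullet> y" for y :: R2 using e by (auto intro!: add_pos_nonneg mult_nonneg_nonneg)
 have "((%s. sqrt (1 + s)) has_real_derivative inverse q / 2) (at (x \<bullet> x))" unfolding q_def using pos(2)[of x] by (auto intro!: derivative_eq_intros)
 moreover have "((%r. r / (1 + epp * r)) has_real_derivative 1 / (1 + epp * q)^2) (at (sqrt (1 + x \<bullet> x)))"
  unfolding q_def[symmetric] using qe by (auto intro!: derivative_eq_intros simp: power2_eq_square field_simps)
 ultimately have "((%s. sqrt (1 + s) / (1 + epp * sqrt (1 + s))) has_real_derivative 1 / (1 + epp * q)^2 * (inverse q / 2)) (at (x \<bullet> x))"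
  using DERIV_chain2[of "%r. r / (1 + epp * r)" _ "%s. sqrt (1 + s)"] by blast
 note D = this
 have "((%x. x \<bullet> x) has_derivative (%h. x \<bullet> h + h \<bullet> x)) (at x)" by (auto intro!: derivative_eq_intros)
 from DERIV_compose_FDERIV[where g="%x. x \<bullet> x" and g'="%h. x \<bullet> h + h \<bullet> x" and s=UNIV and x=x, OF D this]
 have "((%x. sqrt (1 + x \<bullet> x) / (1 + epp * sqrt (1 + x \<bullet> x))) has_derivative (%h. (x \<bullet> h + h \<bullet> x) * (1 / (1 + epp * q)^2 * (inverse q / 2)))) (at x)"
  by simp
 moreover have "(%h. (x \<bullet> h + h \<bullet> x) * (1 / (1 + epp * q)^2 * (inverse q / 2))) = (%h. wtg epp x \<bullet> h)"
  unfolding wtg_def q_def[symmetric] by (auto simp: inner_commute field_simps)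
 ultimately show "(wt epp has_derivative (%h. wtg epp x \<bullet> h)) (at x)" unfolding wt_def[abs_def] by simp
 show "continuous_on UNIV (wt epp)" "continuous_on UNIV (wtg epp)" unfolding wt_def[abs_def] wtg_def[abs_def]
  using pos by (auto intro!: continuous_intros simp: less_imp_neq[symmetric])
 have w: "wt epp x = q / (1 + epp * q)" by (simp add: wt_def q_def)
 show "0 < wt epp x" unfolding w using q qe by simp
 show "wt epp x <= 1 / epp" 
 proof -
  have "q <= 1 / epp * (1 + epp * q)" using e by (simp add: distrib_left)
  then show ?thesis unfolding w using qe by (subst pos_divide_le_eq) auto
 qed
 have "wt epp x <= q" unfolding w using q qe by (simp add: divide_le_eq mult_left_mono[of 1, simplified])
 then have "(wt epp x)^2 <= q^2" using \<open>0 < wt epp x\<close> by (intro power_mono) auto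
 then show "(wt epp x)^2 <= 1 + (norm x)^2" unfolding q by (simp add: power2_norm_eq_inner)
 have "1 <= (1 + epp * q)^2" using qe by (simp add: one_le_power)
 then have "norm x <= q * (1 + epp * q)^2" using nq q mult_left_mono[of 1 "(1 + epp * q)^2" q] by linarith
 then show "norm (wtg epp x) <= 1" unfolding wtg_def q_def[symmetric] using q qe by (simp add: abs_mult)
qed

context choquard
begin

text \<open>For fixed \<open>epp\<close> the weight is bounded with bounded gradient, so
  multiplication by it, even twice, gives admissible test functions. Only the resulting bounds must
  be uniform in \<open>epp\<close>.\<close>

lemma wt_mult:
 assumes u: "u : E" and e: "epp > 0"
 shows "(%x. wt epp x * u x) : E" "AE x in lebesgue. wgrad (%x. wt epp x * u x) x = wt epp x *r wgrad u x + u x *r wtg epp x"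
proof -
 note d = E_dest[OF u] and w = wt[OF e]
 have wg: "weak_grad (%x. wt epp x * u x) (%x. wt epp x *r wgrad u x + u x *r wtg epp x)" by (rule weak_grad_mult[OF d(2) w(1) w(3)])
 show "AE x in lebesgue. wgrad (%x. wt epp x * u x) x = wt epp x *r wgrad u x + u x *r wtg epp x" by (rule wgrad_AE[OF wg])
 have m: "lm (wt epp)" "lm (wtg epp)" by (intro continuous_lebesgue_measurable w)+
 have um: "lm (%x. wt epp x * u x)" using m d by auto
 have "L2 (%x. wt epp x *r wgrad u x)"
  by (rule L2_bound[OF L2_scaleR[OF d(3), of "1 / epp"]]) (use m d mult_right_mono[OF w(5) norm_ge_zero] w(4) e in \<open>auto intro!: AE_I2 simp: abs_of_pos\<close>)
 moreover have "L2 (%x. u x *r wtg epp x)"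
  by (rule L2_bound[OF d(7)]) (use m d w(7) in \<open>auto intro!: AE_I2 mult_left_le\<close>)
 ultimately have gL: "L2 (%x. wt epp x *r wgrad u x + u x *r wtg epp x)" by (rule L2_add(1))
 have le: "(wt epp x)^2 <= (1 / epp)^2" for x using w(4,5)[of x] by (intro power_mono) auto
 have "li (%x. W x * (wt epp x * u x)^2)"
 proof (rule Bochner_Integration.integrable_bound[OF integrable_mult_right[OF d(4), of "(1 / epp)^2"]])
  show "lm (%x. W x * (wt epp x * u x)^2)" using um lmW by auto
  have "W x * (wt epp x * u x)^2 <= (1 / epp)^2 * (W x * (u x)^2)" for x
   using mult_right_mono[OF le[of x], of "W x * (u x)^2"] Wpos(2)[of x] by (simp add: power_mult_distrib mult_ac)
  then show "AE x in lebesgue. norm (W x * (wt epp x * u x)^2) <= norm ((1 / epp)^2 * (W x * (u x)^2))"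
   using Wpos(2) by (intro AE_I2) (simp add: abs_mult less_imp_le)
 qed
 then show "(%x. wt epp x * u x) : E" by (rule E_intro[OF um wg gL])
qed

lemma mass_in_ball:
 assumes u: "u : E" "n2 u > 0" obtains R where "R > 0" "ms R u > 0"
proof -
 note d = E_dest[OF u(1)]
 define M where "M = n2 u + n2 (wgrad u) + (LI x. V x * (u x)^2)"
 have Vn: "0 <= V x" for x using Wpos(5)[of x] by simp
 have "0 <= (LI x. V x * (u x)^2)" using Vn by (intro integral_nonneg_AE) auto
 then have M: "n2 u <= M" "n2 (wgrad u) <= M" "(LI x. V x * (u x)^2) <= M" by (auto simp: M_def)
 define e where "e = n2 u / 2"
 have e: "e > 0" using u by (simp add: e_def)
 obtain R where R: "R > 0" "!!u g. L2 u ==> weak_grad u g ==> L2 g ==> n2 u <= M ==> n2 g <= M ==>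
  li (%x. V x * (u x)^2) ==> (LI x. V x * (u x)^2) <= M ==> n2 (%x. indicator (- cball 0 R) x *r u x) <= e"
  by (rule uniform_tail[OF lmV Vn Vfin e]) (assumption, rule that)
 have "n2 (%x. indicator (- cball 0 R) x *r u x) < n2 u" using R(2)[OF d(7,2,3) M(1,2) d(5) M(3)] u by (simp add: e_def)
 then have "(n2 (%x. indicator (- cball 0 R) x *r u x))^2 < (n2 u)^2" by (intro power_strict_mono) auto
 then show ?thesis using that[OF R(1)] by (simp add: ms_eq[OF u(1)])
qed


text \<open>An Agmon-type estimate. With \<open>rh = wt * u\<close>, testing the equation gives
  \<open>qV rh rh\<close>, up to the mass of \<open>u\<close>, plus a multiple \<open>c1\<close> of
  the logarithmic moment of \<open>rh^2\<close>. The power term is absorbed half by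
  \<open>qV rh rh\<close> and half by a multiple of the mass of \<open>rh\<close>. That mass is in
  turn absorbed: far out because the logarithmic weight exceeds any constant, and in a ball because
  the weight is bounded there independently of \<open>epp\<close>.\<close>

lemma weighted_mass:
 assumes u: "u : E" "n2 u > 0"
 obtains Q where "!!epp. epp > 0 ==> (%x. wt epp x * (wt epp x * u x)) : E ==> dI u (%x. wt epp x * (wt epp x * u x)) = 0 ==> qV (%x. wt epp x * u x) (%x. wt epp x * u x) <= Q"
proof -
 note du = E_dest[OF u(1)]
 obtain R where R: "R > 0" "ms R u > 0" by (rule mass_in_ball[OF u]) (rule that)
 obtain C where C: "C > 0" "!!u t. u : E ==> qV u u <= t^2 ==> 0 < t ==> Lq u <= C * (n2 u)^2 * t powr (p - 2)"
  by (rule V_bounds) (rule that)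
 define muu ka L m where "muu = ms R u" and "ka = ln (1 + R) + ln 2" and "L = Lq u" and "m = (n2 u)^2"
 \<comment> \<open>This makes the coefficient \<open>b * e^2 * L\<close> of \<open>qV rh rh\<close>
   at most 1/2, so that it can be absorbed.\<close>
 define e where "e = sqrt (1 / (2 * (b * L + 1)))"
 have L0: "0 <= L" unfolding L_def by (rule Lq_nonneg)
 have bL: "0 <= b * L" using b L0 by simp
 have e: "e > 0" "b * (e^2 * L) <= 1 / 2" using bL by (auto simp: e_def field_simps)
 define c1 where "c1 = muu / (2 * pi)"
 have c1: "c1 > 0" using R by (simp add: c1_def muu_def)
 define D where "D = (lgc + 1) * sQ (%x. (u x)^2)"
 have D: "0 <= D" unfolding D_def using lgc_nonneg by (intro mult_nonneg_nonneg) (auto simp: sQ_def)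
 define K where "K = (muu * ka + D) / (2 * pi) + b * (e powr (2 - p) * C)"
 have K: "0 <= K" unfolding K_def using R D b C by (intro add_nonneg_nonneg divide_nonneg_nonneg mult_nonneg_nonneg) (auto simp: muu_def ka_def)
 \<comment> \<open>Beyond this radius \<open>c1 * lw x\<close> is at least \<open>K\<close>, so the
   logarithmic moment dominates the mass term there.\<close>
 define r where "r = exp (K / c1)"
 have r: "r > 0" "K <= c1 * ln (1 + r)"
 proof -
  show "r > 0" by (simp add: r_def)
  have "K / c1 <= ln (1 + r)" using ln_mono[of r "1 + r"] by (simp add: r_def)
  then show "K <= c1 * ln (1 + r)" using c1 by (simp add: field_simps)
 qed
 show ?thesis
 proof (rule that[of "2 * (m + 1 + K * (1 + r^2) * m)"])
  fix epp :: real assume eps: "epp > 0" and wE: "(%x. wt epp x * (wt epp x * u x)) : E" and dI0: "dI u (%x. wt epp x * (wt epp x * u x)) = 0"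
  define rh where "rh = (%x. wt epp x * u x)"
  define w where "w = (%x. wt epp x * rh x)"
  note W1 = wt_mult[OF u(1) eps, folded rh_def]
  note W2 = wt_mult[OF W1(1) eps, folded w_def]
  note we = wt[OF eps] and dr = E_dest[OF W1(1)]
  have m: "lm (wtg epp)" by (intro continuous_lebesgue_measurable we)
  have gL: "L2 (%x. u x *r wtg epp x)" "n2 (%x. u x *r wtg epp x) <= n2 u"
   using we(7) du(1) m by (auto intro!: L2_bound[OF du(7)] n2_mono[OF du(7)] AE_I2 mult_left_le)
  have "qV u w = (LI x. (wgrad rh x \<bullet> wgrad rh x + V x * (rh x * rh x)) - (norm (u x *r wtg epp x))^2)" unfolding qV_def
  proof (rule integral_cong_AE)
   show "lm (%x. wgrad u x \<bullet> wgrad w x + V x * (u x * w x))" using qV_integrable[OF u(1) W2(1)] by (rule borel_measurable_integrable)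
   show "lm (%x. (wgrad rh x \<bullet> wgrad rh x + V x * (rh x * rh x)) - (norm (u x *r wtg epp x))^2)"
    using borel_measurable_integrable[OF qV_integrable[OF W1(1) W1(1)]] L2_measurable[OF gL(1)] by measurable
   show "AE x in lebesgue. wgrad u x \<bullet> wgrad w x + V x * (u x * w x) = (wgrad rh x \<bullet> wgrad rh x + V x * (rh x * rh x)) - (norm (u x *r wtg epp x))^2"
    using W1(2) W2(2)
   proof eventually_elim
    case (elim x)
    \<comment> \<open>The pointwise identity behind the test: the gradient of \<open>u\<close> times
      that of eta^2 u is |grad (eta u)|^2 - u^2 |grad eta|^2.\<close>
    have alg: "U \<bullet> (t *r (t *r U + y *r g) + (t * y) *r g) = (t *r U + y *r g) \<bullet> (t *r U + y *r g) - (y *r g) \<bullet> (y *r g)" for U g :: R2 and t y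
     by (simp add: inner_add_left inner_add_right inner_commute[of g U] distrib_left)
    have v: "V x * (u x * w x) = V x * (rh x * rh x)" unfolding w_def rh_def by simp
    show ?case unfolding elim(2) v unfolding elim(1) power2_norm_eq_inner unfolding rh_def alg by simp
   qed
  qed
  also have "... = qV rh rh - ((n2 (%x. u x *r wtg epp x))^2)" unfolding n2_sq qV_def using qV_integrable[OF W1(1) W1(1)] L2_integrable[OF gL(1)] by simp
  finally have q: "qV rh rh - m <= qV u w" using power_mono[OF gL(2) n2_nonneg, of 2] by (simp add: m_def)
  define Z where "Z = (n2 rh)^2"
  have uw: "(%x. u x * w x) = (%x. (rh x)^2)" unfolding w_def rh_def by (auto simp: power2_eq_square mult_ac)
  have B: "muu * (sL (%x. (rh x)^2) - ka * Z) - D * Z <= B4 u u w"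
  proof -
   note Du = Dl_sq[OF u(1)] and Dr = Dl_sq[OF W1(1)]
   have "muu * (sL (%x. (rh x)^2) - ka * Z) <= Bk lgp (%x. (u x)^2) (%x. (rh x)^2)" unfolding muu_def ms_def ka_def Z_def s1_sq[symmetric] using R by (intro Bk_lgp_lower Du Dr) auto
   moreover have "Bk lgm (%x. (u x)^2) (%x. (rh x)^2) = Bk lgm (%x. (rh x)^2) (%x. (u x)^2)" by (rule Bk_sym[OF lgm_minus borel_lg(2)]) (use Du Dr in \<open>auto simp: Dl_def\<close>)
   moreover have "abs (Bk lgm (%x. (rh x)^2) (%x. (u x)^2)) <= D * Z" using Bk_lgm(2)[OF Dr Du] unfolding D_def Z_def s1_sq by (simp add: mult_ac)
   ultimately show ?thesis unfolding B4_def BB_def uw by linarith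
  qed
  \<comment> \<open>Dividing \<open>rh\<close> by \<open>t\<close> puts it in the unit ball of
    \<open>H_V\<close>, where \<open>Lq\<close> is bounded by a multiple of the squared mass. After
    scaling back, the power term grows only quadratically in \<open>rh\<close>.\<close>
  define t where "t = sqrt (qV rh rh + 1)"
  have q0: "0 <= qV rh rh" by (rule qV_nonneg)
  have t: "t > 0" "t^2 = qV rh rh + 1" using q0 by (auto simp: t_def)
  define si where "si = (%x. 1 / t * rh x)"
  have sE: "si : E" unfolding si_def by (rule E_cmult[OF W1(1)])
  have "qV si si = (1 / t)^2 * qV rh rh" unfolding si_def using t by (intro II_scale(2)[OF W1(1)]) simp
  then have "qV si si <= 1^2" using t q0 by (simp add: power_divide)
  then have "Lq si <= C * (n2 si)^2 * 1 powr (p - 2)" by (intro C(2) sE) auto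
  moreover have "n2 si = n2 rh / t" unfolding si_def using n2_cmult[of "1 / t" rh] t by simp
  ultimately have Ls: "t^2 * Lq si <= C * Z" using t(1) by (simp add: power_divide Z_def field_simps)
  have "Ap u w <= (LI x. t^2 * (e^2 * abs (u x) powr p + e powr (2 - p) * abs (si x) powr p))" unfolding Ap_def
  proof (rule integral_mono)
   show "li (%x. abs (u x) powr (p - 2) * u x * w x)" by (rule Ap_integrable(1)[OF u(1) W2(1)])
   show "li (%x. t^2 * (e^2 * abs (u x) powr p + e powr (2 - p) * abs (si x) powr p))" using Lq_integrable[OF p u(1)] Lq_integrable[OF p sE] by simp
   fix x
   have "abs (u x) powr (p - 2) * u x * w x = t^2 * (abs (u x) powr (p - 2) * (abs (si x))^2)" using fun_cong[OF uw, of x] t(1) by (simp add: si_def power_divide mult.assoc)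
   also have "... <= t^2 * (e^2 * abs (u x) powr p + e powr (2 - p) * abs (si x) powr p)" using e(1) p by (intro mult_left_mono young_powr) auto
   finally show "abs (u x) powr (p - 2) * u x * w x <= t^2 * (e^2 * abs (u x) powr p + e powr (2 - p) * abs (si x) powr p)" .
  qed
  also have "... = t^2 * (e^2 * L) + e powr (2 - p) * (t^2 * Lq si)" unfolding L_def Lq_eq using Lq_integrable[OF p u(1)] Lq_integrable[OF p sE] by (simp add: algebra_simps)
  also have "... <= t^2 * (e^2 * L) + e powr (2 - p) * (C * Z)" using Ls by (intro add_left_mono mult_left_mono) auto
  finally have "b * Ap u w <= b * (t^2 * (e^2 * L) + e powr (2 - p) * (C * Z))" using b by (intro mult_left_mono) auto
  also have "... = t^2 * (b * (e^2 * L)) + b * (e powr (2 - p) * C) * Z" by (simp add: algebra_simps)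
  also have "... <= t^2 * (1 / 2) + b * (e powr (2 - p) * C) * Z" using e(2) by (intro add_right_mono mult_left_mono) auto
  finally have A: "b * Ap u w <= (qV rh rh + 1) / 2 + b * (e powr (2 - p) * C) * Z" unfolding t(2) by simp
  have "(muu * (sL (%x. (rh x)^2) - ka * Z) - D * Z) / (2 * pi) <= B4 u u w / (2 * pi)" using B by (intro divide_right_mono) auto
  moreover have "(muu * (sL (%x. (rh x)^2) - ka * Z) - D * Z) / (2 * pi) = c1 * sL (%x. (rh x)^2) - (muu * ka + D) / (2 * pi) * Z" unfolding c1_def by (simp add: diff_divide_distrib add_divide_distrib algebra_simps)
  moreover have "qV u w + B4 u u w / (2 * pi) - b * Ap u w = 0" using dI0 unfolding dI_def w_def rh_def .
  moreover have "K * Z = (muu * ka + D) / (2 * pi) * Z + b * (e powr (2 - p) * C) * Z" unfolding K_def by (rule distrib_right)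
  ultimately have main: "qV rh rh / 2 + c1 * sL (%x. (rh x)^2) <= m + 1 + K * Z" using q A unfolding add_divide_distrib by linarith
  define J where "J = K * (1 + r^2) * m"
  have "K * Z = (LI x. K * (rh x)^2)" by (simp add: Z_def n2_sq)
  also have "... <= (LI x. c1 * (lw x * (rh x)^2) + K * (1 + r^2) * (u x)^2)"
  proof (rule integral_mono)
   show "li (%x. K * (rh x)^2)" "li (%x. c1 * (lw x * (rh x)^2) + K * (1 + r^2) * (u x)^2)" using L2_integrable[OF dr(7)] L2_integrable[OF du(7)] dr(6) by auto
   fix x
   show "K * (rh x)^2 <= c1 * (lw x * (rh x)^2) + K * (1 + r^2) * (u x)^2"
   proof (cases "norm x <= r")
    case True
    have "(rh x)^2 <= (1 + (norm x)^2) * (u x)^2" unfolding rh_def power_mult_distrib by (intro mult_right_mono we) auto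
    also have "... <= (1 + r^2) * (u x)^2" using True by (intro mult_right_mono add_left_mono power_mono) auto
    finally have "K * (rh x)^2 <= K * ((1 + r^2) * (u x)^2)" using K by (intro mult_left_mono)
    moreover have "0 <= c1 * (lw x * (rh x)^2)" using c1 lw_nonneg[of x] by simp
    ultimately show ?thesis by (simp add: mult.assoc)
   next
    case False
    have "ln (1 + r) <= lw x" unfolding lw_def using False r(1) by (intro ln_mono) auto
    then have "c1 * ln (1 + r) <= c1 * lw x" using c1 by (intro mult_left_mono) auto
    then have "K <= c1 * lw x" using r(2) by linarith
    then have "K * (rh x)^2 <= c1 * lw x * (rh x)^2" by (intro mult_right_mono) auto
    moreover have "0 <= K * (1 + r^2) * (u x)^2" using K by (intro mult_nonneg_nonneg) (auto simp: add_nonneg_nonneg)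
    ultimately show ?thesis by (simp add: mult.assoc)
   qed
  qed
  also have "... = c1 * sL (%x. (rh x)^2) + J" unfolding J_def sL_def m_def n2_sq using dr(6) L2_integrable[OF du(7)] by simp
  finally have k: "K * Z <= c1 * sL (%x. (rh x)^2) + J" .
  have "x <= 2 * (m' + 1 + j)" if "z <= y + j" "x / 2 + y <= m' + 1 + z" for x y z m' j :: real using that by (simp add: field_simps)
  from this[OF k main] show "qV (%x. wt epp x * u x) (%x. wt epp x * u x) <= 2 * (m + 1 + K * (1 + r^2) * m)" unfolding rh_def[symmetric] J_def[symmetric] .
 qed
qed

lemma crit_decay:
 assumes c: "crit_point V b p u" and n: "n2 u > 0"
 shows "L2 (%x. norm x *r wgrad u x)"
proof -
 have u: "u : E" and d0: "!!w. w : E ==> dI u w = 0" using c by (auto simp: crit_iff)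
 note du = E_dest[OF u]
 obtain Q where Q: "!!epp. epp > 0 ==> (%x. wt epp x * (wt epp x * u x)) : E ==> dI u (%x. wt epp x * (wt epp x * u x)) = 0 ==> qV (%x. wt epp x * u x) (%x. wt epp x * u x) <= Q"
  by (rule weighted_mass[OF u n]) (rule that)
 define epp where "epp k = 1 / real (Suc k)" for k
 have e: "epp k > 0" for k by (simp add: epp_def)
 have el: "epp ---> 0" unfolding epp_def by (rule LIMSEQ_inverse_real_of_nat[unfolded inverse_eq_divide])
 have m: "lm (wtg (epp k))" "lm (wt (epp k))" for k by (intro continuous_lebesgue_measurable wt e)+
 have b: "L2 (%x. wt (epp k) x *r wgrad u x)" "n2 (%x. wt (epp k) x *r wgrad u x) <= sqrt (abs Q) + n2 u" for k
 proof -
  note W1 = wt_mult[OF u e[of k]] and we = wt[OF e[of k]]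
  have "qV (%x. wt (epp k) x * u x) (%x. wt (epp k) x * u x) <= Q" using wt_mult(1)[OF W1(1) e[of k]] by (intro Q e d0) auto
  then have q: "qV (%x. wt (epp k) x * u x) (%x. wt (epp k) x * u x) <= (sqrt (abs Q))^2" by simp
  have gL: "L2 (%x. u x *r wtg (epp k) x)" "n2 (%x. u x *r wtg (epp k) x) <= n2 u"
   using we(7) du(1) m by (auto intro!: L2_bound[OF du(7)] n2_mono[OF du(7)] AE_I2 mult_left_le)
  note gr = E_dest(3)[OF W1(1)]
  have mm: "lm (%x. wt (epp k) x *r wgrad u x)" using m du(3) by auto
  have ae: "AE x in lebesgue. wt (epp k) x *r wgrad u x = wgrad (%x. wt (epp k) x * u x) x - u x *r wtg (epp k) x" using W1(2) by eventually_elim simp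
  show "L2 (%x. wt (epp k) x *r wgrad u x)" by (rule L2_cong_AE[OF L2_diff[OF gr gL(1)] mm ae])
  have "n2 (%x. wt (epp k) x *r wgrad u x) = n2 (%x. wgrad (%x. wt (epp k) x * u x) x - u x *r wtg (epp k) x)" by (rule n2_cong_AE[OF mm L2_measurable[OF L2_diff[OF gr gL(1)]] ae])
  then show "n2 (%x. wt (epp k) x *r wgrad u x) <= sqrt (abs Q) + n2 u" using n2_triangle_diff[OF gr gL(1)] qV_dest(1)[OF W1(1) q] gL(2) by simp
 qed
 have "L2 (%x. sqrt (1 + x \<bullet> x) *r wgrad u x)"
 proof (rule L2_Fatou(1)[of "%k x. wt (epp k) x *r wgrad u x", OF b(1)])
  have "lm (%x::R2. sqrt (1 + x \<bullet> x))" by (intro continuous_lebesgue_measurable continuous_intros)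
  then show "lm (%x. sqrt (1 + x \<bullet> x) *r wgrad u x)" using du(3) by auto
  show "\<forall>\<^sub>F k in sequentially. n2 (%x. wt (epp k) x *r wgrad u x) <= sqrt (abs Q) + n2 u" using b(2) by simp
  have "(%k. wt (epp k) x *r wgrad u x) ---> (sqrt (1 + x \<bullet> x) / (1 + 0 * sqrt (1 + x \<bullet> x))) *r wgrad u x" for x
   unfolding wt_def by (intro tendsto_intros el) simp
  then show "AE x in lebesgue. (%k. wt (epp k) x *r wgrad u x) ---> sqrt (1 + x \<bullet> x) *r wgrad u x" by simp
 qed
 then show ?thesis
 proof (rule L2_bound)
  have "lm (%x::R2. norm x)" by (intro continuous_lebesgue_measurable continuous_intros)
  then show "lm (%x. norm x *r wgrad u x)" using du(3) by auto
  have "norm x <= sqrt (1 + x \<bullet> x)" for x :: R2 by (simp add: norm_eq_sqrt_inner)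
  from mult_right_mono[OF this norm_ge_zero] show "AE x in lebesgue. norm (norm x *r wgrad u x) <= norm (sqrt (1 + x \<bullet> x) *r wgrad u x)"
   by (intro AE_I2) (simp add: add_nonneg_nonneg)
 qed
qed

text \<open>In the application \<open>h\<close> is a dilation increment: \<open>n2 h\<close> is O(s)
  but \<open>nE h\<close> is only o(1), so a bound quadratic in \<open>nE h\<close> would be too
  weak. The positive kernel part of \<open>B4 u h h\<close>, which has no better estimate, is
  nonnegative and dropped; every other piece has at least one factor \<open>n2 h\<close>.\<close>

lemma Rn_lower:
 assumes u: "u : E"
 obtains A where "A > 0" "!!h. h : E ==> nE h <= 1 + 2 * (1 + 4 * KW) * nE u ==> - A * ((n2 h)^2 + n2 h * nE h) <= Rn u h"
proof (rule Lp_nE, goal_cases)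
 case (1 C)
 note C = 1(2,4,5)
 define N where "N = 1 + 2 * (1 + 4 * KW) * nE u + 2 * nE u"
 have k0: "0 <= 2 * (1 + 4 * KW) * nE u" using KW by (intro mult_nonneg_nonneg) auto
 have N: "N > 0" unfolding N_def using k0 nE_nonneg[of u] by linarith
 define A1 where "A1 = 2 * (lgc + 1) * sQ (%x. (u x)^2)"
 define A2 where "A2 = N * (C * N) + C * N * N + (lgc + 1) * (C * N) * (C * (C * N))"
 have A1: "A1 >= 0" unfolding A1_def using lgc_nonneg by (intro mult_nonneg_nonneg) (auto simp: sQ_def)
 have A2: "A2 > 0" unfolding A2_def using lgc_nonneg C N by (intro add_pos_nonneg mult_pos_pos mult_nonneg_nonneg) auto
 show ?thesis
 proof (rule that[of "A1 + A2"])
  show "A1 + A2 > 0" using A1 A2 by simp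
  fix h assume h: "h : E" "nE h <= 1 + 2 * (1 + 4 * KW) * nE u"
  define z where "z = (%x. 2 * u x + h x)"
  have z: "z : E" unfolding z_def by (rule E_add[OF E_cmult[OF u] h(1)])
  have nz: "nE z <= N" unfolding z_def N_def using nE_add[OF E_cmult[OF u, of 2] h(1)] nE_cmult[OF u, of 2] h(2) by simp
  define a g where "a = n2 h" and "g = nE h"
  have a0: "0 <= a" "0 <= g" by (auto simp: a_def g_def)
  note Du = Dl_sq[OF u] and Dh = Dl_sq[OF h(1)]
  have "Bk lgm (%x. (u x)^2) (%x. (h x)^2) = Bk lgm (%x. (h x)^2) (%x. (u x)^2)" by (rule Bk_sym[OF lgm_minus borel_lg(2)]) (use Du Dh in \<open>auto simp: Dl_def\<close>)
  moreover have "abs (Bk lgm (%x. (h x)^2) (%x. (u x)^2)) <= (lgc + 1) * a^2 * sQ (%x. (u x)^2)" using Bk_lgm(2)[OF Dh Du] unfolding s1_sq a_def .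
  moreover have "0 <= Bk lgp (%x. (u x)^2) (%x. (h x)^2)" unfolding Bk_def by (intro integral_nonneg_AE) (auto simp: lgp_nonneg)
  moreover have "B4 u h h = Bk lgp (%x. (u x)^2) (%x. (h x)^2) - Bk lgm (%x. (u x)^2) (%x. (h x)^2)" unfolding B4_def BB_def by (simp add: power2_eq_square)
  moreover have "A1 * a^2 = 2 * ((lgc + 1) * a^2 * sQ (%x. (u x)^2))" unfolding A1_def by simp
  ultimately have 1: "- (A1 * a^2) <= 2 * B4 u h h" by linarith
  note D = Dl_mult[OF h(1) z]
  have l0: "0 <= l3 v" for v by (simp add: l3_def)
  have i1: "s1 (%x. h x * z x) <= a * (C * N)" using order_trans[OF D(2) mult_left_mono[OF C(3)[OF z nz]]] by (simp add: a_def)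
  have i2: "sL (%x. h x * z x) <= g * N" by (rule order_trans[OF D(3) mult_mono]) (use nE_bounds(3)[OF h(1)] nE_bounds(3)[OF z] nz in \<open>auto simp: g_def\<close>)
  have i3: "sQ (%x. h x * z x) <= (C * g) * (C * N)" by (rule order_trans[OF D(4) mult_mono]) (use C(2)[OF h(1) order_refl] C(2)[OF z nz] l0 C(1) in \<open>auto simp: g_def\<close>)
  have nn: "0 <= s1 f" "0 <= sL f" "0 <= sQ f" for f unfolding s1_def sL_def sQ_def using lw_nonneg by (auto intro!: integral_nonneg_AE)
  have "abs (BB (%x. h x * z x) (%x. h x * z x)) <= sL (%x. h x * z x) * s1 (%x. h x * z x) + s1 (%x. h x * z x) * sL (%x. h x * z x) + (lgc + 1) * s1 (%x. h x * z x) * sQ (%x. h x * z x)" by (rule BB_le[OF D(1) D(1)])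
  also have "... <= (g * N) * (a * (C * N)) + (a * (C * N)) * (g * N) + (lgc + 1) * (a * (C * N)) * ((C * g) * (C * N))"
   using i1 i2 i3 nn lgc_nonneg C(1) N a0 by (intro add_mono mult_mono mult_nonneg_nonneg) auto
  also have "... = A2 * (a * g)" unfolding A2_def by (simp add: algebra_simps)
  finally have "- (A2 * (a * g)) <= BB (%x. h x * z x) (%x. h x * z x)" by linarith
  moreover have "Rn u h = 2 * B4 u h h + BB (%x. h x * z x) (%x. h x * z x)" unfolding Rn_def z_def ..
  ultimately have "- (A1 * a^2) - A2 * (a * g) <= Rn u h" using 1 by linarith
  moreover have "0 <= A2 * a^2" "0 <= A1 * (a * g)" using A1 A2 a0 by auto
  moreover have "- (A1 + A2) * (a^2 + a * g) = - (A1 * a^2) - A2 * (a * g) - A2 * a^2 - A1 * (a * g)" by (simp add: algebra_simps)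
  ultimately show "- (A1 + A2) * ((n2 h)^2 + n2 h * nE h) <= Rn u h" unfolding a_def[symmetric] g_def[symmetric] by linarith
 qed
qed

text \<open>The energy of \<open>T s u\<close> is bounded above by the dilation estimate and below
  by the Taylor expansion at \<open>u\<close>, in which the linear term vanishes and
  \<open>qV h h\<close> is nonnegative. Dividing by \<open>s\<close>, the remainders collected in
  \<open>F\<close> tend to 0 because decay of the gradient gives
  \<open>n2 h <= s * 2 G\<close>.\<close>

lemma Pohozaev:
 assumes c: "crit_point V b p u" and n: "n2 u > 0"
 shows "PP u <= 0"
proof -
 have u: "u : E" and d0: "!!w. w : E ==> dI u w = 0" using c by (auto simp: crit_iff)
 note du = E_dest[OF u]
 define G where "G = n2 (%x. norm x *r wgrad u x)"
 obtain A where A: "A > 0" "!!h. h : E ==> nE h <= 1 + 2 * (1 + 4 * KW) * nE u ==> - A * ((n2 h)^2 + n2 h * nE h) <= Rn u h" by (rule Rn_lower[OF u]) (rule that)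
 obtain C where C: "C > 0" "!!u N. u : E ==> N > 0 ==> n2 (wgrad u) <= N ==> li (%x. abs (u x) powr p) \<and> (LI x. abs (u x) powr p) <= C * (n2 u)^2 * N powr (p - 2)"
  by (rule Lp_bound[OF p]) (rule that)
 define N where "N = 1 + 2 * (1 + 4 * KW) * nE u"
 have N: "N > 0" unfolding N_def using KW nE_nonneg[of u] by (intro add_pos_nonneg mult_nonneg_nonneg) auto
 \<comment> \<open>The midpoint of 1/2 and 1 / (p - 2), an interval that is nonempty because
   \<open>p < 4\<close>. With Young parameter t^a both parts of the remainder of the power term are
   o(t): e^2 = t * t^(2a - 1) and e^(2 - p) t^2 = t * t^(1 - a (p - 2)).\<close>
 define a where "a = (1 / 2 + 1 / (p - 2)) / 2"
 have a: "2 * a - 1 > 0" "1 - a * (p - 2) > 0" 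
 proof -
  have "1 / 2 < 1 / (p - 2)" using p by (simp add: field_simps)
  then show "2 * a - 1 > 0" by (simp add: a_def)
  have "a * (p - 2) = ((p - 2) / 2 + 1) / 2" using p by (simp add: a_def distrib_right)
  also have "... < 1" using p by simp
  finally show "1 - a * (p - 2) > 0" by simp
 qed
 define B where "B = 4 * p * (p - 1)"
 define K where "K = 3 * abs (N0 u) + (n2 u) ^ 4"
 define L where "L = C * (2 * G)^2 * N powr (p - 2)"
 \<comment> \<open>Starting at 1/2 keeps the dilation factors in the range [1/2, 2] for every
   index.\<close>
 define s where "s k = 1 / real (k + 2)" for k
 have s: "0 < s k" "s k <= 1 / 2" for k by (auto simp: s_def field_simps)
 have sl: "s ---> 0" unfolding s_def by (rule LIMSEQ_ignore_initial_segment[OF lim_1_over_n, of 2])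
 define h where "h k = (%x. T (s k) u x - u x)" for k
 have TE: "T (s k) u : E" for k unfolding T_def using s[of k] by (intro dil_E[OF u] T_range) auto
 have hE: "h k : E" for k unfolding h_def by (rule E_diff[OF TE u])
 have hl: "(%k. nE (h k)) ---> 0" unfolding h_def T_def
 proof (rule dil_continuous[OF u])
  have "(%k. 1 / (1 - s k)) ---> 1 / (1 - 0)" by (intro tendsto_intros sl) auto
  then show "(%k. 1 / (1 - s k)) ---> 1" by simp
  show "1 / 2 <= 1 / (1 - s k)" "1 / (1 - s k) <= 2" for k using s[of k] by (intro T_range; simp)+
 qed
 have hN: "nE (h k) <= N" for k
 proof -
  have "nE (T (s k) u) <= (1 + 4 * KW) * nE u" unfolding T_def using s[of k] by (intro nE_dil[OF u] T_range) auto
  moreover have "1 * nE u <= (1 + 4 * KW) * nE u" using KW by (intro mult_right_mono) auto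
  moreover have "2 * (1 + 4 * KW) * nE u = (1 + 4 * KW) * nE u + (1 + 4 * KW) * nE u" by (simp add: algebra_simps)
  ultimately show ?thesis using nE_diff[OF TE u, of k] unfolding h_def N_def by linarith
 qed
 have h2: "n2 (h k) <= s k * (2 * G)" for k
 proof -
  have e: "1 / (1 - s k) - 1 <= 2 * s k" "1 <= 1 / (1 - s k)" "1 / (1 - s k) <= 2" using s[of k] by (auto simp: field_simps)
  have "n2 (h k) <= (1 / (1 - s k) - 1) * G" unfolding h_def T_def dil_def G_def by (rule n2_dilation_increment[OF du(7,2,3) crit_decay[OF c n] e(2,3)])
  also have "... <= 2 * s k * G" using e(1) by (intro mult_right_mono) (auto simp: G_def)
  finally show ?thesis by simp
 qed
 define F where "F k = s k * K + A * (s k * (2 * G)^2 + 2 * G * nE (h k)) / (8 * pi) + b / p * (B * (s k powr (2 * a - 1) * Lq u + (s k powr (1 - a * (p - 2)) + s k) * L))" for k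
 have le: "PP u <= F k" for k
 proof -
  define t where "t = s k"
  have t: "0 < t" "t <= 1/2" using s[of k] by (auto simp: t_def)
  have ue: "(%x. u x + h k x) = T t u" by (simp add: h_def t_def)
  have up: "II (T t u) <= II u - t * PP u + t^2 * K" unfolding K_def using t by (intro II_T_le[OF u]) auto
  have ex: "II (T t u) = II u + qV (h k) (h k) / 2 + Rn u (h k) / (8 * pi) - b / p * Rp u (h k)" using I_expand[OF u hE[of k]] d0[OF hE[of k]] unfolding ue by simp
  have "(n2 (h k))^2 <= (t * (2 * G))^2" using h2[of k] by (intro power_mono) (auto simp: t_def)
  moreover have "n2 (h k) * nE (h k) <= t * (2 * G) * nE (h k)" using h2[of k] by (intro mult_right_mono) (auto simp: t_def)
  ultimately have "A * ((n2 (h k))^2 + n2 (h k) * nE (h k)) <= A * ((t * (2 * G))^2 + t * (2 * G) * nE (h k))" using A(1) by (intro mult_left_mono) auto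
  also have "... = t * (A * (t * (2 * G)^2 + 2 * G * nE (h k)))" by (simp add: power2_eq_square algebra_simps)
  finally have "- (t * (A * (t * (2 * G)^2 + 2 * G * nE (h k)))) <= Rn u (h k)" using A(2)[OF hE hN[unfolded N_def], of k] by linarith
  then have R1: "- (t * (A * (t * (2 * G)^2 + 2 * G * nE (h k)))) / (8 * pi) <= Rn u (h k) / (8 * pi)" by (rule divide_right_mono) simp
  have "Lq (h k) <= C * (n2 (h k))^2 * N powr (p - 2)" using C(2)[OF hE N, of k] nE_bounds(1)[OF hE, of k] hN[of k] unfolding Lq_eq by auto
  also have "... <= C * (t * (2 * G))^2 * N powr (p - 2)" using h2[of k] C(1) by (intro mult_right_mono mult_left_mono power_mono) (auto simp: t_def)
  finally have Lh: "Lq (h k) <= t^2 * L" unfolding L_def by (simp add: power_mult_distrib mult_ac)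
  define e where "e = t powr a"
  have e: "e > 0" using t by (simp add: e_def)
  have e1: "e^2 = t * t powr (2 * a - 1)"
  proof -
   have "e^2 = t powr a * t powr a" by (simp add: e_def power2_eq_square)
   also have "... = t powr 1 * t powr (2 * a - 1)" unfolding powr_add[symmetric] by simp
   finally show ?thesis using t by simp
  qed
  have e2: "e powr (2 - p) * t^2 = t * t powr (1 - a * (p - 2))"
  proof -
   have "e powr (2 - p) * t^2 = t powr (a * (2 - p)) * t powr 2" using t by (simp add: e_def powr_powr powr_numeral)
   also have "... = t powr 1 * t powr (1 - a * (p - 2))" unfolding powr_add[symmetric] by (simp add: algebra_simps)
   finally show ?thesis using t by simp
  qed
  have B0: "0 <= B" using p by (simp add: B_def)
  have "Rp u (h k) <= B * (e^2 * Lq u + (e powr (2 - p) + 1) * Lq (h k))" using Rp_le[OF u hE[of k] e] unfolding B_def by linarith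
  also have "... <= B * (e^2 * Lq u + (e powr (2 - p) + 1) * (t^2 * L))" using Lh B0 by (intro mult_left_mono add_left_mono) (auto simp: add_nonneg_nonneg)
  also have "(e powr (2 - p) + 1) * (t^2 * L) = (e powr (2 - p) * t^2 + t^2) * L" by (simp add: algebra_simps)
  also have "B * (e^2 * Lq u + (e powr (2 - p) * t^2 + t^2) * L) = t * (B * (t powr (2 * a - 1) * Lq u + (t powr (1 - a * (p - 2)) + t) * L))"
   unfolding e1 e2 by (simp add: power2_eq_square algebra_simps)
  finally have R2: "b / p * Rp u (h k) <= b / p * (t * (B * (t powr (2 * a - 1) * Lq u + (t powr (1 - a * (p - 2)) + t) * L)))" using b p by (intro mult_left_mono) auto
  have "t * PP u <= t^2 * K + t * (A * (t * (2 * G)^2 + 2 * G * nE (h k))) / (8 * pi) + b / p * (t * (B * (t powr (2 * a - 1) * Lq u + (t powr (1 - a * (p - 2)) + t) * L)))"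
   using up ex R1 R2 qV_nonneg[of "h k"] unfolding minus_divide_left by linarith
  also have "... = t * F k" unfolding F_def t_def[symmetric] by (simp add: power2_eq_square algebra_simps)
  finally show ?thesis using t by simp
 qed
 have "F ---> 0 * K + A * (0 * (2 * G)^2 + 2 * G * 0) / (8 * pi) + b / p * (B * (0 * Lq u + (0 + 0) * L))"
  unfolding F_def using a s(1) by (intro tendsto_intros sl hl tendsto_zero_powrI[OF sl tendsto_const]) (auto simp: less_imp_le)
 then have F0: "F ---> 0" by simp
 show ?thesis by (rule LIMSEQ_le_const[OF F0]) (use le in blast)
qed

subsection \<open>Existence of a ground state\<close>


lemma nonzero_ae_iff: "u : E ==> nonzero_ae u \<longleftrightarrow> 0 < n2 u"
proof -
 assume u: "u : E"
 have "AE x in lebesgue. u x = 0" if "\<not> 0 < n2 u" using n2_eq_0[OF E_dest(7)[OF u]] that n2_nonneg[of u] by linarith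
 moreover have "n2 u = 0" if "AE x in lebesgue. u x = 0" using n2_cong_AE[OF E_dest(1)[OF u] _ that] by simp
 ultimately show ?thesis unfolding nonzero_ae_def by fastforce
qed

text \<open>Used twice: for the sequence from the mountain pass and for a minimizing sequence of
  critical points. The lower bound \<open>d\<close> on \<open>qV\<close> survives in the limit and,
  through \<open>mass_lower\<close>, forces positive mass.\<close>

lemma Palais_Smale_limit:
 fixes et :: "nat => real"
 assumes u: "!!n. u n : E" "!!n. II (u n) <= M" "!!n. PP (u n) <= 1" "!!n. d <= qV (u n) (u n)" "d > 0"
  and eta: "et ---> 0" "!!n. et n <= 1" and dI: "!!n w. w : E ==> nE w <= 1 + nE (u n) ==> abs (dI (u n) w) <= et n"
 obtains s v where "strict_mono (s :: nat => nat)" "crit_point V b p v" "0 < n2 v" "(%n. II (u (s n))) ---> II v"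
proof (rule energy_bound[of M], goal_cases)
 case (1 K)
 note K = 1(2-)
 have "abs (dI (u n) (u n)) <= 1" for n using dI[OF u(1), of n n] eta(2)[of n] by auto
 note b = K(2)[OF u(1) u(2) this u(3)]
 obtain s v where s: "strict_mono (s :: nat => nat)" and v: "v : E" "(%n. nE (%x. u (s n) x - v x)) ---> 0"
  by (rule compactness[OF K(1) u(5) u(1) conjunct1[OF b] conjunct2[OF b] u(4) eta(1) dI]) (assumption, assumption, rule that)
 have es: "(%n. et (s n)) ---> 0" using LIMSEQ_subseq_LIMSEQ[OF eta(1) s] by (simp add: comp_def)
 note lc = limit_critical[of "%n. u (s n)", OF u(1) v es dI]
 have c: "crit_point V b p v" using lc(1) by blast
 have q: "d <= qV v v" by (rule LIMSEQ_le_const[OF lc(3)]) (use u(4) in auto)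
 define k where "k = sqrt (qV v v)"
 have k: "k > 0" "qV v v <= k^2" using q u(5) by (auto simp: k_def)
 obtain C where C: "C > 0" "!!u. u : E ==> qV u u <= k^2 ==> qV u u <= dI u u + C * (n2 u)^2" by (rule mass_lower[OF k(1)]) (rule that)
 have "qV v v <= C * (n2 v)^2" using C(2)[OF v(1) k(2)] c v(1) by (simp add: crit_iff)
 then have "n2 v ~= 0" using q u(5) by auto
 then have "0 < n2 v" using n2_nonneg[of v] by linarith
 then show ?thesis using that[OF s c] lc(2) by blast
qed

lemma critical_point_exists: obtains v where "crit_point V b p v" "0 < n2 v"
proof (rule mountain_pass, goal_cases)
 case (1 M al0)
 note a0 = 1(2) and mp = 1(3)
 \<comment> \<open>The extra factor makes the error in the Nehari relation at most
   \<open>2 * al0\<close>, small against the energy level.\<close>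
 define et where "et k = min 1 (2 * al0) * (1 / real (Suc k))" for k
 have "et ---> min 1 (2 * al0) * 0" unfolding et_def by (intro tendsto_mult_left LIMSEQ_inverse_real_of_nat[unfolded inverse_eq_divide])
 then have el: "et ---> 0" by simp
 have ep: "et k > 0" for k using a0 by (simp add: et_def)
 have "et k <= min 1 (2 * al0) * 1" for k unfolding et_def using a0 by (intro mult_left_mono) auto
 then have e1: "et k <= 1" "et k <= 2 * al0" for k by simp_all
 have "ALL k. EX u. u : E \<and> al0 <= II u \<and> II u <= M \<and> PP u <= et k \<and> (ALL w:E. nE w <= 1 + nE u --> - et k <= dI u w)" using mp[OF ep] by blast
 then obtain u where u: "!!k. u k : E" "!!k. al0 <= II (u k)" "!!k. II (u k) <= M" "!!k. PP (u k) <= et k" "!!k w. w : E ==> nE w <= 1 + nE (u k) ==> - et k <= dI (u k) w" by metis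
 have dI: "abs (dI (u k) w) <= et k" if w: "w : E" "nE w <= 1 + nE (u k)" for k w
 proof -
  have "nE (%x. (-1) * w x) <= 1 + nE (u k)" using nE_cmult[OF w(1), of "-1"] w(2) by simp
  then have "- et k <= dI (u k) (%x. (-1) * w x)" by (rule u(5)[OF E_cmult[OF w(1)]])
  then show ?thesis using u(5)[OF w] dI_cmult[OF u(1) w(1), of k "-1"] by simp
 qed
 \<comment> \<open>Subtracting a quarter of the Nehari relation from the energy removes
   \<open>N0\<close>, and the power term then has a favourable sign because \<open>p < 4\<close>. So
   the positive energy level bounds \<open>qV\<close> from below.\<close>
 have q: "2 * al0 <= qV (u k) (u k)" for k
 proof -
  define A N c where "A = qV (u k) (u k)" and "N = N0 (u k)" and "c = b * Lq (u k)"
  have "0 <= c" using b Lq_nonneg by (simp add: c_def)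
  then have "c / 4 <= c / p" using p by (intro divide_left_mono) auto
  moreover have "al0 <= A / 2 + N / 4 - c / p" using u(2)[of k] unfolding Ifun_def normV_sq_eq Lq_def[symmetric] A_def N_def c_def by simp
  moreover have "A + N - c <= 2 * al0" using dI[OF u(1), of k k] e1(2)[of k] unfolding dI_self[OF u(1)] A_def N_def c_def by simp
  ultimately show ?thesis unfolding A_def[symmetric] by argo
 qed
 have P: "PP (u k) <= 1" for k using u(4)[of k] e1(1)[of k] by linarith
 have d: "2 * al0 > 0" using a0 by simp
 show ?thesis by (rule Palais_Smale_limit[OF u(1) u(3) P q d el e1(1) dI]) (assumption+, rule that)
qed

text \<open>On a small ball of \<open>H_V\<close> the Nehari quantity \<open>dI u u\<close> is
  positive, so no nontrivial critical point lies there. This prevents a minimizing sequence from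
  degenerating to 0.\<close>

lemma critical_gap: obtains d where "d > 0" "!!u. crit_point V b p u ==> 0 < n2 u ==> d <= qV u u"
proof -
 obtain r where r: "r > 0" "!!u. u : E ==> qV u u <= r^2 ==> 0 < qV u u ==> 0 < dI u u" by (rule geometry) (rule that)
 show ?thesis
 proof (rule that[of "r^2"])
  show "0 < r^2" using r by simp
  fix u assume c: "crit_point V b p u" and n: "0 < n2 u"
  have u: "u : E" "dI u u = 0" using c by (auto simp: crit_iff)
  have "V0 * (n2 u)^2 <= qV u u" using qV_dest(3)[OF u(1), of "sqrt (qV u u)"] qV_nonneg[of u] by simp
  moreover have "0 < V0 * (n2 u)^2" using V0 n by simp
  ultimately show "r^2 <= qV u u" using r(2)[OF u(1)] u(2) by force
 qed
qed

text \<open>The functional itself is not bounded below. Critical points with energy at most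
  \<open>M\<close> are bounded in \<open>H_V\<close> by the Pohozaev inequality, and there the
  energy is bounded below.\<close>

lemma critical_lower_bound: obtains m where "!!u. crit_point V b p u ==> 0 < n2 u ==> II u <= M ==> m <= II u"
proof (rule energy_bound[of M], rule V_bounds, goal_cases)
 case (1 K C)
 note K = 1(2,3) and C = 1(4,5,8)
 show ?thesis
 proof (rule that)
  fix u assume c: "crit_point V b p u" and n: "0 < n2 u" and M: "II u <= M"
  have u: "u : E" "dI u u = 0" using c by (auto simp: crit_iff)
  have q: "qV u u <= K^2" using K(2)[OF u(1) M] u(2) Pohozaev[OF c n] by simp
  have "Lq u <= C * (n2 u)^2 * K powr (p - 2)" by (rule C(2)[OF u(1) q K(1)])
  also have "... <= C * (K / sqrt V0)^2 * K powr (p - 2)" using qV_dest(2)[OF u(1) q] K(1) C(1) by (intro mult_right_mono mult_left_mono power_mono) auto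
  finally have "b / p * Lq u <= b / p * (C * (K / sqrt V0)^2 * K powr (p - 2))" using b p by (intro mult_left_mono) auto
  then show "- C * K ^ 4 / 4 - b / p * (C * (K / sqrt V0)^2 * K powr (p - 2)) <= II u"
   unfolding Ifun_def normV_sq_eq Lq_def[symmetric] using C(3)[OF u(1) q K(1)] qV_nonneg[of u] by linarith
 qed
qed

lemma ground_state_exists: "EX u. ground_state V b p u"
proof -
 obtain v where v: "crit_point V b p v" "0 < n2 v" by (rule critical_point_exists) (rule that)
 obtain d where d: "d > 0" "!!u. crit_point V b p u ==> 0 < n2 u ==> d <= qV u u" by (rule critical_gap) (rule that)
 obtain m where m: "!!u. crit_point V b p u ==> 0 < n2 u ==> II u <= II v ==> m <= II u" by (rule critical_lower_bound) (rule that)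
 define S where "S = {u. crit_point V b p u \<and> 0 < n2 u \<and> II u <= II v}"
 define i where "i = Inf (II ` S)"
 have bb: "bdd_below (II ` S)" using m by (intro bdd_belowI[of _ m]) (auto simp: S_def)
 have vS: "v : S" using v by (simp add: S_def)
 have i: "i <= II u" if "u : S" for u unfolding i_def by (rule cInf_lower[OF _ bb]) (use that in simp)
 have "ALL k. EX u. u : S \<and> II u < i + 1 / real (Suc k)"
 proof
  fix k
  have "Inf (II ` S) < i + 1 / real (Suc k)" by (simp add: i_def)
  then show "EX u. u : S \<and> II u < i + 1 / real (Suc k)" using cInf_lessD[of "II ` S"] vS by blast
 qed
 then obtain u where u: "!!k. u k : S" "!!k. II (u k) < i + 1 / real (Suc k)" by metis
 have uS: "crit_point V b p (u k)" "0 < n2 (u k)" "II (u k) <= II v" "u k : E" for k using u(1)[of k] by (auto simp: S_def crit_iff)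
 have P: "PP (u k) <= 1" for k using Pohozaev[OF uS(1,2), of k] by simp
 \<comment> \<open>The members are exact critical points, so the sequence of errors can be taken
   identically 0.\<close>
 have dI: "abs (dI (u k) w) <= 0" if "w : E" for k w using uS(1)[of k] that by (simp add: crit_iff)
 obtain s w where s: "strict_mono (s :: nat => nat)" and w: "crit_point V b p w" "0 < n2 w" "(%n. II (u (s n))) ---> II w"
  by (rule Palais_Smale_limit[OF uS(4) uS(3) P d(2)[OF uS(1,2)] d(1) tendsto_const[of 0] _ dI]) (simp, assumption, rule that)
 have "(%k. II (u k)) ---> i"
 proof (rule tendsto_sandwich[of "%k. i" _ _ "%k. i + 1 / real (Suc k)"])
  have "(%k. i + 1 / real (Suc k)) ---> i + 0" by (intro tendsto_add tendsto_const LIMSEQ_inverse_real_of_nat[unfolded inverse_eq_divide])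
  then show "(%k. i + 1 / real (Suc k)) ---> i" by simp
 qed (use i u in \<open>auto simp: less_imp_le\<close>)
 from LIMSEQ_subseq_LIMSEQ[OF this s] have "II w = i" using LIMSEQ_unique[OF w(3)] by (simp add: comp_def)
 then have "II w <= II z" if "crit_point V b p z" "0 < n2 z" for z
  using i[of z] i[OF vS] that by (cases "II z <= II v") (auto simp: S_def)
 then show ?thesis unfolding ground_state_def using w(1,2) nonzero_ae_iff by (intro exI[of _ w]) (auto simp: crit_iff)
qed

end


theorem theorem1p2:
  fixes V :: "real ^ 2 \<Rightarrow> real" and b p :: real
  assumes "b > 0" and "2 < p" and "p < 4"
    and "cond_V0 V" and "cond_V1 V"
  shows "\<exists>u. ground_state V b p u"
proof -
  obtain c where c: "c > 0" "!!x. c <= V x" "!!M. M > 0 ==> emeasure lebesgue {x. V x <= M} < \<infinity>" using \<open>cond_V0 V\<close> unfolding cond_V0_def by blast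
  obtain gV \<alpha> \<beta> where g: "continuous_on UNIV V" "weak_grad V gV" "\<alpha> > 0" "\<beta> > 0" "AE x in lebesgue. \<bar>gV x \<bullet> x\<bar> <= \<alpha> * V x \<and> 2 * V x + gV x \<bullet> x >= - \<beta>"
    using \<open>cond_V1 V\<close> unfolding cond_V1_def by blast
  interpret choquard V b p c \<alpha> \<beta> gV by unfold_locales (use assms c g in auto)
  show ?thesis by (rule ground_state_exists)
qed

end
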